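(* For every $n\ge 0$, the irreducible subquotients of the proper standard module $\bar\Delta(n)$ are isomorphic (up to grading shifts) to $L(n+2m)$ for $m\geq0$, with graded multiplicities $$[\bar\Delta(n):L(n+2m)]_q=\begin{cases}q^{-m(2m-1)}\big/(1-q^{-4})(1-q^{-8})\cdots(1-q^{-4m})&\text{if } n\equiv t\pmod 2,\\ q^{-m(2m+1)}\big/(1-q^{-4})(1-q^{-8})\cdots(1-q^{-4m})&\text{if } n\not\equiv t\pmod 2,\end{cases}$$ (expanded as series in $q^{-1}$).
   Context: Let $\Bbbk$ be a field of characteristic $\neq2$, $t\in\{0,1\}$, and let $\mathcal{NB}_t$ be the nil-Brauer category: the strict graded $\Bbbk$-linear monoidal category (tensor $\star$, unit $\mathbb1$, composition $\circ$) generated by an object $B$ and morphisms $x:B\to B$ (degree 2), $\tau:B\star B\to B\star B$ (degree $-2$), $\cap:B\star B\to\mathbb1$, $\cup:\mathbb1\to B\star B$ (degree 0), with relations ($1=1_B$): $\tau\circ\tau=0$; $(\tau\star1)\circ(1\star\tau)\circ(\tau\star1)=(1\star\tau)\circ(\tau\star1)\circ(1\star\tau)$; $\cap\circ\cup=t1_{\mathbb1}$; $(\cap\star1)\circ(1\star\cup)=1=(1\star\cap)\circ(\cup\star1)$; $\cap\circ\tau=0$; $(1\star\cap)\circ(\tau\star1)=(\cap\star1)\circ(1\star\tau)$; $(x\star1)\circ\tau-\tau\circ(1\star x)=1\star1-\cup\circ\cap$; $\cap\circ(1\star x)=-\cap\circ(x\star1)$. Path algebra $\mathrm{NB}=\bigoplus_{m,n}1_m\mathrm{NB}1_n$,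 $1_m\mathrm{NB}1_n=\mathrm{Hom}(B^{\star n},B^{\star m})$; graded modules are locally unital graded left modules; $q$ is the downward grading shift $(qV)_k=V_{k+1}$. For $n\ge0$, $\mathrm{NB}_{\ge n}$ is the quotient of $\mathrm{NB}$ by the two-sided ideal generated by $1_m$, $m<n$, with images denoted $\bar u$. In $1_n\mathrm{NB}1_n$ let $\tau_i=1^{\star(i-1)}\star\tau\star1^{\star(n-i-1)}$, $x_i=1^{\star(i-1)}\star x\star1^{\star(n-i)}$, $e_r(x_1,\dots,x_n)$ the elementary symmetric polynomials in the commuting $x_i$, and $b_r:=\cap\circ(1\star x^r)\circ\cup\in\mathrm{End}(\mathbb1)$. The standard module is $\Delta(n):=q^{\frac12n(n-1)}\mathrm{NB}_{\ge n}\bar1_n/\sum_{i}\mathrm{NB}_{\ge n}\bar\tau_i$; it has a unique irreducible graded quotient $L(n)$, and the $L(n)$, $n\ge0$, are a complete set of irreducible graded $\mathrm{NB}$-modules up to isomorphism and grading shift. The proper standard module is $\bar\Delta(n):=q^{\frac12n(n-1)}\mathrm{NB}_{\ge n}\bar1_n\big/\big(\sum_{i=1}^{n-1}\mathrm{NB}_{\ge n}\bar\tau_i+\sum_{r=1}^n\mathrm{NB}_{\ge n}\overline{e_r(x_1,\dots,x_n)}+\sum_{r\ge1}\mathrm{NB}_{\ge n}\overline{1_n\star b_r}\big)$. For a graded module $V$ with finite-dimensional graded weight spaces, the graded multiplicity $[V:L(b)]_q$ is $\sum_{d\in\mathbb Z}c_dq^d$, where $c_d$ is the supremum, over finite graded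 filtrations $0=V_0\subseteq\dots\subseteq V_k=V$, of the number of $r$ with $V_r/V_{r-1}\cong q^dL(b)$. *)

theory Defs
  imports "HOL-Library.Extended_Nat" "HOL-Computational_Algebra.Formal_Power_Series"
begin

section \<open>Morphism expressions of the free strict monoidal category on B, x, tau, cap, cup\<close>

datatype gen = GX | GTau | GCap | GCup

datatype mexp = Gen gen | Id nat | Comp mexp mexp | Tens mexp mexp
  (* Comp f g = f \<circ> g ;  Tens f g = f \<star> g ;  Id n = identity of B^{\<star> n} *)

fun gsrc :: "gen \<Rightarrow> nat" where
  "gsrc GX = 1" | "gsrc GTau = 2" | "gsrc GCap = 2" | "gsrc GCup = 0"

fun gtgt :: "gen \<Rightarrow> nat" where
  "gtgt GX = 1" | "gtgt GTau = 2" | "gtgt GCap = 0" | "gtgt GCup = 2"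

fun gdeg :: "gen \<Rightarrow> int" where
  "gdeg GX = 2" | "gdeg GTau = -2" | "gdeg GCap = 0" | "gdeg GCup = 0"

fun src :: "mexp \<Rightarrow> nat" where
  "src (Gen g) = gsrc g" | "src (Id n) = n" | "src (Comp f g) = src g"
| "src (Tens f g) = src f + src g"

fun tgt :: "mexp \<Rightarrow> nat" where
  "tgt (Gen g) = gtgt g" | "tgt (Id n) = n" | "tgt (Comp f g) = tgt f"
| "tgt (Tens f g) = tgt f + tgt g"

fun wt :: "mexp \<Rightarrow> bool" where
  "wt (Gen g) = True" | "wt (Id n) = True"
| "wt (Comp f g) = (wt f \<and> wt g \<and> src f = tgt g)"
| "wt (Tens f g) = (wt f \<and> wt g)"

fun deg :: "mexp \<Rightarrow> int" where
  "deg (Gen g) = gdeg g" | "deg (Id n) = 0" | "deg (Comp f g) = deg f + deg g"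
| "deg (Tens f g) = deg f + deg g"

section \<open>Formal linear combinations (representatives of elements of the path algebra NB)\<close>

type_synonym 'k comb = "mexp \<Rightarrow> 'k"

definition dl :: "mexp \<Rightarrow> 'k::field comb" where
  "dl e = (\<lambda>e'. if e' = e then 1 else 0)"

definition czero :: "'k::field comb" where "czero = (\<lambda>_. 0)"
definition cadd :: "'k::field comb \<Rightarrow> 'k comb \<Rightarrow> 'k comb" where
  "cadd a b = (\<lambda>e. a e + b e)"
definition cdiff :: "'k::field comb \<Rightarrow> 'k comb \<Rightarrow> 'k comb" where
  "cdiff a b = (\<lambda>e. a e - b e)"
definition csc :: "'k::field \<Rightarrow> 'k comb \<Rightarrow> 'k comb" where
  "csc c a = (\<lambda>e. c * a e)"

definition lc :: "('k::field \<times> mexp) list \<Rightarrow> 'k comb" where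
  "lc l = (\<lambda>e. sum_list (map fst (filter (\<lambda>p. snd p = e) l)))"

definition comp :: "'k::field comb \<Rightarrow> 'k comb \<Rightarrow> 'k comb" where
  "comp a b = (\<lambda>e. case e of Comp f g \<Rightarrow> (if src f = tgt g then a f * b g else 0) | _ \<Rightarrow> 0)"

definition tens :: "'k::field comb \<Rightarrow> 'k comb \<Rightarrow> 'k comb" where
  "tens a b = (\<lambda>e. case e of Tens f g \<Rightarrow> a f * b g | _ \<Rightarrow> 0)"

definition hom :: "int \<Rightarrow> 'k::field comb \<Rightarrow> 'k comb" where
  "hom d a = (\<lambda>e. if deg e = d then a e else 0)"

definition structural :: "'k::field comb set" where
  "structural =
     {cdiff (dl (Comp (Comp f g) h)) (dl (Comp f (Comp g h))) | f g h.
        wt f \<and> wt g \<and> wt h \<and> src f = tgt g \<and> src g = tgt h}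
   \<union> {cdiff (dl (Comp (Id (tgt f)) f)) (dl f) | f. wt f}
   \<union> {cdiff (dl (Comp f (Id (src f)))) (dl f) | f. wt f}
   \<union> {cdiff (dl (Tens (Tens f g) h)) (dl (Tens f (Tens g h))) | f g h. wt f \<and> wt g \<and> wt h}
   \<union> {cdiff (dl (Tens (Id 0) f)) (dl f) | f. wt f}
   \<union> {cdiff (dl (Tens f (Id 0))) (dl f) | f. wt f}
   \<union> {cdiff (dl (Tens (Id m) (Id n))) (dl (Id (m + n))) | m n. True}
   \<union> {cdiff (dl (Tens (Comp f g) (Comp f' g'))) (dl (Comp (Tens f f') (Tens g g'))) | f g f' g'.
        wt f \<and> wt g \<and> wt f' \<and> wt g' \<and> src f = tgt g \<and> src f' = tgt g'}"

abbreviation "I1 \<equiv> Id 1"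
abbreviation "eX \<equiv> Gen GX"
abbreviation "eT \<equiv> Gen GTau"
abbreviation "eCap \<equiv> Gen GCap"
abbreviation "eCup \<equiv> Gen GCup"

text \<open>Defining relations of the nil-Brauer category NB_t.\<close>
definition nbrels :: "nat \<Rightarrow> 'k::field comb set" where
  "nbrels t =
    { dl (Comp eT eT),
      cdiff (dl (Comp (Tens eT I1) (Comp (Tens I1 eT) (Tens eT I1))))
            (dl (Comp (Tens I1 eT) (Comp (Tens eT I1) (Tens I1 eT)))),
      cdiff (dl (Comp eCap eCup)) (csc (of_nat t) (dl (Id 0))),
      cdiff (dl (Comp (Tens eCap I1) (Tens I1 eCup))) (dl I1),
      cdiff (dl (Comp (Tens I1 eCap) (Tens eCup I1))) (dl I1),
      dl (Comp eCap eT),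
      cdiff (dl (Comp (Tens I1 eCap) (Tens eT I1))) (dl (Comp (Tens eCap I1) (Tens I1 eT))),
      lc [(1, Comp (Tens eX I1) eT), (-1, Comp eT (Tens I1 eX)), (-1, Tens I1 I1), (1, Comp eCup eCap)],
      lc [(1, Comp eCap (Tens I1 eX)), (1, Comp eCap (Tens eX I1))] }"

text \<open>The tensor ideal of combinations that vanish in NB_t.\<close>
inductive_set rel :: "nat \<Rightarrow> 'k::field comb set" for t :: nat where
  rel_struct: "a \<in> structural \<Longrightarrow> a \<in> rel t"
| rel_nb: "a \<in> nbrels t \<Longrightarrow> a \<in> rel t"
| rel_zero: "czero \<in> rel t"
| rel_add: "a \<in> rel t \<Longrightarrow> b \<in> rel t \<Longrightarrow> cadd a b \<in> rel t"
| rel_smult: "a \<in> rel t \<Longrightarrow> csc c a \<in> rel t"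
| rel_compL: "a \<in> rel t \<Longrightarrow> wt e \<Longrightarrow> comp (dl e) a \<in> rel t"
| rel_compR: "a \<in> rel t \<Longrightarrow> wt e \<Longrightarrow> comp a (dl e) \<in> rel t"
| rel_tensL: "a \<in> rel t \<Longrightarrow> wt e \<Longrightarrow> tens (dl e) a \<in> rel t"
| rel_tensR: "a \<in> rel t \<Longrightarrow> wt e \<Longrightarrow> tens a (dl e) \<in> rel t"

text \<open>Kernel of NB -> NB_{\<ge>n}: two-sided ideal generated by 1_m, m < n.\<close>
inductive_set idealLow :: "nat \<Rightarrow> nat \<Rightarrow> 'k::field comb set" for t n :: nat where
  il_rel: "a \<in> rel t \<Longrightarrow> a \<in> idealLow t n"
| il_unit: "m < n \<Longrightarrow> dl (Id m) \<in> idealLow t n"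
| il_zero: "czero \<in> idealLow t n"
| il_add: "a \<in> idealLow t n \<Longrightarrow> b \<in> idealLow t n \<Longrightarrow> cadd a b \<in> idealLow t n"
| il_smult: "a \<in> idealLow t n \<Longrightarrow> csc c a \<in> idealLow t n"
| il_compL: "a \<in> idealLow t n \<Longrightarrow> wt e \<Longrightarrow> comp (dl e) a \<in> idealLow t n"
| il_compR: "a \<in> idealLow t n \<Longrightarrow> wt e \<Longrightarrow> comp a (dl e) \<in> idealLow t n"

text \<open>Representatives of NB 1_n.\<close>
definition Pn :: "nat \<Rightarrow> 'k::field comb set" where
  "Pn n = {a. finite {e. a e \<noteq> 0} \<and> (\<forall>e. a e \<noteq> 0 \<longrightarrow> wt e \<and> src e = n)}"

inductive_set lsub :: "'k::field comb set \<Rightarrow> 'k comb set" for S :: "'k comb set" where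
  ls_base: "a \<in> S \<Longrightarrow> a \<in> lsub S"
| ls_zero: "czero \<in> lsub S"
| ls_add: "a \<in> lsub S \<Longrightarrow> b \<in> lsub S \<Longrightarrow> cadd a b \<in> lsub S"
| ls_smult: "a \<in> lsub S \<Longrightarrow> csc c a \<in> lsub S"
| ls_compL: "a \<in> lsub S \<Longrightarrow> wt e \<Longrightarrow> comp (dl e) a \<in> lsub S"

definition xE :: "nat \<Rightarrow> nat \<Rightarrow> mexp" where
  "xE n i = Tens (Id (i - 1)) (Tens eX (Id (n - i)))"

definition tauE :: "nat \<Rightarrow> nat \<Rightarrow> mexp" where
  "tauE n i = Tens (Id (i - 1)) (Tens eT (Id (n - i - 1)))"

fun xprod :: "nat \<Rightarrow> nat list \<Rightarrow> mexp" where
  "xprod n [] = Id n"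
| "xprod n (i # is) = Comp (xE n i) (xprod n is)"

definition esym :: "nat \<Rightarrow> nat \<Rightarrow> 'k::field comb" where
  "esym n r = (\<lambda>e. \<Sum>S\<in>{S. S \<subseteq> {1..n} \<and> card S = r}. dl (xprod n (sorted_list_of_set S)) e)"

fun xpow :: "nat \<Rightarrow> mexp" where
  "xpow 0 = Id 1"
| "xpow (Suc r) = Comp eX (xpow r)"

definition bE :: "nat \<Rightarrow> mexp" where
  "bE r = Comp eCap (Comp (Tens (Id 1) (xpow r)) eCup)"

section \<open>Standard and proper standard modules (as quotients Pn n / K)\<close>

definition Kstd :: "nat \<Rightarrow> nat \<Rightarrow> 'k::field comb set" where
  "Kstd t n = lsub ((idealLow t n \<inter> Pn n) \<union> {dl (tauE n i) | i. 1 \<le> i \<and> i < n})"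

definition Kprop :: "nat \<Rightarrow> nat \<Rightarrow> 'k::field comb set" where
  "Kprop t n = lsub ((idealLow t n \<inter> Pn n) \<union> {dl (tauE n i) | i. 1 \<le> i \<and> i < n}
                     \<union> {esym n r | r. 1 \<le> r \<and> r \<le> n}
                     \<union> {dl (Tens (Id n) (bE r)) | r. 1 \<le> r})"

definition shift :: "nat \<Rightarrow> int" where
  "shift n = int (n * (n - 1) div 2)"

text \<open>W/K is a graded submodule of P/K.\<close>
definition gsub :: "'k::field comb set \<Rightarrow> 'k comb set \<Rightarrow> 'k comb set \<Rightarrow> bool" where
  "gsub K P W \<longleftrightarrow> K \<subseteq> W \<and> W \<subseteq> P \<and> czero \<in> W
     \<and> (\<forall>a\<in>W. \<forall>b\<in>W. cadd a b \<in> W) \<and> (\<forall>c. \<forall>a\<in>W. csc c a \<in> W)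
     \<and> (\<forall>a\<in>W. \<forall>e. wt e \<longrightarrow> comp (dl e) a \<in> W)
     \<and> (\<forall>a\<in>W. \<forall>d. hom d a \<in> W)"

text \<open>P/U is an irreducible graded module.\<close>
definition irr :: "'k::field comb set \<Rightarrow> 'k comb set \<Rightarrow> bool" where
  "irr P U \<longleftrightarrow> U \<noteq> P \<and> (\<forall>W. gsub U P W \<longrightarrow> W = U \<or> W = P)"

text \<open>W1/W0 (subquotient of proper standard module of Delta-bar(n)) is isomorphic as graded
  module to q^d L(b), where L(b) is the irreducible graded quotient of Delta(b).\<close>
definition isoL :: "nat \<Rightarrow> nat \<Rightarrow> 'k::field comb set \<Rightarrow> 'k comb set \<Rightarrow> nat \<Rightarrow> int \<Rightarrow> bool" where
  "isoL t n W0 W1 b d \<longleftrightarrow>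
    (\<exists>U. gsub (Kstd t b) (Pn b) U \<and> irr (Pn b) U \<and>
      (\<exists>\<phi> :: 'k comb \<Rightarrow> 'k comb.
         (\<forall>w\<in>W1. \<phi> w \<in> Pn b)
       \<and> (\<forall>w\<in>W1. \<forall>w'\<in>W1. cdiff (\<phi> (cadd w w')) (cadd (\<phi> w) (\<phi> w')) \<in> U)
       \<and> (\<forall>c. \<forall>w\<in>W1. cdiff (\<phi> (csc c w)) (csc c (\<phi> w)) \<in> U)
       \<and> (\<forall>e. \<forall>w\<in>W1. wt e \<longrightarrow> cdiff (\<phi> (comp (dl e) w)) (comp (dl e) (\<phi> w)) \<in> U)
       \<and> (\<forall>w\<in>W1. \<forall>j. cdiff (\<phi> (hom j w)) (hom (j - shift n + shift b + d) (\<phi> w)) \<in> U)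
       \<and> (\<forall>w\<in>W1. \<phi> w \<in> U \<longleftrightarrow> w \<in> W0)
       \<and> (\<forall>p\<in>Pn b. \<exists>w\<in>W1. cdiff (\<phi> w) p \<in> U)))"

text \<open>Coefficient c_d of q^d in the graded multiplicity [Delta-bar(n) : L(b)]_q.\<close>
definition gmult :: "'k::field itself \<Rightarrow> nat \<Rightarrow> nat \<Rightarrow> nat \<Rightarrow> int \<Rightarrow> enat" where
  "gmult _ t n b d = Sup {enat (card {r \<in> {1..k}. isoL t n (W (r - 1)) (W r) b d}) | k (W :: nat \<Rightarrow> 'k comb set).
      W 0 = Kprop t n \<and> W k = Pn n \<and> (\<forall>r\<le>k. gsub (Kprop t n) (Pn n) (W r))
      \<and> (\<forall>r<k. W r \<subseteq> W (Suc r))}"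

text \<open>Coefficient of q^d in q^{-a} / ((1-q^{-4})(1-q^{-8})...(1-q^{-4m})), expanded in q^{-1}.\<close>
definition pcoeff :: "nat \<Rightarrow> nat \<Rightarrow> int \<Rightarrow> rat" where
  "pcoeff m a d = (if d \<le> 0 then
      fps_nth (fps_X ^ a * inverse (\<Prod>i\<in>{1..m}. 1 - fps_X ^ (4 * i))) (nat (- d)) else 0)"

end

theory Submission
 imports Defs "HOL-Computational_Algebra.Fraction_Field" "HOL-Computational_Algebra.Polynomial" "HOL-Library.Function_Algebras"
begin

text \<open>The algebra acts faithfully enough on a generic fibre functor, in which one strand has a basis of \<open>N\<close>
 vectors with generic dot eigenvalues, to show that an explicit spanning set of the proper standard module is a basis.
 The idempotent \<open>ei b\<close>, built from the longest crossing \<open>w b\<close>, cuts out of \<open>L(b)\<close> a single vector, and by a degree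
 estimate kills nothing else relevant: the multiplicity of \<open>L(b)\<close> is the graded dimension of \<open>ei b\<close> applied to the module.
 Restricting by one strand resolves \<open>ei b\<close> into the idempotents for \<open>b + 1\<close> and \<open>b - 1\<close>; the resulting recursion for
 these dimensions is solved by the stated product.\<close>

text \<open>The parity of \<open>N\<close> realises the parameter \<open>t\<close>: a partial
  fraction identity makes the undotted bubble act by \<open>N mod 2\<close>. Bubbles and symmetric
  polynomials act on suitable vectors by scalars, so independence comes down to Vandermonde systems
  in the eigenvalues. An eigenvalue has to differ from its negative, hence characteristic different
  from 2. The delicate point is that a vector fixed by \<open>ei b\<close> in an irreducible
  subquotient might belong to some \<open>L(c)\<close> with \<open>c < b\<close>. Going from the
  least weight \<open>c\<close> to the vector, and back after reflecting the diagram, would give two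
  elements outside \<open>Kp c\<close>. The solved recursion puts both degrees strictly above
  \<open>shift c - shift b\<close>, while their sum is exactly twice that number. The recursion
  arises because a strand left of \<open>ei b\<close> can be absorbed into the idempotent or be used
  to restrict the module, which changes \<open>n\<close> by one. Comparing both eliminates the
  strand and leaves the rank in degree \<open>D\<close> minus the rank in degree
  \<open>D - 2b\<close>; vanishing in low degrees then fixes the solution.\<close>

lemmas assoc = mult.assoc and algs = algebra_simps

text \<open>The algebra becomes a type, and a type cannot depend on a number; so \<open>t\<close> is
  carried by a type, \<open>unit\<close> for 0 and \<open>bool\<close> for 1.\<close>

class tparam =
 fixes tparam :: "'a itself => nat"
 assumes tparam_le: "tparam TYPE('a) <= 1"

instantiation unit :: tparam
begin
definition tparam_unit :: "unit itself => nat" where "tparam_unit _ = 0"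
instance by standard (simp add: tparam_unit_def)
end

instantiation bool :: tparam
begin
definition tparam_bool :: "bool itself => nat" where "tparam_bool _ = 1"
instance by standard (simp add: tparam_bool_def)
end

section \<open>Well-typed finite combinations, and the path algebra as a quotient type\<close>

definition good :: "'k::field comb => bool" where
 "good a \<longleftrightarrow> finite {e. a e ~= 0} & (ALL e. a e ~= 0 --> wt e)"
lemmas comb_defs = dl_def czero_def cadd_def cdiff_def csc_def
lemma good_czero [simp]: "good czero" by (simp add: good_def czero_def)
lemma good_dl: "wt e ==> good (dl e)"
 by (auto simp: good_def dl_def)
lemma good_cadd: "good a ==> good b ==> good (cadd a b)"
proof -
 assume a: "good a" "good b"
 have "{e. cadd a b e ~= 0} <= {e. a e ~= 0} \<union> {e. b e ~= 0}" by (auto simp: cadd_def)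
 hence "finite {e. cadd a b e ~= 0}" using a unfolding good_def by (meson finite_UnI finite_subset)
 moreover have "ALL e. cadd a b e ~= 0 --> wt e" using a unfolding good_def cadd_def by (metis add.right_neutral)
 ultimately show ?thesis by (simp add: good_def)
qed
lemma good_csc: "good a ==> good (csc c a)"
by (simp add: csc_def good_def)
lemma cdiff_alt: "cdiff a b = cadd a (csc (-1) b)" by (auto simp: comb_defs)
lemma good_cdiff: "good a ==> good b ==> good (cdiff a b)"
 by (simp add: cdiff_alt good_cadd good_csc)
lemma good_comp: "good a ==> good b ==> good (comp a b)"
proof -
 assume a: "good a" "good b"
 let ?A = "({e. a e ~= 0} \<times> {e. b e ~= 0})"
 have "{e. comp a b e ~= 0} <= (%(f, g). Comp f g) ` ?A"
 proof
  fix e assume "e : {e. comp a b e ~= 0}"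
  thus "e : (%(f, g). Comp f g) ` ?A"
   by (cases e) (auto simp: comp_def split: if_splits)
 qed
 hence "finite {e. comp a b e ~= 0}" using a unfolding good_def
  by (meson finite_SigmaI finite_imageI finite_subset)
 moreover have "ALL e. comp a b e ~= 0 --> wt e" using a
  by (auto simp: good_def comp_def split: mexp.splits if_splits)
 ultimately show ?thesis by (simp add: good_def)
qed
lemma good_tens: "good a ==> good b ==> good (tens a b)"
proof -
 assume a: "good a" "good b"
 let ?A = "({e. a e ~= 0} \<times> {e. b e ~= 0})"
 have "{e. tens a b e ~= 0} <= (%(f, g). Tens f g) ` ?A"
 proof
  fix e assume "e : {e. tens a b e ~= 0}"
  thus "e : (%(f, g). Tens f g) ` ?A"
   by (cases e) (auto simp: tens_def split: if_splits)
 qed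
 hence "finite {e. tens a b e ~= 0}" using a unfolding good_def
  by (meson finite_SigmaI finite_imageI finite_subset)
 moreover have "ALL e. tens a b e ~= 0 --> wt e" using a
  by (auto simp: good_def tens_def split: mexp.splits if_splits)
 ultimately show ?thesis by (simp add: good_def)
qed
lemma good_hom: "good a ==> good (hom d a)"
proof -
 assume a: "good a"
 have "{e. hom d a e ~= 0} <= {e. a e ~= 0}" by (auto simp: hom_def)
 hence "finite {e. hom d a e ~= 0}" using a unfolding good_def by (meson finite_subset)
 thus ?thesis using a by (auto simp: good_def hom_def)
qed
lemma good_induct [consumes 1, case_names zero add]:
 assumes "good a" and z: "P czero"
  and s: "!!c e a. wt e ==> good a ==> P a ==> P (cadd (csc c (dl e)) a)"
 shows "P a"
proof -
 have "ALL a. good a --> {e. a e ~= 0} = S --> P a" if "finite S" for S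
  using that
 proof (induction S)
  case empty
  have "a = czero" if "{e. a e ~= 0} = {}" for a :: "'a comb" using that by (auto simp: czero_def)
  thus ?case using z by metis
 next
  case (insert e S)
  show ?case
  proof (intro allI impI)
   fix a :: "'a comb" assume a: "good a" "{e. a e ~= 0} = insert e S"
   define b where "b = (%x. if x = e then 0 else a x)"
   have bS: "{e. b e ~= 0} = S" using a insert.hyps by (auto simp: b_def)
   have "a = cadd (csc (a e) (dl e)) b" by (auto simp: comb_defs b_def)
   moreover have "wt e" using a by (auto simp: good_def)
   ultimately show "P a" by (metis insert.hyps a s[of e b "a e"] insert.IH bS b_def good_def bS)
  qed
 qed
 thus ?thesis using assms(1) unfolding good_def by metis
qed
lemma comp_cadd_left: "comp (cadd a b) c = cadd (comp a c) (comp b c)"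
 by (auto simp: comp_def cadd_def algs split: mexp.splits)
lemma comp_cadd_right: "comp c (cadd a b) = cadd (comp c a) (comp c b)"
 by (auto simp: comp_def cadd_def algs split: mexp.splits)
lemma comp_csc_left: "comp (csc k a) c = csc k (comp a c)"
 by (auto simp: comp_def csc_def algs split: mexp.splits)
lemma comp_csc_right: "comp c (csc k a) = csc k (comp c a)"
 by (auto simp: comp_def csc_def algs split: mexp.splits)
lemma comp_czero [simp]: "comp czero a = czero" "comp a czero = czero"
 by (auto simp: comp_def czero_def split: mexp.splits)
lemma comp_dl: "comp (dl f) (dl g) = (if src f = tgt g then dl (Comp f g) else czero)"
 by (rule ext) (auto simp: comp_def dl_def czero_def split: mexp.splits)
lemma tens_cadd_left: "tens (cadd a b) c = cadd (tens a c) (tens b c)"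
 by (auto simp: tens_def cadd_def algs split: mexp.splits)
lemma tens_cadd_right: "tens c (cadd a b) = cadd (tens c a) (tens c b)"
 by (auto simp: tens_def cadd_def algs split: mexp.splits)
lemma tens_csc_left: "tens (csc k a) c = csc k (tens a c)"
 by (auto simp: tens_def csc_def algs split: mexp.splits)
lemma tens_csc_right: "tens c (csc k a) = csc k (tens c a)"
 by (auto simp: tens_def csc_def algs split: mexp.splits)
lemma tens_czero [simp]: "tens czero a = czero" "tens a czero = czero"
 by (auto simp: tens_def czero_def split: mexp.splits)
lemma tens_dl: "tens (dl f) (dl g) = dl (Tens f g)"
 by (rule ext) (auto simp: tens_def dl_def split: mexp.splits)
lemma hom_cadd: "hom d (cadd a b) = cadd (hom d a) (hom d b)"
 by (auto simp: hom_def cadd_def)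
lemma hom_csc: "hom d (csc k a) = csc k (hom d a)"
 by (auto simp: hom_def csc_def)
lemma hom_dl: "hom d (dl e) = (if deg e = d then dl e else czero)"
 by (rule ext) (auto simp: hom_def dl_def czero_def)
lemma hom_czero [simp]: "hom d czero = czero" by (auto simp: hom_def czero_def)
lemma hom_comp_dl: "hom d (comp (dl e) a) = comp (dl e) (hom (d - deg e) a)"
 "hom d (comp a (dl e)) = comp (hom (d - deg e) a) (dl e)"
 by (rule ext, auto simp: hom_def comp_def dl_def split: mexp.splits)+
lemma hom_tens_dl: "hom d (tens (dl e) a) = tens (dl e) (hom (d - deg e) a)"
 "hom d (tens a (dl e)) = tens (hom (d - deg e) a) (dl e)"
 by (rule ext, auto simp: hom_def tens_def dl_def split: mexp.splits)+
lemma rel_cdiff: "a : rel t ==> b : rel t ==> cdiff a b : rel t"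
 by (simp add: cdiff_alt rel_add rel_smult)
lemma lc_Nil: "lc [] = czero" and lc_Cons: "lc (p # l) = cadd (csc (fst p) (dl (snd p))) (lc l)"
 by (auto simp: lc_def comb_defs)
lemma good_lc: "(!!p. p : set l ==> wt (snd p)) ==> good (lc l)"
 by (induction l) (simp_all add: lc_Nil lc_Cons good_cadd good_csc good_dl)
lemma rel_good: "a : rel t ==> good a"
proof (induction rule: rel.induct)
 case (rel_struct a)
 thus ?case by (auto simp: structural_def intro!: good_cdiff good_dl)
next
 case (rel_nb a)
 thus ?case unfolding nbrels_def
  by (auto intro!: good_cdiff good_dl good_csc good_lc)
qed (auto intro: good_cadd good_csc good_comp good_tens good_dl)
lemma rel_comp_left: "good g ==> a : rel t ==> comp g a : rel t"
 by (induction g rule: good_induct)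
  (auto simp: comp_cadd_left comp_csc_left intro: rel_zero rel_add rel_smult rel_compL)
lemma rel_comp_right: "good g ==> a : rel t ==> comp a g : rel t"
 by (induction g rule: good_induct)
  (auto simp: comp_cadd_right comp_csc_right intro: rel_zero rel_add rel_smult rel_compR)
lemma rel_tens_left: "good g ==> a : rel t ==> tens g a : rel t"
 by (induction g rule: good_induct)
  (auto simp: tens_cadd_left tens_csc_left intro: rel_zero rel_add rel_smult rel_tensL)
lemma rel_tens_right: "good g ==> a : rel t ==> tens a g : rel t"
 by (induction g rule: good_induct)
  (auto simp: tens_cadd_right tens_csc_right intro: rel_zero rel_add rel_smult rel_tensR)
lemma hom_cdiff: "hom d (cdiff a b) = cdiff (hom d a) (hom d b)"
 by (simp add: cdiff_alt hom_cadd hom_csc)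
lemma hom_homog: assumes "ALL e. a e ~= 0 --> deg e = c" shows "hom d a = (if d = c then a else czero)"
 using assms by (force simp: hom_def czero_def)

definition homog :: "int => 'k::field comb => bool" where "homog d a \<longleftrightarrow> (ALL e. a e ~= 0 --> deg e = d)"
lemma homog_dl: "deg e = d ==> homog d (dl e)" and homog_czero: "homog d czero"
 by (auto simp: homog_def dl_def czero_def split: if_splits)
lemma homog_cadd: "homog d a ==> homog d b ==> homog d (cadd a b)"
 unfolding homog_def cadd_def by (metis add.right_neutral)
lemma homog_csc: "homog d a ==> homog d (csc c a)" by (auto simp: homog_def csc_def)
lemma homog_cdiff: "homog d a ==> homog d b ==> homog d (cdiff a b)"
 by (simp add: cdiff_alt homog_cadd homog_csc)
lemmas homog_intros = homog_dl homog_czero homog_cadd homog_csc homog_cdiff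
lemma structural_homog: "a : structural ==> EX c. homog c a"
proof -
 have *: "deg e = deg f ==> EX c. homog c (cdiff (dl e) (dl f :: 'a comb))" for e f
  by (rule exI[of _ "deg e"]) (simp add: homog_intros)
 assume "a : structural"
 thus ?thesis unfolding structural_def by (elim UnE CollectE exE conjE; hypsubst) (auto intro!: *)
qed
lemma nbrels_homog: "a : nbrels t ==> EX c. homog c a"
proof -
 assume "a : nbrels t"
 hence "homog 0 a | homog 2 a | homog (-2) a | homog (-4) a | homog (-6) a"
  unfolding nbrels_def by (elim insertE emptyE; hypsubst) (simp_all add: homog_intros lc_Cons lc_Nil)
 thus ?thesis by blast
qed
text \<open>All relations are homogeneous, so the tensor ideal is stable under taking components;
  this lets the grading descend to the quotient.\<close>

lemma rel_hom: "a : rel t ==> hom d a : rel t"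
proof (induction arbitrary: d rule: rel.induct)
 case (rel_struct a)
 thus ?case using structural_homog[OF rel_struct] hom_homog[of a] unfolding homog_def by (metis rel.rel_struct rel_zero)
next
 case (rel_nb a)
 thus ?case using nbrels_homog[OF rel_nb] hom_homog[of a] unfolding homog_def by (metis rel.rel_nb rel_zero)
qed (auto simp: hom_cadd hom_csc hom_comp_dl hom_tens_dl intro: rel.intros)

text \<open>Elements are congruence classes of good combinations: \<open>comb\<close> also contains
  functions with infinite support or with ill-typed expressions in their support, which represent
  nothing in the path algebra.\<close>

typedef (overloaded) ('k::field, 't::tparam) nb =
 "{C :: 'k comb set. EX a. good a & C = {b. good b & cdiff a b : rel (tparam TYPE('t))}}"
 by (auto intro: good_czero)

definition qa :: "'k::field comb => ('k, 't::tparam) nb" where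
 "qa a = Abs_nb {b. good b & cdiff a b : rel (tparam TYPE('t))}"
definition qr :: "('k::field, 't::tparam) nb => 'k comb" where
 "qr y = (SOME a. good a & qa a = y)"
lemma qr: "good (qr y)" "qa (qr y) = y"
proof -
 obtain a where "good a" "qa a = y"
  using Rep_nb[of y] Rep_nb_inverse[of y] unfolding qa_def by auto
 hence "EX a. good a & qa a = y" by blast
 thus "good (qr y)" "qa (qr y) = y" unfolding qr_def by (metis (mono_tags, lifting) someI_ex)+
qed
lemma nb_cases [cases type: nb]: obtains a where "good a" "y = qa a" using qr[of y] by metis
lemma cdiff_self: "cdiff a a = czero" by (auto simp: comb_defs)
lemma qa_eq_iff:
 assumes "good a" "good b"
 shows "(qa a :: ('k::field, 't::tparam) nb) = qa b \<longleftrightarrow> cdiff a b : rel (tparam TYPE('t))"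
proof -
 let ?A = "(tparam TYPE('t))"
 let ?C = "%a. {b. good b & cdiff a b : rel ?A}"
 have 1: "cdiff b c : rel ?A"
  if "cdiff a b : rel ?A" "cdiff a c : rel ?A" for a b c :: "'k comb"
 proof -
  have "cdiff b c = cdiff (cdiff a c) (cdiff a b)" by (auto simp: comb_defs)
  thus ?thesis using that by (simp add: rel_cdiff)
 qed
 have 2: "cdiff a c : rel ?A"
  if "cdiff a b : rel ?A" "cdiff b c : rel ?A" for a b c :: "'k comb"
 proof -
  have "cdiff a c = cadd (cdiff a b) (cdiff b c)" by (auto simp: comb_defs)
  thus ?thesis using that by (simp add: rel_add)
 qed
 have "qa a = (qa b :: ('k, 't) nb) \<longleftrightarrow> ?C a = ?C b"
  unfolding qa_def using assms by (subst Abs_nb_inject) auto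
 also have "... \<longleftrightarrow> cdiff a b : rel ?A"
 proof
  assume "?C a = ?C b"
  moreover have "b : ?C b" using assms by (simp add: cdiff_self rel_zero)
  ultimately show "cdiff a b : rel ?A" by blast
 next
  assume "cdiff a b : rel ?A"
  thus "?C a = ?C b" using 1 2 by blast
 qed
 finally show ?thesis .
qed
lemma strI:
 "wt f ==> wt g ==> wt h ==> src f = tgt g ==> src g = tgt h ==>
  cdiff (dl (Comp (Comp f g) h)) (dl (Comp f (Comp g h))) : structural"
 "wt f ==> cdiff (dl (Comp (Id (tgt f)) f)) (dl f) : structural"
 "wt f ==> cdiff (dl (Comp f (Id (src f)))) (dl f) : structural"
 "wt f ==> wt g ==> wt h ==> cdiff (dl (Tens (Tens f g) h)) (dl (Tens f (Tens g h))) : structural"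
 "wt f ==> cdiff (dl (Tens (Id 0) f)) (dl f) : structural"
 "wt f ==> cdiff (dl (Tens f (Id 0))) (dl f) : structural"
 "cdiff (dl (Tens (Id m) (Id n))) (dl (Id (m + n))) : structural"
 "wt f ==> wt g ==> wt f' ==> wt g' ==> src f = tgt g ==> src f' = tgt g' ==>
  cdiff (dl (Tens (Comp f g) (Comp f' g'))) (dl (Comp (Tens f f') (Tens g g'))) : structural"
 unfolding structural_def by blast+
lemma qa_eqI: "good a ==> good b ==> cdiff a b : rel (tparam TYPE('t)) ==> (qa a :: ('k::field, 't::tparam) nb) = qa b"
 by (simp add: qa_eq_iff)
lemma rel_qr: "good a ==> cdiff (qr (qa a :: ('k::field, 't::tparam) nb)) a : rel (tparam TYPE('t))"
 using qa_eq_iff[of "qr (qa a :: ('k, 't) nb)" a] qr by metis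

instantiation nb :: (field, tparam) "{ab_group_add, times}"
begin
definition zero_nb :: "('a, 'b) nb" where "zero_nb = qa czero"
definition plus_nb :: "('a, 'b) nb => ('a, 'b) nb => ('a, 'b) nb" where "plus_nb y z = qa (cadd (qr y) (qr z))"
definition uminus_nb :: "('a, 'b) nb => ('a, 'b) nb" where "uminus_nb y = qa (csc (-1) (qr y))"
definition minus_nb :: "('a, 'b) nb => ('a, 'b) nb => ('a, 'b) nb" where "minus_nb y z = y + - z"
definition times_nb :: "('a, 'b) nb => ('a, 'b) nb => ('a, 'b) nb" where "times_nb y z = qa (comp (qr y) (qr z))"
lemma qa_add: assumes "good a" "good b" shows "qa a + qa b = qa (cadd a b)"
proof -
 let ?a = "qr (qa a :: ('a, 'b) nb)" and ?b = "qr (qa b :: ('a, 'b) nb)"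
 have "cdiff (cadd ?a ?b) (cadd a b) = cadd (cdiff ?a a) (cdiff ?b b)" by (auto simp: comb_defs)
 thus ?thesis unfolding plus_nb_def
  by (intro qa_eqI) (simp_all add: assms good_cadd qr rel_add rel_qr)
qed
lemma qa_uminus: assumes "good a" shows "- qa a = qa (csc (-1) a)"
proof -
 let ?a = "qr (qa a :: ('a, 'b) nb)"
 have "cdiff (csc (-1) ?a) (csc (-1) a) = csc (-1) (cdiff ?a a)" by (auto simp: comb_defs)
 thus ?thesis unfolding uminus_nb_def
  by (intro qa_eqI) (simp_all add: assms good_csc qr rel_smult rel_qr)
qed
lemma qa_mult: assumes "good a" "good b" shows "qa a * qa b = qa (comp a b)"
proof -
 let ?a = "qr (qa a :: ('a, 'b) nb)" and ?b = "qr (qa b :: ('a, 'b) nb)"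
 have "cdiff (comp ?a ?b) (comp a b) = cadd (comp (cdiff ?a a) ?b) (comp a (cdiff ?b b))"
  by (simp add: cdiff_alt comp_cadd_left comp_cadd_right comp_csc_left comp_csc_right) (auto simp: comb_defs)
 thus ?thesis unfolding times_nb_def
  by (intro qa_eqI) (simp_all add: assms good_comp qr rel_add rel_comp_left rel_comp_right rel_qr)
qed
lemma qa_diff: assumes "good a" "good b" shows "qa a - qa b = qa (cdiff a b)"
 unfolding minus_nb_def qa_uminus[OF assms(2)] cdiff_alt by (rule qa_add) (simp_all add: assms good_csc)
lemmas qa_simps0 = qa_add qa_uminus qa_mult qa_diff
lemma nb_addassoc: "(a + b) + c = a + (b + (c :: ('a::field, 'b::tparam) nb))"
 by (cases a; cases b; cases c) (simp add: qa_simps0 good_cadd, simp add: comb_defs add.assoc)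
lemma nb_addcomm: "a + b = b + (a :: ('a::field, 'b::tparam) nb)"
 by (cases a; cases b) (simp add: qa_simps0 good_cadd, simp add: comb_defs add.commute)
lemma nb_add0: "0 + a = (a :: ('a::field, 'b::tparam) nb)"
 by (cases a) (simp add: zero_nb_def qa_simps0 good_cadd, simp add: comb_defs)
lemma nb_distl: "(a + b) * c = a * c + b * (c :: ('a::field, 'b::tparam) nb)"
 by (cases a; cases b; cases c) (simp add: qa_simps0 good_cadd good_comp comp_cadd_left)
lemma nb_distr: "c * (a + b) = c * a + c * (b :: ('a::field, 'b::tparam) nb)"
 by (cases a; cases b; cases c) (simp add: qa_simps0 good_cadd good_comp comp_cadd_right)
instance
proof
 fix a b c :: "('a, 'b) nb"
 show "a + b + c = a + (b + c)" by (rule nb_addassoc)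
 show "a + b = b + a" by (rule nb_addcomm)
 show "0 + a = a" by (rule nb_add0)
 show "- a + a = 0" by (cases a) (simp add: zero_nb_def qa_simps0 good_csc, simp add: comb_defs)
 show "a - b = a + - b" by (rule minus_nb_def)
qed
end

definition "q e = qa (dl e)"
definition smul :: "'a::field => ('a, 'b::tparam) nb => ('a, 'b) nb" (infixr "*s" 75) where "c *s y = qa (csc c (qr y))"
lemma qa_smul: assumes "good a" shows "c *s qa a = qa (csc c a)"
proof -
 let ?a = "qr (qa a :: ('a, 'b) nb)"
 have "cdiff (csc c ?a) (csc c a) = csc c (cdiff ?a a)" by (auto simp: comb_defs algs)
 thus ?thesis unfolding smul_def
  by (intro qa_eqI) (simp_all add: assms good_csc qr rel_smult rel_qr)
qed
lemmas qa_simps = qa_simps0 qa_smul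
lemma nb_smull: "(k *s a) * c = k *s (a * c)"
 by (cases a; cases c) (simp add: qa_simps good_csc good_comp comp_csc_left)
lemma nb_smulr: "c * (k *s a) = k *s (c * a)"
 by (cases a; cases c) (simp add: qa_simps good_csc good_comp comp_csc_right)
lemma nb_mult0: "0 * c = (0 :: ('a::field, 'b::tparam) nb)" "c * 0 = (0 :: ('a::field, 'b::tparam) nb)"
 by (cases c, simp add: zero_nb_def qa_simps)+
lemma nb_induct [case_names zero add]:
 assumes "P 0" "!!c e y. wt e ==> P y ==> P (c *s q e + y)"
 shows "P y"
proof (cases y)
 case (1 a)
 have "P (qa a)" if "good a" for a using that
 proof (induction rule: good_induct)
  case zero thus ?case using assms(1) by (simp add: zero_nb_def)
 next
  case (add c e a)
  thus ?case using assms(2)[of e "qa a" c] by (simp add: q_def qa_simps good_csc good_dl)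
 qed
 thus ?thesis using 1 by simp
qed
lemma q_mult: "wt f ==> wt g ==> q f * q g = (if src f = tgt g then q (Comp f g) else 0)"
 by (simp add: q_def qa_simps good_dl comp_dl zero_nb_def)
lemma structural_eq: assumes "cdiff (dl e) (dl f) : (structural :: 'a::field comb set)" "wt e" "wt f"
 shows "(q e :: ('a, 'b::tparam) nb) = q f"
 unfolding q_def by (rule qa_eqI) (simp_all add: assms good_dl rel_struct)
lemma nb_multassoc: "(a * b) * c = a * (b * (c :: ('a::field, 'b::tparam) nb))"
proof (induction a rule: nb_induct)
 case (add ka e a)
 have "(q e * b) * c = q e * (b * c)"
 proof (induction b rule: nb_induct)
  case (add kb f b)
  have "(q e * q f) * c = q e * (q f * c)"
  proof (induction c rule: nb_induct)
   case (add kc g c)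
   have "q (Comp (Comp e f) g) = (q (Comp e (Comp f g)) :: ('a, 'b) nb)" if "src e = tgt f" "src f = tgt g"
    using that \<open>wt e\<close> \<open>wt f\<close> \<open>wt g\<close> by (intro structural_eq) (simp_all add: strI)
   hence "(q e * q f) * q g = q e * (q f * (q g :: ('a, 'b) nb))" using \<open>wt e\<close> \<open>wt f\<close> \<open>wt g\<close>
    by (auto simp: q_mult nb_mult0)
   thus ?case using add by (simp add: nb_distr nb_smulr)
  qed (simp add: nb_mult0)
  thus ?case using add by (simp add: nb_distl nb_distr nb_smull nb_smulr)
 qed (simp add: nb_mult0)
 thus ?case using add by (simp add: nb_distl nb_smull)
qed (simp add: nb_mult0)

instance nb :: (field, tparam) ring
proof
 fix a b c :: "('a, 'b) nb"
 show "a * b * c = a * (b * c)" by (rule nb_multassoc)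
 show "(a + b) * c = a * c + b * c" by (rule nb_distl)
 show "a * (b + c) = a * b + a * c" by (rule nb_distr)
qed
lemma smul_left [simp]: "(k *s a) * c = k *s (a * c)" by (rule nb_smull)
lemma smul_right [simp]: "c * (k *s a) = k *s (c * a)" by (rule nb_smulr)
lemma smul_add: "k *s (a + b) = k *s a + k *s b"
 by (cases a; cases b) (simp add: qa_simps good_cadd good_csc, simp add: comb_defs algs)
lemma smul_add_left: "(k + l) *s a = k *s a + l *s a"
 by (cases a) (simp add: qa_simps good_cadd good_csc, simp add: comb_defs algs)
lemma smul_diff: "k *s (a - b) = k *s a - k *s (b :: ('a::field, 'b::tparam) nb)"
 using smul_add[of k "a - b" b] by simp
lemma smul_smul [simp]: "k *s (l *s a) = (k * l) *s a"
 by (cases a) (simp add: qa_simps good_cadd good_csc, simp add: comb_defs algs)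
lemma smul_one [simp]: "1 *s a = a"
 by (cases a) (simp add: qa_simps good_cadd good_csc, simp add: comb_defs algs)

interpretation nbv: vector_space "smul :: 'a::field => ('a, 'b::tparam) nb => ('a, 'b) nb"
 by unfold_locales (simp_all add: smul_add smul_add_left)
lemmas nb_scale [simp] = nbv.scale_zero_left nbv.scale_zero_right nbv.scale_minus_left nbv.scale_minus_right

section \<open>Tensor product, homogeneous components and identity morphisms on the quotient\<close>

definition ten :: "('a::field, 'b::tparam) nb => ('a, 'b) nb => ('a, 'b) nb" (infixr "**" 72) where
 "y ** z = qa (tens (qr y) (qr z))"
definition hc :: "int => ('a::field, 'b::tparam) nb => ('a, 'b) nb" where
 "hc d y = qa (hom d (qr y))"
lemma qa_ten: assumes "good a" "good b" shows "qa a ** qa b = qa (tens a b)"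
proof -
 let ?a = "qr (qa a :: ('a, 'b) nb)" and ?b = "qr (qa b :: ('a, 'b) nb)"
 have "cdiff (tens ?a ?b) (tens a b) = cadd (tens (cdiff ?a a) ?b) (tens a (cdiff ?b b))"
  by (simp add: cdiff_alt tens_cadd_left tens_cadd_right tens_csc_left tens_csc_right) (auto simp: comb_defs)
 thus ?thesis unfolding ten_def
  by (intro qa_eqI) (simp_all add: assms good_tens qr rel_add rel_tens_left rel_tens_right rel_qr)
qed
lemma qa_hc: assumes "good a" shows "hc d (qa a) = qa (hom d a)"
proof -
 let ?a = "qr (qa a :: ('a, 'b) nb)"
 have "cdiff (hom d ?a) (hom d a) = hom d (cdiff ?a a)" by (simp add: hom_cdiff)
 thus ?thesis unfolding hc_def
  by (intro qa_eqI) (simp_all add: assms good_hom qr rel_hom rel_qr)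
qed
lemma ten_add_left: "(a + b) ** c = a ** c + b ** c"
 by (cases a; cases b; cases c) (simp add: qa_simps qa_ten good_cadd good_tens tens_cadd_left)
lemma ten_add_right: "c ** (a + b) = c ** a + c ** b"
 by (cases a; cases b; cases c) (simp add: qa_simps qa_ten good_cadd good_tens tens_cadd_right)
lemma ten_smul_left [simp]: "(k *s a) ** c = k *s (a ** c)"
 by (cases a; cases c) (simp add: qa_simps qa_ten good_csc good_tens tens_csc_left)
lemma ten_smul_right [simp]: "c ** (k *s a) = k *s (c ** a)"
 by (cases a; cases c) (simp add: qa_simps qa_ten good_csc good_tens tens_csc_right)
lemma ten_zero [simp]: "0 ** c = 0" "c ** 0 = 0"
 by (cases c, simp add: zero_nb_def qa_ten)+
lemma ten_uminus [simp]: "(- a) ** c = - (a ** c)" "c ** (- a) = - (c ** a)"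
 using ten_smul_left[of "-1" a c] ten_smul_right[of c "-1" a] by simp_all
lemma ten_diff: "(a - b) ** c = a ** c - b ** c" "c ** (a - b) = c ** a - c ** b"
 by (simp_all only: diff_conv_add_uminus ten_add_left ten_add_right ten_uminus)
lemma hc_add: "hc d (a + b) = hc d a + hc d b"
 by (cases a; cases b) (simp add: qa_simps qa_hc good_cadd good_hom hom_cadd)
lemma hc_smul [simp]: "hc d (k *s a) = k *s hc d a"
 by (cases a) (simp add: qa_simps qa_hc good_csc good_hom hom_csc)
lemma hc_zero [simp]: "hc d 0 = 0"
 by (simp add: zero_nb_def qa_hc)
lemma hc_uminus [simp]: "hc d (- a) = - hc d a"
 using hc_smul[of d "-1" a] by simp
lemma hc_diff: "hc d (a - b) = hc d a - hc d b"
 by (simp only: diff_conv_add_uminus hc_add hc_uminus)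
lemma hc_sum: "hc d (sum f A) = (SUM i:A. hc d (f i))"
 by (induction A rule: infinite_finite_induct) (simp_all add: hc_add)
lemma hc_q: "wt e ==> hc d (q e) = (if deg e = d then q e else 0)"
 by (simp add: q_def qa_hc good_dl hom_dl zero_nb_def)
lemma ten_q: "wt e ==> wt f ==> q e ** q f = q (Tens e f)"
 by (simp add: q_def qa_ten good_dl tens_dl)

definition I :: "nat => ('a::field, 'b::tparam) nb" where "I n = q (Id n)"
lemma I_q: "wt e ==> I m * q e = (if m = tgt e then q e else 0)"
 "wt e ==> q e * I m = (if m = src e then q e else 0)"
proof -
 assume w: "wt e"
 have "q (Comp (Id (tgt e)) e) = q e" "q (Comp e (Id (src e))) = q e"
  using w by (intro structural_eq; simp add: strI)+
 thus "I m * q e = (if m = tgt e then q e else 0)"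
  "q e * I m = (if m = src e then q e else 0)"
  using w by (auto simp: I_def q_mult)
qed
lemma I_I: "I m * I n = (if m = n then I m else 0)"
 using I_q(1)[of "Id n" m] by (auto simp: I_def)
lemma ten_I [simp]: "I m ** I n = I (m + n)"
proof -
 have "q (Tens (Id m) (Id n)) = (q (Id (m + n)) :: ('a, 'b) nb)"
  by (intro structural_eq) (simp_all add: strI)
 thus ?thesis by (simp add: I_def ten_q)
qed
lemma ten_I0 [simp]: "I 0 ** y = y" "y ** I 0 = y"
proof -
 have "q (Tens (Id 0) e) = (q e :: ('a, 'b) nb)" "q (Tens e (Id 0)) = (q e :: ('a, 'b) nb)" if "wt e" for e
  using that by (intro structural_eq; simp add: strI)+
 hence "wt e ==> I 0 ** q e = (q e :: ('a, 'b) nb)" "wt e ==> q e ** I 0 = (q e :: ('a, 'b) nb)" for e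
  by (simp_all add: I_def ten_q)
 thus "I 0 ** y = y" "y ** I 0 = y"
  by (induction y rule: nb_induct) (simp_all add: ten_add_left ten_add_right)
qed
lemma ten_assoc: "(a ** b) ** c = a ** (b ** c)"
proof (induction a rule: nb_induct)
 case (add ka e a)
 have "(q e ** b) ** c = q e ** (b ** c)"
 proof (induction b rule: nb_induct)
  case (add kb f b)
  have "(q e ** q f) ** c = q e ** (q f ** c)"
  proof (induction c rule: nb_induct)
   case (add kc g c)
   have "q (Tens (Tens e f) g) = (q (Tens e (Tens f g)) :: ('a, 'b) nb)"
    using \<open>wt e\<close> \<open>wt f\<close> \<open>wt g\<close> by (intro structural_eq) (simp_all add: strI)
   hence "(q e ** q f) ** q g = q e ** (q f ** (q g :: ('a, 'b) nb))" using \<open>wt e\<close> \<open>wt f\<close> \<open>wt g\<close>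
    by (auto simp: ten_q)
   thus ?case using add by (simp add: ten_add_right)
  qed simp
  thus ?case using add by (simp add: ten_add_left ten_add_right)
 qed simp
 thus ?case using add by (simp add: ten_add_left)
qed simp
text \<open>The inserted identities make the interchange law true without typing hypotheses:
  expressions that do not fit vanish on both sides. Hence all four arguments can be decomposed
  independently.\<close>

lemma interchange0:
 "(x * I p * y) ** (z * I r * w) = ((x * I p) ** (z * I r)) * ((I p * y) ** (I r * w))"
proof (induction x rule: nb_induct)
 case (add kx e x)
 have "(q e * I p * y) ** (z * I r * w) = ((q e * I p) ** (z * I r)) * ((I p * y) ** (I r * w))"
 proof (induction y rule: nb_induct)
  case (add ky f y)
  have "(q e * I p * q f) ** (z * I r * w) = ((q e * I p) ** (z * I r)) * ((I p * q f) ** (I r * w))"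
  proof (induction z rule: nb_induct)
   case (add kz g z)
   have "(q e * I p * q f) ** (q g * I r * w) = ((q e * I p) ** (q g * I r)) * ((I p * q f) ** (I r * w))"
   proof (induction w rule: nb_induct)
    case (add kw h w)
    have "q (Tens (Comp e f) (Comp g h)) = (q (Comp (Tens e g) (Tens f h)) :: ('a, 'b) nb)"
     if "src e = tgt f" "src g = tgt h"
     using that \<open>wt e\<close> \<open>wt f\<close> \<open>wt g\<close> \<open>wt h\<close> by (intro structural_eq) (simp_all add: strI)
    hence "(q e * I p * q f) ** (q g * I r * q h) = ((q e * I p) ** (q g * I r)) * ((I p * q f) ** (I r * (q h :: ('a, 'b) nb)))"
     using \<open>wt e\<close> \<open>wt f\<close> \<open>wt g\<close> \<open>wt h\<close>
     by (auto simp: I_q q_mult ten_q)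
    thus ?case using add by (simp add: ten_add_right distrib_left)
   qed simp
   thus ?case using add by (simp add: ten_add_left ten_add_right distrib_left distrib_right)
  qed simp
  thus ?case using add by (simp add: ten_add_left ten_add_right distrib_left distrib_right)
 qed simp
 thus ?case using add by (simp add: ten_add_left ten_add_right distrib_left distrib_right)
qed simp

text \<open>Membership in \<open>Hom(B^n, B^m)\<close>, target first. The ring has no unit, so
  typing is expressed by absorbing the idempotents.\<close>

definition hm :: "nat => nat => ('a::field, 'b::tparam) nb => bool" where
 "hm m n y \<longleftrightarrow> I m * y = y & y * I n = y"
lemma interchange: "hm m p x ==> hm p n y ==> hm m' p' z ==> hm p' n' w ==> (x * y) ** (z * w) = (x ** z) * (y ** w)"
 using interchange0[of x p y z p' w] by (simp add: hm_def)
lemma hm_mult: "hm m p y ==> hm p n z ==> hm m n (y * z)"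
 unfolding hm_def by (metis assoc)
lemma hm_I [simp]: "hm n n (I n)" by (simp add: hm_def I_I)
lemma hm_ten: assumes "hm m n y" "hm p r z" shows "hm (m + p) (n + r) (y ** z)"
using interchange[OF hm_I assms(1) hm_I assms(2)] interchange[OF assms(1) hm_I assms(2) hm_I] assms by (simp add: hm_def)
lemma hm_q: "wt e ==> hm (tgt e) (src e) (q e)" by (simp add: hm_def I_q)
lemma hm_0 [simp]: "hm m n 0" by (simp add: hm_def)
lemma hm_add: "hm m n y ==> hm m n z ==> hm m n (y + z)" by (simp add: hm_def distrib_left distrib_right)
lemma hm_diff: "hm m n y ==> hm m n z ==> hm m n (y - z)" by (simp add: hm_def left_diff_distrib right_diff_distrib)
lemma hm_smul: "hm m n y ==> hm m n (c *s y)" by (simp add: hm_def)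
lemma hm_sum: "(!!i. i : A ==> hm m n (f i)) ==> hm m n (sum f A)"
 by (induction A rule: infinite_finite_induct) (simp_all add: hm_add)

definition "dg d y \<longleftrightarrow> hc d y = y"
lemma hc_hc: "hc d (hc d' y) = (if d = d' then hc d y else 0)"
 by (induction y rule: nb_induct) (auto simp: hc_add hc_q)
lemma dg_hc: "dg d (hc d y)" by (simp add: dg_def hc_hc)
lemma dg_0 [simp]: "dg d 0" by (simp add: dg_def)
lemma dg_q: "wt e ==> dg (deg e) (q e)" by (simp add: dg_def hc_q)
lemma dg_I [simp]: "dg 0 (I n)" by (simp add: dg_def hc_q I_def)
lemma dg_add: "dg d y ==> dg d z ==> dg d (y + z)" by (simp add: dg_def hc_add)
lemma dg_smul: "dg d y ==> dg d (c *s y)" by (simp add: dg_def)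
lemma dg_sum: "(!!i. i : A ==> dg d (f i)) ==> dg d (sum f A)"
 by (induction A rule: infinite_finite_induct) (simp_all add: dg_add)
lemma dg_hc_eq: "dg d y ==> hc d' y = (if d = d' then y else 0)"
 using hc_hc[of d' d y] by (auto simp: dg_def)
lemma hc_mult_q: "wt e ==> hc d (q e * y) = q e * (hc (d - deg e) y)"
 by (induction y rule: nb_induct) (auto simp: hc_add hc_q q_mult distrib_left)
lemma hc_mult: assumes "dg d y" shows "hc (d + d') (y * z) = y * (hc d' z)"
proof -
 have "hc (d + d') (hc d y * z) = hc d y * hc d' z"
  by (induction y rule: nb_induct) (auto simp: hc_add hc_q hc_mult_q distrib_right)
 thus ?thesis using assms by (simp add: dg_def)
qed
lemma hc_mult_right: assumes "dg d' z" shows "hc (d + d') (y * z) = hc d y * z"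
proof -
 have 1: "hc (d + d') (y * q e) = hc (d + d' - deg e) y * (q e :: ('a, 'b) nb)" if "wt e" for e d
  using that by (induction y rule: nb_induct) (auto simp: hc_add hc_q q_mult distrib_right)
 have "hc (d + d') (y * hc d' z) = hc d y * hc d' z"
  by (induction z rule: nb_induct) (auto simp: hc_add hc_q 1 distrib_left)
 thus ?thesis using assms by (simp add: dg_def)
qed
lemma dg_mult: "dg d y ==> dg d' z ==> dg (d + d') (y * z)"
 using hc_mult[of d y d' z] by (simp add: dg_def)
lemma hc_ten_q: "wt e ==> hc d (q e ** y) = q e ** (hc (d - deg e) y)"
 by (induction y rule: nb_induct) (auto simp: hc_add hc_q ten_q ten_add_right)
lemma dg_ten: assumes "dg d y" "dg d' z" shows "dg (d + d') (y ** z)"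
proof -
 have "hc (d + d') (hc d y ** z) = hc d y ** hc d' z"
  by (induction y rule: nb_induct) (auto simp: hc_add hc_q hc_ten_q ten_add_left)
 thus ?thesis using assms by (simp add: dg_def)
qed
text \<open>Any finite superset of the degrees is allowed, so that decompositions of several
  elements can be taken over one common index set.\<close>

lemma hc_decomp: "EX D. finite D & (ALL D'. finite D' & D <= D' --> y = (SUM d:D'. hc d y))"
proof (induction y rule: nb_induct)
 case zero
 show ?case by (rule exI[of _ "{}"]) simp
next
 case (add c e y)
 then obtain D where D: "finite D" "!!D'. finite D' & D <= D' ==> y = (SUM d:D'. hc d y)" by blast
 show ?case
 proof (rule exI[of _ "insert (deg e) D"], intro conjI allI impI)
  show "finite (insert (deg e) D)" using D by simp
  fix D' assume D': "finite D' & insert (deg e) D <= D'"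
  hence 1: "(SUM d:D'. hc d y) = y" using D(2)[of D'] by simp
  have 2: "(SUM d:D'. if deg e = d then q e else (0 :: ('a, 'b) nb)) = q e" using D' by simp
  have "(SUM d:D'. hc d (c *s q e + y)) = (SUM d:D'. c *s (if deg e = d then q e else 0)) + (SUM d:D'. hc d y)"
   using \<open>wt e\<close> by (simp add: hc_add hc_q sum.distrib)
  also have "... = c *s q e + y" unfolding 1 by (simp only: nbv.scale_sum_right[symmetric] 2)
  finally show "c *s q e + y = (SUM d:D'. hc d (c *s q e + y))" by simp
 qed
qed
text \<open>Products are kept nested to the right, where a relation between two adjacent factors
  rewrites only after it has been extended by the rest \<open>y\<close> of the word.\<close>

lemma mult_ext:
 fixes a b c d y :: "'r::semigroup_mult"
 shows "a * b = c * d ==> a * (b * y) = c * (d * y)" by (metis assoc)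
lemma mult_ext1:
 fixes a b c y :: "'r::semigroup_mult"
 shows "a * b = c ==> a * (b * y) = c * y" by (metis assoc)
lemma mult_ext0:
 fixes a b y :: "'r::ring"
 shows "a * b = 0 ==> a * (b * y) = 0" by (metis assoc mult_zero_left)

section \<open>Morphisms placed among identity strands, and the relations of the generators\<close>

definition pd :: "nat => ('a::field, 'b::tparam) nb => nat => ('a, 'b) nb" where
 "pd i y j = I i ** (y ** I j)"
lemma pd_add: "pd i (y + z) j = pd i y j + pd i z j" by (simp add: pd_def ten_add_left ten_add_right)
lemma pd_smul [simp]: "pd i (c *s y) j = c *s pd i y j" by (simp add: pd_def)
lemma pd_zero [simp]: "pd i 0 j = 0" by (simp add: pd_def)
lemma pd_uminus [simp]: "pd i (- y) j = - pd i y j" by (simp add: pd_def)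
lemma pd_diff: "pd i (y - z) j = pd i y j - pd i z j" by (simp add: pd_def ten_diff)
lemma pd_I [simp]: "pd i (I n) j = I (i + n + j)" by (simp add: pd_def add.assoc)
lemma pd_pd: "pd i (pd k y l) j = pd (i + k) y (l + j)"
proof -
 have "pd i (pd k y l) j = (I i ** I k) ** (y ** (I l ** I j))" by (simp only: pd_def ten_assoc)
 thus ?thesis by (simp add: pd_def)
qed
lemma pd_00 [simp]: "pd 0 y 0 = y" by (simp add: pd_def)
lemma hm_pd: "hm m n y ==> hm (i + m + j) (i + n + j) (pd i y j)"
 unfolding pd_def add.assoc by (intro hm_ten hm_I)
lemma dg_pd: "dg d y ==> dg d (pd i y j)"
 using dg_ten[of 0 "I i" d "y ** I j"] dg_ten[of d y 0 "I j"] by (simp add: pd_def)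
lemma pd_mult: "pd i (y * z) j = pd i y j * pd i z j"
proof (induction y rule: nb_induct)
 case (add c e y)
 have "pd i (q e * z) j = pd i (q e) j * pd i z j"
 proof (induction z rule: nb_induct)
  case (add c f z)
  have "pd i (q e * q f) j = pd i (q e) j * (pd i (q f) j :: ('a, 'b) nb)"
  proof (cases "src e = tgt f")
   case True
   have 1: "hm (tgt e) (src e) (q e :: ('a, 'b) nb)" "hm (src e) (src f) (q f :: ('a, 'b) nb)"
    using hm_q[OF \<open>wt e\<close>] hm_q[OF \<open>wt f\<close>] True by auto
   have "(q e * q f) ** (I j * I j) = (q e ** I j) * ((q f :: ('a, 'b) nb) ** I j)"
    by (rule interchange[OF 1 hm_I hm_I])
   moreover have "(I i * I i) ** ((q e ** I j) * ((q f :: ('a, 'b) nb) ** I j)) = (I i ** (q e ** I j)) * (I i ** (q f ** I j))"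
    by (rule interchange[OF hm_I hm_I hm_ten[OF 1(1) hm_I] hm_ten[OF 1(2) hm_I]])
   ultimately show ?thesis by (simp add: pd_def I_I)
  next
   case False
   thus ?thesis using \<open>wt e\<close> \<open>wt f\<close> by (simp add: pd_def I_def ten_q q_mult)
  qed
  thus ?case using add by (simp add: pd_add distrib_left)
 qed simp
 thus ?case using add by (simp add: pd_add distrib_right)
qed simp
text \<open>Both sides are \<open>y\<close> and \<open>z\<close> side by side with \<open>k\<close>
  strands between them; the interchange law absorbs the identities.\<close>

lemma far:
 assumes "hm m m' y" "hm p p' z" "j = i + m' + k" "a = k + p + l" "j2 = i + m + k" "a2 = k + p' + l"
 shows "pd i y a * pd j z l = pd j2 z l * pd i y a2"
proof -
 note 1 = assms(1,2)
 have a1: "(y ** I (k + p)) * (I (m' + k) ** z) = y ** (I k ** z)"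
 proof -
  have "(y ** I (k + p)) * (I m' ** (I k ** z)) = (y * I m') ** (I (k + p) * (I k ** z))"
   using interchange[OF 1(1) hm_I hm_I hm_ten[OF hm_I 1(2)]] by simp
  moreover have "I (k + p) * (I k ** z) = I k ** z" using hm_ten[OF hm_I 1(2)] by (simp add: hm_def)
  moreover have "I m' ** (I k ** z) = I (m' + k) ** z" by (simp flip: ten_assoc)
  ultimately show ?thesis using 1(1) by (simp add: hm_def)
 qed
 have a2: "(I (m + k) ** z) * (y ** I (k + p')) = y ** (I k ** z)"
 proof -
  have "(I m ** (I k ** z)) * (y ** I (k + p')) = (I m * y) ** ((I k ** z) * I (k + p'))"
   using interchange[OF hm_I 1(1) hm_ten[OF hm_I 1(2)] hm_I] by simp
  moreover have "(I k ** z) * I (k + p') = I k ** z" using hm_ten[OF hm_I 1(2)] by (simp add: hm_def)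
  moreover have "I m ** (I k ** z) = I (m + k) ** z" by (simp flip: ten_assoc)
  ultimately show ?thesis using 1(1) by (simp add: hm_def)
 qed
 have "pd i y a * pd j z l = pd i (pd 0 y (k + p) * pd (m' + k) z 0) l"
  unfolding pd_mult pd_pd assms(3,4) by (simp add: add.assoc)
 also have "... = pd i (pd (m + k) z 0 * pd 0 y (k + p')) l" using a1 a2 by (simp add: pd_def)
 also have "... = pd j2 z l * pd i y a2" unfolding pd_mult pd_pd assms(5,6) by (simp add: add.assoc)
 finally show ?thesis .
qed
text \<open>All positions are separate variables tied by equations, so the rule unifies with any
  placement of generators and leaves only arithmetic.\<close>

lemma far':
 assumes "hm m m' y" "hm p p' z" "j = i + m' + k" "a = k + p + l" "j2 = i + m + k" "a2 = k + p' + l" "c = l" "c2 = l" "i2 = i"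
 shows "pd i y a * pd j z c = pd j2 z c2 * pd i2 y a2"
 using far[OF assms(1-6)] assms(7-9) by simp

definition gx :: "('a::field, 'b::tparam) nb" where "gx = q eX"
definition gt :: "('a::field, 'b::tparam) nb" where "gt = q eT"
definition ga :: "('a::field, 'b::tparam) nb" where "ga = q eCap"
definition gu :: "('a::field, 'b::tparam) nb" where "gu = q eCup"
lemma hm_gens: "hm (Suc 0) (Suc 0) gx" "hm 2 2 gt" "hm 0 2 ga" "hm 2 0 gu"
 using hm_q[of eX] hm_q[of eT] hm_q[of eCap] hm_q[of eCup] by (simp_all add: gx_def gt_def ga_def gu_def)

text \<open>Positions count from 0 at the left. Out-of-range generators are 0, so that most
  relations below hold without bounds on the index.\<close>

definition X :: "nat => nat => ('a::field, 'b::tparam) nb" where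
 "X n i = (if i < n then pd i gx (n - Suc i) else 0)"
definition T :: "nat => nat => ('a::field, 'b::tparam) nb" where
 "T n i = (if Suc i < n then pd i gt (n - i - 2) else 0)"
definition A :: "nat => nat => ('a::field, 'b::tparam) nb" where
 "A n i = (if Suc i < n then pd i ga (n - i - 2) else 0)"
definition U :: "nat => nat => ('a::field, 'b::tparam) nb" where
 "U n i = (if Suc i < n then pd i gu (n - i - 2) else 0)"
definition "L y = I 1 ** y"
definition "R y = y ** I 1"
definition tI :: "nat => ('a::field, 'b::tparam) nb" where "tI n = of_nat (tparam TYPE('b)) *s I n"
lemma L_pd: "L y = pd 1 y 0" and R_pd: "R y = pd 0 y 1" by (simp_all add: L_def R_def pd_def)
lemma L_simps [simp]: "L 0 = 0" "L (y + z) = L y + L z" "L (y - z) = L y - L z" "L (- y) = - L y"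
 "L (c *s y) = c *s L y" "L (y * z) = L y * L z" "L (I n) = I (Suc n)"
 by (simp_all only: L_pd pd_add pd_diff pd_uminus pd_smul pd_mult pd_I pd_zero) simp
lemma R_simps [simp]: "R 0 = 0" "R (y + z) = R y + R z" "R (y - z) = R y - R z" "R (- y) = - R y"
 "R (c *s y) = c *s R y" "R (y * z) = R y * R z" "R (I n) = I (Suc n)"
 by (simp_all only: R_pd pd_add pd_diff pd_uminus pd_smul pd_mult pd_I pd_zero) simp
lemma L_sum: "L (sum f S) = (SUM i:S. L (f i))" by (induction S rule: infinite_finite_induct) auto
lemma L_gens [simp]: "L (X n i) = X (Suc n) (Suc i)" "L (T n i) = T (Suc n) (Suc i)" "L (A n i) = A (Suc n) (Suc i)" "L (U n i) = U (Suc n) (Suc i)"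
 by (simp_all add: X_def T_def A_def U_def L_pd pd_pd)
lemma R_gens: "Suc i < n ==> R (T n i) = T (Suc n) i" "i < n ==> R (X n i) = X (Suc n) i"
 by (simp_all add: X_def T_def R_pd pd_pd Suc_diff_le Suc_diff_Suc)
lemma hm_L: "hm m n y ==> hm (Suc m) (Suc n) (L y)" using hm_pd[of m n y 1 0] by (simp add: L_pd)
lemma dg_L: "dg d y ==> dg d (L y)" by (simp add: L_pd dg_pd)
lemma hm_X: "hm n n (X n i)"
 using hm_pd[OF hm_gens(1), of i "n - Suc i"] by (auto simp: X_def)
lemma hm_T: "hm n n (T n i)"
proof -
 have "Suc i < n ==> i + 2 + (n - i - 2) = n" by arith
 thus ?thesis using hm_pd[OF hm_gens(2), of i "n - i - 2"] by (auto simp: T_def)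
qed
lemma hm_A: "hm (n - 2) n (A n i)"
proof -
 have "Suc i < n ==> i + (n - i - 2) = n - 2 & i + 2 + (n - i - 2) = n" by arith
 thus ?thesis using hm_pd[OF hm_gens(3), of i "n - i - 2"] by (auto simp: A_def)
qed
lemma hm_U: "hm n (n - 2) (U n i)"
proof -
 have "Suc i < n ==> i + (n - i - 2) = n - 2 & i + 2 + (n - i - 2) = n" by arith
 thus ?thesis using hm_pd[OF hm_gens(4), of i "n - i - 2"] by (auto simp: U_def)
qed
lemma dg_X: "dg 2 (X n i)" and dg_T: "dg (-2) (T n i)" and dg_A: "dg 0 (A n i)" and dg_U: "dg 0 (U n i)"
 using dg_q[of eX] dg_q[of eT] dg_q[of eCap] dg_q[of eCup]
 by (auto simp: X_def T_def A_def U_def gx_def gt_def ga_def gu_def intro!: dg_pd)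
lemma I_gen [simp]: "I n * X n i = X n i" "X n i * I n = X n i" "I n * T n i = T n i" "T n i * I n = T n i"
 "A n i * I n = A n i" "I n * U n i = U n i"
 "I n * (X n i * y) = X n i * y" "I n * (T n i * y) = T n i * y" "I n * (U n i * y) = U n i * y"
 "X n i * (I n * y) = X n i * y" "T n i * (I n * y) = T n i * y" "A n i * (I n * y) = A n i * y"
 using hm_X hm_T hm_A hm_U unfolding hm_def by (metis assoc)+
lemma I_gen2 [simp]: "m = n - 2 ==> I m * A n i = A n i" "m = n - 2 ==> U n i * I m = U n i"
 "m = n - 2 ==> I m * (A n i * y) = A n i * y" "m = n - 2 ==> U n i * (I m * y) = U n i * y"
 using hm_A hm_U unfolding hm_def by (metis assoc)+
lemma I_I' [simp]: "I n * I n = I n" "I n * (I n * y) = I n * y"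
 by (simp_all add: I_I flip: assoc)
lemma XX: "X n i * X n j = X n j * X n i"
proof -
 have *: "X n i * X n j = X n j * X n i" if "i < j" for i j
  using that by (auto simp: X_def intro!: far'[OF hm_gens(1) hm_gens(1), where k = "j - Suc i" and i = i and l = "n - Suc j"])
 show ?thesis using * by (metis linorder_neqE_nat)
qed
lemma XT_lt: "i < j ==> X n i * T n j = T n j * X n i"
 by (auto simp: X_def T_def intro!: far'[OF hm_gens(1) hm_gens(2), where k = "j - Suc i" and i = i and l = "n - j - 2"])
lemma XT_gt: "Suc j < i ==> X n i * T n j = T n j * X n i"
 by (auto simp: X_def T_def intro!: far'[OF hm_gens(2) hm_gens(1), where k = "i - j - 2" and i = j and l = "n - Suc i", symmetric])
lemma XT: "i < j | Suc j < i ==> X n i * T n j = T n j * X n i" using XT_lt XT_gt by blast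
lemma TT: assumes "Suc i < j | Suc j < i" shows "T n i * T n j = T n j * T n i"
proof -
 have *: "T n i * T n j = T n j * T n i" if "Suc i < j" for i j
  using that by (auto simp: T_def intro!: far'[OF hm_gens(2) hm_gens(2), where k = "j - i - 2" and i = i and l = "n - j - 2"])
 show ?thesis using * assms by metis
qed
lemma AX_lt: "j < i ==> A n i * X n j = X (n - 2) j * A n i"
 by (auto simp: X_def A_def intro!: far'[OF hm_gens(1) hm_gens(3), where k = "i - Suc j" and i = j and l = "n - i - 2", symmetric])
lemma AX_ge: "i + 2 <= j ==> A n i * X n j = X (n - 2) (j - 2) * A n i"
 by (auto simp: X_def A_def intro!: far'[OF hm_gens(3) hm_gens(1), where k = "j - i - 2" and i = i and l = "n - Suc j"])
lemma AT_lt: "Suc j < i ==> A n i * T n j = T (n - 2) j * A n i"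
 by (auto simp: T_def A_def intro!: far'[OF hm_gens(2) hm_gens(3), where k = "i - j - 2" and i = j and l = "n - i - 2", symmetric])
lemma AT_ge: "i + 2 <= j ==> A n i * T n j = T (n - 2) (j - 2) * A n i"
 by (auto simp: T_def A_def intro!: far'[OF hm_gens(3) hm_gens(2), where k = "j - i - 2" and i = i and l = "n - j - 2"])
lemma XU_lt: "j < i ==> X n j * U n i = U n i * X (n - 2) j"
 by (auto simp: X_def U_def intro!: far'[OF hm_gens(1) hm_gens(4), where k = "i - Suc j" and i = j and l = "n - i - 2"])
lemma XU_ge: "i + 2 <= j ==> X n j * U n i = U n i * X (n - 2) (j - 2)"
 by (auto simp: X_def U_def intro!: far'[OF hm_gens(4) hm_gens(1), where k = "j - i - 2" and i = i and l = "n - Suc j", symmetric])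
lemma TU_lt: "Suc j < i ==> T n j * U n i = U n i * T (n - 2) j"
 by (auto simp: T_def U_def intro!: far'[OF hm_gens(2) hm_gens(4), where k = "i - j - 2" and i = j and l = "n - i - 2"])
lemma TU_ge: "i + 2 <= j ==> T n j * U n i = U n i * T (n - 2) (j - 2)"
 by (auto simp: T_def U_def intro!: far'[OF hm_gens(4) hm_gens(2), where k = "j - i - 2" and i = i and l = "n - j - 2", symmetric])
lemma UU: "i + 2 <= j ==> U n j * U (n - 2) i = U n i * U (n - 2) (j - 2)"
 by (auto simp: U_def intro!: far'[OF hm_gens(4) hm_gens(4), where k = "j - i - 2" and i = i and l = "n - j - 2", symmetric])
lemma AU_ge: "j + 2 <= i ==> A n i * U n j = U (n - 2) j * A (n - 2) (i - 2)"
 by (auto simp: A_def U_def intro!: far'[OF hm_gens(4) hm_gens(3), where k = "i - j - 2" and i = j and l = "n - i - 2", symmetric])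
lemma AU_le: "i + 2 <= j ==> A n i * U n j = U (n - 2) (j - 2) * A (n - 2) i"
 by (auto simp: A_def U_def intro!: far'[OF hm_gens(3) hm_gens(4), where k = "j - i - 2" and i = i and l = "n - j - 2"])
lemma rel_eq0: "a : nbrels (tparam TYPE('b)) ==> qa a = (0 :: ('a::field, 'b::tparam) nb)"
 unfolding zero_nb_def
proof (rule qa_eqI)
 assume a: "a : nbrels (tparam TYPE('b))"
 thus "good a" using rel_good[OF rel_nb] by blast
 show "cdiff a czero : rel (tparam TYPE('b))" using a by (simp add: comb_defs rel_nb)
qed simp
lemma q_exp: "wt f ==> wt g ==> src f = tgt g ==> q (Comp f g) = q f * q g"
 "wt f ==> wt g ==> q (Tens f g) = q f ** q g" "q (Id n) = I n"
 "q eX = gx" "q eT = gt" "q eCap = ga" "q eCup = gu"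
 by (simp_all add: q_mult ten_q I_def gx_def gt_def ga_def gu_def)
lemma rel_TT: "gt * gt = 0"
 using rel_eq0[where 'a='a and 'b='b, of "dl (Comp eT eT)"] by (simp add: nbrels_def q_def[symmetric] q_exp)
lemma rel_braid: "pd 0 gt 1 * (pd 1 gt 0 * pd 0 gt 1) = pd 1 gt 0 * (pd 0 gt 1 * pd 1 gt 0)"
 using rel_eq0[where 'a='a and 'b='b, of "cdiff (dl (Comp (Tens eT I1) (Comp (Tens I1 eT) (Tens eT I1))))
      (dl (Comp (Tens I1 eT) (Comp (Tens eT I1) (Tens I1 eT))))"]
 by (simp add: nbrels_def qa_diff[symmetric] good_dl q_def[symmetric] pd_def q_exp)
lemma rel_AU: "ga * gu = tI 0"
 using rel_eq0[where 'a='a and 'b='b, of "cdiff (dl (Comp eCap eCup)) (csc (of_nat (tparam TYPE('b))) (dl (Id 0)))"]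
 by (simp add: nbrels_def qa_diff[symmetric] qa_smul[symmetric] good_dl good_csc q_def[symmetric] q_exp tI_def)
lemma rel_zig: "pd 0 ga 1 * pd 1 gu 0 = (I 1 :: ('a::field, 'b::tparam) nb)"
 "pd 1 ga 0 * pd 0 gu 1 = (I 1 :: ('a::field, 'b::tparam) nb)"
 using rel_eq0[where 'a='a and 'b='b, of "cdiff (dl (Comp (Tens eCap I1) (Tens I1 eCup))) (dl I1)"]
  rel_eq0[where 'a='a and 'b='b, of "cdiff (dl (Comp (Tens I1 eCap) (Tens eCup I1))) (dl I1)"]
 by (simp_all add: nbrels_def qa_diff[symmetric] good_dl q_def[symmetric] pd_def q_exp)
lemma rel_AT: "ga * gt = 0"
 using rel_eq0[where 'a='a and 'b='b, of "dl (Comp eCap eT)"] by (simp add: nbrels_def q_def[symmetric] q_exp)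
lemma rel_fork: "pd 1 ga 0 * pd 0 gt 1 = pd 0 ga 1 * pd 1 gt 0"
 using rel_eq0[where 'a='a and 'b='b, of "cdiff (dl (Comp (Tens I1 eCap) (Tens eT I1))) (dl (Comp (Tens eCap I1) (Tens I1 eT)))"]
 by (simp add: nbrels_def qa_diff[symmetric] good_dl q_def[symmetric] pd_def q_exp)
lemma rel_XT: "pd 0 gx 1 * gt - gt * pd 1 gx 0 = I 2 - gu * ga"
proof -
 have "q (Tens I1 I1) = (I 2 :: ('a, 'b) nb)" using ten_I[of 1 1] by (simp add: q_exp flip: numeral_2_eq_2)
 moreover have "q (Comp (Tens eX I1) eT) - q (Comp eT (Tens I1 eX)) - q (Tens I1 I1) + q (Comp eCup eCap) = (0 :: ('a, 'b) nb)"
  using rel_eq0[where 'a='a and 'b='b, of "lc [(1, Comp (Tens eX I1) eT), (-1, Comp eT (Tens I1 eX)), (-1, Tens I1 I1), (1, Comp eCup eCap)]"]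
  by (simp add: nbrels_def lc_Cons lc_Nil qa_add[symmetric] qa_smul[symmetric] good_dl good_csc good_cadd q_def[symmetric] zero_nb_def[symmetric] algs)
 ultimately show ?thesis
  by (simp add: pd_def q_exp algs)
qed
lemma rel_AX: "ga * pd 1 gx 0 = - (ga * pd 0 gx 1)"
using rel_eq0[where 'a='a and 'b='b, of "lc [(1, Comp eCap (Tens I1 eX)), (1, Comp eCap (Tens eX I1))]"] by (simp add: nbrels_def lc_Cons lc_Nil qa_add[symmetric] qa_smul[symmetric] good_dl good_csc good_cadd q_def[symmetric] zero_nb_def[symmetric] algs pd_def q_exp eq_neg_iff_add_eq_0)
lemma placed:
 "i < n ==> X n i = pd i gx (n - Suc i)" "Suc i < n ==> X n i = pd i (pd 0 gx 1) (n - i - 2)"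
 "Suc i < n ==> X n (Suc i) = pd i (pd 1 gx 0) (n - i - 2)"
 "Suc i < n ==> T n i = pd i gt (n - i - 2)" "Suc i < n ==> A n i = pd i ga (n - i - 2)" "Suc i < n ==> U n i = pd i gu (n - i - 2)"
 "i + 2 < n ==> T n i = pd i (pd 0 gt 1) (n - i - 3)" "i + 2 < n ==> T n (Suc i) = pd i (pd 1 gt 0) (n - i - 3)"
 "i + 2 < n ==> A n i = pd i (pd 0 ga 1) (n - i - 3)" "i + 2 < n ==> A n (Suc i) = pd i (pd 1 ga 0) (n - i - 3)"
 "i + 2 < n ==> U n i = pd i (pd 0 gu 1) (n - i - 3)" "i + 2 < n ==> U n (Suc i) = pd i (pd 1 gu 0) (n - i - 3)"
 unfolding pd_pd by (auto simp: X_def T_def A_def U_def intro!: arg_cong[where f = "pd _ _"])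
lemma T2 [simp]: "T n i * T n i = 0"
by (simp add: pd_mult[symmetric] rel_TT T_def)
lemma braid: "T n i * (T n (Suc i) * T n i) = T n (Suc i) * (T n i * T n (Suc i))"
proof (cases "i + 2 < n")
 case True
 show ?thesis unfolding placed(7,8)[OF True] pd_mult[symmetric] rel_braid ..
qed (simp add: T_def)
lemma AU: "Suc i < n ==> A n i * U n i = tI (n - 2)"
 unfolding placed(5,6) pd_mult[symmetric] rel_AU tI_def by (simp add: Suc_diff_le)
lemma zig: "Suc (Suc i) < n ==> A n i * U n (Suc i) = I (n - 2)" "Suc (Suc i) < n ==> A n (Suc i) * U n i = I (n - 2)"
proof -
 assume "Suc (Suc i) < n"
 hence a: "i + 2 < n" and e: "i + 1 + (n - i - 3) = n - 2" by arith+
 show "A n i * U n (Suc i) = I (n - 2)" unfolding placed(9,12)[OF a] pd_mult[symmetric] rel_zig pd_I e ..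
 show "A n (Suc i) * U n i = I (n - 2)" unfolding placed(10,11)[OF a] pd_mult[symmetric] rel_zig pd_I e ..
qed
lemmas zig' = mult_ext1[OF zig(1)] mult_ext1[OF zig(2)]
lemma ATz [simp]: "A n i * T n i = 0"
proof (cases "Suc i < n")
 case True
 show ?thesis unfolding placed(4,5)[OF True] pd_mult[symmetric] rel_AT by simp
qed (simp add: T_def)
lemma fork: "A n (Suc i) * T n i = A n i * T n (Suc i)"
proof (cases "i + 2 < n")
 case True
 show ?thesis unfolding placed(7-10)[OF True] pd_mult[symmetric] rel_fork ..
qed (simp add: T_def A_def)
lemma XTr: "Suc i < n ==> X n i * T n i = T n i * X n (Suc i) + I n - U n i * A n i"
proof -
 assume a: "Suc i < n"
 have "X n i * T n i - T n i * X n (Suc i) = pd i (pd 0 gx 1 * gt - gt * pd 1 gx 0) (n - i - 2)"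
  using a by (simp add: placed(2-4) pd_mult pd_diff)
 also have "i + 2 + (n - i - 2) = n" using a by arith
 hence "pd i (pd 0 gx 1 * gt - gt * pd 1 gx 0) (n - i - 2) = I n - U n i * A n i"
  unfolding rel_XT using a by (simp add: placed(5,6) pd_mult pd_diff)
 finally show ?thesis by (simp add: algs)
qed
lemma AXs: "A n i * X n (Suc i) = - (A n i * X n i)"
proof (cases "Suc i < n")
 case True
 show ?thesis unfolding placed(2,3,5)[OF True] pd_mult[symmetric] rel_AX by simp
qed (simp add: A_def)
text \<open>Bending: the zigzag and the pitchfork write a crossing as a crossing between
  neighbouring strands, with a cup on the left and a cap on the right. The relations for cups, which
  are not among the defining ones, are derived from those for caps through this formula.\<close>

lemma rot: assumes "Suc i < n" shows "T n i = A (n + 2) (i + 2) * (T (n + 2) (i + 1) * U (n + 2) i)"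
proof -
 have "A (n + 2) (Suc (i + 1)) * T (n + 2) (i + 1) = A (n + 2) (i + 1) * T (n + 2) (Suc (i + 1))" by (rule fork)
 from mult_ext[OF this, of "U (n + 2) i"]
 have "A (n + 2) (i + 2) * (T (n + 2) (i + 1) * U (n + 2) i) = A (n + 2) (i + 1) * (T (n + 2) (i + 2) * U (n + 2) i)"
  by simp
 also have "T (n + 2) (i + 2) * U (n + 2) i = U (n + 2) i * T n i" using TU_ge[of i "i + 2" "n + 2"] by simp
 also have "A (n + 2) (i + 1) * (U (n + 2) i * T n i) = T n i"
  using assms by (simp add: zig')
 finally show ?thesis ..
qed
lemma TUs: "T n i * U n (Suc i) = T n (Suc i) * U n i"
proof (cases "i + 2 < n")
 case True
 have "T n i * U n (Suc i) = A (n + 2) (i + 2) * (T (n + 2) (i + 1) * (U (n + 2) i * U n (Suc i)))"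
  by (subst rot[of i n]) (use True in "auto simp only: assoc")
 also have "U (n + 2) i * U n (Suc i) = U (n + 2) (i + 3) * U n i" using UU[of i "i + 3" "n + 2", symmetric] by (simp add: numeral_3_eq_3)
 also have "T (n + 2) (i + 1) * (U (n + 2) (i + 3) * U n i) = U (n + 2) (i + 3) * (T n (i + 1) * U n i)"
  using mult_ext[OF TU_lt[of "i + 1" "i + 3" "n + 2"], of "U n i"] by simp
 also have "A (n + 2) (i + 2) * (U (n + 2) (i + 3) * (T n (i + 1) * U n i)) = T n (Suc i) * U n i"
  using True by (simp add: zig' numeral_3_eq_3)
 finally show ?thesis .
qed (simp add: T_def U_def)
lemma TUz [simp]: "T n i * U n i = 0"
proof (cases "Suc i < n")
 case True
 have "T n i * U n i = A (n + 2) (i + 2) * (T (n + 2) (i + 1) * (U (n + 2) i * U n i))"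
  by (subst rot[of i n]) (use True in "auto simp only: assoc")
 also have "U (n + 2) i * U n i = U (n + 2) (i + 2) * U n i" using UU[of i "i + 2" "n + 2", symmetric] by simp
 also have "T (n + 2) (i + 1) * (U (n + 2) (i + 2) * U n i) = T (n + 2) (i + 2) * (U (n + 2) (i + 1) * U n i)"
  using mult_ext[OF TUs[of "n + 2" "i + 1"], of "U n i"] by simp
 finally show ?thesis by (simp add: mult_ext0)
qed (simp add: U_def)
lemma XUs: "X n (Suc i) * U n i = - (X n i * U n i :: ('a::field, 'b::tparam) nb)"
proof (cases "Suc i < n")
 case True
 let ?A = "(A (n + 2) (i + 1) * (X (n + 2) (i + 1) * U (n + 2) i))"
 have 1: "X n i = - ?A"
 proof -
  have "X n i = A (n + 2) (i + 1) * (U (n + 2) i * X n i)" using True by (simp add: zig')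
  also have "U (n + 2) i * X n i = X (n + 2) (i + 2) * U (n + 2) i" by (simp add: XU_ge)
  also have "A (n + 2) (i + 1) * (X (n + 2) (i + 2) * U (n + 2) i) = - ?A"
   by (simp add: AXs flip: assoc)
  finally show ?thesis .
 qed
 have "X n i * U n i = - (A (n + 2) (i + 1) * (X (n + 2) (i + 1) * (U (n + 2) i * U n i)) :: ('a, 'b) nb)"
  by (subst 1) (simp add: assoc)
 also have "U (n + 2) i * U n i = U (n + 2) (i + 2) * U n i" using UU[of i "i + 2" "n + 2", symmetric] by simp
 also have "X (n + 2) (i + 1) * (U (n + 2) (i + 2) * U n i) = U (n + 2) (i + 2) * (X n (i + 1) * U n i)"
  using mult_ext[OF XU_lt[of "i + 1" "i + 2" "n + 2"], of "U n i"] by simp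
 also have "A (n + 2) (i + 1) * (U (n + 2) (i + 2) * (X n (i + 1) * U n i)) = X n (i + 1) * U n i"
  using True by (simp add: zig')
 finally show ?thesis by simp
qed (simp add: U_def)
text \<open>The defining relation treats the dot on one of the two strands only; rotating the
  crossing by \<open>rot\<close> exchanges the strands and yields the other slide.\<close>

lemma TXr: assumes "Suc i < n" shows "T n i * X n i = (X n (Suc i) * T n i + I n - U n i * A n i :: ('a::field, 'b::tparam) nb)"
proof -
 let ?n = "n + 2"
 let ?A = "A ?n (i + 2) :: ('a, 'b) nb" and ?U = "U ?n i :: ('a, 'b) nb"
 have s: "?A * (X ?n (i + 1) * (T ?n (i + 1) * ?U)) = ?A * (T ?n (i + 1) * (X ?n (i + 2) * ?U)) + ?A * ?U - ?A * (U ?n (i + 1) * (A ?n (i + 1) * ?U))"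
 proof -
  have "?A * ((X ?n (i + 1) * T ?n (i + 1)) * ?U) = ?A * ((T ?n (i + 1) * X ?n (Suc (i + 1)) + I ?n - U ?n (i + 1) * A ?n (i + 1)) * ?U)"
   by (subst XTr) (use assms in auto)
  thus ?thesis by (simp add: algs)
 qed
 have 1: "?A * (X ?n (i + 1) * (T ?n (i + 1) * ?U)) = X n (Suc i) * T n i"
  using mult_ext[OF AX_lt[of "i + 1" "i + 2" ?n], of "T ?n (i + 1) * ?U"] by (simp add: rot[OF assms])
 have 2: "?A * (T ?n (i + 1) * (X ?n (i + 2) * ?U)) = T n i * X n i"
  by (simp add: rot[OF assms] assoc XU_ge)
 have 3: "?A * ?U = U n i * A n i" using AU_ge[of i "i + 2" ?n] by simp
 have 4: "?A * (U ?n (i + 1) * (A ?n (i + 1) * ?U)) = I n"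
  using assms by (simp add: zig zig')
 show ?thesis using s unfolding 1 2 3 4 by (simp add: algs)
qed

section \<open>Reflection of diagrams in a horizontal line\<close>

fun gflip :: "gen => gen" where
 "gflip GX = GX" | "gflip GTau = GTau" | "gflip GCap = GCup" | "gflip GCup = GCap"

fun flip :: "mexp => mexp" where
 "flip (Gen g) = Gen (gflip g)" | "flip (Id n) = Id n"
| "flip (Comp f g) = Comp (flip g) (flip f)" | "flip (Tens f g) = Tens (flip f) (flip g)"
lemma gflip [simp]: "gflip (gflip g) = g" "gsrc (gflip g) = gtgt g" "gtgt (gflip g) = gsrc g" "gdeg (gflip g) = gdeg g"
 by (cases g; simp)+
lemma flip_flip [simp]: "flip (flip e) = e" by (induction e) auto
lemma flip_src [simp]: "src (flip e) = tgt e" "tgt (flip e) = src e" "deg (flip e) = deg e" by (induction e) auto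
lemma flip_wt [simp]: "wt (flip e) = wt e" by (induction e) auto
lemma flip_eq_iff: "flip e = f \<longleftrightarrow> e = flip f" by (metis flip_flip)

definition cflip :: "'k::field comb => 'k comb" where "cflip a = (%e. a (flip e))"
lemma cflip_simps [simp]: "cflip (dl e) = dl (flip e)" "cflip (cadd a b) = cadd (cflip a) (cflip b)"
 "cflip (cdiff a b) = cdiff (cflip a) (cflip b)" "cflip (csc c a) = csc c (cflip a)" "cflip czero = czero"
 by (auto simp: cflip_def comb_defs flip_eq_iff)
lemma cflip_comp [simp]: "cflip (comp a b) = comp (cflip b) (cflip a)"
proof
 show "cflip (comp a b) e = comp (cflip b) (cflip a) e" for e by (cases e) (auto simp: cflip_def comp_def)
qed
lemma cflip_tens [simp]: "cflip (tens a b) = tens (cflip a) (cflip b)"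
proof
 show "cflip (tens a b) e = tens (cflip a) (cflip b) e" for e by (cases e) (auto simp: cflip_def tens_def)
qed
lemma good_cflip: "good a ==> good (cflip a)"
 by (induction rule: good_induct) (simp_all add: good_cadd good_csc good_dl)
lemma rel_swap: "cdiff a b : rel t ==> cdiff b a : rel t"
proof -
 assume "cdiff a b : rel t"
 moreover have "cdiff b a = csc (-1) (cdiff a b)" by (auto simp: comb_defs)
 ultimately show ?thesis by (simp add: rel_smult)
qed
lemma structural_flip: "a : structural ==> cflip a : rel t"
proof -
 have 1: "cdiff (dl (Comp (flip h) (Comp (flip g) (flip f)))) (dl (Comp (Comp (flip h) (flip g)) (flip f))) : rel t"
  if "wt f" "wt g" "wt h" "src f = tgt g" "src g = tgt h" for f g h
  by (rule rel_swap, rule rel_struct, rule strI(1)) (simp_all add: that)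
 have 2: "cdiff (dl (Comp (Id (src f)) (flip f))) (dl (flip f)) : rel t"
  "cdiff (dl (Comp (flip f) (Id (tgt f)))) (dl (flip f)) : rel t" if "wt f" for f
  using that rel_struct[OF strI(2)[of "flip f"]] rel_struct[OF strI(3)[of "flip f"]] by simp_all
 assume "a : structural"
 thus ?thesis
  unfolding structural_def
  by (elim UnE CollectE exE conjE; hypsubst)
   (simp_all only: cflip_simps flip.simps, (rule 1 2 rel_struct[OF strI(4)] rel_struct[OF strI(5)]
     rel_struct[OF strI(6)] rel_struct[OF strI(7)] rel_struct[OF strI(8)];
    simp only: flip_src flip_wt)+)
qed
lemma qa_zero_rel: "good a ==> qa a = (0 :: ('a::field, 'b::tparam) nb) ==> a : rel (tparam TYPE('b))"
 using qa_eq_iff[where 'k='a and 't='b, of a czero] unfolding zero_nb_def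
 by (simp add: cdiff_def czero_def good_czero[unfolded czero_def])
text \<open>The reflected relations that are not again defining relations are the consequences
  \<open>TUz\<close>, \<open>TUs\<close>, \<open>TXr\<close> and \<open>XUs\<close> obtained by
  bending strands.\<close>

lemma nbrels_flip:
 assumes "a : (nbrels (tparam TYPE('b::tparam)) :: 'a::field comb set)" shows "cflip a : rel (tparam TYPE('b))"
proof (rule qa_zero_rel)
 show "good (cflip a)" using rel_good[OF rel_nb[OF assms]] by (rule good_cflip)
 have 7: "pd 0 gt 1 * pd 1 gu 0 = (pd 1 gt 0 * pd 0 gu 1 :: ('a, 'b) nb)" using TUs[where 'a='a and 'b='b, of 3 0] by (simp add: T_def U_def)
 have 6: "gt * gu = (0 :: ('a, 'b) nb)" using TUz[where 'a='a and 'b='b, of 2 0] by (simp add: T_def U_def)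
 have 8: "gt * pd 0 gx 1 = pd 1 gx 0 * gt + I 2 - (gu * ga :: ('a, 'b) nb)" using TXr[where 'a='a and 'b='b, of 0 2] by (simp add: T_def U_def X_def A_def)
 have 9: "pd 1 gx 0 * gu = - (pd 0 gx 1 * gu :: ('a, 'b) nb)" using XUs[where 'a='a and 'b='b, of 2 0] by (simp add: U_def X_def)
 note r = rel_TT[where 'a='a and 'b='b] rel_AU[where 'a='a and 'b='b, unfolded tI_def] rel_braid[where 'a='a and 'b='b] rel_zig[where 'a='a and 'b='b] 6 7 8 9
 show "qa (cflip a) = (0 :: ('a, 'b) nb)"
  using assms unfolding nbrels_def
  by (elim insertE emptyE; hypsubst)
   (use r in "simp_all add: lc_Cons lc_Nil qa_add[symmetric] qa_diff[symmetric] qa_smul[symmetric] good_dl good_csc good_cadd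
    q_def[symmetric] zero_nb_def[symmetric] q_exp pd_def assoc numeral_2_eq_2")
qed
lemma rel_flip: "a : rel (tparam TYPE('b::tparam)) ==> cflip a : rel (tparam TYPE('b))"
proof (induction rule: rel.induct)
 case (rel_struct a) thus ?case by (rule structural_flip)
next
 case (rel_nb a) thus ?case by (rule nbrels_flip)
qed (auto intro: rel.intros)

definition star :: "('a::field, 'b::tparam) nb => ('a, 'b) nb" where "star y = qa (cflip (qr y))"
lemma qa_star: assumes "good a" shows "star (qa a) = qa (cflip a)"
proof -
 let ?a = "qr (qa a :: ('a, 'b) nb)"
 have "cdiff (cflip ?a) (cflip a) = cflip (cdiff ?a a)" by simp
 thus ?thesis unfolding star_def
  by (intro qa_eqI) (simp_all only: assms good_cflip qr rel_flip rel_qr)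
qed
lemma star_simps [simp]:
 fixes y z :: "('a::field, 'b::tparam) nb"
 shows "star (y + z) = star y + star z" "star (c *s y) = c *s star y" "star 0 = (0 :: ('a, 'b) nb)"
 "star (y * z) = star z * star y" "star (y ** z) = star y ** star z"
 by (cases y; cases z; simp add: qa_simps qa_ten qa_star good_cadd good_csc good_comp good_tens good_cflip zero_nb_def)+
lemma star_minus [simp]: "star (- y) = - star y" "star (y - z) = star y - star z"
 using star_simps(2)[of "-1" y] star_simps(1)[of y "- z"] star_simps(2)[of "-1" z] by simp_all
lemma star_q: "wt e ==> star (q e) = q (flip e)" by (simp add: q_def qa_star good_dl)
lemma star_star [simp]: "star (star y) = y"
 by (induction y rule: nb_induct) (simp_all add: star_q)
lemma star_I [simp]: "star (I n) = I n" by (simp add: I_def star_q)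
lemma star_pd: "star (pd i y j) = pd i (star y) j" by (simp add: pd_def)
lemma star_L [simp]: "star (L y) = L (star y)" and star_R [simp]: "star (R y) = R (star y)" by (simp_all add: L_def R_def)
lemma star_gens [simp]: "star (X n i) = X n i" "star (T n i) = T n i" "star (A n i) = U n i" "star (U n i) = A n i"
 by (simp_all add: X_def T_def A_def U_def star_pd gx_def gt_def ga_def gu_def star_q)
lemma star_sum: "star (sum f S) = (SUM i:S. star (f i))" by (induction S rule: infinite_finite_induct) auto
lemma hm_star: "hm m n y ==> hm n m (star y)" unfolding hm_def by (metis star_I star_simps(4))
lemma hc_star: "hc d (star y) = star (hc d y)"
 by (induction y rule: nb_induct) (auto simp: hc_add hc_q star_q)
lemma dg_star: "dg d y ==> dg d (star y)" by (simp add: dg_def hc_star)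

section \<open>Dots, trains of crossings and the longest crossing\<close>

locale nbt = fixes ty :: "('a::field, 'b::tparam) nb itself"
begin

abbreviation xx :: "nat => nat => ('a, 'b) nb" where "xx \<equiv> X"
abbreviation tt :: "nat => nat => ('a, 'b) nb" where "tt \<equiv> T"
abbreviation aa :: "nat => nat => ('a, 'b) nb" where "aa \<equiv> A"
abbreviation uu :: "nat => nat => ('a, 'b) nb" where "uu \<equiv> U"
abbreviation ii :: "nat => ('a, 'b) nb" where "ii \<equiv> I"
lemma hm_left: "hm m n y ==> ii m * y = y" and hm_right: "hm m n y ==> y * ii n = y"
 and hm_left': "hm m n y ==> ii m * (y * z) = y * z" and hm_right': "hm m n y ==> y * (ii n * z) = y * z"
 unfolding hm_def by (metis assoc)+
lemma far0:
 assumes "hm m n y"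
 shows "xx (Suc m) 0 * L y = L y * xx (Suc n) 0"
  "tt (Suc (Suc m)) 0 * L (L y) = L (L y) * tt (Suc (Suc n)) 0"
  "aa (Suc (Suc m)) 0 * L (L y) = y * aa (Suc (Suc n)) 0"
  "L (L y) * uu (Suc (Suc n)) 0 = uu (Suc (Suc m)) 0 * y"
using far'[OF hm_gens(2) assms, of 2 0 0 m 0 2 n 0 0 0] far'[OF hm_gens(3) assms, of 2 0 0 m 0 0 n 0 0 0] far'[OF hm_gens(4) assms, of 0 0 0 m 0 2 n 0 0 0] by (auto simp: L_pd pd_pd numeral_2_eq_2 X_def far'[OF hm_gens(1) assms] T_def A_def U_def)
lemma cross [simp]: "tt (Suc (Suc n)) 0 * (L (L y) * z) = L (L y) * (tt (Suc (Suc n)) 0 * z)" if "hm n n y" for y z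
 using mult_ext[OF far0(2)[OF that]] .

primrec xp :: "nat => nat => nat => ('a, 'b) nb" where
 "xp n i 0 = I n"
| "xp n i (Suc k) = X n i * xp n i k"
lemma hm_xp: "hm n n (xp n i k)" by (induction k) (auto intro: hm_mult hm_X)
lemma dg_xp: "dg (2 * int k) (xp n i k)"
proof (induction k)
 case (Suc k)
 show ?case using dg_mult[OF dg_X Suc] by (simp add: xp.simps)
qed simp
lemma xp_comm:
 assumes "y * xx n i = xx m j * y" "y * ii n = ii m * y"
 shows "y * xp n i k = xp m j k * y"
proof (induction k)
 case (Suc k)
 thus ?case using mult_ext[OF assms(1), of "xp n i k"] by (simp add: assoc)
qed (use assms in simp)
lemma xp_comm':
 assumes "xx n i * y = y * xx m j" "y * ii m = ii n * y"
 shows "xp n i k * y = y * xp m j k"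
 using xp_comm[of y m j n i k] assms by simp
lemma xp_Suc2: "xp n i (Suc k) = xp n i k * xx n i"
 by (induction k) (simp_all flip: assoc)
lemma xp_XX: "xp n i k * xx n j = xx n j * xp n i k" by (rule xp_comm') (simp_all add: XX)
lemma xp_xp: "xp n i k * xp n j l = xp n j l * xp n i k" by (rule xp_comm) (simp_all add: xp_XX hm_left[OF hm_xp] hm_right[OF hm_xp])
lemma xp_T: "i < j | Suc j < i ==> xp n i k * tt n j = tt n j * xp n i k"
 by (rule xp_comm') (simp_all add: XT)
lemma A_xp_lt: "j < i ==> aa n i * xp n j k = xp (n - 2) j k * aa n i"
 by (rule xp_comm) (simp_all add: AX_lt)
lemma A_xp_ge: "i + 2 <= j ==> aa n i * xp n j k = xp (n - 2) (j - 2) k * aa n i"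
 by (rule xp_comm) (simp_all add: AX_ge)
lemma xp_U_lt: "j < i ==> xp n j k * uu n i = uu n i * xp (n - 2) j k"
 by (rule xp_comm') (simp_all add: XU_lt)
lemma xp_U_ge: "i + 2 <= j ==> xp n j k * uu n i = uu n i * xp (n - 2) (j - 2) k"
 by (rule xp_comm') (simp_all add: XU_ge)
lemma L_xp [simp]: "L (xp n i k) = xp (Suc n) (Suc i) k" by (induction k) auto
lemma star_xp [simp]: "star (xp n i k) = xp n i k" by (induction k) (auto simp: xp_XX)
lemma xp_L: "hm m n y ==> xp (Suc m) 0 k * L y = L y * xp (Suc n) 0 k"
 by (rule xp_comm') (simp_all add: far0 hm_left hm_right flip: L_simps(7) L_simps(6))
lemma xp_U: "xp n (Suc i) k * uu n i = (-1) ^ k *s (xp n i k * uu n i)"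
proof (induction k)
 case (Suc k)
 have "xp n (Suc i) (Suc k) * uu n i = xp n (Suc i) k * (xx n (Suc i) * uu n i)" by (simp add: xp_Suc2 assoc del: xp.simps)
 also have "... = - (xx n i * (xp n (Suc i) k * uu n i))" using mult_ext[OF xp_XX] by (simp add: XUs)
 finally show ?case unfolding Suc.IH by (simp add: assoc)
qed simp
text \<open>The train \<open>T_(k-1) ... T_0\<close>, which carries the strand entering at position
  0 across \<open>k\<close> neighbours. \<open>asc\<close> is its reflection; \<open>dsc1\<close>
  and \<open>asc1\<close> are the same trains shifted by one strand.\<close>

primrec dsc :: "nat => nat => ('a, 'b) nb" where
 "dsc n 0 = I n" | "dsc n (Suc k) = T n k * dsc n k"
primrec asc :: "nat => nat => ('a, 'b) nb" where
 "asc n 0 = I n" | "asc n (Suc k) = asc n k * T n k"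
primrec dsc1 :: "nat => nat => ('a, 'b) nb" where
 "dsc1 n 0 = I n" | "dsc1 n (Suc k) = T n (Suc k) * dsc1 n k"
primrec asc1 :: "nat => nat => ('a, 'b) nb" where
 "asc1 n 0 = I n" | "asc1 n (Suc k) = asc1 n k * T n (Suc k)"
lemma star_dsc [simp]: "star (dsc n k) = asc n k" by (induction k) auto
lemma star_asc [simp]: "star (asc n k) = dsc n k" by (induction k) auto
lemma L_dsc [simp]: "L (dsc n k) = dsc1 (Suc n) k" by (induction k) auto
lemma L_asc [simp]: "L (asc n k) = asc1 (Suc n) k" by (induction k) auto
lemma hm_dsc: "hm n n (dsc n k)" and hm_asc: "hm n n (asc n k)" and hm_dsc1: "hm n n (dsc1 n k)" and hm_asc1: "hm n n (asc1 n k)"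
 by (induction k) (auto intro: hm_mult hm_T)
lemma dsc_Suc: "dsc n (Suc k) = dsc1 n k * tt n 0" by (induction k) (auto simp: assoc)
lemma asc_Suc: "asc n (Suc k) = tt n 0 * asc1 n k" by (induction k) (auto simp flip: assoc)
lemma dg_dsc: "dg (- 2 * int k) (dsc n k)" "dg (- 2 * int k) (dsc1 n k)"
proof -
 have e: "- 2 * int (Suc k) = -2 + (- 2 * int k)" for k by simp
 show "dg (- 2 * int k) (dsc n k)" by (induction k) (simp, simp only: e dsc.simps dg_mult[OF dg_T])
 show "dg (- 2 * int k) (dsc1 n k)" by (induction k) (simp, simp only: e dsc1.simps dg_mult[OF dg_T])
qed
lemma T_dsc: "k < j ==> tt n j * dsc n k = dsc n k * tt n j"
proof (induction k)
 case (Suc k)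
 thus ?case using mult_ext[OF TT[of j k n], of "dsc n k"] by (simp add: assoc)
qed simp

text \<open>A reduced word of the longest permutation of \<open>n\<close> strands, the analogue of
  the top divided difference in the nilHecke algebra.\<close>

primrec w :: "nat => ('a, 'b) nb" where
 "w 0 = I 0" | "w (Suc n) = dsc (Suc n) n * L (w n)"
lemma hm_w: "hm n n (w n)" by (induction n) (auto intro: hm_mult hm_dsc hm_L)
lemma hm_w' [simp]: "ii n * w n = w n" "w n * ii n = w n" "ii n * (w n * y) = w n * y" "w n * (ii n * y) = w n * y"
 by (simp_all add: hm_left[OF hm_w] hm_right[OF hm_w] hm_left'[OF hm_w] hm_right'[OF hm_w])
lemma dg_w: "dg (- int (n * (n - 1))) (w n)"
proof (induction n)
 case (Suc n)
 have "- int (Suc n * (Suc n - 1)) = - 2 * int n + - int (n * (n - 1))"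
  by (cases n) (auto simp: algs)
 thus ?case using dg_mult[OF dg_dsc(1) dg_L[OF Suc]] by (simp only: w.simps)
qed simp
text \<open>Peeling a strand from both ends leaves a middle part shifted by two strands, which
  commutes with the crossing at 0. This uses the induction hypothesis for the two preceding
  sizes.\<close>

lemma star_w [simp]: "star (w n) = w n"
proof (induction n rule: less_induct)
 case (less n)
 consider "n = 0" | "n = 1" | m where "n = Suc (Suc m)" by (metis One_nat_def not0_implies_Suc)
 thus ?case
 proof cases
  case 3
  have 1: "w (Suc m) = L (w m) * asc (Suc m) m"
   using less.IH[of "Suc m"] less.IH[of m] 3 by (simp add: star_L)
  have "w (Suc (Suc m)) = dsc1 (Suc (Suc m)) m * (tt (Suc (Suc m)) 0 * (L (L (w m)) * asc1 (Suc (Suc m)) m))"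
   unfolding w.simps(2)[of "Suc m"] 1 dsc_Suc by (simp add: assoc)
  also have "... = dsc1 (Suc (Suc m)) m * (L (L (w m)) * (tt (Suc (Suc m)) 0 * asc1 (Suc (Suc m)) m))"
   by (simp add: hm_w)
  also have "... = L (w (Suc m)) * asc (Suc (Suc m)) (Suc m)"
   unfolding w.simps asc_Suc by (simp add: assoc)
  also have "... = star (w (Suc (Suc m)))" using less.IH[of "Suc m"] 3 by (simp del: w.simps(2) add: w.simps(2)[of "Suc m"])
  finally show ?thesis using 3 by simp
 qed (simp_all)
qed
lemma w_alt: "w (Suc n) = L (w n) * asc (Suc n) n"
 using star_w[of "Suc n"] by simp
text \<open>For \<open>i > 0\<close> the reflected recursion \<open>w_alt\<close> exposes the
  shifted \<open>w n\<close>. For \<open>i = 0\<close> the braid relation trades the crossing at 0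
  for the one at 1, which the induction hypothesis kills.\<close>

lemma T_w [simp]: "tt n i * w n = 0"
proof (induction n arbitrary: i)
 case (Suc n)
 show ?case
 proof (cases i)
  case (Suc j)
  have "tt (Suc n) i * w (Suc n) = L (tt n j * w n) * asc (Suc n) n"
   unfolding w_alt by (simp add: Suc assoc)
  thus ?thesis by (simp only: Suc.IH) simp
 next
  case 0
  consider "n = 0" | "n = 1" | m where "n = Suc (Suc m)" by (metis One_nat_def not0_implies_Suc)
  thus ?thesis
  proof cases
   case 2
   thus ?thesis using 0 mult_ext0[OF T2] by (simp add: w.simps)
  next
   case (3 m)
   let ?N = "Suc n"
   have h: "hm m m (dsc m m)" by (rule hm_dsc)
   have N: "?N = Suc (Suc (Suc m))" using 3 by simp
   have d: "dsc ?N n = L (L (dsc (Suc m) m)) * (tt ?N 1 * tt ?N 0)"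
    unfolding N 3 dsc_Suc by (simp add: dsc_Suc[of "Suc (Suc m)" m, THEN arg_cong[of _ _ L], simplified] assoc)
   have ww: "L (w n) = L (L (w (Suc m))) * asc1 ?N (Suc m)"
    unfolding 3 w_alt[of "Suc m"] by simp
   have cr: "tt ?N 0 * (L (L y) * z) = L (L y) * (tt ?N 0 * z)" if "hm (Suc m) (Suc m) y" for y z
    using that unfolding N by simp
   let ?A = "(L (L (w (Suc m))) * asc1 ?N (Suc m))"
   have "tt ?N 0 * w ?N = L (L (dsc (Suc m) m)) * (tt ?N 0 * (tt ?N 1 * (tt ?N 0 * ?A)))"
    unfolding w.simps d ww assoc by (rule cr[OF hm_dsc])
   also have "tt ?N 0 * (tt ?N 1 * (tt ?N 0 * ?A)) =
     tt ?N 1 * (tt ?N 0 * (tt ?N 1 * ?A))"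
    using arg_cong[OF braid[of ?N 0], of "%z. z * ?A"] by (simp add: assoc)
   also have "tt ?N 1 * ?A = L (tt n 0 * w n)"
    unfolding ww[symmetric] by (simp add: 3)
   finally show ?thesis using 0 Suc.IH by (simp add: assoc)
  qed (use 0 in "simp add: T_def")
 qed
qed (simp add: T_def)
lemma w_T [simp]: "w n * tt n i = 0" by (metis T_w star_simps(3,4) star_w star_gens(2))
lemma T_w' [simp]: "tt n i * (w n * y) = 0" and w_T' [simp]: "w n * (tt n i * y) = 0"
 by (simp_all add: mult_ext0)

text \<open>Closure under scalars is demanded separately, because there is no unit through which
  scalars could act.\<close>

definition lideal :: "('a, 'b) nb set => bool" where
 "lideal J \<longleftrightarrow> 0 : J & (ALL a:J. ALL b:J. a + b : J) & (ALL c. ALL a:J. c *s a : J) & (ALL y. ALL a:J. y * a : J)"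
lemma lidealD:
 assumes "lideal J"
 shows "0 : J" "a : J ==> b : J ==> a + b : J" "a : J ==> c *s a : J" "a : J ==> y * a : J"
  "a : J ==> - a : J" "a : J ==> b : J ==> a - b : J"
proof -
 show *: "0 : J" "a : J ==> b : J ==> a + b : J" "a : J ==> c *s a : J" "a : J ==> y * a : J" for a b c y
  using assms by (auto simp: lideal_def)
 show "a : J ==> - a : J" for a using *(3)[of a "-1"] by simp
 thus "a : J ==> b : J ==> a - b : J" using *(2)[of a "- b"] by simp
qed
lemma lideal_sum: "lideal J ==> (!!i. i : S ==> f i : J) ==> sum f S : J"
 by (induction S rule: infinite_finite_induct) (auto intro: lidealD)
lemma lideal_0: "lideal {0}" by (simp add: lideal_def)

text \<open>\<open>T_{k}...T_0 X_0\<close> on vectors killed by \<open>T_1, ..., T_k\<close>: the recursion behind all later resolutions.\<close>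
lemma dsc_X:
 assumes J: "lideal J" and "!!i. 1 <= i ==> i <= k ==> tt n i * z : J" "ii n * z = z" "Suc k < n"
 shows "dsc n (Suc k) * (xx n 0 * z) - (xx n (Suc k) * (dsc n (Suc k) * z) + dsc n k * z - dsc1 n k * (uu n 0 * (aa n 0 * z))) : J"
 using assms(2-)
proof (induction k)
 case 0
 have "tt n 0 * xx n 0 * z = (xx n (Suc 0) * tt n 0 + ii n - uu n 0 * aa n 0) * z" using 0 by (subst TXr) auto
 thus ?case using 0 lidealD(1)[OF J] by (simp add: algs)
next
 case (Suc k)
 let ?z = "dsc n (Suc k) * z"
 let ?d = "dsc n (Suc k) * (xx n 0 * z) - (xx n (Suc k) * ?z + dsc n k * z - dsc1 n k * (uu n 0 * (aa n 0 * z)))"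
 have d: "?d : J" using Suc by simp
 have TD: "tt n (Suc k) * (dsc n k * z) : J"
  using mult_ext[OF T_dsc[of k "Suc k" n], of z] Suc.prems(1)[of "Suc k"] lidealD(4)[OF J] by simp
 have AD: "aa n (Suc k) * ?z : J" using mult_ext[OF fork[of n k], of "dsc n k * z"] TD lidealD(4)[OF J] by (simp add: assoc)
 have "tt n (Suc k) * xx n (Suc k) * ?z = (xx n (Suc (Suc k)) * tt n (Suc k) + ii n - uu n (Suc k) * aa n (Suc k)) * ?z"
  using Suc.prems by (subst TXr) auto
 hence e: "tt n (Suc k) * (xx n (Suc k) * ?z) = xx n (Suc (Suc k)) * (tt n (Suc k) * ?z) + ?z - uu n (Suc k) * (aa n (Suc k) * ?z)"
  by (simp del: dsc.simps(2) add: algs hm_left'[OF hm_dsc])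
 have "dsc n (Suc (Suc k)) * (xx n 0 * z) - (xx n (Suc (Suc k)) * (dsc n (Suc (Suc k)) * z) + ?z - dsc1 n (Suc k) * (uu n 0 * (aa n 0 * z)))
   = tt n (Suc k) * ?d + tt n (Suc k) * (dsc n k * z) - uu n (Suc k) * (aa n (Suc k) * ?z)"
  unfolding dsc.simps(2)[of n "Suc k"] right_diff_distrib distrib_left e by (simp del: dsc.simps(2) add: assoc)
 thus ?case using d TD AD J by (simp only: lidealD)
qed
text \<open>Divided differences of a power of one dot: each crossing of the train removes at most
  one of the \<open>j\<close> dots, an undotted crossing kills \<open>z\<close>, and the cup-cap
  corrections vanish by hypothesis.\<close>

lemma dsc_xp:
 assumes "!!i. i < k ==> tt n i * z = 0" "ii n * z = z" "k < n" "!!j. j < k ==> aa n 0 * (xp n 0 j * z) = 0"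
 shows "j <= k ==> dsc n k * (xp n 0 j * z) = (if j = k then z else 0)"
 using assms
proof (induction j arbitrary: k)
 case 0
 show ?case
 proof (cases k)
  case (Suc k')
  thus ?thesis using 0 unfolding Suc dsc_Suc by (simp add: assoc)
 qed (use 0 in simp)
next
 case (Suc j)
 then obtain k' where k: "k = Suc k'" by (cases k) auto
 have T: "tt n i * (xp n 0 j * z) = 0" if "1 <= i" "i <= k'" for i
  using mult_ext[OF xp_T[of 0 i n j], of z] that Suc.prems(2)[of i] k by simp
 have "dsc n (Suc k') * (xx n 0 * (xp n 0 j * z)) = xx n (Suc k') * (dsc n (Suc k') * (xp n 0 j * z))
   + dsc n k' * (xp n 0 j * z) - dsc1 n k' * (uu n 0 * (aa n 0 * (xp n 0 j * z)))"
  using dsc_X[OF lideal_0, of k' n "xp n 0 j * z"] T Suc.prems k by (simp add: hm_left'[OF hm_xp] del: dsc.simps)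
 also have "aa n 0 * (xp n 0 j * z) = 0" using Suc.prems k by simp
 also have "dsc n (Suc k') * (xp n 0 j * z) = 0" using Suc.IH[of k] Suc.prems k by simp
 also have "dsc n k' * (xp n 0 j * z) = (if j = k' then z else 0)" using Suc.IH[of k'] Suc.prems k by simp
 finally show ?case using k by (simp add: assoc)
qed

end

section \<open>Dotted caps on the longest crossing, and the idempotents\<close>

context nbt begin

definition tk :: 'a where "tk = of_nat (tparam TYPE('b))"
text \<open>Equal to 1 exactly when \<open>n\<close> has the parity of \<open>t\<close>
  (\<open>cc_iff\<close>); the two cases of the multiplicity formula come from this number.\<close>

definition cc :: "nat => 'a" where "cc n = (if even n then 1 - tk else tk)"
lemma tk_cases: "tk = 0 | tk = 1" using tparam_le[where 'a='b] by (cases "tparam TYPE('b)") (auto simp: tk_def)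
lemma cc_cases: "cc n = 0 | cc n = 1" using tk_cases by (auto simp: cc_def)
lemma cc_Suc: "cc (Suc n) = 1 - cc n" by (simp add: cc_def)
lemma cc_iff: "cc n = 1 \<longleftrightarrow> n mod 2 = tparam TYPE('b) mod 2"
 using tparam_le[where 'a='b] by (cases "tparam TYPE('b)") (auto simp: cc_def tk_def even_iff_mod_2_eq_zero odd_iff_mod_2_eq_one)
lemma AU_tk: "Suc i < n ==> aa n i * uu n i = tk *s ii (n - 2)" by (simp add: AU tI_def tk_def)

text \<open>The bubble to the left of \<open>n\<close> strands, with \<open>k\<close> dots on its
  left leg. By naturality it passes every morphism (\<open>lb_comm\<close>).\<close>

definition "lb n k = aa (n + 2) 0 * (xp (n + 2) 0 k * uu (n + 2) 0)"
lemma hm_lb: "hm n n (lb n k)"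
 unfolding lb_def using hm_mult[OF hm_A hm_mult[OF hm_xp hm_U]] by (metis add_diff_cancel_right')
lemma lb_0: "lb n 0 = tk *s ii n" by (simp add: lb_def AU_tk)
lemma lb_comm: "hm m n y ==> lb m k * y = y * lb n k"
proof -
 assume h: "hm m n y"
 have x: "xp (Suc (Suc m)) 0 k * L (L y) = L (L y) * xp (Suc (Suc n)) 0 k" using xp_L[OF hm_L[OF h]] .
 have "lb m k * y = aa (Suc (Suc m)) 0 * (xp (Suc (Suc m)) 0 k * (L (L y) * uu (Suc (Suc n)) 0))"
  using far0(4)[OF h] by (simp add: lb_def assoc)
 also have "... = aa (Suc (Suc m)) 0 * (L (L y) * (xp (Suc (Suc n)) 0 k * uu (Suc (Suc n)) 0))"
  by (subst mult_ext[OF x]) simp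
 also have "... = y * lb n k" by (subst mult_ext[OF far0(3)[OF h]]) (simp add: lb_def)
 finally show ?thesis .
qed
lemma A_xp_X1: "aa n 0 * (xp n 0 k * xx n (Suc 0)) = - (aa n 0 * xp n 0 (Suc k))"
proof -
 have "aa n 0 * (xp n 0 k * xx n (Suc 0)) = (aa n 0 * xx n (Suc 0)) * xp n 0 k" by (simp add: xp_XX assoc)
 thus ?thesis by (simp add: AXs assoc)
qed
text \<open>The dots on the left leg of the cap are carried through the crossing one at a time.
  Beyond it they sit on the right leg and return with a sign; a cap on a bare crossing is 0. The
  cup-cap corrections split off bubbles.\<close>

lemma A_xp_T:
 assumes "1 < n"
 shows "aa n 0 * (xp n 0 i * tt n 0) = (SUM b<i. (-1) ^ b *s (aa n 0 * xp n 0 (i - 1) - lb (n - 2) (i - 1 - b) * (aa n 0 * xp n 0 b)))"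
proof (induction i)
 case (Suc i)
 have n: "Suc (Suc (n - 2)) = n" using assms by simp
 have "xp n 0 (Suc i) * tt n 0 = xp n 0 i * (tt n 0 * xx n (Suc 0) + ii n - uu n 0 * aa n 0)"
  using assms by (simp add: xp_Suc2 assoc XTr del: xp.simps)
 hence "aa n 0 * (xp n 0 (Suc i) * tt n 0) = (aa n 0 * (xp n 0 i * tt n 0)) * xx n (Suc 0) + aa n 0 * xp n 0 i
   - lb (n - 2) i * aa n 0"
  by (simp add: distrib_left right_diff_distrib assoc hm_right[OF hm_xp] lb_def n)
 also have "(aa n 0 * (xp n 0 i * tt n 0)) * xx n (Suc 0) =
   (SUM b<i. (-1) ^ Suc b *s (aa n 0 * xp n 0 i - lb (n - 2) (i - Suc b) * (aa n 0 * xp n 0 (Suc b))))"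
 using sum.cong by (simp add: left_diff_distrib assoc A_xp_X1 smul_diff Suc.IH sum_distrib_right)
 finally show ?case
  by (subst sum.lessThan_Suc_shift) (simp add: hm_right[OF hm_A])
qed simp
lemma sum_alt: "(SUM b<i. (-1) ^ b) = (if odd i then 1 else (0 :: 'a))" by (induction i) auto
text \<open>By hypothesis only the term with the undotted bubble, of value \<open>tk\<close>,
  survives among the bubbles. It corrects an alternating sum of ones, whence the dependence on the
  parity of \<open>i\<close>.\<close>

lemma A_xp_T_app:
 assumes "1 < n" "!!b. b + 1 < i ==> aa n 0 * (xp n 0 b * y) = 0" "1 <= i"
 shows "aa n 0 * (xp n 0 i * (tt n 0 * y)) = (if odd i then 1 - tk else tk) *s (aa n 0 * (xp n 0 (i - 1) * y))"
proof -
 let ?Y = "aa n 0 * (xp n 0 (i - 1) * y)"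
 have "aa n 0 * (xp n 0 i * (tt n 0 * y)) = (aa n 0 * (xp n 0 i * tt n 0)) * y" by (simp add: assoc)
 also have "... = (SUM b<i. (-1) ^ b *s (?Y - lb (n - 2) (i - 1 - b) * (aa n 0 * (xp n 0 b * y))))"
  unfolding A_xp_T[OF assms(1)] sum_distrib_right by (simp add: left_diff_distrib assoc)
 also have "... = (SUM b<i. ((-1) ^ b - (if b = i - 1 then (-1) ^ b * tk else 0)) *s ?Y)"
 proof (rule sum.cong[OF refl])
  fix b assume b: "b : {..<i}"
  show "(-1) ^ b *s (?Y - lb (n - 2) (i - 1 - b) * (aa n 0 * (xp n 0 b * y))) = ((-1) ^ b - (if b = i - 1 then (-1) ^ b * tk else 0)) *s ?Y"
  using assms(2)[of b] b by (simp add: lb_0 smul_diff nbv.scale_left_diff_distrib)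
 qed
 also have "... = ((SUM b<i. (-1) ^ b) - (-1) ^ (i - 1) * tk) *s ?Y"
  using assms(3) by (simp add: nbv.scale_sum_left[symmetric] sum_subtractf)
 also have "(SUM b<i. (-1) ^ b) - (-1) ^ (i - 1) * tk = (if odd i then 1 - tk else tk)"
  using assms(3) by (cases i) (auto simp: sum_alt simp del: sum.lessThan_Suc)
 finally show ?thesis .
qed

text \<open>Crossing words. Carrying a strand across one of them (\<open>dsc_L_R\<close>) is free of
  corrections, which fails once dots are present.\<close>

inductive_set Tw :: "nat => ('a, 'b) nb set" for n where
 Tw_I: "ii n : Tw n" | Tw_T: "y : Tw n ==> tt n i * y : Tw n"
lemma Tw_hm: "y : Tw n ==> hm n n y" by (induction rule: Tw.induct) (auto intro: hm_mult hm_T)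
lemma Tw_mult: "y : Tw n ==> z : Tw n ==> y * z : Tw n"
 by (induction rule: Tw.induct) (auto simp: assoc hm_left[OF Tw_hm] intro: Tw.intros)
lemma Tw_L: "y : Tw n ==> L y : Tw (Suc n)" by (induction rule: Tw.induct) (auto intro: Tw.intros)
lemma Tw_dsc: "dsc n k : Tw n" by (induction k) (auto intro: Tw.intros)
lemma Tw_w: "w n : Tw n" by (induction n) (auto intro: Tw.intros Tw_mult Tw_dsc Tw_L)
lemma dsc_T: "Suc i < k ==> dsc n k * tt n (Suc i) = tt n i * dsc n k"
proof (induction k)
 case (Suc k)
 show ?case
 proof (cases "Suc i = k")
  case True
  hence d: "dsc n (Suc k) = tt n (Suc i) * (tt n i * dsc n i)" by (metis dsc.simps(2))
  have "dsc n (Suc k) * tt n (Suc i) = tt n (Suc i) * (tt n i * (tt n (Suc i) * dsc n i))"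
   unfolding d by (simp add: assoc T_dsc)
  also have "... = (tt n (Suc i) * (tt n i * tt n (Suc i))) * dsc n i" by (simp add: assoc)
  also have "... = tt n i * dsc n (Suc k)" unfolding d braid[symmetric] by (simp add: assoc)
  finally show ?thesis .
 next
  case False
  thus ?thesis using Suc mult_ext[OF TT[of i k n], of "dsc n k"] by (simp add: assoc)
 qed
qed simp
lemma dsc_L_R: "y : Tw n ==> dsc (Suc n) n * L y = R y * dsc (Suc n) n"
proof (induction rule: Tw.induct)
 case Tw_I
 thus ?case by (simp add: hm_left[OF hm_dsc] hm_right[OF hm_dsc])
next
 case (Tw_T y i)
 show ?case
 proof (cases "Suc i < n")
  case True
  have "dsc (Suc n) n * L (tt n i * y) = (dsc (Suc n) n * tt (Suc n) (Suc i)) * L y" by (simp add: assoc)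
  also have "... = tt (Suc n) i * (dsc (Suc n) n * L y)" using True by (simp add: dsc_T assoc)
  finally show ?thesis using Tw_T True by (simp add: R_gens assoc)
 next
  case False
  thus ?thesis by (simp add: T_def)
 qed
qed
lemma w_R: "w (Suc n) = asc (Suc n) n * R (w n)"
using dsc_L_R[OF Tw_w, of n] star_w[of "Suc n"] by simp
lemma A_asc1: "aa n 0 * asc1 n k = aa n k * dsc n k"
proof (induction k)
 case (Suc k)
 have "aa n 0 * asc1 n (Suc k) = (aa n 0 * asc1 n k) * tt n (Suc k)" by (simp add: assoc)
 also have "... = (aa n k * tt n (Suc k)) * dsc n k" using T_dsc[of k "Suc k" n] by (simp add: Suc assoc)
 also have "... = aa n (Suc k) * dsc n (Suc k)" by (simp add: fork[symmetric] assoc)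
 finally show ?case .
qed simp
lemma xp_asc1: "xp n 0 b * asc1 n k = asc1 n k * xp n 0 b"
proof (induction k)
 case (Suc k)
 thus ?case using mult_ext[OF Suc, of "tt n (Suc k)"] xp_T[of 0 "Suc k" n b] by (simp add: assoc)
qed (simp add: hm_left[OF hm_xp] hm_right[OF hm_xp])
lemma R_dsc: "k < n ==> R (dsc n k) = dsc (Suc n) k" by (induction k) (auto simp: R_gens)
lemma R_xp: "R (xp (Suc n) 0 k) = xp (Suc (Suc n)) 0 k" by (induction k) (auto simp: R_gens)
text \<open>Write \<open>w N\<close> as \<open>T_0 y\<close>. By \<open>A_xp_T_app\<close> a cap
  with \<open>i\<close> dots on it reduces to a cap with \<open>i - 1\<close> dots on
  \<open>y\<close>, and this is a cap behind a divided difference of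
  \<open>xp (i - 1) * w (N - 1)\<close>, which is 0 when there are too few dots. At
  \<open>i = N - 1\<close> the coefficient in front is \<open>cc N\<close>, which explains the
  second statement.\<close>

lemma A_xp_w:
 shows "i + 2 <= n ==> aa n 0 * (xp n 0 i * w n) = 0"
  "cc n = 0 ==> i + 1 <= n ==> aa n 0 * (xp n 0 i * w n) = 0"
proof -
 have "(ALL i. i + 2 <= n --> aa n 0 * (xp n 0 i * w n) = 0) & (cc n = 0 --> (ALL i. i + 1 <= n --> aa n 0 * (xp n 0 i * w n) = 0))"
 proof (induction n)
  case (Suc n)
  show ?case
  proof (cases n)
   case 0
   thus ?thesis by (simp add: A_def)
  next
   case (Suc m)
   let ?N = "Suc (Suc m)"
   define y where "y = asc1 ?N m * R (w (Suc m))"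
   have wy: "w ?N = tt ?N 0 * y" unfolding y_def w_R[of "Suc m"] asc_Suc by (simp add: assoc)
   have *: "aa ?N 0 * (xp ?N 0 b * y) = 0" if "b < m" for b
   proof -
    have "aa ?N 0 * (xp ?N 0 b * y) = (aa ?N 0 * asc1 ?N m) * (xp ?N 0 b * R (w (Suc m)))"
     unfolding y_def using mult_ext[OF xp_asc1[of ?N b m], of "R (w (Suc m))"] by (simp only: assoc)
    also have "... = aa ?N m * R (dsc (Suc m) m * (xp (Suc m) 0 b * w (Suc m)))"
     unfolding A_asc1 by (simp add: R_dsc R_xp assoc del: w.simps)
    also have "dsc (Suc m) m * (xp (Suc m) 0 b * w (Suc m)) = 0"
     using that Suc.IH Suc by (subst dsc_xp) (auto simp del: w.simps)
    finally show ?thesis by simp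
   qed
   have **: "aa ?N 0 * (xp ?N 0 i * w ?N) = (if odd i then 1 - tk else tk) *s (aa ?N 0 * (xp ?N 0 (i - 1) * y))" if "1 <= i" "i <= Suc m" for i
    unfolding wy using that * by (intro A_xp_T_app) auto
   have "aa ?N 0 * (xp ?N 0 0 * w ?N) = 0" unfolding wy using mult_ext0[OF ATz] by simp
   hence 1: "aa ?N 0 * (xp ?N 0 i * w ?N) = 0" if "i <= m" for i
    using that **[of i] *[of "i - 1"] by (cases i) (auto simp del: w.simps xp.simps(2))
   have 2: "cc ?N = 0 ==> aa ?N 0 * (xp ?N 0 (Suc m) * w ?N) = 0"
    using **[of "Suc m"] by (auto simp: cc_def simp del: w.simps xp.simps split: if_splits)
   show ?thesis unfolding Suc using 1 2 by (auto simp del: w.simps xp.simps simp: le_Suc_eq)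
  qed
 qed (simp add: A_def)
 thus "i + 2 <= n ==> aa n 0 * (xp n 0 i * w n) = 0" "cc n = 0 ==> i + 1 <= n ==> aa n 0 * (xp n 0 i * w n) = 0" by blast+
qed
lemma w_xp_U:
 shows "i + 2 <= n ==> w n * (xp n 0 i * uu n 0) = 0"
  "cc n = 0 ==> i + 1 <= n ==> w n * (xp n 0 i * uu n 0) = 0"
 using arg_cong[OF A_xp_w(1)[of i n], of star] arg_cong[OF A_xp_w(2)[of n i], of star] by (simp_all add: assoc)
lemma dsc_xp_w: "j <= k ==> k < n ==> dsc n k * (xp n 0 j * w n) = (if j = k then w n else 0)"
 by (rule dsc_xp) (auto intro: A_xp_w(1))

text \<open>The staircase monomial \<open>x_0^(n-1) x_1^(n-2) ...\<close>, on which the top divided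
  difference takes the value 1; \<open>w_rho_w\<close> is this fact.\<close>

primrec rho :: "nat => ('a, 'b) nb" where
 "rho 0 = I 0" | "rho (Suc n) = xp (Suc n) 0 n * L (rho n)"
lemma hm_rho: "hm n n (rho n)" by (induction n) (auto intro: hm_mult hm_xp hm_L)
lemma dg_rho: "dg (int (n * (n - 1))) (rho n)"
proof (induction n)
 case (Suc n)
 have "int (Suc n * (Suc n - 1)) = 2 * int n + int (n * (n - 1))" by (cases n) (auto simp: algs)
 thus ?case using dg_mult[OF dg_xp dg_L[OF Suc]] by (simp only: rho.simps)
qed simp
lemma w_rho_w: "w n * (rho n * w n) = w n"
proof (induction n)
 case (Suc n)
 have "w (Suc n) * (rho (Suc n) * w (Suc n)) = dsc (Suc n) n * (L (w n) * (xp (Suc n) 0 n * (L (rho n) * (L (w n) * asc (Suc n) n))))"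
  by (subst (2) w_alt) (simp add: assoc)
 also have "... = dsc (Suc n) n * (xp (Suc n) 0 n * (L (w n * (rho n * w n)) * asc (Suc n) n))"
  using mult_ext[OF xp_L[OF hm_w, of n n], symmetric] by (simp add: assoc)
 also have "L (w n * (rho n * w n)) * asc (Suc n) n = w (Suc n)" unfolding Suc w_alt ..
 also have "dsc (Suc n) n * (xp (Suc n) 0 n * w (Suc n)) = w (Suc n)" by (subst dsc_xp_w) auto
 finally show ?case .
qed simp

text \<open>Idempotent because \<open>w * rho * w = w\<close>, and of degree 0 because the degrees
  of \<open>w\<close> and \<open>rho\<close> cancel.\<close>

definition "ei n = w n * rho n"
lemma hm_ei: "hm n n (ei n)" unfolding ei_def by (rule hm_mult[OF hm_w hm_rho])
lemma dg_ei: "dg 0 (ei n)" using dg_mult[OF dg_w dg_rho, of n n] by (simp add: ei_def)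
lemma ei_w: "ei n * w n = w n" "ei n * (w n * y) = w n * y"
 using w_rho_w[of n] by (simp_all add: ei_def assoc flip: assoc[of _ _ y] assoc[of _ _ "_ * y"])
lemma ei_ei: "ei n * ei n = ei n" by (simp add: ei_w ei_def[of n] flip: assoc) (simp add: ei_def assoc w_rho_w flip: assoc[of _ _ "rho n"])

text \<open>A cup whose right leg is fully crossed with the \<open>m\<close> remaining strands: the
  map by which a copy of \<open>ei m\<close> enters one strand placed beside
  \<open>ei (m + 1)\<close>.\<close>

definition "gg m = L (w (Suc m)) * uu (Suc (Suc m)) 0"
lemma hm_gg: "hm (Suc (Suc m)) m (gg m)"
 using hm_mult[OF hm_L[OF hm_w] hm_U, of "Suc m" 0] unfolding gg_def by simp
lemma gg_alt: "gg m = dsc1 (Suc (Suc m)) m * (uu (Suc (Suc m)) 0 * w m)"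
 using far0(4)[OF hm_w, of m] by (simp add: gg_def assoc)
lemma dg_gg: "dg (- int (Suc m * m)) (gg m)"
 using dg_mult[OF dg_L[OF dg_w] dg_U, of "Suc m" "Suc (Suc m)" 0] by (simp add: gg_def)
lemma gg_eq: "gg m = dsc1 (Suc (Suc m)) m * uu (Suc (Suc m)) 0 * w m" by (simp add: gg_alt assoc)
lemma T_gg: "1 <= i ==> tt (Suc (Suc m)) i * gg m = 0"
proof -
 assume "1 <= i"
 then obtain j where j: "i = Suc j" by (cases i) auto
 have "tt (Suc (Suc m)) i * gg m = L (tt (Suc m) j * w (Suc m)) * uu (Suc (Suc m)) 0"
  by (simp add: gg_def j assoc del: w.simps T_w)
 thus ?thesis by (simp del: w.simps)
qed
text \<open>These pairings with dotted caps show that \<open>gg m\<close> splits off a copy of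
  \<open>w m\<close> exactly when \<open>cc (Suc m) = 1\<close>. \<open>TUs\<close> brings a
  crossing of \<open>gg m\<close> directly under the cap, and in the alternating sum of
  \<open>A_xp_T\<close> the rule \<open>dsc_xp_w\<close> leaves only terms with \<open>m - 1\<close>
  dots.\<close>

lemma A_xp_gg: "l <= m ==> aa (Suc (Suc m)) 0 * (xp (Suc (Suc m)) 0 l * gg m) = (if l = m then cc (Suc m) *s w m else 0)"
proof (cases m)
 case 0
 thus "l <= m ==> ?thesis" by (simp add: gg_alt AU_tk hm_left[OF hm_U] cc_def flip: assoc)
next
 case (Suc p)
 assume lm: "l <= m"
 let ?N = "Suc (Suc m)" and ?D = "dsc m p"
 define y where "y = uu ?N (Suc 0) * w m"
 have gy: "gg m = L (L ?D) * (tt ?N 0 * y)"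
 proof -
  have "gg m = L (L ?D) * ((tt ?N (Suc 0) * uu ?N 0) * w m)"
   unfolding gg_alt using dsc_Suc[of "Suc m" p, THEN arg_cong[of _ _ L]] by (simp add: Suc assoc)
  thus ?thesis unfolding y_def TUs[symmetric] by (simp add: assoc)
 qed
 have red: "aa ?N 0 * (xp ?N 0 l * gg m) = ?D * (aa ?N 0 * (xp ?N 0 l * (tt ?N 0 * y)))"
 by (metis mult_ext[OF xp_L[OF hm_L[OF hm_dsc[of m p]], of l]] mult_ext[OF far0(3)[OF hm_dsc[of m p]]] gy)
 have Ay: "aa ?N 0 * (xp ?N 0 b * y) = xp m 0 b * w m" for b
  unfolding y_def using mult_ext[OF xp_U_lt[of 0 "Suc 0" ?N b]] Suc by (simp add: zig' hm_left'[OF hm_xp] del: w.simps)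
 show ?thesis
 proof (cases "l = 0")
  case True
  thus ?thesis unfolding red using Suc mult_ext0[OF ATz[of ?N 0], of y] by (simp add: hm_left hm_T flip: assoc[of "tt _ _"] )
 next
  case False
  have "aa ?N 0 * (xp ?N 0 l * (tt ?N 0 * y)) = (aa ?N 0 * (xp ?N 0 l * tt ?N 0)) * y" by (simp add: assoc)
  also have "... = (SUM b<l. (-1) ^ b *s (xp m 0 (l - 1) * w m - lb m (l - 1 - b) * (xp m 0 b * w m)))"
   by (subst A_xp_T) (simp_all add: sum_distrib_right left_diff_distrib assoc Ay)
  finally have "aa ?N 0 * (xp ?N 0 l * gg m) = (SUM b<l. (-1) ^ b *s (?D * (xp m 0 (l - 1) * w m) - lb m (l - 1 - b) * (?D * (xp m 0 b * w m))))"
   unfolding red by (simp add: sum_distrib_left right_diff_distrib lb_comm[OF hm_dsc] flip: assoc)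
  also have "... = (SUM b<l. ((if l = m then (-1) ^ b else 0) - (if b = m - 1 then (-1) ^ b * tk else 0)) *s w m)"
  proof (rule sum.cong[OF refl])
   fix b assume b: "b : {..<l}"
   have 1: "?D * (xp m 0 (l - 1) * w m) = (if l = m then w m else 0)" "?D * (xp m 0 b * w m) = (if b = m - 1 then w m else 0)"
    using lm b False Suc by (auto simp: dsc_xp_w simp del: w.simps)
   have 2: "b = m - 1 ==> l - 1 - b = 0" using lm b Suc by auto
   show "(-1) ^ b *s (?D * (xp m 0 (l - 1) * w m) - lb m (l - 1 - b) * (?D * (xp m 0 b * w m))) =
    ((if l = m then (-1) ^ b else 0) - (if b = m - 1 then (-1) ^ b * tk else 0)) *s w m"
    unfolding 1 using 2 by (auto simp: lb_0 smul_diff nbv.scale_left_diff_distrib simp del: w.simps)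
  qed
  also have "... = (SUM b<l. (if l = m then (-1) ^ b else 0) - (if b = m - 1 then (-1) ^ b * tk else 0)) *s w m"
   by (simp only: nbv.scale_sum_left)
  also have "(SUM b<l. (if l = m then (-1) ^ b else 0) - (if b = m - 1 then (-1) ^ b * tk else 0)) = (if l = m then cc (Suc m) else 0)"
  using Suc lm by (simp add: sum_subtractf sum_alt cc_def)
  finally show ?thesis by (simp del: w.simps)
 qed
qed

end

section \<open>Resolving one more strand beside the longest crossing\<close>

context nbt begin
text \<open>Solving \<open>dsc_X\<close> for its term with the shorter train shows that
  \<open>dsc n e * (xp n 0 j * z)\<close> lies in \<open>M\<close> as soon as this holds for the
  train \<open>Suc e\<close> with \<open>j\<close> and \<open>j + 1\<close> dots. The range of
  exponents shrinks together with the train, and the empty train leaves \<open>z\<close>.\<close>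

lemma resolve:
 assumes M: "lideal M" and k: "k < n" and z: "ii n * z = z"
  and T: "!!i j. 1 <= i ==> tt n i * (xp n 0 j * z) : M"
  and D: "!!j. j <= k ==> dsc n k * (xp n 0 j * z) : M"
  and A: "!!l. l < k ==> aa n 0 * (xp n 0 l * z) : M"
 shows "z : M"
proof -
 have "d <= k ==> (ALL j<=k - d. dsc n (k - d) * (xp n 0 j * z) : M)" for d
 proof (induction d)
  case 0 thus ?case using D by simp
 next
  case (Suc d)
  define e where "e = k - Suc d"
  have e: "k - d = Suc e" "Suc e < n" "e < k" using Suc.prems k by (auto simp: e_def)
  show ?case unfolding e_def[symmetric]
  proof (intro allI impI)
   fix j assume j: "j <= e"
   let ?y = "xp n 0 j * z"
   let ?A = "(uu n 0 * (aa n 0 * ?y))"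
   let ?r = "dsc n (Suc e) * (xx n 0 * ?y) - (xx n (Suc e) * (dsc n (Suc e) * ?y) + dsc n e * ?y - dsc1 n e * ?A)"
   have "?r : M" using T z e by (intro dsc_X[OF M]) (auto simp: hm_left'[OF hm_xp])
   moreover have "dsc n (Suc e) * (xx n 0 * ?y) : M" "dsc n (Suc e) * ?y : M"
    using Suc.IH Suc.prems e j by (force dest: spec[of _ "Suc j"] simp: assoc simp del: dsc.simps, force simp del: dsc.simps)
   moreover have "aa n 0 * ?y : M" using A[of j] j e by simp
   ultimately have "dsc n (Suc e) * (xx n 0 * ?y) - xx n (Suc e) * (dsc n (Suc e) * ?y) + dsc1 n e * ?A - ?r : M"
    using M by (simp only: lidealD)
   moreover have "dsc n (Suc e) * (xx n 0 * ?y) - xx n (Suc e) * (dsc n (Suc e) * ?y) + dsc1 n e * ?A - ?r = dsc n e * ?y"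
    by (simp add: algs)
   ultimately show "dsc n e * ?y : M" by simp
  qed
 qed
 from this[of k] show ?thesis using z by simp
qed
lemma dsc_xp_Lw: "dsc (Suc b) b * (xp (Suc b) 0 j * (L (w b) * y)) = w (Suc b) * (xp (Suc b) 0 j * y)"
 using mult_ext[OF xp_L[OF hm_w, of b j], of y] by (simp add: assoc)
text \<open>\<open>resolve\<close> writes \<open>L (w b)\<close> with unknown coefficients on the
  left of the detecting trains and caps. Since all these have explicit reflections,
  \<open>star\<close> turns the result into images of \<open>w (Suc b)\<close> and
  \<open>gg (b - 1)\<close> with the unknown coefficients on the right.\<close>

lemma Lw_decomp:
 "EX p r. L (w b) = (SUM j<=b. xp (Suc b) 0 j * (w (Suc b) * p j)) + (SUM l<b. xp (Suc b) 0 l * (gg (b - 1) * r l))"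
proof -
 let ?n = "Suc b" and ?z = "L (w b)"
 define M where "M = {y. EX p h. y = (SUM j<=b. p j * (dsc ?n b * (xp ?n 0 j * ?z))) + (SUM l<b. h l * (aa ?n 0 * (xp ?n 0 l * ?z)))}"
 have "lideal M" unfolding lideal_def
 proof (intro conjI ballI allI)
  show "0 : M" unfolding M_def by (auto intro!: exI[of _ "%_. 0"])
  fix y assume "y : M"
  then obtain p h where 1: "y = (SUM j<=b. p j * (dsc ?n b * (xp ?n 0 j * ?z))) + (SUM l<b. h l * (aa ?n 0 * (xp ?n 0 l * ?z)))"
   unfolding M_def by blast
  show "y + y' : M" if "y' : M" for y'
  proof -
   from that obtain p' h' where 2: "y' = (SUM j<=b. p' j * (dsc ?n b * (xp ?n 0 j * ?z))) + (SUM l<b. h' l * (aa ?n 0 * (xp ?n 0 l * ?z)))"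
    unfolding M_def by blast
   show ?thesis unfolding M_def 1 2
    by (rule CollectI, rule exI[of _ "%j. p j + p' j"], rule exI[of _ "%j. h j + h' j"])
     (simp add: distrib_right sum.distrib)
  qed
  show "c *s y : M" for c unfolding M_def 1
   by (rule CollectI, rule exI[of _ "%j. c *s p j"], rule exI[of _ "%j. c *s h j"])
    (simp add: nbv.scale_right_distrib nbv.scale_sum_right)
  show "u * y : M" for u unfolding M_def 1
   by (rule CollectI, rule exI[of _ "%j. u * p j"], rule exI[of _ "%j. u * h j"])
    (simp add: distrib_left sum_distrib_left assoc)
 qed
 moreover have "tt ?n i * (xp ?n 0 j * ?z) : M" if i: "1 <= i" for i j
 proof -
  obtain i' where i': "i = Suc i'" using i by (cases i) auto
  have "tt ?n i * (xp ?n 0 j * ?z) = xp ?n 0 j * L (tt b i' * w b)"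
   using mult_ext[OF xp_T[of 0 i ?n j], of ?z] i by (simp add: i' del: T_w)
  thus ?thesis using \<open>lideal M\<close> by (simp add: lidealD)
 qed
 moreover have "dsc ?n b * (xp ?n 0 j * ?z) : M" if "j <= b" for j
  unfolding M_def
  by (rule CollectI, rule exI[of _ "%i. if i = j then ii ?n else 0"], rule exI[of _ "%_. 0"])
   (use that in \<open>simp add: if_distrib[of "%x. x * _"] hm_left'[OF hm_dsc] cong: if_cong\<close>)
 moreover have "aa ?n 0 * (xp ?n 0 l * ?z) : M" if "l < b" for l
  unfolding M_def
  by (rule CollectI, rule exI[of _ "%_. 0"], rule exI[of _ "%i. if i = l then ii (b - 1) else 0"])
   (use that in \<open>simp add: if_distrib[of "%x. x * _"] cong: if_cong\<close>)
 moreover have "ii ?n * ?z = ?z" using hm_left[OF hm_L[OF hm_w]] .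
 ultimately have "?z : M" by (intro resolve[of M b ?n ?z]) auto
 then obtain p h where 1: "?z = (SUM j<=b. p j * (dsc ?n b * (xp ?n 0 j * ?z))) + (SUM l<b. h l * (aa ?n 0 * (xp ?n 0 l * ?z)))"
  unfolding M_def by blast
 have 2: "dsc ?n b * (xp ?n 0 j * ?z) = w ?n * xp ?n 0 j" for j
  using xp_L[OF hm_w, of b j] by (simp add: assoc)
 have 3: "star (aa ?n 0 * (xp ?n 0 l * ?z)) = xp ?n 0 l * gg (b - 1)" if "l < b" for l
  using that xp_L[OF hm_w, of b l] by (cases b) (simp_all add: gg_def assoc del: w.simps, simp add: assoc[symmetric] del: w.simps)
 have "?z = star ?z" by simp
 also have "... = (SUM j<=b. xp ?n 0 j * (w ?n * star (p j))) + (SUM l<b. xp ?n 0 l * (gg (b - 1) * star (h l)))"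
  by (subst 1) (simp add: 2 star_sum assoc 3[simplified] del: w.simps, simp add: 3[simplified, symmetric] assoc[symmetric] del: w.simps)
 finally show ?thesis by (intro exI[of _ "%j. star (p j)"] exI[of _ "%l. star (h l)"])
qed
text \<open>When the pairing of \<open>A_xp_gg\<close> degenerates, the relevant caps vanish on
  \<open>gg m\<close>, and the descent of \<open>resolve\<close> becomes an exact computation. The
  factorisation through \<open>w (m + 2)\<close> removes the summand for \<open>m\<close> from the
  later recursion.\<close>

lemma gg_in_w: assumes "cc (Suc m) = 0" shows "gg m = w (m + 2) * (xp (m + 2) 0 (Suc m) * uu (m + 2) 0)"
proof -
 let ?n = "Suc (Suc m)" and ?z = "gg m"
 let ?y = "w ?n * (xp ?n 0 (Suc m) * uu ?n 0)"
 have Az: "aa ?n 0 * (xp ?n 0 l * ?z) = 0" if "l <= m" for l using A_xp_gg[OF that] assms by auto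
 have Dz: "dsc ?n (Suc m) * (xp ?n 0 j * ?z) = w ?n * (xp ?n 0 j * uu ?n 0)" for j
  unfolding gg_def by (rule dsc_xp_Lw)
 have "d <= Suc m ==> (ALL j<=Suc m - d. dsc ?n (Suc m - d) * (xp ?n 0 j * ?z) = (if j = Suc m - d then ?y else 0))" for d
 proof (induction d)
  case 0
  show ?case unfolding minus_nat.diff_0 Dz by (auto simp: w_xp_U simp del: w.simps xp.simps)
 next
  case (Suc d)
  define e where "e = Suc m - Suc d"
  have e: "Suc m - d = Suc e" "Suc e < ?n" "e < Suc m" using Suc.prems by (auto simp: e_def)
  show ?case unfolding e_def[symmetric]
  proof (intro allI impI)
   fix j assume j: "j <= e"
   let ?v = "xp ?n 0 j * ?z"
   have T: "tt ?n i * ?v = 0" if "1 <= i" for i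
    using mult_ext[OF xp_T[of 0 i ?n j], of ?z] that by (simp add: T_gg)
   have "dsc ?n (Suc e) * (xx ?n 0 * ?v) = xx ?n (Suc e) * (dsc ?n (Suc e) * ?v) + dsc ?n e * ?v - dsc1 ?n e * (uu ?n 0 * (aa ?n 0 * ?v))"
    using dsc_X[OF lideal_0, of e ?n ?v] T e by (simp add: hm_left'[OF hm_xp] del: dsc.simps)
   moreover have "dsc ?n (Suc e) * (xx ?n 0 * ?v) = (if j = e then ?y else 0)"
    using Suc.IH Suc.prems e j by (force dest: spec[of _ "Suc j"] simp: assoc simp del: dsc.simps w.simps)
   moreover have "dsc ?n (Suc e) * ?v = 0" using Suc.IH Suc.prems e j by (force simp del: dsc.simps w.simps)
   ultimately show "dsc ?n e * ?v = (if j = e then ?y else 0)" using Az[of j] j e by (simp del: w.simps)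
  qed
 qed
 from this[of "Suc m"] show ?thesis by (simp add: hm_left[OF hm_gg] del: w.simps)
qed

end

section \<open>Bubbles and their slide across a strand\<close>

context nbt begin

definition "rb n k = pd n (lb 0 k) 0"
definition "bub n i k = pd i (lb 0 k) (n - i)"
lemma rb_comm: "hm m n y ==> rb m k * y = y * rb n k"
 using far'[where y = y and z = "lb 0 k" and i = 0 and k = 0 and l = 0, OF _ hm_lb] by (simp add: rb_def)
lemma hm_rb: "hm n n (rb n k)" using hm_pd[OF hm_lb[of 0 k], of n 0] by (simp add: rb_def)
lemma L_rb [simp]: "L (rb n k) = rb (Suc n) k" by (simp add: rb_def L_pd pd_pd)
lemma bub_rb: "bub n n k = rb n k" by (simp add: bub_def rb_def)
lemma dg_lb: "dg (2 * int k) (lb n k)"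
 using dg_mult[OF dg_A dg_mult[OF dg_xp dg_U]] unfolding lb_def by (metis add_0 add_0_right)
lemma dg_rb: "dg (2 * int k) (rb n k)" unfolding rb_def by (rule dg_pd[OF dg_lb])
lemma pd_xp: "i <= n ==> pd i (xp 2 0 k) (n - i) = xp (n + 2) i k" "i <= n ==> pd i (xp 1 0 k) (n - i) = xp (n + 1) i k"
 by (induction k) (auto simp: pd_mult X_def pd_pd Suc_diff_le)
lemma bub_alt: "i <= n ==> aa (n + 2) i * (xp (n + 2) i k * uu (n + 2) i) = bub n i k"
 unfolding bub_def lb_def pd_mult by (simp add: pd_xp[unfolded numeral_2_eq_2] numeral_2_eq_2) (simp add: A_def U_def pd_pd)

text \<open>The shape of a slid bubble: the strand with \<open>k\<close> dots, and with
  \<open>k - e\<close> dots beside a right bubble with \<open>e\<close> dots. Only this shape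
  matters later, so coefficients are not recorded.\<close>

inductive_set SR :: "nat => ('a, 'b) nb set" for k where
 SR_x: "xp 1 0 k : SR k"
| SR_r: "e <= k ==> xp 1 0 (k - e) * rb 1 e : SR k"
| SR_add: "y : SR k ==> z : SR k ==> y + z : SR k"
| SR_smul: "y : SR k ==> c *s y : SR k"
lemma SR_X: "y : SR k ==> xx 1 0 * y : SR (Suc k)"
proof (induction rule: SR.induct)
 case SR_x
 thus ?case using SR.SR_x[of "Suc k"] by simp
next
 case (SR_r e)
 thus ?case using SR.SR_r[of e "Suc k"] by (simp add: Suc_diff_le assoc)
qed (auto simp: distrib_left intro: SR.intros)
lemma SR_diff: "y : SR k ==> z : SR k ==> y - z : SR k"
 using SR_add[OF _ SR_smul[where c = "-1"], of y k z] by simp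
lemma SR_0: "0 : SR k" using SR_smul[OF SR_x, where c = 0] by simp
text \<open>\<open>Y\<close> is a strand with a cup crossing it. Capped on the left
  (\<open>Q\<close>) it produces left bubbles, on the right (\<open>Q'\<close>) right bubbles, each
  by a recursion (\<open>S2\<close>, \<open>S3\<close>). The mixed elements \<open>V\<close>
  identify an alternating sum \<open>d\<close> of the \<open>Q\<close> with one of the
  \<open>Q'\<close>; hence \<open>d\<close> obeys a recursion in right bubbles (\<open>r1\<close>)
  and also computes the left bubble (\<open>r2\<close>).\<close>

lemma bubble_slide: "lb 1 k : SR k"
proof -
 let ?x = "xx 1 0"
 define Y where "Y = tt 3 1 * uu 3 0"
 define Q where "Q b = aa 3 0 * (xp 3 0 b * Y)" for b
 define Q' where "Q' b = aa 3 1 * (xp 3 2 b * Y)" for b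
 have Y2: "Y = tt 3 0 * uu 3 1" unfolding Y_def by (simp add: TUs)
 have n3: "(3 :: nat) = Suc (Suc (Suc 0))" by simp
 have rb1: "rb 1 e = aa 3 1 * (xp 3 1 e * uu 3 1)" for e
  using bub_alt[of 1 1 e] by (simp add: bub_rb n3)
 have lb1: "lb 1 e = aa 3 0 * (xp 3 0 e * uu 3 0)" for e by (simp add: lb_def n3)
 have AU10: "aa 3 1 * uu 3 0 = ii 1" "aa 3 0 * uu 3 1 = ii 1" by (simp_all add: zig)
 have AU10': "aa 3 1 * (uu 3 0 * z) = ii 1 * z" "aa 3 0 * (uu 3 1 * z) = ii 1 * z" for z using AU10 by (simp_all add: mult_ext1)
 have U0X: "xp 3 2 b * uu 3 0 = uu 3 0 * xp 1 0 b" for b using xp_U_ge[of 0 2 3 b] by simp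
 have U1X: "xp 3 0 b * uu 3 1 = uu 3 1 * xp 1 0 b" for b using xp_U_lt[of 0 1 3 b] by simp
 have A0X: "aa 3 0 * xp 3 2 b = xp 1 0 b * aa 3 0" for b using A_xp_ge[of 0 2 3 b] by simp
 have A1X: "aa 3 1 * xp 3 0 b = xp 1 0 b * aa 3 1" for b using A_xp_lt[of 0 1 3 b] by simp
 have X2T: "xx 3 2 * tt 3 1 = tt 3 1 * xx 3 1 - ii 3 + uu 3 1 * aa 3 1"
 proof -
  have "tt 3 1 * xx 3 1 = xx 3 2 * tt 3 1 + ii 3 - uu 3 1 * aa 3 1" by (subst TXr) (simp_all add: numeral_2_eq_2)
  thus ?thesis by (simp add: algs)
 qed
 have X2TU: "xx 3 2 * (tt 3 1 * (xp 3 0 b * uu 3 0)) = - (tt 3 1 * (xp 3 0 (Suc b) * uu 3 0)) - xp 3 0 b * uu 3 0 + uu 3 1 * xp 1 0 b" for b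
 proof -
  have "xx 3 2 * (tt 3 1 * (xp 3 0 b * uu 3 0)) = (xx 3 2 * tt 3 1) * (xp 3 0 b * uu 3 0)" by (simp add: assoc)
  also have "... = tt 3 1 * (xx 3 1 * (xp 3 0 b * uu 3 0)) - xp 3 0 b * uu 3 0 + uu 3 1 * (aa 3 1 * (xp 3 0 b * uu 3 0))"
   unfolding X2T by (simp add: algs hm_left'[OF hm_xp])
  also have "xx 3 1 * (xp 3 0 b * uu 3 0) = - (xp 3 0 (Suc b) * uu 3 0)"
   using mult_ext[OF xp_XX[of 3 0 b 1], of "uu 3 0", symmetric] mult_ext[OF xp_XX[of 3 0 b 0], of "uu 3 0"] by (simp add: assoc XUs)
  also have "aa 3 1 * (xp 3 0 b * uu 3 0) = xp 1 0 b" using mult_ext[OF A1X[of b], of "uu 3 0"] by (simp add: AU10 hm_right[OF hm_xp] del: One_nat_def)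
  finally show ?thesis by simp
 qed
 have S1: "xx 3 2 * Y + xx 3 0 * Y = uu 3 1 - uu 3 0"
  using X2TU[of 0] mult_ext[OF XT[of 0 1 3], of "uu 3 0"] by (simp add: Y_def)
 have S2: "Q (Suc b) + ?x * Q b = xp 1 0 b - lb 1 b" for b
 proof -
  have "aa 3 0 * (xp 3 0 b * (xx 3 2 * Y + xx 3 0 * Y)) = ?x * Q b + Q (Suc b)"
   unfolding Q_def distrib_left using mult_ext[OF xp_XX[of 3 0 b 2], of Y] mult_ext[OF A0X[of 1], of "xp 3 0 b * Y"] mult_ext[OF xp_XX[of 3 0 b 0], of Y]
   by (simp add: assoc)
  thus ?thesis unfolding S1 right_diff_distrib U1X lb1[symmetric] AU10' by (simp add: hm_left[OF hm_xp] add.commute)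
 qed
 have S3: "Q' (Suc b) + ?x * Q' b = (-1) ^ b *s rb 1 b - xp 1 0 b" for b
 proof -
  have "aa 3 1 * (xp 3 2 b * (xx 3 2 * Y + xx 3 0 * Y)) = Q' (Suc b) + ?x * Q' b"
   unfolding Q'_def distrib_left using mult_ext[OF xp_XX[of 3 2 b 0], of Y] mult_ext[OF A1X[of 1], of "xp 3 2 b * Y"] mult_ext[OF xp_XX[of 3 2 b 2], of Y]
   by (simp add: assoc)
  moreover have "xp 3 2 b * uu 3 1 = (-1) ^ b *s (xp 3 1 b * uu 3 1)" using xp_U[of 3 1 b] by (simp add: numeral_2_eq_2)
  ultimately show ?thesis unfolding S1 right_diff_distrib U0X AU10' by (simp add: rb1[unfolded One_nat_def] hm_left[OF hm_xp])
 qed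
 have cl: "lb 1 b * ?x = ?x * lb 1 b" for b by (rule lb_comm[OF hm_X])
 have cr: "rb 1 b * ?x = ?x * rb 1 b" for b by (rule rb_comm[OF hm_X])
 have Q0: "Q 0 = 0" unfolding Q_def Y2 using mult_ext0[OF ATz[of 3 0]] by (simp add: hm_left'[OF hm_T])
 have Q'0: "Q' 0 = 0" unfolding Q'_def Y_def using mult_ext0[OF ATz[of 3 1]] by (simp add: hm_left'[OF hm_T])
 have cQ: "Q b * ?x = ?x * Q b" for b
 proof (induction b)
  case (Suc b)
  have "Q (Suc b) = xp 1 0 b - lb 1 b - ?x * Q b" using S2[of b] by (simp add: algs)
  thus ?case using Suc by (simp only: left_diff_distrib right_diff_distrib assoc cl xp_XX)
 qed (simp add: Q0)
 have cQ': "Q' b * ?x = ?x * Q' b" for b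
 proof (induction b)
  case (Suc b)
  have "Q' (Suc b) = (-1) ^ b *s rb 1 b - xp 1 0 b - ?x * Q' b" using S3[of b] by (simp add: algs)
  thus ?case using Suc by (simp only: left_diff_distrib right_diff_distrib assoc cr xp_XX smul_left smul_right)
 qed (simp add: Q'0)
 have cQx: "Q b * xp 1 0 j = xp 1 0 j * Q b" "Q' b * xp 1 0 j = xp 1 0 j * Q' b" for b j
 proof -
  have h: "hm 1 1 (Q b)" "hm 1 1 (Q' b)" unfolding Q_def Q'_def Y_def
   using hm_mult[OF hm_A hm_mult[OF hm_xp hm_mult[OF hm_T hm_U]], of 3] by (simp_all)
  show "Q b * xp 1 0 j = xp 1 0 j * Q b" "Q' b * xp 1 0 j = xp 1 0 j * Q' b"
   by (rule xp_comm; use h cQ cQ' in "simp add: hm_left hm_right del: One_nat_def")+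
 qed
 define V where "V j b = aa 3 0 * (xp 3 0 b * (tt 3 1 * (xp 3 2 j * Y)))" for j b
 have fk: "aa 3 0 * (tt 3 1 * z) = aa 3 1 * (tt 3 0 * z)" for z by (rule mult_ext) (simp add: fork)
 have sw: "tt 3 0 * (xp 3 2 j * z) = xp 3 2 j * (tt 3 0 * z)" for j z by (rule mult_ext) (simp add: xp_T)
 have V0: "V j 0 = 0" for j
 proof -
  have "V j 0 = aa 3 1 * (tt 3 0 * (xp 3 2 j * (tt 3 0 * uu 3 1)))"
   unfolding V_def Y2 by (simp add: fk hm_left'[OF hm_xp] del: One_nat_def)
  thus ?thesis by (simp add: sw mult_ext0 del: One_nat_def)
 qed
 have V0': "V 0 b = 0" for b unfolding V_def Y_def by (simp add: mult_ext0 hm_left'[OF hm_T])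
 have VV: "V (Suc j) b + V j (Suc b) = xp 1 0 b * Q' j - xp 1 0 j * Q b" for j b
 proof -
  have c: "xp 3 0 b * (tt 3 1 * z) = tt 3 1 * (xp 3 0 b * z)" "xp 3 0 b * (xp 3 2 j * z) = xp 3 2 j * (xp 3 0 b * z)" for b j z
   using mult_ext[OF xp_T[of 0 1 3 b]] mult_ext[OF xp_xp[of 3 0 b 2 j]] by auto
  have "V (Suc j) b = aa 3 0 * (tt 3 1 * (xp 3 2 j * (xx 3 2 * (tt 3 1 * (xp 3 0 b * uu 3 0)))))"
   unfolding V_def Y_def xp_Suc2 c assoc using c xp_XX[of 3 0 b 2] by (simp add: mult_ext[of "xp 3 0 b" "xx 3 2"])
  also have "... = - V j (Suc b) - aa 3 0 * (tt 3 1 * (xp 3 2 j * (xp 3 0 b * uu 3 0))) + aa 3 0 * (tt 3 1 * (xp 3 2 j * (uu 3 1 * xp 1 0 b)))"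
   unfolding X2TU right_diff_distrib distrib_left V_def Y_def c by simp
  also have "aa 3 0 * (tt 3 1 * (xp 3 2 j * (xp 3 0 b * uu 3 0))) = Q b * xp 1 0 j"
   unfolding Q_def Y_def c using mult_ext[OF xp_xp[of 3 2 j 0 b], of "uu 3 0"] by (simp add: U0X assoc)
  also have "aa 3 0 * (tt 3 1 * (xp 3 2 j * (uu 3 1 * xp 1 0 b))) = Q' j * xp 1 0 b"
   unfolding Q'_def Y2 fk sw by (simp only: assoc)
  finally show ?thesis by (simp add: cQx del: One_nat_def)
 qed
 define d where "d N = (SUM b<N. (-1) ^ b *s (xp 1 0 (N - 1 - b) * Q b))" for N
 define a where "a N = (SUM b<N. (-1) ^ b *s (xp 1 0 b * Q' (N - 1 - b)))" for N
 \<comment> \<open>Along an antidiagonal the alternating sum of \<open>VV\<close> telescopes, and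
   \<open>V\<close> vanishes at both ends.\<close>
 have ad: "a N = d N" for N
 proof (cases N)
  case (Suc M)
  have "(SUM b<=M. (-1) ^ b *s (V (Suc (M - b)) b + V (M - b) (Suc b))) = 0"
  proof -
   have "(SUM b<=m. (-1) ^ b *s (V (Suc (M - b)) b + V (M - b) (Suc b))) = (-1) ^ m *s V (M - m) (Suc m)" if "m <= M" for m
    using that by (induction m) (auto simp: V0 Suc_diff_Suc smul_add)
   from this[of M] show ?thesis by (simp add: V0')
  qed
  thus ?thesis by (simp add: smul_diff VV sum_subtractf lessThan_Suc_atMost a_def d_def Suc)
 qed (simp add: a_def d_def)
 have dS: "d (Suc N) = (-1) ^ N *s Q N + ?x * d N" for N
 proof -
  have "?x * d N = (SUM b<N. (-1) ^ b *s (xp 1 0 (N - b) * Q b))"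
   unfolding d_def sum_distrib_left
  proof (rule sum.cong[OF refl])
   fix b assume "b : {..<N}"
   hence e: "N - b = Suc (N - 1 - b)" by auto
   show "?x * ((-1) ^ b *s (xp 1 0 (N - 1 - b) * Q b)) = (-1) ^ b *s (xp 1 0 (N - b) * Q b)"
    by (simp only: e xp.simps assoc smul_right)
  qed
  thus ?thesis by (simp add: d_def hm_left add.commute) (simp add: Q_def flip: assoc)
 qed
 have aS: "a (Suc N) = Q' N - ?x * a N" for N
 proof -
  have "?x * a N = (SUM b<N. (-1) ^ b *s (xp 1 0 (Suc b) * Q' (N - Suc b)))"
   unfolding a_def sum_distrib_left by (rule sum.cong) (auto simp: assoc)
  moreover have "ii 1 * Q' N = Q' N" unfolding Q'_def by simp
  ultimately show ?thesis unfolding a_def by (subst sum.lessThan_Suc_shift) (simp add: sum_negf del: xp.simps(2))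
 qed
 have r1: "d (Suc (Suc N)) = (-1) ^ N *s rb 1 N - xp 1 0 N - 2 *s (?x * d (Suc N)) - ?x * (?x * d N)" for N
 proof -
  have "d (Suc (Suc N)) = Q' (Suc N) - ?x * d (Suc N)" using aS[of "Suc N"] by (simp add: ad)
  moreover have "?x * d (Suc N) = ?x * Q' N - ?x * (?x * d N)" using aS[of N] by (simp add: ad right_diff_distrib)
  moreover have two: "(2::'a) *s y = y + y" for y :: "('a, 'b) nb" using smul_add_left[of 1 1 y] by simp
  moreover have "a1 = r - p - (u + u) - w" if "a1 = q1 - u" "u = v - w" "q1 + v = r - p" for a1 r p u w q1 v :: "('a, 'b) nb"
  proof -
   have 1: "v = u + w" and 2: "q1 = r - p - v" using that by (simp_all add: algs)
   show ?thesis unfolding that(1) 2 1 by (simp add: algs)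
  qed
  ultimately show ?thesis using S3[of N] unfolding two by blast
 qed
 have r2: "lb 1 N = xp 1 0 N + (-1) ^ N *s (d (Suc (Suc N)) - 2 *s (?x * d (Suc N)) + ?x * (?x * d N))" for N
 proof -
  have e: "d (Suc (Suc N)) - ?x * d (Suc N) = (-1) ^ Suc N *s Q (Suc N)" "?x * d (Suc N) - ?x * (?x * d N) = (-1) ^ N *s (?x * Q N)"
   using dS[of "Suc N"] dS[of N] by (simp_all add: algs)
  have "(2::'a) *s y = y + y" for y :: "('a, 'b) nb" using smul_add_left[of 1 1 y] by simp
  hence "d (Suc (Suc N)) - 2 *s (?x * d (Suc N)) + ?x * (?x * d N) = (d (Suc (Suc N)) - ?x * d (Suc N)) - (?x * d (Suc N) - ?x * (?x * d N))"
   by (simp add: algs)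
  also have "... = - ((-1) ^ N *s (Q (Suc N) + ?x * Q N))" unfolding e by (simp add: smul_add)
  finally show ?thesis unfolding S2 by (simp add: smul_diff flip: power_mult_distrib)
 qed
 \<comment> \<open>\<open>d N\<close> has the degree of \<open>N - 2\<close> dots, so the recursion
   starts from two zeros and the index drops by two.\<close>
 have dSR: "d N = 0 & N = 0 | (EX M. N = Suc M & (d N = 0 & M = 0 | (EX K. M = Suc K & d N : SR K)))" for N
 proof (induction N rule: less_induct)
  case (less N)
  consider "N = 0" | "N = 1" | K where "N = Suc (Suc K)" by (metis One_nat_def not0_implies_Suc)
  thus ?case
  proof cases
   case 1 thus ?thesis by (simp add: d_def)
  next
   case 2 thus ?thesis using dS[of 0] by (simp add: Q0 d_def)
  next
   case 3
   have 1: "?x * d (Suc K) : SR K"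
    using less.IH[of "Suc K"] 3 SR_X SR_0 by (cases K) (auto simp del: One_nat_def)
   have "?x * (?x * d K) : SR K"
    using less.IH[of K] 3 SR_X[OF SR_X] SR_0 by (cases K; cases "K - 1") (auto simp del: One_nat_def)
   moreover have "rb 1 K : SR K" using SR_r[of K K] by (simp add: hm_left[OF hm_rb] del: One_nat_def)
   ultimately have "d N : SR K" unfolding 3 r1 using 1 by (intro SR_diff SR_smul SR_x)
   thus ?thesis using 3 by simp
  qed
 qed
 have 1: "d (Suc (Suc k)) : SR k" using dSR[of "Suc (Suc k)"] by auto
 have 2: "?x * d (Suc k) : SR k" using dSR[of "Suc k"] SR_X SR_0 by (cases k) (auto simp del: One_nat_def)
 have 3: "?x * (?x * d k) : SR k" using dSR[of k] SR_X[OF SR_X] SR_0 by (cases k; cases "k - 1") (auto simp del: One_nat_def)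
 show ?thesis unfolding r2[of k] using 1 2 3 by (intro SR_add SR_diff SR_smul SR_x)
qed

end

section \<open>Spanning by words without caps\<close>

datatype letter = LX nat | LT nat | LB nat

text \<open>The number of crossings is the measure for the elimination of caps: a dot passing a
  crossing leaves errors with fewer crossings.\<close>

fun nT :: "letter list => nat" where
 "nT [] = 0" | "nT (LT _ # ls) = Suc (nT ls)" | "nT (LX _ # ls) = nT ls" | "nT (LB _ # ls) = nT ls"
lemma nT_append [simp]: "nT (l1 @ l2) = nT l1 + nT l2"
 by (induction l1 rule: nT.induct) auto
lemma nT_replicate [simp]: "nT (replicate a (LX i)) = 0" by (induction a) auto

context nbt begin

inductive_set low :: "nat => ('a, 'b) nb set" for n where
 low_0: "0 : low n"
| low_step: "v : low n ==> m < n ==> y * (ii m * z) + v : low n"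
lemma low_gen: "m < n ==> y * (ii m * z) : low n" using low_step[OF low_0, of m n y z] by simp
lemma low_add: "v : low n ==> v' : low n ==> v + v' : low n"
 by (induction rule: low.induct) (auto simp: add.assoc intro: low.intros)
lemma low_left: "v : low n ==> u * v : low n"
 by (induction rule: low.induct) (auto simp: distrib_left low_0 intro: low_add low_gen simp flip: assoc[of u])
lemma low_right: "v : low n ==> v * u : low n"
 by (induction rule: low.induct) (auto simp: distrib_right low_0 assoc intro: low_add low_gen)
lemma low_smul: "v : low n ==> c *s v : low n"
proof (induction rule: low.induct)
 case (low_step v m y z)
 thus ?case using low_gen[of m n "c *s y" z] by (simp add: smul_add low_add)
qed (simp add: low_0)
lemma lideal_low: "lideal (low n)" unfolding lideal_def by (auto intro: low_0 low_add low_smul low_left)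
lemma low_hm: "m < n ==> hm m p z ==> y * z : low n" using low_gen[of m n y z] by (simp add: hm_left)
lemma low_hm': "m < n ==> hm m p z ==> z : low n" using low_gen[of m n "ii m" z] by (simp add: hm_left)
lemma low_hm_right: "m < n ==> hm p m z ==> z : low n" using low_gen[of m n z "ii m"] by (simp add: hm_right)
lemma L_low: "v : low n ==> L v : low (Suc n)"
 by (induction rule: low.induct) (auto intro: low.intros)
primrec lv :: "nat => letter => ('a, 'b) nb" where
 "lv m (LX i) = X m i" | "lv m (LT i) = T m i" | "lv m (LB k) = rb m k"
primrec wd :: "nat => letter list => ('a, 'b) nb" where
 "wd m [] = I m" | "wd m (a # ls) = lv m a * wd m ls"
lemma hm_lv: "hm m m (lv m a)" by (cases a) (auto intro: hm_X hm_T hm_rb)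
lemma hm_wd: "hm m m (wd m ls)" by (induction ls) (auto intro: hm_mult hm_lv)
lemma wd_append: "wd m (l1 @ l2) = wd m l1 * wd m l2"
 by (induction l1) (auto simp: assoc hm_left[OF hm_wd])
lemma wd_xp: "wd m (replicate a (LX i)) = xp m i a" by (induction a) auto

text \<open>\<open>Wp n u m\<close>: combinations of words in dots, crossings, cups and right bubbles from \<open>n\<close> to \<open>m\<close> strands
 with at most \<open>u\<close> cups, up to morphisms that factor through fewer than \<open>n\<close> strands.\<close>

inductive Wp :: "nat => nat => nat => ('a, 'b) nb => bool" for n where
 Wp_low: "v : low n ==> hm m n v ==> Wp n u m v"
| Wp_I: "Wp n u n (ii n)"
| Wp_add: "Wp n u m y ==> Wp n u m z ==> Wp n u m (y + z)"
| Wp_smul: "Wp n u m y ==> Wp n u m (c *s y)"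
| Wp_lv: "Wp n u m y ==> Wp n u m (lv m a * y)"
| Wp_U: "Wp n u m y ==> Wp n (Suc u) (Suc (Suc m)) (uu (Suc (Suc m)) i * y)"
lemma Wp_hm: "Wp n u m y ==> hm m n y"
proof (induction rule: Wp.induct)
 case (Wp_U u m y i)
 thus ?case using hm_mult[OF hm_U, of "Suc (Suc m)"] by simp
qed (auto intro: hm_add hm_smul hm_mult hm_lv)
lemma Wp_Suc: "Wp n u m y ==> Wp n (Suc u) m y"
 by (induction rule: Wp.induct) (auto intro: Wp.intros)
lemma Wp_wd: "Wp n u m y ==> Wp n u m (wd m ls * y)"
proof (induction ls)
 case Nil thus ?case using Wp_hm[OF Nil] by (simp add: hm_left)
qed (auto simp: assoc intro: Wp_lv)
lemma Wp_X: "Wp n u m y ==> Wp n u m (xx m i * y)" and Wp_T: "Wp n u m y ==> Wp n u m (tt m i * y)"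
 and Wp_rb: "Wp n u m y ==> Wp n u m (rb m i * y)"
 using Wp_lv[of n u m y "LX i"] Wp_lv[of n u m y "LT i"] Wp_lv[of n u m y "LB i"] by simp_all
lemma Wp_0: "Wp n u m 0" by (rule Wp_low) (auto intro: low_0)
lemma Wp_diff: "Wp n u m y ==> Wp n u m z ==> Wp n u m (y - z)"
 using Wp_add[of n u m y "(-1) *s z"] Wp_smul[of n u m z "-1"] by simp
lemma Wp_U': "Wp n u (m - 2) y ==> Wp n (Suc u) m (uu m i * y)"
proof (cases "1 < m")
 case True
 hence "Suc (Suc (m - 2)) = m" by arith
 thus "Wp n u (m - 2) y ==> ?thesis" using Wp_U[of n u "m - 2" y i] by simp
next
 case False
 thus ?thesis using Wp_0 by (simp add: U_def)
qed
lemma Wp_xp: "Wp n u m y ==> Wp n u m (xp m i a * y)" using Wp_wd[of n u m y "replicate a (LX i)"] by (simp add: wd_xp)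
text \<open>Repeated use of \<open>bubble_slide\<close> pushes a bubble to the right edge, where
  bubbles are letters of the words.\<close>

lemma Wp_bub: "i <= m ==> Wp n u m y ==> Wp n u m (bub m i k * y)"
proof (induction "m - i" arbitrary: i k)
 case 0
 thus ?case by (simp add: bub_rb Wp_rb)
next
 case (Suc d)
 have i: "i < m" "d = m - Suc i" "Suc (m - Suc i) = m - i" using Suc by auto
 have "Wp n u m (pd i z (m - Suc i) * y)" if "z : SR k" for z using that
 proof (induction rule: SR.induct)
  case SR_x
  thus ?case using pd_xp(2)[of i "m - 1" k] i Wp_xp[OF Suc.prems(2)] by simp
 next
  case (SR_r e)
  have "pd i (rb 1 e) (m - Suc i) = bub m (Suc i) e" by (simp add: rb_def bub_def pd_pd)
  moreover have "pd i (xp 1 0 (k - e)) (m - Suc i) = xp m i (k - e)" using pd_xp(2)[of i "m - 1" "k - e"] i by simp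
  ultimately show ?case using Suc.hyps(1)[OF i(2)] Suc.prems(2) i Wp_xp by (simp add: pd_mult assoc del: One_nat_def)
 qed (auto simp: pd_add distrib_right intro: Wp_add Wp_smul)
 from this[OF bubble_slide] have "Wp n u m (pd i (lb 1 k) (m - Suc i) * y)" .
 moreover have "lb 1 k = pd 0 (lb 0 k) 1"
  using lb_def unfolding lb_def pd_mult by (simp add: pd_xp[of 0 1, simplified numeral_2_eq_2, simplified] numeral_2_eq_2) (simp add: A_def U_def pd_pd)
 hence "pd i (lb 1 k) (m - Suc i) = bub m i k" using i by (simp add: pd_pd bub_def)
 ultimately show ?case by simp
qed

text \<open>The train \<open>T_(i+1) ... T_(i+l)\<close> along which the right leg of a cap at
  \<open>i\<close> travels across \<open>l\<close> strands.\<close>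

primrec tr :: "nat => nat => nat => ('a, 'b) nb" where
 "tr m i 0 = I m" | "tr m i (Suc l) = tr m i l * T m (i + Suc l)"
lemma hm_tr: "hm m m (tr m i l)" by (induction l) (auto intro: hm_mult hm_T)
lemma tr_wd: "EX ls. nT ls = l & tr m i l = wd m ls"
proof (induction l)
 case 0 show ?case by (rule exI[of _ "[]"]) simp
next
 case (Suc l)
 then obtain ls where "nT ls = l" "tr m i l = wd m ls" by blast
 thus ?case by (intro exI[of _ "ls @ [LT (i + Suc l)]"]) (simp add: wd_append hm_right[OF hm_T])
qed
lemma T_tr: "p < i | i + l + 1 < p ==> tr m i l * tt m p = tt m p * tr m i l"
proof (induction l)
 case (Suc l)
 have a: "tt m (i + Suc l) * tt m p = tt m p * tt m (i + Suc l)" by (rule TT) (use Suc.prems in auto)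
 have b: "tr m i l * tt m p = tt m p * tr m i l" using Suc by auto
 show ?case unfolding tr.simps assoc a unfolding assoc[symmetric] b ..
qed simp
lemma tr_first: "tr m i (Suc l) = tt m (Suc i) * tr m (Suc i) l"
 by (induction l) (simp_all add: assoc[symmetric])
lemma tr_T_mid: "i + 1 <= p ==> p < i + l ==> tr m i l * tt m p = tt m (Suc p) * tr m i l"
proof (induction l)
 case (Suc l)
 show ?case
 proof (cases "p = i + l")
  case True
  then obtain l' where l: "l = Suc l'" using Suc.prems by (cases l) auto
  have "tr m i (Suc l) * tt m p = tr m i l' * (tt m p * (tt m (Suc p) * tt m p))" by (simp add: l True assoc)
  also have "... = tr m i l' * (tt m (Suc p) * (tt m p * tt m (Suc p)))" by (simp add: braid)
  also have "... = tt m (Suc p) * tr m i (Suc l)" using T_tr[of "Suc p" i l' m] True l by (simp add: assoc[symmetric])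
  finally show ?thesis .
 next
  case False
  have a: "tt m (i + Suc l) * tt m p = tt m p * tt m (i + Suc l)" by (rule TT) (use Suc.prems False in auto)
  have b: "tr m i l * tt m p = tt m (Suc p) * tr m i l" using Suc False by auto
  show ?thesis unfolding tr.simps assoc a unfolding assoc[symmetric] b ..
 qed
qed simp
lemma tr_T_last: "0 < l ==> tr m i l * tt m (i + l) = 0" by (cases l) (simp_all add: assoc)
lemma A_rb: "aa m i * rb m k = rb (m - 2) k * aa m i" using rb_comm[OF hm_A] by simp
lemma TX_gen: "EX r' c. tt m p * xx m r = xx m r' * tt m p + c *s (ii m - uu m p * aa m p)"
proof -
 consider "r < p | Suc p < r" | "~ Suc p < m" | "r = p" "Suc p < m" | "r = Suc p" "Suc p < m" by force
 thus ?thesis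
 proof cases
  case 1 thus ?thesis by (intro exI[of _ r] exI[of _ 0]) (auto simp: XT[of r p m])
 next
  case 2 thus ?thesis by (intro exI[of _ r] exI[of _ 0]) (simp add: T_def)
 next
  case 3 thus ?thesis by (intro exI[of _ "Suc p"] exI[of _ 1]) (simp add: TXr)
 next
  case 4 thus ?thesis by (intro exI[of _ p] exI[of _ "-1"]) (simp add: XTr)
 qed
qed

text \<open>The induction runs over the number of cups. Caps are assumed to be absorbed by elements
  with \<open>u\<close> cups; for one more cup, the cap has to be moved through a word until it
  meets that cup.\<close>

context
 fixes n u :: nat
 assumes C1: "!!m i y. Wp n u m y ==> Wp n u (m - 2) (aa m i * y)"
  and CU: "!!m i j y. Wp n u m y ==> Wp n u m (uu m j * (aa m i * y))"
begin

definition Gd :: "nat => nat => ('a, 'b) nb => bool" where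
 "Gd m i d \<longleftrightarrow> (ALL j y. Wp n u (m - 2) y --> Wp n u (m - 2) (aa m i * (d * (uu m j * y))))"
lemma Gd_add: "Gd m i d ==> Gd m i d' ==> Gd m i (d + d')" unfolding Gd_def by (auto simp: distrib_left distrib_right intro: Wp_add)
lemma Gd_diff: "Gd m i d ==> Gd m i d' ==> Gd m i (d - d')" unfolding Gd_def by (auto simp: left_diff_distrib right_diff_distrib intro: Wp_diff)
lemma Gd_smul: "Gd m i d ==> Gd m i (c *s d)" unfolding Gd_def by (auto intro: Wp_smul)
lemma Gd_0: "Gd m i 0" unfolding Gd_def by (auto intro: Wp_0)

context
 fixes k :: nat
 assumes IH: "!!ls m i. nT ls < k ==> Gd m i (wd m ls)"
begin
text \<open>The error of a dot slide is an identity, which joins the two words, minus a cup-cap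
  pair, which splits the sandwich into two shorter ones. All resulting words have fewer than
  \<open>k\<close> crossings.\<close>

lemma lowG:
 assumes "nT l1 + nT l2 < k" shows "Gd m i (wd m l1 * ((ii m - uu m p * aa m p) * wd m l2))"
proof -
 have 1: "Gd m i (wd m l1 * wd m l2)" using IH[of "l1 @ l2"] assms by (simp add: wd_append)
 have 2: "Gd m i (wd m l1 * (uu m p * (aa m p * wd m l2)))" unfolding Gd_def
 using allI impI IH[of l2 m p] assms IH[of l1 m i] by (simp add: Gd_def assoc)
 show ?thesis using Gd_diff[OF 1 2] by (simp add: left_diff_distrib right_diff_distrib assoc hm_left[OF hm_wd])
qed
lemma tr_X:
 assumes "nT l1 + l + nT l2 <= k"
 shows "EX r'. Gd m i (wd m l1 * (xx m r' * (tr m i' l * wd m l2))) --> Gd m i (wd m l1 * (tr m i' l * (xx m r * wd m l2)))"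
 using assms
proof (induction l arbitrary: l2 r)
 case 0
 show ?case by (rule exI[of _ r]) (simp add: hm_left[OF hm_wd])
next
 case (Suc l)
 let ?p = "i' + Suc l"
 obtain r1 c where r1: "tt m ?p * xx m r = xx m r1 * tt m ?p + c *s (ii m - uu m ?p * aa m ?p)" using TX_gen by blast
 obtain r' where r': "Gd m i (wd m l1 * (xx m r' * (tr m i' l * wd m (LT ?p # l2)))) --> Gd m i (wd m l1 * (tr m i' l * (xx m r1 * wd m (LT ?p # l2))))"
  using Suc.IH[of "LT ?p # l2" r1] Suc.prems by auto
 obtain lt where lt: "nT lt = l" "tr m i' l = wd m lt" using tr_wd by blast
 let ?A = "(wd m (l1 @ lt) * ((ii m - uu m ?p * aa m ?p) * wd m l2))"
 have g: "Gd m i ?A" using Suc.prems lt by (intro lowG) simp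
 have "wd m l1 * (tr m i' (Suc l) * (xx m r * wd m l2)) = wd m l1 * (tr m i' l * ((tt m ?p * xx m r) * wd m l2))" by (simp add: assoc)
 also have "... = wd m l1 * (tr m i' l * (xx m r1 * wd m (LT ?p # l2))) + c *s ?A"
  unfolding r1 lt wd_append by (simp add: distrib_left distrib_right assoc)
 finally show ?case using r' g by (intro exI[of _ r']) (auto simp: assoc intro!: Gd_add Gd_smul)
qed
lemma xp_T_swap:
 assumes "nT l1 + nT l2 < k" "tt m p * xx m r' = xx m r * tt m p + c *s (ii m - uu m p * aa m p)"
  and "Gd m i (wd m l1 * (tt m p * (xp m r' a * wd m l2)))"
 shows "Gd m i (wd m l1 * (xp m r a * (tt m p * wd m l2)))"
 using assms(1,3)
proof (induction a arbitrary: l2)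
 case 0
 thus ?case by (simp add: hm_left[OF hm_wd])
next
 case (Suc a)
 have e: "xx m r * tt m p = tt m p * xx m r' - c *s (ii m - uu m p * aa m p)" using assms(2) by simp
 have "Gd m i (wd m l1 * (tt m p * (xp m r' a * wd m (LX r' # l2))))"
  using Suc.prems mult_ext[OF xp_XX[of m r' a r'], of "wd m l2"] by (simp add: assoc)
 from Suc.IH[OF _ this] have 1: "Gd m i (wd m l1 * (xp m r a * (tt m p * wd m (LX r' # l2))))" using Suc.prems by simp
 let ?A = "(wd m (l1 @ replicate a (LX r)) * ((ii m - uu m p * aa m p) * wd m l2))"
 have 2: "Gd m i ?A" using Suc.prems by (intro lowG) simp
 have "wd m l1 * (xp m r (Suc a) * (tt m p * wd m l2)) = wd m l1 * (xp m r a * ((xx m r * tt m p) * wd m l2))"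
  by (simp only: xp_Suc2 assoc)
 also have "... = wd m l1 * (xp m r a * (tt m p * wd m (LX r' # l2))) - c *s ?A"
  unfolding e wd_append wd_xp by (simp add: right_diff_distrib left_diff_distrib assoc)
 finally show ?case using 1 2 by (auto intro!: Gd_diff Gd_smul)
qed
lemma Gd_lv:
 assumes "Gd m i d"
 shows "r < i | Suc i < r ==> Gd m i (xx m r * d)" "Suc p < i | Suc i < p ==> Gd m i (tt m p * d)" "Gd m i (rb m e * d)"
proof -
 show "Gd m i (xx m r * d)" if "r < i | Suc i < r"
 proof -
  have "aa m i * (xx m r * z) = xx (m - 2) (if r < i then r else r - 2) * (aa m i * z)" for z
   by (rule mult_ext) (use that in "auto simp: AX_lt AX_ge")
  thus ?thesis using assms unfolding Gd_def by (auto simp: assoc intro: Wp_X)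
 qed
 show "Gd m i (tt m p * d)" if "Suc p < i | Suc i < p"
 proof -
  have "aa m i * (tt m p * z) = tt (m - 2) (if Suc p < i then p else p - 2) * (aa m i * z)" for z
   by (rule mult_ext) (use that in "auto simp: AT_lt AT_ge")
  thus ?thesis using assms unfolding Gd_def by (auto simp: assoc intro: Wp_T)
 qed
 show "Gd m i (rb m e * d)"
  using assms mult_ext[OF A_rb[of m i e]] unfolding Gd_def by (auto simp: assoc intro: Wp_rb)
qed
lemma Gd_AT: "Gd m i (tt m i * d)" "Gd m i (tt m (Suc i) * (tt m i * d))"
proof -
 show "Gd m i (tt m i * d)" unfolding Gd_def by (simp add: assoc mult_ext0 Wp_0)
 have "aa m i * (tt m (Suc i) * (tt m i * z)) = 0" for z
  using mult_ext[OF fork[of m i], of "tt m i * z"] by (simp add: mult_ext0)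
 thus "Gd m i (tt m (Suc i) * (tt m i * d))" unfolding Gd_def by (simp add: assoc Wp_0)
qed
lemma Gd_Ti:
 "nT ls < k ==> Gd m i (xp m i a * (tt m i * wd m ls))"
 "Suc (nT ls) < k ==> Gd m i (xp m i a * (tt m (Suc i) * (tt m i * wd m ls)))"
proof -
 have e: "tt m i * xx m (Suc i) = xx m i * tt m i + (if Suc i < m then - 1 else 0) *s (ii m - uu m i * aa m i)"
  by (cases "Suc i < m") (simp add: XTr, simp add: T_def)
 show "Gd m i (xp m i a * (tt m i * wd m ls))" if "nT ls < k"
  using xp_T_swap[of "[]" ls m i "Suc i" i _ i a, OF _ e] that Gd_AT(1)[of m i] by (simp add: hm_left'[OF hm_xp] hm_left'[OF hm_T])
 show "Gd m i (xp m i a * (tt m (Suc i) * (tt m i * wd m ls)))" if "Suc (nT ls) < k"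
  using xp_T_swap[of "[LT (Suc i)]" ls m i "Suc i" i _ i a, OF _ e] that Gd_AT(2)[of m i] mult_ext[OF xp_T[of i "Suc i" m a]]
  by (simp add: assoc hm_left'[OF hm_xp] hm_left'[OF hm_T])
qed
text \<open>The end of the journey, where the cap meets the cup: they are disjoint, close to a
  bubble, or form a zigzag.\<close>

lemma base0: "Wp n u (m - 2) y ==> Wp n u (m - 2) (aa m i * (xp m i a * (uu m j * y)))"
proof -
 assume y: "Wp n u (m - 2) y"
 consider "~ Suc i < m" | "~ Suc j < m" | "j + 2 <= i" | "i + 2 <= j" | "j = i" "Suc i < m" | "j = Suc i" "Suc j < m" | "i = Suc j" "Suc i < m"
  by linarith
 thus ?thesis
 proof cases
  case 1 thus ?thesis by (simp add: A_def Wp_0)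
 next
  case 2 thus ?thesis by (simp add: U_def Wp_0)
 next
  case 3
  show ?thesis by (metis mult_ext[OF xp_U_ge[OF 3, of m a], of y] mult_ext[OF AU_ge[where 'a='a and 'b='b, OF 3, of m]] CU[OF Wp_xp[OF y]])
 next
  case 4
  show ?thesis using mult_ext[OF xp_U_lt[of i j m a], of y] mult_ext[OF AU_le[where 'a='a and 'b='b, OF 4, of m]] 4 CU[OF Wp_xp[OF y]] by simp
 next
  case 5
  have "Suc (Suc (m - 2)) = m" "i <= m - 2" using 5 by auto
  thus ?thesis using Wp_bub[OF _ y, of i a] bub_alt[of i "m - 2" a] 5 by (simp flip: assoc)
 next
  case 6
  show ?thesis using mult_ext[OF xp_U_lt[of i j m a], of y] 6 Wp_xp[OF y] by (simp add: zig' hm_left'[OF hm_xp])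
 next
  case 7
  have "aa m i * (xp m i a * (uu m j * y)) = (-1) ^ a *s (aa m i * ((xp m j a * uu m j) * y))"
   using xp_U[of m j a] 7 by (simp flip: assoc[of _ _ y])
  also have "... = (-1) ^ a *s (xp (m - 2) j a * (ii (m - 2) * y))"
   using mult_ext[OF A_xp_lt[of j i m a], of "uu m j * y"] 7 by (simp add: zig' assoc)
  finally show ?thesis using Wp_xp[OF y, of j a] by (simp add: Wp_smul hm_right'[OF hm_xp])
 qed
qed
lemma base: "l <= k ==> Wp n u (m - 2) y ==> Wp n u (m - 2) (aa m i * (xp m i a * (tr m i l * (uu m j * y))))"
proof (induction l arbitrary: j y)
 case 0
 thus ?case using base0 by simp
next
 case (Suc l)
 define p where "p = i + Suc l"
 have tr: "tr m i (Suc l) * (uu m j * y) = tr m i l * (tt m p * (uu m j * y))" by (simp add: p_def assoc)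
 let ?A = "(xp m i a * (tr m i l * (tt m p * (uu m j * y))))"
 let ?G = "Wp n u (m - 2) (aa m i * ?A)"
 consider "p + 2 <= j" | "j + 2 <= p" | "j = p" | "j = Suc p" | "p = Suc j" by linarith
 thus ?case unfolding tr
 proof cases
  case 1
  thus ?G
   using Suc.IH[of "tt (m - 2) p * y" j] Suc.prems Wp_T mult_ext[OF TU_lt[of p j m], of y] by simp
 next
  case 2
  thus ?G
   using Suc.IH[of "tt (m - 2) (p - 2) * y" j] Suc.prems Wp_T mult_ext[OF TU_ge[of j p m], of y] by simp
 next
  case 3
  thus ?G using mult_ext0[OF TUz[of m p], of y] by (simp add: Wp_0)
 next
  case 4
  have "aa m i * ?A = aa m i * (xp m i a * (tr m i l * (tt m (Suc p) * (uu m p * y))))"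
   using mult_ext[OF TUs[of m p], of y] 4 by simp
  also have "... = tt (m - 2) (Suc p - 2) * (aa m i * (xp m i a * (tr m i l * (uu m p * y))))"
   using mult_ext[OF T_tr[of "Suc p" i l m]] mult_ext[OF xp_T[of i "Suc p" m a]] mult_ext[OF AT_ge[where 'a='a and 'b='b, of i "Suc p" m]] by (simp add: p_def)
  finally show ?G using Suc by (simp add: Wp_T)
 next
  case 5
  have e: "tt m p * (uu m j * y) = tt m j * (uu m (Suc j) * y)" using mult_ext[OF TUs[of m j], of y] 5 by simp
  show ?G
  proof (cases "l = 0")
   case True
   hence "j = i" using 5 by (simp add: p_def)
   thus ?thesis unfolding e using Gd_Ti(1)[of "[]" m i a] True Suc.prems
    by (simp add: Gd_def assoc hm_right[OF hm_T])
  next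
   case False
   hence "tr m i l * tt m j = 0" using tr_T_last[of l m i] 5 by (simp add: p_def)
   thus ?thesis unfolding e by (simp add: mult_ext0 Wp_0)
  qed
 qed
qed
text \<open>The word is read from the cap downwards, behind a prefix in standard form:
  \<open>a\<close> dots on the left leg of the cap and a train of \<open>l\<close> crossings on its
  right leg. Each letter either passes out through the cap, or enters the prefix, or makes the term
  vanish, up to errors with fewer crossings. Crossings of the prefix count in the measure.\<close>

lemma C_claim: "l + nT ls <= k ==> Gd m i (xp m i a * (tr m i l * wd m ls))"
proof (induction ls arbitrary: i l a)
 case Nil
 thus ?case using base[of l m] unfolding Gd_def by (simp add: assoc hm_right[OF hm_tr])
next
 case (Cons x ls)
 obtain lt where lt: "nT lt = l" "tr m i l = wd m lt" using tr_wd by blast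
 show ?case
 proof (cases x)
  case (LB e)
  show ?thesis using LB mult_ext[OF rb_comm[OF hm_tr, symmetric]] mult_ext[OF rb_comm[OF hm_xp, symmetric]] Cons Gd_lv(3) by simp
 next
  case (LX r)
  obtain r' where r': "Gd m i (xp m i a * (xx m r' * (tr m i l * wd m ls))) --> Gd m i (xp m i a * (tr m i l * (xx m r * wd m ls)))"
   using tr_X[of "replicate a (LX i)" l ls m i i r] Cons.prems LX by (auto simp: wd_xp)
  have 1: "Gd m i (xp m i b * (tr m i l * wd m ls))" for b using Cons LX by simp
  have c: "xp m i a * (xx m r' * z) = xx m r' * (xp m i a * z)" for z using mult_ext[OF xp_XX] .
  consider "r' = i" | "r' = Suc i" | "r' < i | Suc i < r'" by linarith
  hence "Gd m i (xp m i a * (xx m r' * (tr m i l * wd m ls)))"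
  proof cases
   case 1
   thus ?thesis using \<open>!!b. Gd m i (xp m i b * _)\<close>[of "Suc a"] c by (simp add: assoc)
  next
   case 2
   have "aa m i * (xx m (Suc i) * z) = - (aa m i * (xx m i * z))" for z
    by (simp add: AXs flip: assoc)
   thus ?thesis using Gd_smul[OF 1[of "Suc a"], of "-1"] unfolding c unfolding 2 by (simp add: Gd_def assoc)
  next
   case 3
   thus ?thesis unfolding c using Gd_lv(1)[OF 1] by simp
  qed
  thus ?thesis using r' LX by simp
 next
  case (LT p)
  have k: "l + Suc (nT ls) <= k" using Cons.prems LT by simp
  have goal: "xp m i a * (tr m i l * wd m (x # ls)) = xp m i a * (tr m i l * (tt m p * wd m ls))" using LT by simp
  let ?G = "Gd m i (xp m i a * (tr m i l * (tt m p * wd m ls)))"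
  consider "Suc p < i" | "i = Suc p" | "p = i" | "i < p" "p < i + l" | "i < p" "p = i + l" | "p = i + l + 1" | "i + l + 1 < p" by linarith
  thus ?thesis unfolding goal
  proof cases
   case 1
   thus ?G
    using Gd_lv(2)[OF Cons.IH[of l i a]] k mult_ext[OF T_tr[of p i l m]] mult_ext[OF xp_T[of i p m a]] by simp
  next
   case 2
   have e: "tt m p * xx m p = xx m (Suc p) * tt m p + (if Suc p < m then 1 else 0) *s (ii m - uu m p * aa m p)"
    by (cases "Suc p < m") (simp add: TXr, simp add: T_def)
   have "Gd m p (xp m p a * (tr m p (Suc l) * wd m ls))" by (rule Cons.IH) (use k in simp)
   hence "Gd m i (tt m p * (xp m p a * (tr m i l * wd m ls)))"
    unfolding Gd_def 2 tr_first
    using mult_ext[OF fork[where 'a='a and 'b='b, of m p]] mult_ext[OF xp_T[of p "Suc p" m a], symmetric] by (simp add: assoc)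
   hence "Gd m i (xp m i a * (tt m p * wd m (lt @ ls)))"
    using xp_T_swap[of "[]" "lt @ ls" m p p i _ i a, OF _ e[folded 2]] k lt
    by (simp add: wd_append hm_left'[OF hm_xp] hm_left'[OF hm_T])
   thus ?G
    using mult_ext[OF T_tr[of p i l m]] 2 lt by (simp add: wd_append)
  next
   case 3
   show ?G
   proof (cases l)
    case 0
    thus ?thesis using Gd_Ti(1)[of ls m i a] k 3 by simp
   next
    case (Suc l')
    obtain ly where ly: "nT ly = l'" "tr m (Suc i) l' = wd m ly" using tr_wd by blast
    have "tr m i l * (tt m p * wd m ls) = tt m (Suc i) * (tt m i * wd m (ly @ ls))"
     unfolding Suc tr_first 3 using mult_ext[OF T_tr[of i "Suc i" l' m]] by (simp add: assoc wd_append ly)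
    thus ?thesis using Gd_Ti(2)[of "ly @ ls" m i a] k Suc ly by simp
   qed
  next
   case 4
   thus ?G
    using Gd_lv(2)[OF Cons.IH[of l i a], of "Suc p"] k mult_ext[OF tr_T_mid[of i p l m]] mult_ext[OF xp_T[of i "Suc p" m a]] by simp
  next
   case 5
   thus ?G using mult_ext0[OF tr_T_last[of l m i]] Gd_0 by simp
  next
   case 6
   thus ?G using Cons.IH[of "Suc l" i a] k by (simp add: assoc)
  next
   case 7
   thus ?G
    using Gd_lv(2)[OF Cons.IH[of l i a]] k mult_ext[OF T_tr[of p i l m]] mult_ext[OF xp_T[of i p m a]] by simp
  qed
 qed
qed

end
lemma Gd_wd: "Gd m i (wd m ls)"
proof -
 have "ALL ls m i. nT ls < k --> Gd m i (wd m ls)" for k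
 proof (induction k)
  case (Suc k)
  have "Gd m i (wd m ls)" if "nT ls <= k" for ls m i
   using C_claim[of k 0 ls m i 0] Suc that by (simp add: hm_left[OF hm_wd])
  thus ?case by (simp add: less_Suc_eq_le)
 qed simp
 thus ?thesis by blast
qed
lemma Wp_A_Suc: "Wp n (Suc u) m y ==> Wp n u (m - 2) (aa m i * y)"
proof -
 have "Wp n v m y ==> v = Suc u ==> Wp n u (m - 2) (aa m i * (wd m ls * y))" for v ls
 proof (induction arbitrary: i ls rule: Wp.induct)
  case (Wp_low y m v)
  show ?case by (metis Wp_low hm_mult[OF hm_A hm_mult[OF hm_wd]] Wp.Wp_low low_left)
 next
  case (Wp_I v)
  thus ?case using C1[OF Wp_wd[OF Wp.Wp_I]] by simp
 next
  case (Wp_lv v m y a)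
  thus ?case using Wp_lv.IH[of i "ls @ [a]"] by (simp add: wd_append assoc hm_right[OF hm_lv])
 next
  case (Wp_U v m y j)
  thus ?case using Gd_wd[of "Suc (Suc m)" i ls] by (auto simp: Gd_def)
 qed (auto simp: distrib_left intro: Wp.intros)
 from this[of "Suc u" "[]"] show "Wp n (Suc u) m y ==> ?thesis"
  using Wp_hm[of n "Suc u" m y] by (simp add: hm_left)
qed

end
lemma Wp_zero_cases: "Wp n v m y ==> v = 0 ==> y : low n | m = n"
 by (induction rule: Wp.induct) (auto intro: low_add low_smul low_left)
text \<open>Without cups the element starts on \<open>n\<close> strands modulo \<open>low n\<close>,
  so a cap leads below \<open>n\<close> and the result is low; this starts the induction on
  \<open>u\<close>.\<close>

lemma Wp_A: "Wp n u m y ==> Wp n u (m - 2) (aa m i * y)" "Wp n u m y ==> Wp n u m (uu m j * (aa m i * y))"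
proof -
 have "(ALL m i y. Wp n u m y --> Wp n u (m - 2) (aa m i * y)) & (ALL m i j y. Wp n u m y --> Wp n u m (uu m j * (aa m i * y)))"
 proof (induction u)
  case 0
  have "aa m i * y : low n" if "Wp n 0 m y" for m i y
  proof (cases "1 < m")
   case True
   thus ?thesis using Wp_zero_cases[OF that] low_left low_hm'[OF _ hm_mult[OF hm_A Wp_hm[OF that]]] by fastforce
  qed (simp add: A_def low_0)
  moreover have "hm (m - 2) n (aa m i * y)" "hm m n (uu m j * (aa m i * y))" if "Wp n 0 m y" for m i j y
   using hm_mult[OF hm_A Wp_hm[OF that]] hm_mult[OF hm_U hm_mult[OF hm_A Wp_hm[OF that]]] by auto
  ultimately show ?case by (blast intro: Wp_low low_left)
 next
  case (Suc u)
  have 1: "Wp n u (m - 2) (aa m i * y)" if "Wp n (Suc u) m y" for m i y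
   using Wp_A_Suc[of n u] Suc that by blast
  thus ?case using Wp_Suc Wp_U' by blast
 qed
 thus "Wp n u m y ==> Wp n u (m - 2) (aa m i * y)" "Wp n u m y ==> Wp n u m (uu m j * (aa m i * y))" by blast+
qed
lemma Wp_mono: "Wp n u m y ==> u <= v ==> Wp n v m y"
 by (induction v) (auto simp: le_Suc_eq intro: Wp_Suc)
lemma Wp_q: "wt e ==> Wp n u (i + src e + j) z ==> EX v. Wp n v (i + tgt e + j) (pd i (q e) j * z)"
proof (induction e arbitrary: i j u z)
 case (Gen g)
 have n: "i + 2 + j = Suc (Suc (i + j))" by simp
 show ?case
 using Wp_X[of n u "i + 1 + j" z i] Gen Wp_T[of n u "i + 2 + j" z i] Wp_A(1)[of n u "i + 2 + j" z i] Wp_U[of n u "i + j" z i] by (cases g) (auto simp: X_def q_exp T_def n A_def U_def)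
next
 case (Id m)
 thus ?case using Wp_hm[of n u "i + m + j" z] by (auto simp: q_exp hm_left)
next
 case (Comp f g)
 then obtain v where "Wp n v (i + tgt g + j) (pd i (q g) j * z)" by fastforce
 with Comp obtain v' where "Wp n v' (i + tgt f + j) (pd i (q f) j * (pd i (q g) j * z))" by fastforce
 thus ?case using Comp.prems by (auto simp: q_exp pd_mult assoc)
next
 case (Tens f g)
 have w: "wt f" "wt g" using Tens.prems by auto
 \<comment> \<open>A tensor product is performed in two steps, \<open>g\<close> beside the source of
   \<open>f\<close> and then \<open>f\<close> beside the target of \<open>g\<close>, so that each
   factor is a padded expression covered by the induction.\<close>
 have e: "pd i (q (Tens f g)) j = pd i (q f) (tgt g + j) * (pd (i + src f) (q g) j :: ('a, 'b) nb)"
 proof -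
  have "(q f * I (src f)) ** (I (tgt g) * q g) = (q f ** I (tgt g)) * (I (src f) ** (q g :: ('a, 'b) nb))"
   by (rule interchange[OF hm_q hm_I hm_I hm_q]) (use w in auto)
  moreover have "q f ** ii (tgt g) = pd 0 (q f) (tgt g)" "ii (src f) ** q g = pd (src f) (q g) 0" by (simp_all add: pd_def)
  ultimately have "q (Tens f g) = pd 0 (q f) (tgt g) * (pd (src f) (q g) 0 :: ('a, 'b) nb)" using w by (simp add: q_exp I_q)
  thus ?thesis by (simp add: pd_mult pd_pd)
 qed
 have "Wp n u ((i + src f) + src g + j) z" using Tens.prems by (simp add: add.assoc)
 from Tens.IH(2)[OF w(2) this] obtain v where "Wp n v (i + src f + (tgt g + j)) (pd (i + src f) (q g) j * z)" by (auto simp: add.assoc)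
 from Tens.IH(1)[OF w(1) this] show ?case unfolding e by (simp add: add.assoc assoc)
qed

theorem Wp_all: assumes "hm m n y" shows "EX u. Wp n u m y"
proof -
 have "EX u. Wp n u m (ii m * (y * ii n))"
 proof (induction y rule: nb_induct)
  case zero show ?case using Wp_0 by auto
 next
  case (add c e y)
  then obtain u where u: "Wp n u m (ii m * (y * ii n))" by blast
  have "EX v. Wp n v m (ii m * (q e * ii n))"
  using Wp_q[of e n 0 0 0 "ii n"] Wp_I[of n 0] add Wp_0 by (auto simp: I_q)
  then obtain v where v: "Wp n v m (ii m * (q e * ii n))" by blast
  have "Wp n (max u v) m (c *s (ii m * (q e * ii n)) + ii m * (y * ii n))"
   by (rule Wp_add[OF Wp_smul]) (use Wp_mono u v in auto)
  thus ?case by (auto simp: distrib_left distrib_right)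
 qed
 thus ?thesis using assms by (simp add: hm_left hm_right)
qed

end

section \<open>The standard ideals, and normal forms modulo them\<close>

context nbt begin
lemma hm_U2: "hm (Suc (Suc m)) m (uu (Suc (Suc m)) i)" and hm_A2: "hm m (Suc (Suc m)) (aa (Suc (Suc m)) i)"
 using hm_U[where 'a='a and 'b='b, of "Suc (Suc m)" i] hm_A[where 'a='a and 'b='b, of "Suc (Suc m)" i] by simp_all
text \<open>Every generator changes the number of strands by an even amount.\<close>

lemma parity: assumes "hm m n (y :: ('a, 'b) nb)" "odd (m + n)" shows "y = 0"
proof -
 have g: "wt e ==> even (src e + tgt e)" for e
 proof (induction e)
  case (Gen g) thus ?case by (cases g) auto
 qed auto
 have "ii m * (y * ii n) = 0"
 proof (induction y rule: nb_induct)
  case (add c e y)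
  thus ?case using g[of e] assms(2) by (auto simp: distrib_left distrib_right I_q)
 qed simp
 thus ?thesis using assms(1) by (simp add: hm_left hm_right)
qed

text \<open>The left ideal by which \<open>NB 1_n\<close> is divided to give the standard module;
  \<open>Kstd_Cs\<close> makes the link.\<close>

inductive_set Kst :: "nat => ('a, 'b) nb set" for n where
 Kst_low: "v : low n ==> v * ii n : Kst n"
| Kst_T: "y * tt n i : Kst n"
| Kst_add: "y : Kst n ==> z : Kst n ==> y + z : Kst n"
lemma Kst_smul: "y : Kst n ==> c *s y : Kst n"
proof (induction rule: Kst.induct)
 case (Kst_low v) thus ?case using Kst.Kst_low[OF low_smul[of v n c]] by simp
next
 case (Kst_T y i) thus ?case using Kst.Kst_T[of "c *s y"] by simp
qed (auto simp: smul_add intro: Kst.intros)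
lemma Kst_left: "y : Kst n ==> u * y : Kst n"
proof (induction rule: Kst.induct)
 case (Kst_low v) thus ?case using Kst.Kst_low[OF low_left[of v n u]] by (simp add: assoc)
next
 case (Kst_T y i) thus ?case using Kst.Kst_T[of "u * y"] by (simp add: assoc)
qed (auto simp: distrib_left intro: Kst.intros)
lemma Kst_right: "y : Kst n ==> y * ii n = y"
 by (induction rule: Kst.induct) (auto simp: assoc distrib_right)
lemma Kst_low': "v : low n ==> hm m n v ==> v : Kst n" using Kst_low[of v n] by (simp add: hm_right)
lemma lideal_Kst: "lideal (Kst n)"
 unfolding lideal_def using Kst_low[OF low_0] by (auto intro: Kst_add Kst_smul Kst_left)

primrec el :: "nat => nat => ('a, 'b) nb" where
 "el 0 r = (if r = 0 then I 0 else 0)"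
| "el (Suc n) r = L (el n r) + (if r = 0 then 0 else X (Suc n) 0 * L (el n (r - 1)))"
lemma hm_el: "hm n n (el n r)" by (induction n arbitrary: r) (auto intro!: hm_add hm_mult hm_X hm_L)
lemma el_0 [simp]: "el n 0 = ii n" by (induction n) auto
lemma el_big: "n < r ==> el n r = 0" by (induction n arbitrary: r) auto
lemma dg_el: "dg (2 * int r) (el n r)"
proof (induction n arbitrary: r)
 case (Suc n)
 have "r ~= 0 ==> dg (2 * int r) (xx (Suc n) 0 * L (el n (r - 1)))"
  using dg_mult[OF dg_X dg_L[OF Suc[of "r - 1"]]] by (simp add: of_nat_diff)
 thus ?case using Suc by (auto intro: dg_add dg_L)
qed auto
lemma el_X: "el n r * xx n i = xx n i * el n r"
proof (induction n arbitrary: r i)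
 case (Suc n)
 show ?case
 proof (cases i)
  case 0
  have c: "L (el n r) * xx (Suc n) 0 = xx (Suc n) 0 * L (el n r)" for r using far0(1)[OF hm_el, of n r] by simp
  show ?thesis using mult_ext[OF c] 0 c by (simp add: distrib_left distrib_right assoc)
 next
  case (Suc j)
  have 1: "L (el n r) * xx (Suc n) (Suc j) = xx (Suc n) (Suc j) * L (el n r)" for r
   using arg_cong[OF Suc.IH[of r j], of L] by simp
  have 2: "xx (Suc n) 0 * (xx (Suc n) (Suc j) * z) = xx (Suc n) (Suc j) * (xx (Suc n) 0 * z)" for z by (rule mult_ext) (rule XX)
  show ?thesis using 1 2 by (simp add: Suc distrib_left distrib_right assoc)
 qed
qed (simp add: X_def)
lemma el_xp: "el n r * xp n i k = xp n i k * el n r"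
 by (rule xp_comm) (simp_all add: el_X hm_left[OF hm_el] hm_right[OF hm_el])
text \<open>Symmetric polynomials commute with crossings only modulo \<open>low\<close>. The sum of
  two neighbouring dots commutes exactly with their crossing; for their product the identity terms
  cancel and cup-cap terms remain.\<close>

lemma el_T: "tt n i * el n r - el n r * tt n i : low n"
proof (induction n arbitrary: i r)
 case (Suc n)
 show ?case
 proof (cases i)
  case (Suc j)
  have "tt (Suc n) i * el (Suc n) r - el (Suc n) r * tt (Suc n) i = L (tt n j * el n r - el n r * tt n j)
    + (if r = 0 then 0 else xx (Suc n) 0 * L (tt n j * el n (r - 1) - el n (r - 1) * tt n j))"
   using mult_ext[OF XT[of 0 "Suc j" "Suc n"], symmetric] by (auto simp: Suc algs)
  thus ?thesis using L_low[OF Suc.IH] by (auto intro!: low_add low_left low_0)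
 next
  case 0
  show ?thesis
  proof (cases n)
   case 0
   thus ?thesis by (simp add: T_def low_0)
  next
   case (Suc p)
   let ?N = "Suc (Suc p)"
   let ?X = "xx ?N 0" and ?Y = "xx ?N (Suc 0)" and ?T = "tt ?N 0"
   define e where "e r = L (L (el p r))" for r
   have he: "hm ?N ?N (e r)" for r unfolding e_def by (intro hm_L hm_el)
   have eT: "e r * ?T = ?T * e r" for r unfolding e_def using far0(2)[OF hm_el] by simp
   have E: "el ?N r = e r + (if r = 0 then 0 else (?X + ?Y) * e (r - 1)) + (if r <= 1 then 0 else ?X * (?Y * e (r - 2)))" for r
    by (cases r; cases "r - 1") (auto simp: e_def algs numeral_2_eq_2)
   have 1: "?T * (?X + ?Y) = (?X + ?Y) * ?T" by (simp add: distrib_left distrib_right TXr XTr)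
   have 2: "?T * (?X * ?Y) - ?X * ?Y * ?T : low ?N"
   proof -
    have "?T * ?X * ?Y = (?Y * ?T + ii ?N - uu ?N 0 * aa ?N 0) * ?Y" by (subst TXr) auto
    moreover have "?Y * (?X * ?T) = ?Y * (?T * ?Y + ii ?N - uu ?N 0 * aa ?N 0)" by (subst XTr) auto
    ultimately have "?T * (?X * ?Y) - ?X * ?Y * ?T = ?Y * (uu ?N 0 * aa ?N 0) - uu ?N 0 * (aa ?N 0 * ?Y)"
     by (simp add: algs XX[of ?N 0 "Suc 0"] flip: assoc[of ?X ?Y])
    moreover have "uu ?N 0 * (aa ?N 0 * ?Y) : low ?N" "?Y * (uu ?N 0 * aa ?N 0) : low ?N"
     using low_hm[of p ?N ?N "aa ?N 0 * ?Y" "uu ?N 0"] low_hm[of p ?N ?N "aa ?N 0" "?Y * uu ?N 0"] hm_mult[OF hm_A hm_X, of ?N 0 "Suc 0"] hm_A[of ?N 0]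
     by (simp_all add: assoc)
    ultimately show ?thesis using lidealD(6)[OF lideal_low] by simp
   qed
   have 3: "?T * (?X * (?Y * z)) - ?X * (?Y * (?T * z)) : low ?N" for z
    using low_right[OF 2, of z] by (simp add: left_diff_distrib assoc)
   have "?T * el ?N r - el ?N r * ?T = (if r <= 1 then 0 else ?T * (?X * (?Y * e (r - 2))) - ?X * (?Y * (?T * e (r - 2))))"
    unfolding E using mult_ext[OF 1] by (auto simp: distrib_left distrib_right eT assoc)
   thus ?thesis using 3 low_0 Suc \<open>i = 0\<close> by auto
  qed
 qed
qed (simp add: T_def low_0)
lemma el_dsc: "dsc n k * el n r - el n r * dsc n k : low n"
proof (induction k)
 case 0
 thus ?case by (simp add: hm_left[OF hm_el] hm_right[OF hm_el] low_0)
next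
 case (Suc k)
 have "dsc n (Suc k) * el n r - el n r * dsc n (Suc k) = tt n k * (dsc n k * el n r - el n r * dsc n k) + (tt n k * el n r - el n r * tt n k) * dsc n k"
  by (simp add: algs)
 thus ?case using Suc low_left low_right[OF el_T] low_add by simp
qed
lemma L_el: "L (el n (Suc r)) = el (Suc n) (Suc r) - xx (Suc n) 0 * L (el n r)" by simp

text \<open>Basis diagrams, encoded by one number for each target strand from left to right. A
  number \<open>c < n\<close> makes the strand a thread to the leftmost source strand with
  \<open>c\<close> dots. Otherwise the strand is the left leg of a cup, whose right leg carries
  \<open>c - n\<close> dots and is taken by a train across the \<open>n\<close> strands; the
  remaining diagram then starts from \<open>n + 1\<close> strands.\<close>

fun bel :: "nat => nat list => ('a, 'b) nb" where
 "bel n [] = I 0"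
| "bel n (c # l) = (if c < n then L (bel (n - 1) l) * xp n 0 c
  else L (bel (Suc n) l * (dsc (Suc n) n * xp (Suc n) 0 (c - n))) * uu (Suc (Suc n)) 0)"
fun val :: "nat => nat list => bool" where
 "val n [] \<longleftrightarrow> n = 0" | "val n (c # l) \<longleftrightarrow> (if c < n then val (n - 1) l else val (Suc n) l)"
fun bdeg :: "nat => nat list => int" where
 "bdeg n [] = 0" | "bdeg n (c # l) = (if c < n then 2 * int c + bdeg (n - 1) l else 2 * int c - 4 * int n + bdeg (Suc n) l)"
lemma hm_bel: "val n l ==> hm (length l) n (bel n l)"
proof (induction l arbitrary: n)
 case (Cons c l)
 show ?case
 proof (cases "c < n")
  case True
  hence "hm (Suc (length l)) n (L (bel (n - 1) l))" using hm_L[OF Cons.IH[of "n - 1"]] Cons.prems by simp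
  thus ?thesis using True by (auto intro: hm_mult hm_xp)
 next
  case False
  hence "hm (length l) (Suc n) (bel (Suc n) l)" using Cons by simp
  hence "hm (length l) (Suc n) (bel (Suc n) l * (dsc (Suc n) n * xp (Suc n) 0 (c - n)))" by (intro hm_mult[OF _ hm_mult[OF hm_dsc hm_xp]])
  thus ?thesis using False hm_mult[OF hm_L hm_U2] by (simp only: bel.simps if_False list.size add_Suc_right add_0_right)
 qed
qed simp
lemma dg_bel: "dg (bdeg n l) (bel n l)"
proof (induction l arbitrary: n)
 case (Cons c l)
 show ?case
 proof (cases "c < n")
  case True
  thus ?thesis using dg_mult[OF dg_L[OF Cons[of "n - 1"]] dg_xp[of c n 0]] by (simp add: add.commute)
 next
  case False
  have "bdeg n (c # l) = (bdeg (Suc n) l + (- 2 * int n + 2 * int (c - n))) + 0" using False by (simp add: of_nat_diff)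
  thus ?thesis
   using dg_mult[OF dg_L[OF dg_mult[OF Cons[of "Suc n"] dg_mult[OF dg_dsc(1) dg_xp]]] dg_U] False by (simp only: bel.simps if_False)
 qed
qed simp

text \<open>Monomials in the elements that become central in the standard module; the second
  argument is half the degree.\<close>

inductive zmon :: "nat => nat => ('a, 'b) nb => bool" for n where
 zmon_I: "zmon n 0 (ii n)"
| zmon_el: "zmon n d z ==> 1 <= r ==> r <= n ==> zmon n (d + r) (z * el n r)"
| zmon_rb: "zmon n d z ==> 1 <= r ==> zmon n (d + r) (z * rb n r)"
lemma hm_zmon: "zmon n d z ==> hm n n z" by (induction rule: zmon.induct) (auto intro: hm_mult hm_el hm_rb)
lemma dg_zmon: "zmon n d z ==> dg (2 * int d) z"
proof (induction rule: zmon.induct)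
 case (zmon_el d z r)
 thus ?case using dg_mult[OF zmon_el.IH dg_el, of r n] by (simp add: distrib_left)
next
 case (zmon_rb d z r)
 thus ?case using dg_mult[OF zmon_rb.IH dg_rb[of r n]] by (simp add: distrib_left)
qed simp

inductive_set NF :: "nat => nat => ('a, 'b) nb set" for n m where
 NF_K: "y : Kst n ==> hm m n y ==> y : NF n m"
| NF_b: "val n l ==> length l = m ==> zmon n d z ==> bel n l * z : NF n m"
| NF_add: "y : NF n m ==> y' : NF n m ==> y + y' : NF n m"
| NF_smul: "y : NF n m ==> c *s y : NF n m"
lemma NF_hm: "y : NF n m ==> hm m n y"
 by (induction rule: NF.induct) (auto intro: hm_add hm_smul hm_mult hm_bel hm_zmon)
lemma NF_0: "0 : NF n m" by (rule NF_K) (simp_all add: lidealD(1)[OF lideal_Kst])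
lemma NF_diff: "y : NF n m ==> y' : NF n m ==> y - y' : NF n m"
 using NF_add[OF _ NF_smul[where c = "-1"], of y n m y'] by simp
lemma NF_low: "v : low n ==> hm m n v ==> v : NF n m" by (intro NF_K Kst_low')
lemma Kst_el: "y : Kst n ==> y * el n r : Kst n"
proof (induction rule: Kst.induct)
 case (Kst_low v)
 thus ?case using Kst.Kst_low[OF low_right[of v n "el n r"]] by (simp add: assoc hm_left[OF hm_el] hm_right[OF hm_el])
next
 case (Kst_T y i)
 have "y * tt n i * el n r = (y * el n r) * tt n i + y * (tt n i * el n r - el n r * tt n i) * ii n"
  by (simp add: algs hm_right[OF hm_el])
 thus ?case using Kst.Kst_add[OF Kst.Kst_T Kst.Kst_low[OF low_left[OF el_T]]] by simp
qed (auto simp: distrib_right intro: Kst.intros)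
lemma Kst_rb: "y : Kst n ==> y * rb n r : Kst n"
proof (induction rule: Kst.induct)
 case (Kst_low v)
 thus ?case using Kst.Kst_low[OF low_right[of v n "rb n r"]] by (simp add: assoc hm_left[OF hm_rb] hm_right[OF hm_rb])
next
 case (Kst_T y i)
 thus ?case using Kst.Kst_T[of "y * rb n r" n i] rb_comm[OF hm_T, of n r i] by (simp add: assoc)
qed (auto simp: distrib_right intro: Kst.intros)
lemma NF_el: "y : NF n m ==> y * el n r : NF n m"
proof (induction rule: NF.induct)
 case (NF_K y)
 thus ?case by (intro NF.NF_K Kst_el hm_mult[OF _ hm_el])
next
 case (NF_b l d z)
 consider "r = 0" | "1 <= r" "r <= n" | "n < r" by linarith
 thus ?case
 proof cases
  case 1 thus ?thesis using NF.NF_b[OF NF_b] hm_right[OF hm_zmon[OF NF_b(3)]] by (simp add: assoc)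
 next
  case 2 thus ?thesis using NF.NF_b[OF NF_b(1,2) zmon_el[OF NF_b(3)]] by (simp add: assoc)
 next
  case 3 thus ?thesis by (simp add: el_big NF_0)
 qed
qed (auto simp: distrib_right intro: NF.intros)
lemma rb_0: "rb n 0 = tk *s ii n" by (simp add: rb_def lb_0)
lemma NF_rb: "y : NF n m ==> y * rb n r : NF n m"
proof (induction rule: NF.induct)
 case (NF_K y)
 thus ?case by (intro NF.NF_K Kst_rb hm_mult[OF _ hm_rb])
next
 case (NF_b l d z)
 show ?case
 using NF.NF_smul[OF NF.NF_b[OF NF_b]] hm_right[OF hm_zmon[OF NF_b(3)]] NF.NF_b[OF NF_b(1,2) zmon_rb[OF NF_b(3)]] by (cases r) (auto simp: assoc rb_0)
qed (auto simp: distrib_right intro: NF.intros)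

text \<open>The leftmost dot satisfies a monic equation whose coefficients are elementary symmetric
  polynomials. Solving the recursion of \<open>el\<close> from the top index, where
  \<open>el p (Suc p) = 0\<close>, downwards trades surplus dots for factors \<open>el\<close> on
  the right.\<close>

lemma thr_bel: assumes "val p l" "length l = m" shows "L (bel p l) * xp (Suc p) 0 c : NF (Suc p) (Suc m)"
proof (induction c rule: less_induct)
 case (less c)
 let ?n = "Suc p"
 show ?case
 proof (cases "c < ?n")
  case True
  thus ?thesis using NF_b[of ?n "c # l" "Suc m", OF _ _ zmon_I] assms by (simp add: assoc hm_right[OF hm_xp])
 next
  case False
  have "d <= ?n ==> L (bel p l) * (L (el p (?n - d)) * xp ?n 0 (c - (?n - d))) : NF ?n (Suc m)" for d
  proof (induction d)
   case 0 thus ?case by (simp add: el_big NF_0)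
  next
   case (Suc d)
   define r where "r = ?n - Suc d"
   have r: "?n - d = Suc r" "c - r = Suc (c - Suc r)" using Suc.prems False by (auto simp: r_def)
   have "L (bel p l) * (L (el p r) * xp ?n 0 (c - r)) = L (bel p l) * xp ?n 0 (c - Suc r) * el ?n (Suc r) - L (bel p l) * (L (el p (Suc r)) * xp ?n 0 (c - Suc r))"
    unfolding L_el r(2) xp.simps using mult_ext[OF far0(1)[OF hm_el, of p r], of "xp ?n 0 (c - Suc r)"]
    by (simp add: left_diff_distrib right_diff_distrib assoc el_xp del: el.simps)
   moreover have "L (bel p l) * xp ?n 0 (c - Suc r) * el ?n (Suc r) : NF ?n (Suc m)" using less.IH[of "c - Suc r"] r by (intro NF_el) simp
   ultimately show ?case using Suc r unfolding r_def[symmetric] by (simp add: NF_diff)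
  qed
  from this[of ?n] show ?thesis by (simp add: hm_left[OF hm_xp])
 qed
qed
lemma thr: "y : NF p m ==> L y * xp (Suc p) 0 c : NF (Suc p) (Suc m)"
proof (induction arbitrary: c rule: NF.induct)
 case (NF_K y)
 have "y : Kst p ==> L y * xp (Suc p) 0 c : Kst (Suc p)"
 proof (induction rule: Kst.induct)
  case (Kst_low v)
  thus ?case using Kst.Kst_low[OF low_right[OF L_low]] by (simp add: assoc hm_left[OF hm_xp]) (metis hm_right hm_xp)
 next
  case (Kst_T y i)
  thus ?case using Kst.Kst_T[of "L y * xp (Suc p) 0 c" "Suc p" "Suc i"] by (simp add: assoc xp_T)
 qed (auto simp: distrib_right intro: Kst.intros)
 thus ?case using NF_K by (intro NF.NF_K hm_mult[OF hm_L hm_xp])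
next
 case (NF_b l d z)
 from NF_b(3) have "L (bel p l * z) * xp (Suc p) 0 c : NF (Suc p) (Suc m)" for c
 proof (induction arbitrary: c rule: zmon.induct)
  case zmon_I
  thus ?case using thr_bel[OF NF_b(1,2)] hm_left[OF hm_xp] by (simp add: assoc)
 next
  case (zmon_el d z r)
  have "L (bel p l * z) * (L (el p r) * xp (Suc p) 0 c) : NF (Suc p) (Suc m)" for r c
  proof (induction r arbitrary: c)
   case 0 thus ?case using zmon_el.IH by (simp add: hm_left[OF hm_xp])
  next
   case (Suc r)
   have "L (bel p l * z) * (L (el p (Suc r)) * xp (Suc p) 0 c) = L (bel p l * z) * xp (Suc p) 0 c * el (Suc p) (Suc r) - L (bel p l * z) * (L (el p r) * xp (Suc p) 0 (Suc c))"
    unfolding L_el xp.simps using mult_ext[OF far0(1)[OF hm_el, of p r], of "xp (Suc p) 0 c"]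
    by (simp add: left_diff_distrib right_diff_distrib assoc el_xp del: el.simps)
   thus ?case using NF_diff[OF NF_el[OF zmon_el.IH] Suc] by (simp only:)
  qed
  thus ?case by (simp add: assoc)
 next
  case (zmon_rb d z r)
  show ?case using rb_comm[OF hm_xp, of "Suc p" r 0 c] NF_rb[OF zmon_rb.IH] by (simp add: assoc)
 qed
 thus ?case .
qed (auto simp: distrib_right intro: NF.intros)

inductive_set PX :: "nat => ('a, 'b) nb set" for n where
 PX_I: "ii n : PX n" | PX_X: "y : PX n ==> xx n i * y : PX n" | PX_rb: "y : PX n ==> rb n k * y : PX n"
inductive_set PK :: "nat => ('a, 'b) nb set" for n where
 PK_K: "y : Kst n ==> y : PK n" | PK_X: "y : PX n ==> y : PK n"
| PK_add: "y : PK n ==> z : PK n ==> y + z : PK n" | PK_smul: "y : PK n ==> c *s y : PK n"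
lemma hm_PX: "y : PX n ==> hm n n y" by (induction rule: PX.induct) (auto intro: hm_mult hm_X hm_rb)
lemma PK_X_left: "y : PK n ==> xx n i * y : PK n"
 by (induction rule: PK.induct) (auto simp: distrib_left intro: PK.intros PX.intros Kst_left)
lemma PK_rb_left: "y : PK n ==> rb n i * y : PK n"
 by (induction rule: PK.induct) (auto simp: distrib_left intro: PK.intros PX.intros Kst_left)
lemma PK_T_X: "y : PX n ==> tt n i * y : PK n"
proof (induction arbitrary: i rule: PX.induct)
 case PX_I
 thus ?case using PK_K[OF Kst_T[of "ii n" n i]] by simp
next
 case (PX_X y j)
 obtain r c where r: "tt n i * xx n j = xx n r * tt n i + c *s (ii n - uu n i * aa n i)" using TX_gen by blast
 have "uu n i * (aa n i * y) : Kst n"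
 proof (cases "1 < n")
  case True
  have "hm (n - 2) n (aa n i * y)" using hm_mult[OF hm_A hm_PX[OF PX_X(1)]] .
  thus ?thesis using True hm_mult[OF hm_U, of n n "aa n i * y" i] by (intro Kst_low'[of _ n n] low_hm[of "n - 2" n n]) auto
 next
  case False thus ?thesis using lidealD(1)[OF lideal_Kst] by (simp add: A_def)
 qed
 moreover have "tt n i * (xx n j * y) = xx n r * (tt n i * y) + c *s (y + (-1) *s (uu n i * (aa n i * y)))"
  using arg_cong[OF r, of "%z. z * y"] by (simp add: algs hm_left[OF hm_PX[OF PX_X(1)]])
 ultimately show ?case using PX_X by (simp only:) (intro PK_add PK_smul PK_X_left; (simp only: | rule PK.PK_X PK_K); assumption?)
next
 case (PX_rb y k)
 thus ?case using mult_ext[OF rb_comm[OF hm_T, symmetric]] PK_rb_left by simp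
qed
lemma PK_T: "y : PK n ==> tt n i * y : PK n"
 by (induction rule: PK.induct) (auto simp: distrib_left intro: PK.intros PK_T_X Kst_left)
text \<open>A word from \<open>n\<close> to \<open>n\<close> strands that contains a cup factors
  through fewer strands, and crossings can be pushed to the right end, into \<open>Kst n\<close>;
  dots and bubbles remain.\<close>

lemma endo_PK: assumes "hm n n x" shows "x : PK n"
proof -
 have "Wp n u m y ==> m = n ==> y : PK n" for u m y
 proof (induction rule: Wp.induct)
  case (Wp_lv u m y a)
  thus ?case by (cases a) (auto intro: PK_X_left PK_T PK_rb_left)
 next
  case (Wp_U u m y i)
  thus ?case using hm_mult[OF hm_U2 Wp_hm[OF Wp_U(1)], of i]
   by (intro PK_K Kst_low'[of _ n n] low_left low_hm'[OF _ Wp_hm[OF Wp_U(1)]]) auto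
 qed (auto intro: PK.intros PX.intros Kst_low')
 thus ?thesis using Wp_all[OF assms] by blast
qed
lemma NF_L_endo:
 assumes IH: "!!y. hm m p y ==> y : NF p m" and y: "hm m p y" and x: "hm (Suc p) (Suc p) x"
 shows "L y * x : NF (Suc p) (Suc m)"
proof -
 have X: "x : PX (Suc p) ==> hm m p y ==> L y * (xp (Suc p) 0 c * x) : NF (Suc p) (Suc m)" for x y c
 proof (induction arbitrary: y c rule: PX.induct)
  case PX_I
  thus ?case using thr[OF IH] by (simp add: hm_right[OF hm_xp])
 next
  case (PX_X x i)
  show ?case
  proof (cases i)
   case 0
   thus ?thesis using PX_X.IH[OF PX_X.prems, of "Suc c"] mult_ext[OF xp_XX[of "Suc p" 0 c 0], of x] by (simp add: assoc)
  next
   case (Suc j)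
   thus ?thesis using PX_X.IH[OF hm_mult[OF PX_X.prems hm_X[of p j]], of c] mult_ext[OF xp_XX[of "Suc p" 0 c i], of x] by (simp add: assoc)
  qed
 next
  case (PX_rb x k)
  thus ?case using PX_rb.IH[OF hm_mult[OF PX_rb.prems hm_rb[of p k]], of c] mult_ext[OF rb_comm[OF hm_xp, of "Suc p" k 0 c], of x] by (simp add: assoc)
 qed
 have "x : PK (Suc p) ==> L y * (x * ii (Suc p)) : NF (Suc p) (Suc m)" for x
 proof (induction rule: PK.induct)
  case (PK_K z)
  show ?case by (metis hm_left'[OF hm_L[OF y]] Kst_right[OF PK_K] assoc hm_def NF_K[OF Kst_left[OF PK_K]])
 next
  case (PK_X z)
  thus ?case using X[OF PK_X y, of 0] by (simp add: hm_right[OF hm_PX] hm_left[OF hm_PX])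
 qed (auto simp: distrib_left distrib_right intro: NF.intros)
 from this[OF endo_PK[OF x]] show ?thesis using x by (simp add: hm_right)
qed
lemma NF_L_low:
 assumes IH: "!!p y. hm m p y ==> y : NF p m" and v: "v : low (Suc n)"
 shows "L (ii m * (v * ii (Suc n))) * uu (Suc (Suc n)) 0 : NF n (Suc m)"
 using v
proof (induction rule: low.induct)
 case low_0 thus ?case by (simp add: NF_0)
next
 case (low_step v p y z)
 let ?y = "ii m * (y * ii p)" and ?z = "ii p * (z * ii (Suc n))"
 have hy: "hm m p ?y" and hz: "hm p (Suc n) ?z" by (simp_all add: hm_def assoc)
 let ?A = "(L ?z * uu (Suc (Suc n)) 0)"
 have hx: "hm (Suc p) n ?A" using hm_mult[OF hm_L[OF hz] hm_U, of 0] by simp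
 have hyx: "hm (Suc m) n (L ?y * ?A)" using hm_mult[OF hm_L[OF hy] hx] .
 have "L ?y * ?A : NF n (Suc m)"
 proof -
  \<comment> \<open>The middle object has at most \<open>n\<close> strands. Below
    \<open>n - 1\<close> the result is low; at \<open>n - 1\<close> the added strand gives an
    endomorphism of \<open>n\<close> strands; at \<open>n\<close> parity forces 0.\<close>
  consider "Suc p < n" | "Suc p = n" | "p = n" using low_step by linarith
  thus ?thesis
  proof cases
   case 1 thus ?thesis by (intro NF_low[OF _ hyx] low_hm[OF 1 hx])
  next
   case 2 thus ?thesis using NF_L_endo[OF IH hy, of "L ?z * uu (Suc (Suc n)) 0"] hx by simp
  next
   case 3 hence "?z = 0" using parity[OF hz] by simp
   thus ?thesis by (simp only: L_simps mult_zero_left mult_zero_right NF_0)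
  qed
 qed
 moreover have "L (ii m * ((y * (ii p * z) + v) * ii (Suc n))) * uu (Suc (Suc n)) 0 = L ?y * ?A + L (ii m * (v * ii (Suc n))) * uu (Suc (Suc n)) 0"
  by (simp add: distrib_left distrib_right assoc)
 ultimately show ?case using low_step.IH NF_add by simp
qed
text \<open>The central factors of the normal form on \<open>n + 1\<close> strands must get past the
  train and the cup. The first is possible modulo \<open>low\<close>; at the cup an elementary
  symmetric polynomial splits into those on \<open>n\<close> strands with at most one extra dot on
  the right leg.\<close>

lemma cup_NF:
 assumes IH: "!!p y. hm m p y ==> y : NF p m" and y: "y : NF (Suc n) m"
 shows "L (y * (dsc (Suc n) n * xp (Suc n) 0 a)) * uu (Suc (Suc n)) 0 : NF n (Suc m)"
 using y
proof (induction arbitrary: a rule: NF.induct)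
 let ?N = "Suc n" and ?U = "uu (Suc (Suc n)) 0"
 have hmc: "hm m ?N v ==> hm (Suc m) n (L v * ?U)" for v using hm_mult[OF hm_L hm_U, of m ?N v 0] by simp
 have dx: "hm ?N ?N (dsc ?N n * xp ?N 0 a)" for a by (rule hm_mult[OF hm_dsc hm_xp])
 have lowc: "L v * ?U : NF n (Suc m)" if "v : low ?N" "hm m ?N v" for v
  using NF_L_low[OF IH that(1)] that(2) by (simp add: hm_left hm_right)
 {
  case (NF_K y)
  have "L (y * (dsc ?N n * xp ?N 0 a)) * ?U : NF n (Suc m)" if "y : Kst ?N" "ii m * y = y" for y
  proof -
   have "L (ii m * (y * (dsc ?N n * xp ?N 0 a))) * ?U : NF n (Suc m)" using that(1)
   proof (induction rule: Kst.induct)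
    case (Kst_low v)
    thus ?case using lowc[of "ii m * (v * (dsc ?N n * xp ?N 0 a))"] dx[of a]
     by (simp add: low_left low_right hm_def assoc)
   next
    case (Kst_T y i)
    have "tt ?N i * (dsc ?N n * xp ?N 0 a) = (if Suc i < n then dsc ?N n * (xp ?N 0 a * tt ?N (Suc i)) else 0)"
    proof -
     consider "Suc i < n" | "Suc i = n" | "n <= i" by linarith
     thus ?thesis
     proof cases
      case 1
      thus ?thesis using mult_ext[OF dsc_T[of i n ?N, symmetric], of "xp ?N 0 a"] xp_T[of 0 "Suc i" ?N a] by simp
     next
      case 2
      thus ?thesis using 2 by (auto simp: assoc mult_ext0)
     qed (simp add: T_def)
    qed
    moreover have "L (ii m * (y * (dsc ?N n * (xp ?N 0 a * tt ?N (Suc i))))) * ?U = (L (ii m * (y * (dsc ?N n * xp ?N 0 a))) * ?U) * tt n i"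
     using TU_ge[where 'a='a and 'b='b, of 0 "Suc (Suc i)" "Suc (Suc n)"] by (simp add: assoc)
    moreover have "(L (ii m * (y * (dsc ?N n * xp ?N 0 a))) * ?U) * tt n i : NF n (Suc m)"
     by (rule NF.NF_K[OF Kst.Kst_T], rule hm_mult[OF hmc hm_T]) (use dx[of a] in "simp add: hm_def assoc hm_right[OF hm_xp]")
    ultimately show ?case by (auto simp: assoc NF_0)
   qed (auto simp: distrib_left distrib_right intro: NF_add)
   thus ?thesis using that(2) by (simp flip: assoc[of "ii m"])
  qed
  thus ?case using NF_K hm_left by blast
 next
  case (NF_b l d z)
  from NF_b(3) have "L (bel ?N l * z * (dsc ?N n * xp ?N 0 a)) * ?U : NF n (Suc m)" for a
  proof (induction arbitrary: a rule: zmon.induct)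
   case zmon_I
   show ?case using NF.NF_b[of n "(n + a) # l" "Suc m", OF _ _ zmon.zmon_I] NF_b(1,2)
    by (simp add: assoc hm_left'[OF hm_dsc])
  next
   case (zmon_el d z r)
   let ?y = "bel ?N l * z"
   have hy: "hm m ?N ?y" using hm_mult[OF hm_bel[OF NF_b(1)] hm_zmon[OF zmon_el(1)]] NF_b(2) by simp
   have "?y * el ?N r * (dsc ?N n * xp ?N 0 a) = ?y * (dsc ?N n * xp ?N 0 a) * el ?N r - ?y * ((dsc ?N n * el ?N r - el ?N r * dsc ?N n) * xp ?N 0 a)"
    by (simp add: right_diff_distrib left_diff_distrib assoc el_xp del: el.simps)
   hence e: "L (bel ?N l * (z * el ?N r) * (dsc ?N n * xp ?N 0 a)) * ?U = L (?y * (dsc ?N n * xp ?N 0 a)) * (L (el ?N r) * ?U)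
     - L (?y * ((dsc ?N n * el ?N r - el ?N r * dsc ?N n) * xp ?N 0 a)) * ?U"
    by (simp only: assoc L_simps left_diff_distrib)
   have 1: "L (?y * ((dsc ?N n * el ?N r - el ?N r * dsc ?N n) * xp ?N 0 a)) * ?U : NF n (Suc m)"
    using hm_mult[OF hy hm_mult[OF hm_diff[OF hm_mult[OF hm_dsc hm_el] hm_mult[OF hm_el hm_dsc]] hm_xp]] by (intro lowc low_left low_right el_dsc)
   have 2: "L (el ?N r) * ?U = ?U * el n r + (if r = 0 then 0 else xx (Suc (Suc n)) (Suc 0) * (?U * el n (r - 1)))"
    using far0(4)[OF hm_el] by (simp add: distrib_right assoc)
   have 3: "L (?y * (dsc ?N n * xp ?N 0 a)) * (?U * el n r) : NF n (Suc m)" for r a using NF_el[OF zmon_el.IH[of a]] by (simp add: assoc)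
   have 4: "L (?y * (dsc ?N n * xp ?N 0 a)) * (xx (Suc (Suc n)) (Suc 0) * (?U * el n r')) : NF n (Suc m)" for r'
    using 3[of "Suc a" r'] by (simp add: xp_Suc2 assoc del: xp.simps)
   show ?case unfolding e using 1 3 4 by (auto simp only: 2 distrib_left intro!: NF_diff NF_add split: if_splits) (auto intro: NF_add NF_0)
  next
   case (zmon_rb d z r)
   show ?case using rb_comm[OF hm_U, of "Suc (Suc n)" r 0] rb_comm[OF dx[of a], of r] NF_rb[OF zmon_rb.IH[of a]] by (simp add: assoc)
  qed
  thus ?case .
 }
qed (auto simp: distrib_right intro: NF.intros)

text \<open>The leftmost target strand of a morphism is bent down to the source, which gives a
  morphism with a smaller target to which the induction applies; the cup in \<open>M\<close> bends
  it back. It remains to put the identity on \<open>n + 1\<close> strands into \<open>M\<close>, and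
  \<open>resolve\<close> reduces this to cups with trains (\<open>cup_NF\<close>) and to threads
  (\<open>thr\<close>).\<close>

theorem NF_all: "hm m n y ==> y : NF n m"
proof (induction m arbitrary: n y)
 case 0
 show ?case
 proof (cases "n = 0")
  case True
  have "Wp 0 u m y ==> m = 0 ==> y : NF 0 0" for u m y
  proof (induction rule: Wp.induct)
   case Wp_I
   thus ?case using NF_b[of 0 "[]" 0, OF _ _ zmon_I] by simp
  next
   case (Wp_lv u m y a)
   thus ?case using rb_comm[OF NF_hm, of y 0 0] NF_rb[of y 0 0] by (cases a) (auto simp: X_def T_def NF_0)
  qed (auto intro: NF.intros NF_low)
  thus ?thesis using Wp_all[OF 0] True by blast
 next
  case False
  thus ?thesis using NF_low[OF low_hm'[OF _ 0] 0] by simp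
 qed
next
 case (Suc m)
 let ?N = "Suc n" and ?U = "uu (Suc (Suc n)) 0"
 define M where "M = {v. ALL y. ii m * y = y --> L (y * (v * ii ?N)) * ?U : NF n (Suc m)}"
 have hmc: "hm m ?N v ==> hm (Suc m) n (L v * ?U)" for v using hm_mult[OF hm_L hm_U, of m ?N v 0] by simp
 have M: "lideal M" unfolding lideal_def M_def
 proof (intro conjI ballI allI; clarify?)
  show "L (y * (0 * ii ?N)) * ?U : NF n (Suc m)" for y by (simp add: NF_0)
  show "L (y * ((c *s v) * ii ?N)) * ?U : NF n (Suc m)"
   if "ALL y. ii m * y = y --> L (y * (v * ii ?N)) * ?U : NF n (Suc m)" "ii m * y = y" for v c y
   using that by (auto intro: NF_smul)
  show "L (y * ((u * v) * ii ?N)) * ?U : NF n (Suc m)"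
   if "ALL y. ii m * y = y --> L (y * (v * ii ?N)) * ?U : NF n (Suc m)" "ii m * y = y" for v u y
  proof -
   show ?thesis by (metis that(2) that(1)[rule_format, of "y * u"] assoc)
  qed
 qed (auto simp: distrib_left distrib_right intro: NF_add)
 have iM: "ii ?N : M"
 proof (rule resolve[OF M, of n])
  fix i j :: nat assume i: "1 <= i"
  then obtain i' where i': "i = Suc i'" by (cases i) auto
  show "tt ?N i * (xp ?N 0 j * ii ?N) : M" unfolding M_def
  proof (clarify)
   fix y assume y: "ii m * y = y"
   have e: "tt ?N i * (xp ?N 0 j * ii ?N) * ii ?N = xp ?N 0 j * tt ?N i"
    using xp_T[of 0 i ?N j] i by (simp add: hm_right[OF hm_xp] assoc)
   have "L (y * (tt ?N i * (xp ?N 0 j * ii ?N) * ii ?N)) * ?U = (L (y * xp ?N 0 j) * ?U) * tt n i'"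
    unfolding e by (simp add: assoc i' TU_ge)
   moreover have "hm (Suc m) n ((L (y * xp ?N 0 j) * ?U) * tt n i')"
    by (intro hm_mult[OF hmc hm_T]) (use y in \<open>simp add: hm_def assoc hm_right[OF hm_xp] flip: assoc[of "ii m"]\<close>)
   ultimately show "L (y * (tt ?N i * (xp ?N 0 j * ii ?N) * ii ?N)) * ?U : NF n (Suc m)" by (simp add: NF_K[OF Kst_T])
  qed
 next
  fix j :: nat assume "j <= n"
  show "dsc ?N n * (xp ?N 0 j * ii ?N) : M" unfolding M_def
  proof (clarify)
   fix y assume y: "ii m * y = y"
   have "hm m ?N (y * ii ?N)" using y by (simp add: hm_def assoc flip: assoc[of "ii m"])
   from cup_NF[OF Suc.IH Suc.IH[OF this], of j]
   show "L (y * (dsc ?N n * (xp ?N 0 j * ii ?N) * ii ?N)) * ?U : NF n (Suc m)"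
    by (simp add: assoc hm_left'[OF hm_dsc] hm_right[OF hm_xp])
  qed
 next
  fix l :: nat assume l: "l < n"
  show "aa ?N 0 * (xp ?N 0 l * ii ?N) : M" unfolding M_def
  proof (clarify)
   fix y assume y: "ii m * y = y"
   obtain p where p: "n = Suc p" using l by (cases n) auto
   have h: "hm m p (y * ii p)" using y by (simp add: hm_def assoc flip: assoc[of "ii m"])
   show "L (y * (aa ?N 0 * (xp ?N 0 l * ii ?N) * ii ?N)) * ?U : NF n (Suc m)"
    using mult_ext[OF A_xp_lt[of 0 "Suc 0" "Suc ?N" l], of ?U] p NF_smul[OF thr[OF Suc.IH[OF h], of l]] by (simp add: xp_U zig hm_right[OF hm_xp] assoc hm_left[OF hm_xp])
  qed
 qed auto
 let ?A = "(aa (Suc (Suc m)) 0 * L y)"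
 have "hm m ?N ?A" by (rule hm_mult[OF hm_A2 hm_L[OF Suc.prems]])
 hence v: "ii m * ?A = aa (Suc (Suc m)) 0 * L y" "aa (Suc (Suc m)) 0 * L y * (ii ?N * ii ?N) = aa (Suc (Suc m)) 0 * L y"
  by (simp_all only: I_I' hm_left hm_right)
 have "L ?A * ?U : NF n (Suc m)"
  using iM[unfolded M_def mem_Collect_eq, rule_format, OF v(1)] unfolding v(2) .
 moreover have "L ?A * ?U = y"
  using far0(4)[OF Suc.prems] by (simp add: assoc zig' hm_left[OF Suc.prems])
 ultimately show ?case by simp
qed

end
text \<open>Expansion of a rational function of \<open>z\<close> with simple poles. At
  \<open>z = 0\<close> it evaluates the closed loop of the model, at \<open>z = - s i\<close> the
  sums needed for a cap or a cup on a crossing.\<close>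

lemma partial_fractions:
 fixes s :: "nat => 'f::field"
 assumes "!!i j. i < n ==> j < n ==> i ~= j ==> s i ~= s j" "!!k. k < n ==> z ~= s k"
 shows "(PROD j<n. (- z - s j) / (z - s j)) = (-1) ^ n - (SUM k<n. 2 * s k * (PROD j:{..<n} - {k}. (- s k - s j) / (s k - s j)) / (z - s k))"
 using assms
proof (induction n arbitrary: z)
 case (Suc n)
 define v where "v k = (PROD j:{..<n} - {k}. (- s k - s j) / (s k - s j))" for k
 have z: "z ~= s n" "!!k. k < n ==> z ~= s k" "!!k. k < n ==> s n ~= s k" using Suc.prems by auto
 have vS: "(PROD j:{..<Suc n} - {k}. (- s k - s j) / (s k - s j)) = v k * ((- s k - s n) / (s k - s n))" if "k < n" for k
 proof -
  have "{..<Suc n} - {k} = insert n ({..<n} - {k})" using that by auto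
  thus ?thesis by (simp add: v_def mult.commute)
 qed
 let ?D = "(SUM k<n. 2 * s k * v k / (s n - s k))"
 have vn: "(PROD j:{..<Suc n} - {n}. (- s n - s j) / (s n - s j)) = (-1) ^ n - ?D"
 proof -
  have "{..<Suc n} - {n} = {..<n}" by auto
  thus ?thesis using Suc.IH[of "s n"] Suc.prems(1) z(3) by (simp add: v_def)
 qed
 have IH: "(PROD j<n. (- z - s j) / (z - s j)) = (-1) ^ n - (SUM k<n. 2 * s k * v k / (z - s k))"
  using Suc.IH[of z] Suc.prems(1) z(2) by (simp add: v_def)
 have e: "2 * s k * (v k * ((- s k - s n) / (s k - s n))) / (z - s k) =
   2 * s k * v k / (z - s k) * ((- z - s n) / (z - s n)) + 2 * s n * (2 * s k * v k / (s n - s k)) / (z - s n)" if "k < n" for k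
 proof -
  have "z - s k ~= 0" "z - s n ~= 0" "s k - s n ~= 0" "s n - s k ~= 0" using z(1) z(2)[OF that] z(3)[OF that] by auto
  thus ?thesis by (simp add: divide_simps) (simp add: algs)
 qed
 have "(SUM k<Suc n. 2 * s k * (PROD j:{..<Suc n} - {k}. (- s k - s j) / (s k - s j)) / (z - s k)) =
   (SUM k<n. 2 * s k * v k / (z - s k)) * ((- z - s n) / (z - s n)) + 2 * s n * ?D / (z - s n)
   + 2 * s n * ((-1) ^ n - ?D) / (z - s n)"
 proof -
  have "(SUM k<n. 2 * s k * (PROD j:{..<Suc n} - {k}. (- s k - s j) / (s k - s j)) / (z - s k)) =
    (SUM k<n. 2 * s k * v k / (z - s k) * ((- z - s n) / (z - s n)) + 2 * s n * (2 * s k * v k / (s n - s k)) / (z - s n))"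
   by (rule sum.cong[OF refl]) (simp only: lessThan_iff vS e)
  also have "... = (SUM k<n. 2 * s k * v k / (z - s k)) * ((- z - s n) / (z - s n)) + 2 * s n * ?D / (z - s n)"
   by (simp only: sum.distrib sum_distrib_left[of "2 * s n"] sum_distrib_right[of _ _ "(- z - s n) / (z - s n)"] sum_divide_distrib)
  finally show ?thesis unfolding sum.lessThan_Suc vn by simp
 qed
 also have "... = (SUM k<n. 2 * s k * v k / (z - s k)) * ((- z - s n) / (z - s n)) + 2 * s n * (-1) ^ n / (z - s n)"
  by (simp add: right_diff_distrib diff_divide_distrib)
 finally have fin: "(SUM k<Suc n. 2 * s k * (PROD j:{..<Suc n} - {k}. (- s k - s j) / (s k - s j)) / (z - s k)) = ..." .
 have "(-1) ^ Suc n - (SUM k<Suc n. 2 * s k * (PROD j:{..<Suc n} - {k}. (- s k - s j) / (s k - s j)) / (z - s k)) =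
   ((-1) ^ n - (SUM k<n. 2 * s k * v k / (z - s k))) * ((- z - s n) / (z - s n))"
 proof -
  have "- 1 - 2 * s n / (z - s n) = (- z - s n) / (z - s n)" using z(1) by (simp add: divide_simps)
  hence "(-1) ^ Suc n - 2 * s n * (-1) ^ n / (z - s n) = (-1) ^ n * ((- z - s n) / (z - s n))"
   by (simp only: power_Suc) (simp add: right_diff_distrib flip: \<open>- 1 - 2 * s n / (z - s n) = _\<close>)
  thus ?thesis unfolding fin left_diff_distrib by (metis (no_types, lifting) add.commute diff_diff_eq diff_right_commute)
 qed
 thus ?case using IH by simp
qed simp

text \<open>A generic fibre functor: one strand becomes a space with basis \<open>e_i\<close>, \<open>i < N\<close>; the operators depend on the state
 \<open>s\<close> of the strands to the right, where \<open>e_i\<close> flips the sign of \<open>s i\<close> and the dot acts on \<open>e_i\<close> by \<open>s i\<close>.\<close>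

definition flp :: "nat => (nat => 'f::field) => nat => 'f" where "flp i s = s(i := - s i)"
lemma flp_simps [simp]: "flp i (flp i s) = s" "flp i s i = - s i" "j ~= i ==> flp i s j = s j"
 by (auto simp: flp_def)
lemma flp_comm: "flp i (flp j s) = flp j (flp i s)" by (auto simp: flp_def)

section \<open>Local operators on two strands of the model\<close>

locale model0 = fixes N :: nat
begin

text \<open>Opposite values are excluded because \<open>flp\<close> may turn one value into the
  negative of another. For \<open>i = j\<close> this contains that \<open>2 * s i\<close> is
  nonzero.\<close>

definition gst :: "(nat => 'f::field) => bool" where
 "gst s \<longleftrightarrow> (ALL i<N. ALL j<N. s i + s j ~= 0 & (i ~= j --> s i ~= s j))"
lemma gstD: assumes "gst s" "i < N" "j < N"
 shows "s i + s j ~= 0" "- s i - s j ~= 0" "- s i ~= s j" "s i ~= - s j" "i ~= j ==> s i ~= s j" "i ~= j ==> s i - s j ~= 0" "2 * s i ~= 0" "s i ~= 0"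
proof -
 show *: "s i + s j ~= 0" using assms by (simp add: gst_def)
 have "- s i - s j = - (s i + s j)" by simp
 thus "- s i - s j ~= 0" using * by (simp only: neg_equal_0_iff_equal) simp
 show "- s i ~= s j" "s i ~= - s j" using * by (auto simp: eq_neg_iff_add_eq_0 neg_eq_iff_add_eq_0)
 show "i ~= j ==> s i ~= s j" "i ~= j ==> s i - s j ~= 0" using assms by (auto simp: gst_def)
 have "2 * s i ~= 0" by (metis assms mult_2[of "s i"] gst_def)
 thus "2 * s i ~= 0" "s i ~= 0" by auto
qed
lemma gst_flp: assumes g: "gst s" shows "gst (flp k s)"
proof (cases "k < N")
 case True
 have 1: "i < N ==> i ~= k ==> - s k + s i ~= 0" "i < N ==> i ~= k ==> s i + - s k ~= 0" for i
  using gstD(6)[OF g _ True] by (auto simp: add.commute)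
 have 3: "i < N ==> - s k ~= s i" "i < N ==> s i ~= - s k" for i using gstD(3)[OF g True] gstD(4)[OF g _ True] by auto
 show ?thesis using gstD(2)[OF g True True] 1 3 gstD(1,5)[OF g] by (simp add: True gst_def flp_def)
next
 case False
 thus ?thesis using g by (auto simp: gst_def flp_def)
qed

text \<open>The weights of a cap (\<open>cf\<close>) and a cup (\<open>df\<close>) on two equal
  basis vectors. They are reciprocal after a flip, which is what the zigzag relations
  require.\<close>

definition cf :: "(nat => 'f::field) => nat => 'f" where "cf s i = (PROD j:{..<N} - {i}. inverse (s i - s j))"
definition df :: "(nat => 'f::field) => nat => 'f" where "df s i = (PROD j:{..<N} - {i}. - s i - s j)"
lemma cf_nz: "gst s ==> i < N ==> cf s i ~= 0" unfolding cf_def using gstD(6) by auto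
lemma df_nz: "gst s ==> i < N ==> df s i ~= 0" unfolding df_def by (auto dest: gstD(2))
lemma df_cf: "df s i * cf s i = (PROD j:{..<N} - {i}. (- s i - s j) / (s i - s j))"
 unfolding df_def cf_def by (simp add: divide_inverse flip: prod.distrib)
lemma cf_flp: "gst s ==> i < N ==> cf (flp i s) i * df s i = 1"
 unfolding cf_def df_def prod.distrib[symmetric] by (rule prod.neutral) (auto simp: field_simps dest: gstD(2))
lemma df_flp: "gst s ==> i < N ==> cf s i * df (flp i s) i = 1"
 using cf_flp[OF gst_flp[of s i], of i] by simp
lemma cf_flp': assumes "gst s" "p < N" "i < N" "p ~= i" shows "cf (flp i s) p = cf s p * (s p - s i) / (s p + s i)"
proof -
 have e: "{..<N} - {p} = insert i ({..<N} - {p, i})" using assms by auto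
 have "(PROD j:{..<N} - {p, i}. inverse (flp i s p - flp i s j)) = (PROD j:{..<N} - {p, i}. inverse (s p - s j))"
  using assms by (intro prod.cong) auto
 thus ?thesis unfolding cf_def e using assms gstD(1,6)[OF assms(1,2,3)] by (simp add: divide_inverse)
qed
lemma df_flp': assumes "gst s" "p < N" "i < N" "p ~= i" shows "df (flp i s) p = df s p * (s p - s i) / (s p + s i)"
proof -
 have e: "{..<N} - {p} = insert i ({..<N} - {p, i})" using assms by auto
 have "(PROD j:{..<N} - {p, i}. - flp i s p - flp i s j) = (PROD j:{..<N} - {p, i}. - s p - s j)"
  using assms by (intro prod.cong) auto
 thus ?thesis unfolding df_def e using assms gstD[OF assms(1,2,3)] by (simp add: field_simps)
qed
text \<open>This sum is the value of the undotted bubble, so the model realises the parameter given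
  by the parity of \<open>N\<close>.\<close>

lemma sum_df_cf: assumes g: "gst s" shows "(SUM k<N. df s k * cf s k) = of_nat (N mod 2)"
proof (cases "N = 0")
 case False
 hence two: "(2 :: 'a) ~= 0" using gstD(7)[OF g, of 0 0] by auto
 have "(PROD j<N. (- 0 - s j) / (0 - s j)) = (1 :: 'a)" by (rule prod.neutral) (use gstD(8)[OF g] in auto)
 moreover have "(PROD j<N. (- 0 - s j) / (0 - s j)) = (-1) ^ N - (SUM k<N. 2 * s k * (PROD j:{..<N} - {k}. (- s k - s j) / (s k - s j)) / (0 - s k))"
  by (rule partial_fractions) (use gstD(5,8)[OF g] in "auto simp: eq_commute[of 0]")
 moreover have "2 * s k * (df s k * cf s k) / (0 - s k) = - 2 * (df s k * cf s k)" if "k < N" for k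
  using gstD(8)[OF g that that] by (simp add: field_simps)
 ultimately have "1 = (-1) ^ N + 2 * (SUM k<N. df s k * cf s k)"
  unfolding df_cf[symmetric] by (simp add: sum_negf sum_distrib_left)
 thus ?thesis using two by (cases "even N") (auto simp: odd_iff_mod_2_eq_one)
qed simp
lemma sum_df_cf': assumes g: "gst s" and i: "i < N" shows "(SUM k<N. df s k * cf s k / (s k + s i)) = 1 / (2 * s i)"
proof -
 have two: "(2 :: 'a) ~= 0" "s i ~= 0" using gstD(7,8)[OF g i i] by auto
 let ?A = "(PROD j<N. (- (- s i) - s j) / (- s i - s j))"
 have a: "?A = (0 :: 'a)" by (rule prod_zero) (use i in auto)
 have b: "?A = (-1) ^ N - (SUM k<N. 2 * s k * (PROD j:{..<N} - {k}. (- s k - s j) / (s k - s j)) / (- s i - s k))"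
  by (rule partial_fractions) (use gstD(3,5)[OF g] i in auto)
 note b[unfolded a]
 moreover have "2 * s k * (df s k * cf s k) / (- s i - s k) = - 2 * (df s k * cf s k) + 2 * s i * (df s k * cf s k / (s k + s i))" if "k < N" for k
 proof -
  have "s k + s i ~= 0" "- s i - s k ~= 0" using gstD(1,2)[OF g] that i by (auto simp: add.commute)
  thus ?thesis by (simp add: divide_simps) algebra
 qed
 ultimately have "0 = (-1) ^ N + 2 * (SUM k<N. df s k * cf s k) - 2 * s i * (SUM k<N. df s k * cf s k / (s k + s i))"
  unfolding df_cf[symmetric] by (simp add: sum.distrib sum_negf sum_distrib_left sum_subtractf)
 moreover have "(-1) ^ N + 2 * (SUM k<N. df s k * cf s k) = (1 :: 'a)"
  unfolding sum_df_cf[OF g] by (cases "even N") (auto simp: odd_iff_mod_2_eq_one)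
 ultimately show ?thesis using two by (simp add: field_simps)
qed

definition "tq s i k = (df s i * cf s k - (if k = i then 1 else 0)) / (s k + s i)"
text \<open>The dot slide forces this formula: solving it for each matrix entry gives a divided
  difference off the diagonal and, from the cup-cap term, the coefficients \<open>tq\<close> on the
  diagonal.\<close>

definition tl2 where tl2d:
 "tl2 s g i j = (if i = j then if i < N then (SUM k<N. tq s i k * g k k) else 0
   else (g i j - g j i) / (s i - s j))"
lemmas tl2_def = tl2d[unfolded tq_def]
definition "al2 s g = (SUM i<N. cf s i * g i i)"
definition "ul2 s c i j = (if i = j & i < N then df s i * c else 0)"
definition sup2 :: "(nat => nat => 'f::field) => bool" where
 "sup2 g \<longleftrightarrow> (ALL i j. g i j ~= 0 --> i < N & j < N)"
lemma sup2D: "sup2 g ==> ~ i < N | ~ j < N ==> g i j = 0" by (auto simp: sup2_def)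
lemma sup2_tl2: "sup2 g ==> sup2 (tl2 s g)" unfolding sup2_def tl2_def by (metis diff_self div_0)
lemma tl2_lin: "tl2 s (%p q. x * g p q + h p q) i j = x * tl2 s g i j + tl2 s h i j"
proof (cases "i = j")
 case True
 thus ?thesis by (auto simp: tl2_def sum_distrib_left distrib_left sum.distrib mult.left_commute intro!: sum.cong)
next
 case False
 thus ?thesis by (simp add: tl2_def add_divide_distrib[symmetric] algs)
qed
lemma al2_lin: "al2 s (%p q. x * g p q + h p q) = x * al2 s g + al2 s h"
 by (auto simp: al2_def sum_distrib_left distrib_left sum.distrib mult.left_commute)
lemma ul2_lin: "ul2 s (x * c + d) i j = x * ul2 s c i j + ul2 s d i j" by (simp add: ul2_def algs)
lemma tl2_diff: "tl2 s (%p q. g p q - h p q) i j = tl2 s g i j - tl2 s h i j"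
 using tl2_lin[of s "-1" h g i j] by simp
lemma tl2_add: "tl2 s (%p q. g p q + h p q) i j = tl2 s g i j + tl2 s h i j"
 using tl2_lin[of s 1 g h i j] by simp
lemma tl2_mult: "tl2 s (%p q. x * g p q) i j = x * tl2 s g i j"
 using tl2_lin[of s x g "%_ _. 0" i j] by (simp add: tl2_def)
lemma al2_diff: "al2 s (%p q. g p q - h p q) = al2 s g - al2 s h"
 using al2_lin[of s "-1" h g] by simp
lemma ul2_0 [simp]: "ul2 s 0 i j = 0" and tl2_0 [simp]: "tl2 s (%_ _. 0) i j = 0" and al2_0 [simp]: "al2 s (%_ _. 0) = 0"
 by (simp_all add: ul2_def tl2_def al2_def)
lemma loc_XT: assumes "gst s" "sup2 g"
 shows "flp j s i * tl2 s g i j = tl2 s (%p q. s q * g p q) i j + g i j - ul2 s (al2 s g) i j"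
proof (cases "i < N & j < N")
 case True
 show ?thesis
 proof (cases "i = j")
  case eq: True
  have "- s i * (tq s i k * g k k) = tq s i k * (s k * g k k) + (if k = i then g i i else 0) - df s i * (cf s k * g k k)" if "k < N" for k
  proof -
   have "tq s i k * s k + tq s i k * s i = df s i * cf s k - (if k = i then 1 else 0)"
    unfolding tq_def distrib_left[symmetric] using gstD(1)[OF assms(1), of k i] that True by simp
   from arg_cong[OF this, of "%x. x * g k k"] show ?thesis by (cases "k = i") (simp_all add: algs)
  qed
  hence "- s i * tl2 s g i i = tl2 s (%p q. s q * g p q) i i + g i i - ul2 s (al2 s g) i i"
   using True by (simp add: tl2d ul2_def al2_def sum_distrib_left sum.distrib sum_subtractf)
  thus ?thesis using eq by simp
 next
  case False
  thus ?thesis using gstD(6)[OF assms(1), of i j] True by (simp add: tl2_def ul2_def divide_simps) (simp add: algs)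
 qed
next
 case False
 thus ?thesis using sup2D[OF assms(2)] by (auto simp: tl2_def ul2_def)
qed
lemma loc_TX: assumes "gst s" "sup2 g"
 shows "tl2 s (%p q. flp q s p * g p q) i j = s j * tl2 s g i j + g i j - ul2 s (al2 s g) i j"
proof -
 have "tl2 s (%p q. (flp q s p + s q) * g p q) i j = (flp j s i + s j) * tl2 s g i j"
  by (auto simp: tl2d right_diff_distrib add.commute)
 thus ?thesis using loc_XT[OF assms, of j i] by (simp add: distrib_right tl2_add algs)
qed
lemma loc_AU: "gst s ==> al2 s (ul2 s c) = of_nat (N mod 2) * c"
 unfolding al2_def ul2_def using sum_df_cf[of s] by (simp add: sum_distrib_right[symmetric] assoc[symmetric] mult.commute[of "cf s _" "df s _"])
lemma loc_AT: assumes g: "gst s" shows "al2 s (tl2 s h) = 0"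
proof -
 have "al2 s (tl2 s h) = (SUM i<N. SUM k<N. cf s i * (tq s i k * h k k))"
  by (simp add: al2_def tl2d sum_distrib_left)
 also have "... = (SUM k<N. SUM i<N. cf s i * (tq s i k * h k k))" by (rule sum.swap)
 also have "... = (SUM k<N. cf s k * h k k * ((SUM i<N. df s i * cf s i / (s i + s k)) - 1 / (2 * s k)))"
 proof (rule sum.cong[OF refl])
  fix k assume k: "k : {..<N}"
  have "cf s i * (tq s i k * h k k) =
   cf s k * h k k * (df s i * cf s i / (s i + s k)) - (if i = k then cf s k * h k k * (1 / (2 * s k)) else 0)" for i
   by (simp add: tq_def diff_divide_distrib left_diff_distrib right_diff_distrib add.commute)
  hence "(SUM i<N. cf s i * (tq s i k * h k k)) =
   cf s k * h k k * (SUM i<N. df s i * cf s i / (s i + s k)) - cf s k * h k k * (1 / (2 * s k))"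
   using k by (simp add: sum_subtractf sum_distrib_left)
  thus "(SUM i<N. cf s i * (tq s i k * h k k)) =
   cf s k * h k k * ((SUM i<N. df s i * cf s i / (s i + s k)) - 1 / (2 * s k))" by (simp only: right_diff_distrib)
 qed
 also have "... = 0" by (rule sum.neutral) (simp add: sum_df_cf'[OF g])
 finally show ?thesis .
qed
lemma loc_TU: assumes g: "gst s" shows "tl2 s (ul2 s c) i j = 0"
proof (cases "i = j & i < N")
 case True
 have "tq s i k * (df s k * c) =
   df s i * c * (df s k * cf s k / (s k + s i)) - (if k = i then df s i * c * (1 / (2 * s i)) else 0)" for k
  by (simp add: tq_def diff_divide_distrib left_diff_distrib right_diff_distrib)
 hence "tl2 s (ul2 s c) i i = df s i * c * (SUM k<N. df s k * cf s k / (s k + s i)) - df s i * c * (1 / (2 * s i))"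
  using True by (simp add: tl2d ul2_def sum_subtractf sum_distrib_left)
 thus ?thesis using True by (simp add: sum_df_cf'[OF g])
qed (auto simp: tl2_def ul2_def)
text \<open>Off the diagonal this is the square of a divided difference. For the diagonal, the
  square commutes with both dots, so generic eigenvalues isolate the matrix entry from
  \<open>(i, i)\<close> to itself. A cap annihilates the square and has nonzero weight there, so
  this entry vanishes as well.\<close>

lemma loc_TT: assumes g: "gst s" and h: "sup2 h" shows "tl2 s (tl2 s h) i j = 0"
proof -
 have off: "tl2 s (tl2 s f) i j = 0" if "i ~= j" for i j f
  using that by (simp add: tl2_def) (metis minus_diff_eq minus_divide_divide)
 have UA: "al2 s (tl2 s f) = 0" for f by (rule loc_AT[OF g])
 have X1: "s j * tl2 s (tl2 s f) i j = tl2 s (tl2 s (%p q. s q * f p q)) i j" if f: "sup2 f" for f i j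
 using loc_TX[OF g sup2_tl2[OF f], of s i j] loc_XT[OF g f] loc_TU[OF g, of "al2 s f" i j] by (simp add: UA tl2_diff tl2_add)
 have X0: "flp j s i * tl2 s (tl2 s f) i j = tl2 s (tl2 s (%p q. flp q s p * f p q)) i j" if f: "sup2 f" for f i j
 proof -
  have "flp j s i * tl2 s (tl2 s f) i j = tl2 s (%p q. s q * tl2 s f p q) i j + tl2 s f i j"
   using loc_XT[OF g sup2_tl2[OF f], of j i s] by (simp add: UA)
  moreover have "(%p q. s q * tl2 s f p q) = (%p q. tl2 s (%p q. flp q s p * f p q) p q - f p q + ul2 s (al2 s f) p q)"
   using loc_TX[OF g f] by auto
  ultimately show ?thesis using loc_TU[OF g, of "al2 s f" i j] by (simp add: tl2_diff tl2_add)
 qed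
 have kill1: "tl2 s (tl2 s f) i j = 0" if "sup2 f" "j < N" "!!p q. q = j ==> f p q = 0" for f i j
 proof -
  define f' where "f' p q = f p q / (s j - s q)" for p q
  have f': "sup2 f'" using that(1) by (auto simp: sup2_def f'_def)
  have "f = (%p q. s j * f' p q - s q * f' p q)"
   using that gstD(6)[OF g that(2)] sup2D[OF that(1)] unfolding f'_def
   by (intro ext) (metis (no_types, opaque_lifting) diff_divide_distrib div_by_0 divide_eq_0_iff left_diff_distrib nonzero_mult_div_cancel_left times_divide_eq_right)
  hence "tl2 s (tl2 s f) i j = s j * tl2 s (tl2 s f') i j - tl2 s (tl2 s (%p q. s q * f' p q)) i j"
   by (simp only: tl2_diff[abs_def] tl2_mult)
  thus ?thesis using X1[OF f'] by simp
 qed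
 have kill0: "tl2 s (tl2 s f) i i = 0" if "sup2 f" "i < N" "!!p q. f p q ~= 0 ==> q = i & p ~= i" for f i
 proof -
  define f' where "f' p q = f p q / (- s i - s p)" for p q
  have f': "sup2 f'" using that(1) by (auto simp: sup2_def f'_def)
  have "f p q = - s i * f' p q - flp q s p * f' p q" for p q
  proof (cases "f p q = 0")
   case False
   hence "- s i - s p ~= 0" "q = i" "p ~= i" using that gstD(2)[OF g that(2)] by (auto simp: sup2_def)
   hence "(- s i - s p) * f' p q = f p q" by (simp add: f'_def)
   thus ?thesis using \<open>q = i\<close> \<open>p ~= i\<close> by (simp add: algs)
  qed (simp add: f'_def)
  hence "f = (%p q. - s i * f' p q - flp q s p * f' p q)" by blast
  hence "tl2 s (tl2 s f) i i = - s i * tl2 s (tl2 s f') i i - tl2 s (tl2 s (%p q. flp q s p * f' p q)) i i"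
   by (simp only: tl2_diff[abs_def] tl2_mult)
  thus ?thesis using X0[OF f', of i i] by simp
 qed
 show ?thesis
 proof (cases "i = j & i < N")
  case True
  define f1 where "f1 p q = (if q = i then 0 else h p q)" for p q
  define f2 where "f2 p q = (if q = i & p ~= i then h p q else 0)" for p q
  define f3 where "f3 p q = (if q = i & p = i then h p q else 0)" for p q
  have sp: "sup2 f1" "sup2 f2" "sup2 f3" using h by (auto simp: sup2_def f1_def f2_def f3_def)
  have "h = (%p q. f1 p q + (f2 p q + f3 p q))" by (intro ext) (auto simp: f1_def f2_def f3_def)
  hence "tl2 s (tl2 s h) i i = tl2 s (tl2 s f1) i i + (tl2 s (tl2 s f2) i i + tl2 s (tl2 s f3) i i)"
   by (simp only: tl2_add[abs_def])
  moreover have "tl2 s (tl2 s f1) i i = 0" using kill1[OF sp(1), of i i] True by (simp add: f1_def)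
  moreover have "tl2 s (tl2 s f2) i i = 0" by (rule kill0[OF sp(2)]) (use True in "auto simp: f2_def split: if_splits")
  moreover have "tl2 s (tl2 s f3) i i = 0"
  proof -
   have "tl2 s (tl2 s f3) l l = 0" if "l < N" "l ~= i" for l
    by (rule kill1[OF sp(3)]) (use that in "auto simp: f3_def")
   hence "al2 s (tl2 s (tl2 s f3)) = cf s i * tl2 s (tl2 s f3) i i"
    unfolding al2_def using True by (subst sum.remove[of _ i]) auto
   thus ?thesis using UA[of "tl2 s f3"] cf_nz[OF g, of i] True by simp
  qed
  ultimately show ?thesis using True by simp
 next
  case False
  thus ?thesis using off by (cases "i = j") (auto simp: tl2_def)
 qed
qed

end

section \<open>Three strands of the model: pitchforks and the braid relation\<close>

context model0
begin

text \<open>The digit in these names is the position of the leftmost strand acted on. Operators on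
  the left pair see the state after the flip caused by the third strand, whence
  \<open>flp k s\<close>.\<close>

definition "t0 s f i j k = tl2 (flp k s) (%p q. f p q k) i j"
definition t1 :: "(nat => 'f::field) => (nat => nat => nat => 'f) => nat => nat => nat => 'f" where
 "t1 s f i j k = tl2 s (f i) j k"
definition "a0 s f k = al2 (flp k s) (%p q. f p q k)"
definition a1 :: "(nat => 'f::field) => (nat => nat => nat => 'f) => nat => 'f" where
 "a1 s f i = al2 s (f i)"
definition "u0 s g i j k = ul2 (flp k s) (g k) i j"
definition u1 :: "(nat => 'f::field) => (nat => 'f) => nat => nat => nat => 'f" where
 "u1 s g i j k = ul2 s (g i) j k"
definition "x0 s f i j k = flp j (flp k s) i * f i j k"
definition "x1 s f i j k = flp k s j * f i j k"
definition x2 :: "(nat => 'f::field) => (nat => nat => nat => 'f) => nat => nat => nat => 'f" where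
 "x2 s f i j k = s k * f i j k"
definition sup3 :: "(nat => nat => nat => 'f::field) => bool" where
 "sup3 f \<longleftrightarrow> (ALL i j k. f i j k ~= 0 --> i < N & j < N & k < N)"
lemma sup3D: "sup3 f ==> ~ i < N | ~ j < N | ~ k < N ==> f i j k = 0" by (auto simp: sup3_def)
lemma sup3_sup2: "sup3 f ==> sup2 (f i)" "sup3 f ==> sup2 (%p q. f p q k)" by (auto simp: sup3_def sup2_def)
lemma tl2_eq_0: "(!!p q. g p q = 0) ==> tl2 s g i j = 0"
proof -
 assume "!!p q. g p q = 0"
 hence "g = (%_ _. 0)" by blast
 thus ?thesis by simp
qed
lemma sup3_t0: assumes "sup3 f" shows "sup3 (t0 s f)"
 unfolding sup3_def
proof (intro allI impI)
 fix i j k assume a: "t0 s f i j k ~= 0"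
 hence "i < N & j < N" using sup2_tl2[OF sup3_sup2(2)[OF assms]] unfolding t0_def sup2_def by blast
 moreover have "k < N" using a tl2_eq_0[of "%p q. f p q k"] sup3D[OF assms] unfolding t0_def by blast
 ultimately show "i < N & j < N & k < N" by simp
qed
lemma sup3_t1: assumes "sup3 f" shows "sup3 (t1 s f)"
 unfolding sup3_def
proof (intro allI impI)
 fix i j k assume a: "t1 s f i j k ~= 0"
 hence "j < N & k < N" using sup2_tl2[OF sup3_sup2(1)[OF assms]] unfolding t1_def sup2_def by blast
 moreover have "i < N" using a tl2_eq_0[of "f i"] sup3D[OF assms] unfolding t1_def by blast
 ultimately show "i < N & j < N & k < N" by simp
qed
lemma sup3_x: "sup3 f ==> sup3 (x0 s f)" "sup3 f ==> sup3 (x1 s f)" "sup3 f ==> sup3 (x2 s f)"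
 by (auto simp: sup3_def x0_def x1_def x2_def)
lemma tl2_plus: "tl2 s (f + g) = tl2 s f + tl2 s g" "tl2 s (f - g) = tl2 s f - tl2 s g" "al2 s (f - g) = al2 s f - al2 s g"
 using tl2_add[of s f g] tl2_diff[of s f g] al2_diff[of s f g] by (auto simp: fun_eq_iff plus_fun_def fun_diff_def)
lemma op3_app: "t1 s f i = tl2 s (f i)" "u1 s h i = ul2 s (h i)" "x0 s f i = (%j k. flp j (flp k s) i * f i j k)"
 "x1 s f i = (%j k. flp k s j * f i j k)" "x2 s f i = (%j k. s k * f i j k)"
 by (auto simp: fun_eq_iff t1_def u1_def x0_def x1_def x2_def)
lemma op3_add: "t0 s (f + g) = t0 s f + t0 s g" "t1 s (f + g) = t1 s f + t1 s g"
 "x0 s (f + g) = x0 s f + x0 s g" "x1 s (f + g) = x1 s f + x1 s g" "x2 s (f + g) = x2 s f + x2 s g"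
 by (auto simp: fun_eq_iff t0_def t1_def x0_def x1_def x2_def tl2_add tl2_plus algs)
lemma op3_diff: "t0 s (f - g) = t0 s f - t0 s g" "t1 s (f - g) = t1 s f - t1 s g"
 "x0 s (f - g) = x0 s f - x0 s g" "x1 s (f - g) = x1 s f - x1 s g" "x2 s (f - g) = x2 s f - x2 s g"
 by (auto simp: fun_eq_iff t0_def t1_def x0_def x1_def x2_def tl2_diff tl2_plus algs)
lemma au_diff: "a0 s (f - g) = a0 s f - a0 s g" "a1 s (f - g) = a1 s f - a1 s g"
 by (auto simp: fun_eq_iff a0_def a1_def al2_diff tl2_plus)
lemma op3_0: "t0 s 0 = 0" "t1 s 0 = 0" "u0 s 0 = 0" "u1 s 0 = 0" "a0 s 0 = 0" "a1 s 0 = 0"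
 by (auto simp: fun_eq_iff t0_def t1_def u0_def u1_def a0_def a1_def al2_def tl2_eq_0)
lemma op3_cmult: "t0 s (%i j k. c * f i j k) = (%i j k. c * t0 s f i j k)" "t1 s (%i j k. c * f i j k) = (%i j k. c * t1 s f i j k)"
 by (auto simp: fun_eq_iff t0_def t1_def tl2_mult)
lemma tl2_state: "tl2 s (%p q. h (flp p (flp q s)) * g p q) i j = h (flp i (flp j s)) * tl2 s g i j"
 by (auto simp: tl2_def sum_distrib_left flp_comm[of j i] right_diff_distrib diff_divide_distrib mult.left_commute)
lemma al2_state: "al2 s (%p q. h (flp p (flp q s)) * g p q) = h s * al2 s g"
 by (simp add: al2_def sum_distrib_left mult.left_commute)

context
 fixes s :: "nat => 'f::field"
 assumes g: "gst s"
begin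
lemma x0t0: "sup3 f ==> x0 s (t0 s f) = t0 s (x1 s f) + f - u0 s (a0 s f)"
 using loc_XT[OF gst_flp[OF g] sup3_sup2(2)] by (auto simp: fun_eq_iff x0_def x1_def t0_def u0_def a0_def)
lemma x1t0: "sup3 f ==> x1 s (t0 s f) = t0 s (x0 s f) - f + u0 s (a0 s f)"
 using loc_TX[OF gst_flp[OF g] sup3_sup2(2)] by (auto simp: fun_eq_iff x0_def x1_def t0_def u0_def a0_def)
lemma x1t1: "sup3 f ==> x1 s (t1 s f) = t1 s (x2 s f) + f - u1 s (a1 s f)"
 using loc_XT[OF g sup3_sup2(1)] by (auto simp: fun_eq_iff op3_app a1_def)
lemma x2t1: "sup3 f ==> x2 s (t1 s f) = t1 s (x1 s f) - f + u1 s (a1 s f)"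
 using loc_TX[OF g sup3_sup2(1)] by (auto simp: fun_eq_iff op3_app a1_def)
lemma x2t0: "x2 s (t0 s f) = t0 s (x2 s f)"
 by (auto simp: fun_eq_iff x2_def t0_def tl2_mult)
lemma x0t1: "x0 s (t1 s f) = t1 s (x0 s f)"
 using tl2_state[where h = "%u. u _" and s = s] by (auto simp: fun_eq_iff op3_app)
lemma t0t0: "sup3 f ==> t0 s (t0 s f) = 0"
 using loc_TT[OF gst_flp[OF g] sup3_sup2(2)] by (auto simp: fun_eq_iff t0_def)
lemma t1t1: "sup3 f ==> t1 s (t1 s f) = 0"
 using loc_TT[OF g sup3_sup2(1)] by (auto simp: fun_eq_iff op3_app)
lemma a0t0: "a0 s (t0 s f) = 0"
 using loc_AT[OF gst_flp[OF g]] by (auto simp: fun_eq_iff t0_def a0_def)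
lemma a1t1: "a1 s (t1 s f) = 0"
 using loc_AT[OF g] by (auto simp: fun_eq_iff op3_app a1_def)
lemma t1u1: "t1 s (u1 s h) = 0"
 using loc_TU[OF g] by (auto simp: fun_eq_iff op3_app)
lemma t0u1: assumes h: "!!i. ~ i < N ==> h i = 0" shows "t0 s (u1 s h) = t1 s (u0 s h)"
proof (intro ext)
 fix i j k :: nat
 note D = t0_def t1_def u0_def u1_def tl2_def ul2_def
 note F = D if_distrib[of "%x. _ * x"] if_distrib[of "%x. x / _"]
 have S: "(SUM l<N. C l * (if l = m & m < N then D l else 0)) = (if m < N then C m * D m else 0)"
   "(SUM l<N. C l * (if m = l & m < N then D l else 0)) = (if m < N then C m * D m else 0)" for C D :: "nat => 'f" and m
  by (simp_all add: if_distrib[of "%x. _ * x"] cong: if_cong)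
 consider "i ~= j" "j ~= k" "i ~= k" | "i = k" "j ~= k" | "j = k" "i ~= j" | "i = j" "j ~= k" | "i = j" "j = k" by blast
 thus "t0 s (u1 s h) i j k = t1 s (u0 s h) i j k"
 proof cases
  case 1 thus ?thesis by (auto simp: D)
 next
  case 2
  show ?thesis
  proof (cases "i < N & j < N")
   case True
   have d: "s j - s i ~= 0" "- s i - s j ~= 0" "s i + s j ~= 0" using gstD[OF g, of j i] gstD[OF g, of i j] True 2 by auto
   show ?thesis using 2 True df_flp'[OF g, of i j] d
    by (simp add: D) (simp add: divide_simps, simp add: algs)
  next
   case False thus ?thesis using 2 h by (auto simp: D)
  qed
 next
  case 3
  show ?thesis
  proof (cases "i < N & j < N")
   case True
   thus ?thesis using 3 df_flp[OF g, of i] gstD[OF g, of i j]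
    by (simp add: F cong: if_cong)
  next
   case False thus ?thesis using 3 h by (auto simp: D S)
  qed
 next
  case 4
  show ?thesis
  proof (cases "i < N & k < N")
   case True
   thus ?thesis using 4 cf_flp[OF g, of k] gstD[OF g, of i k] gstD[OF g, of k i]
    by (simp add: F cong: if_cong)
  next
   case False thus ?thesis using 4 h by (auto simp: D S)
  qed
 next
  case 5
  show ?thesis
  proof (cases "i < N")
   case True
   have c: "cf (flp i s) i * df s i = 1" "cf s i * df (flp i s) i = 1" using True cf_flp[OF g, of i] df_flp[OF g, of i] by auto
   have "t0 s (u1 s h) i i i = (df (flp i s) i * cf (flp i s) i - 1) * df s i / (- s i - s i) * h i"
    using True by (simp add: F cong: if_cong)
   also have "(df (flp i s) i * cf (flp i s) i - 1) * df s i = df (flp i s) i - df s i"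
    using c by (simp add: left_diff_distrib assoc)
   finally have A: "t0 s (u1 s h) i i i = (df (flp i s) i - df s i) / (- s i - s i) * h i" .
   have "t1 s (u0 s h) i i i = (df s i * cf s i - 1) * df (flp i s) i / (s i + s i) * h i"
    using True by (simp add: F cong: if_cong)
   also have "(df s i * cf s i - 1) * df (flp i s) i = df s i - df (flp i s) i"
    using c by (simp add: left_diff_distrib assoc)
   finally have B: "t1 s (u0 s h) i i i = (df s i - df (flp i s) i) / (s i + s i) * h i" .
   show ?thesis by (metis minus_add_distrib minus_diff_eq minus_divide_divide diff_conv_add_uminus 5 A B)
  next
   case False thus ?thesis using 5 h by (auto simp: D S)
  qed
 qed
qed
text \<open>The summands with an index different from \<open>i\<close> agree one by one, by the
  change \<open>cf_flp'\<close> of the cap weights under a flip; the summand at \<open>i\<close> is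
  treated apart on both sides.\<close>

lemma a1t0: assumes f: "sup3 f" shows "a1 s (t0 s f) = a0 s (t1 s f)"
proof
 fix i
 show "a1 s (t0 s f) i = a0 s (t1 s f) i"
 proof (cases "i < N")
  case False
  thus ?thesis using sup3D[OF sup3_t0[OF f]] sup3D[OF sup3_t1[OF f]] by (simp add: a1_def a0_def al2_def)
 next
  case i: True
  hence iN: "i : {..<N}" by simp
  have p: "s i + s i ~= 0" "s i ~= 0" "(2::'f) ~= 0" using gstD[OF g i i] by auto
  have q: "s j + s i ~= 0" "s i + s j ~= 0" "s j - s i ~= 0" "- s j - s i ~= 0" if "j < N" "j ~= i" for j
   using gstD[OF g that(1) i] gstD[OF g i that(1)] that(2) by auto
  let ?A = "(SUM k<N. (df (flp i s) i * cf (flp i s) k - (if k = i then 1 else 0)) / (flp i s k - s i) * f k k i)"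
  let ?D = "(SUM j:{..<N}-{i}. cf s j * (f i j j - f j i j) / (s i + s j))"
  have L: "a1 s (t0 s f) i = ?D
    + cf s i * ?A"
  proof -
   have "cf s j * t0 s f i j j = cf s j * (f i j j - f j i j) / (s i + s j)" if "j : {..<N} - {i}" for j
    using that by (simp add: t0_def tl2_def)
   thus ?thesis unfolding a1_def al2_def
    by (subst sum.remove[of _ i]) (use i in "simp_all add: t0_def tl2_def")
  qed
  let ?B = "(SUM k<N. (df s i * cf s k - (if k = i then 1 else 0)) / (s k + s i) * f i k k)"
  let ?C = "(SUM j:{..<N}-{i}. cf (flp i s) j * (f j j i - f j i j) / (s j - s i))"
  have R: "a0 s (t1 s f) i = ?C
    + cf (flp i s) i * ?B"
  proof -
   have "cf (flp i s) j * t1 s f j j i = cf (flp i s) j * (f j j i - f j i j) / (s j - s i)" if "j : {..<N} - {i}" for j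
    using that by (simp add: t1_def tl2_def)
   thus ?thesis unfolding a0_def al2_def
    by (subst sum.remove[of _ i]) (use i in "simp_all add: t1_def tl2_def")
  qed
  let ?E = "(SUM k:{..<N}-{i}. cf (flp i s) k / (s k - s i) * f k k i)"
  have L2: "cf s i * ?A =
    ?E + (cf (flp i s) i - cf s i) / (- 2 * s i) * f i i i"
  using df_flp[OF g i] arg_cong2[of _ _ _ _ "(+)"] sum.cong by (simp add: assoc[symmetric] right_diff_distrib sum.remove[OF finite_lessThan iN] distrib_left sum_distrib_left simp_thms if_True)
  let ?F = "(SUM k:{..<N}-{i}. cf s k / (s i + s k) * f i k k)"
  have R2: "cf (flp i s) i * ?B =
    ?F + (cf s i - cf (flp i s) i) / (2 * s i) * f i i i"
  using cf_flp[OF g i] arg_cong2[of _ _ _ _ "(+)"] sum.cong by (simp add: assoc[symmetric] add.commute right_diff_distrib sum.remove[OF finite_lessThan iN] distrib_left sum_distrib_left simp_thms if_True)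
  have M: "cf s j * (f i j j - f j i j) / (s i + s j) + cf (flp i s) j / (s j - s i) * f j j i =
    cf (flp i s) j * (f j j i - f j i j) / (s j - s i) + cf s j / (s i + s j) * f i j j" if "j : {..<N} - {i}" for j
  proof -
   have c: "cf (flp i s) j = cf s j * (s j - s i) / (s j + s i)" using cf_flp'[OF g _ i, of j] that by simp
   show ?thesis unfolding c using that q[of j] by (simp add: divide_simps) (simp add: algs)
  qed
  have E: "(cf (flp i s) i - cf s i) / (- 2 * s i) = (cf s i - cf (flp i s) i) / (2 * s i)"
   by (metis minus_diff_eq minus_divide_divide mult_minus_left)
  have "?D + ?E =
    ?C + ?F"
   unfolding sum.distrib[symmetric] by (rule sum.cong[OF refl]) (rule M)
  thus ?thesis unfolding L R L2 R2 E by (simp only: add.assoc[symmetric])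
 qed
qed
lemma a0u1: "h k = 0 | k < N ==> a0 s (u1 s h) k = h k"
proof -
 assume h: "h k = 0 | k < N"
 have "a0 s (u1 s h) k = (SUM p<N. if p = k then cf (flp k s) k * df s k * h k else 0)"
  unfolding a0_def al2_def u1_def ul2_def by (intro sum.cong) auto
 thus ?thesis using h cf_flp[OF g, of k] by auto
qed
lemma a1u0: "h k = 0 | k < N ==> a1 s (u0 s h) k = h k"
proof -
 assume h: "h k = 0 | k < N"
 have "a1 s (u0 s h) k = (SUM p<N. if p = k then cf s k * df (flp k s) k * h k else 0)"
  unfolding a1_def al2_def u0_def ul2_def by (intro sum.cong) auto
 thus ?thesis using h df_flp[OF g, of k] by auto
qed

definition D3 :: "(nat => nat => nat => 'f) => nat => nat => nat => 'f" where
 "D3 f = t0 s (t1 s (t0 s f)) - t1 s (t0 s (t1 s f))"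
lemma a_supp: "sup3 f ==> ~ i < N ==> a0 s f i = 0" "sup3 f ==> ~ i < N ==> a1 s f i = 0"
 by (simp_all add: a0_def a1_def al2_def sup3D)
lemma sup3_u: "(!!i. ~ i < N ==> h i = 0) ==> sup3 (u0 s h)" "(!!i. ~ i < N ==> h i = 0) ==> sup3 (u1 s h)"
 by (auto simp: sup3_def u0_def u1_def ul2_def)
text \<open>Both sides of the braid relation produce the same corrections when a dot passes through,
  so the corrections cancel in their difference \<open>D3\<close>.\<close>

lemma D3_x2: assumes f: "sup3 f" shows "D3 (x2 s f) = x0 s (D3 f)"
proof -
 note s3 = f sup3_t0[OF f] sup3_t1[OF f] sup3_t1[OF sup3_t0[OF f]] sup3_t0[OF sup3_t1[OF f]] sup3_x[OF f]
  sup3_x[OF sup3_t0[OF f]] sup3_x[OF sup3_t1[OF f]]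
 have "x0 s (t0 s (t1 s (t0 s f))) = t0 s (t1 s (t0 s (x2 s f))) - t1 s (u0 s (a0 s (t1 s f))) + t1 s (t0 s f)"
  using a_supp s3 by (simp add: x0t0 x1t1 x2t0 op3_add op3_diff t0t0 a1t0[symmetric] a0t0 op3_0 t0u1[symmetric])
 moreover have "x0 s (t1 s (t0 s (t1 s f))) = t1 s (t0 s (t1 s (x2 s f))) + t1 s (t0 s f) - t1 s (u0 s (a0 s (t1 s f)))"
  using a_supp s3 by (simp add: sup3_u x0t1 x0t0 x1t1 op3_add op3_diff t1t1 op3_0 t0u1 t1u1)
 ultimately show ?thesis by (simp add: D3_def op3_diff)
qed
lemma D3_x1: assumes f: "sup3 f" shows "D3 (x1 s f) = x1 s (D3 f)"
proof -
 note s3 = f sup3_t0[OF f] sup3_t1[OF f] sup3_t1[OF sup3_t0[OF f]] sup3_t0[OF sup3_t1[OF f]] sup3_x[OF f]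
  sup3_x[OF sup3_t0[OF f]] sup3_x[OF sup3_t1[OF f]]
 have "x1 s (t0 s (t1 s (t0 s f))) = t0 s (t1 s (t0 s (x1 s f))) + t0 s (t1 s f) - t1 s (t0 s f)"
  using a_supp s3 by (simp add: sup3_u x1t0 x0t1 x0t0 op3_add op3_diff t0t0 a1t0[symmetric] a0t0 op3_0 t0u1[symmetric])
 moreover have "x1 s (t1 s (t0 s (t1 s f))) = t1 s (t0 s (t1 s (x1 s f))) - t1 s (t0 s f) + t0 s (t1 s f)"
  using a_supp s3 by (simp add: sup3_u x1t1 x2t0 x2t1 op3_add op3_diff t1t1 op3_0 a1t0 a1t1 t0u1 t1u1)
 ultimately show ?thesis by (simp add: D3_def op3_diff)
qed
lemma D3_cmult: "D3 (%i j k. c * f i j k) = (%i j k. c * D3 f i j k)"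
 by (simp add: D3_def op3_cmult fun_eq_iff right_diff_distrib)
lemma D3_diff: "D3 (f - h) = D3 f - D3 h" and D3_add: "D3 (f + h) = D3 f + D3 h"
 by (simp_all add: D3_def op3_diff op3_add)
lemma D3_distinct:
 assumes "i < N" "j < N" "k < N" "i ~= j" "j ~= k" "i ~= k"
 shows "D3 f i j k = 0"
proof -
 have d: "s i - s j ~= 0" "s j - s i ~= 0" "s i - s k ~= 0" "s k - s i ~= 0" "s j - s k ~= 0" "s k - s j ~= 0"
  using gstD(6)[OF g] assms by auto
 show ?thesis using assms(4-6) d
  by (simp add: D3_def t0_def t1_def tl2_def) (simp add: divide_simps, simp add: algs)
qed

text \<open>A block of \<open>f\<close> on which the dots act with eigenvalues different from those required by \<open>D3_x2\<close> contributes nothing.\<close>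
lemma D3_sep2:
 assumes f: "sup3 f" and c: "!!p q r. f p q r ~= 0 ==> s r ~= c" and e: "flp j (flp k s) i = c"
 shows "D3 f i j k = 0"
proof -
 define h where "h p q r = f p q r / (s r - c)" for p q r
 have h: "sup3 h" using f by (auto simp: sup3_def h_def)
 have "f = x2 s h - (%p q r. c * h p q r)" using c
  by (auto simp: fun_eq_iff x2_def h_def diff_divide_distrib[symmetric] left_diff_distrib[symmetric])
 hence "D3 f i j k = x0 s (D3 h) i j k - c * D3 h i j k"
  by (simp add: D3_diff D3_cmult D3_x2[OF h])
 thus ?thesis by (simp add: x0_def e)
qed
lemma D3_sep1:
 assumes f: "sup3 f" and c: "!!p q r. f p q r ~= 0 ==> flp r s q ~= c" and e: "flp k s j = c"
 shows "D3 f i j k = 0"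
proof -
 define h where "h p q r = f p q r / (flp r s q - c)" for p q r
 have h: "sup3 h" using f by (auto simp: sup3_def h_def)
 have "f = x1 s h - (%p q r. c * h p q r)" using c
  by (auto simp: fun_eq_iff x1_def h_def diff_divide_distrib[symmetric] left_diff_distrib[symmetric])
 hence "D3 f i j k = x1 s (D3 h) i j k - c * D3 h i j k"
  by (simp add: D3_diff D3_cmult D3_x1[OF h])
 thus ?thesis by (simp add: x1_def e)
qed
text \<open>Distinct indices are a direct computation. If exactly two indices agree, the eigenvalues
  of the dots at the output do not fit any input, after splitting \<open>f\<close> in one of the
  cases. Three equal indices cannot be separated; there capping annihilates \<open>D3 f\<close>, and
  the cap weight is nonzero.\<close>

lemma braid3: assumes f: "sup3 f" shows "D3 f = 0"
proof -
 have r: "r < N" if "f p q r ~= 0" for p q r using f that by (auto simp: sup3_def)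
 have neg: "D3 f i j k = 0" if "i < N" "i = j | i = k" "~ (i = j & i = k)" for i j k
  by (rule D3_sep2[OF f, where c = "- s i"]) (use that gstD(4)[OF g r that(1)] in "auto simp: flp_def")
 have jii: "D3 f j i i = 0" if "i < N" "j < N" "i ~= j" for i j
 proof -
  define f1 where "f1 p q r = (if r = j then 0 else f p q r)" for p q r
  define f2 where "f2 p q r = (if r = j then f p q r else 0)" for p q r
  have s12: "sup3 f1" "sup3 f2" using f by (auto simp: sup3_def f1_def f2_def)
  have "D3 f1 j i i = 0"
   by (rule D3_sep2[OF s12(1), where c = "s j"]) (use that gstD(5)[OF g r that(2)] in "auto simp: f1_def split: if_splits")
  moreover have "D3 f2 j i i = 0"
  proof (rule D3_sep1[OF s12(2), where c = "- s i"])
   fix p q r assume a: "f2 p q r ~= 0"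
   hence "r = j" "q < N" using s12(2) by (auto simp: f2_def sup3_def split: if_splits)
   thus "flp r s q ~= - s i" using that gstD(4)[OF g, of q i] gstD(5)[OF g, of i j] by (cases "q = j") auto
  qed (use that in auto)
  moreover have "f = f1 + f2" by (auto simp: fun_eq_iff f1_def f2_def)
  ultimately show ?thesis by (simp add: D3_add)
 qed
 have s3: "sup3 (D3 f)" unfolding D3_def sup3_def
  using sup3D[OF sup3_t0[OF sup3_t1[OF sup3_t0[OF f]]]] sup3D[OF sup3_t1[OF sup3_t0[OF sup3_t1[OF f]]]]
  by simp (metis diff_self)
 have iii: "D3 f i i i = 0" if i: "i < N" for i
 proof -
  have "a0 s (D3 f) i = 0" by (simp add: au_diff a0t0 a1t0[symmetric] sup3_t0 sup3_t1 f t0t0 op3_0 D3_def)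
  moreover have "a0 s (D3 f) i = cf (flp i s) i * D3 f i i i"
   unfolding a0_def al2_def by (subst sum.remove[of _ i]) (use i neg in "auto intro!: sum.neutral")
  ultimately show ?thesis using cf_nz[OF gst_flp[OF g] i, of i] by simp
 qed
 show ?thesis
 proof (intro ext)
  fix i j k :: nat
  show "D3 f i j k = 0 i j k"
  proof (cases "i < N & j < N & k < N")
   case True
   thus ?thesis using neg[of i j k] jii[of j i] iii[of i] D3_distinct[of i j k f] by (cases "i = j"; cases "i = k"; cases "j = k") auto
  qed (use sup3D[OF s3] in auto)
 qed
qed

end
end

section \<open>The model on words of arbitrary length\<close>

locale model = model0 N for N +
 fixes base :: "nat => 'f::field"
 assumes base: "gst base"
begin

primrec st :: "nat list => nat => 'f" where
 "st [] = base" | "st (i # v) = flp i (st v)"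
lemma gst_st: "gst (st v)" by (induction v) (simp_all add: base gst_flp)

definition VW :: "nat => (nat list => 'f) set" where
 "VW n = {ph. ALL v. ph v ~= 0 --> n <= length v & set v <= {..<N}}"

fun opg :: "gen => (nat list => 'f) => nat list => 'f" where
 "opg GX ph (i # u) = st u i * ph (i # u)"
| "opg GTau ph (i # j # u) = tl2 (st u) (%p r. ph (p # r # u)) i j"
| "opg GCap ph u = al2 (st u) (%p r. ph (p # r # u))"
| "opg GCup ph (i # j # u) = ul2 (st u) (ph u) i j"
| "opg _ ph _ = 0"
lemma opg_Cap: "opg GCap ph = (%u. al2 (st u) (%p r. ph (p # r # u)))" by (intro ext) simp

definition skip :: "nat => ((nat list => 'f) => nat list => 'f) => (nat list => 'f) => nat list => 'f" where
 "skip k h ph v = (if length v < k then 0 else h (%u. ph (take k v @ u)) (drop k v))"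

text \<open>For a tensor product the right factor acts first, behind the letters of the source of
  the left factor. The other order gives the same on \<open>VW\<close> by
  \<open>opn_skip\<close>.\<close>

fun opn :: "mexp => (nat list => 'f) => nat list => 'f" where
 "opn (Gen g) = opg g"
| "opn (Id n) = id"
| "opn (Comp f g) = opn f \<circ> opn g"
| "opn (Tens f g) = opn f \<circ> skip (src f) (opn g)"
lemma skip_0 [simp]: "skip 0 h = h" by (intro ext) (simp add: skip_def)
lemma skip_Suc_Cons [simp]: "skip (Suc k) h ph (i # v) = skip k h (%u. ph (i # u)) v"
 "skip (Suc k) h ph [] = 0"
 by (simp_all add: skip_def)
lemma skip_comp: "skip k h (skip k h' ph) = skip k (h \<circ> h') ph"
proof
 fix v
 show "skip k h (skip k h' ph) v = skip k (h \<circ> h') ph v"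
 using ext by (simp add: skip_def min_def)
qed
lemma skip_skip: "skip k (skip l h) ph = skip (k + l) h ph"
proof
 fix v
 show "skip k (skip l h) ph v = skip (k + l) h ph v"
 by (auto simp: skip_def take_add[of k l] add.commute[of l k])
qed
lemma VW_D: "ph : VW n ==> length v < n | ~ set v <= {..<N} ==> ph v = 0"
 unfolding VW_def using linorder_not_le by blast
lemma VW_I: assumes "!!v. length v < n | ~ set v <= {..<N} ==> ph v = 0" shows "ph : VW n"
 unfolding VW_def using assms linorder_not_le by blast
lemma VW_sect: "ph : VW (length x + n) ==> (%u. ph (x @ u)) : VW n"
 using VW_D[of ph "length x + n" "x @ _"] by (intro VW_I) auto
lemma VW_Cons: "ph : VW (Suc n) ==> (%u. ph (i # u)) : VW n" using VW_sect[of ph "[i]" n] by simp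
lemma VW_0: "(%_. 0) : VW n" by (simp add: VW_def)
lemma VW_le: "ph : VW n ==> m <= n ==> ph : VW m" by (auto simp: VW_def)

text \<open>The last clause says that the operator preserves the state \<open>st\<close>. Operators
  further left depend on their right neighbours through that state only, so this clause yields the
  interchange law.\<close>

definition Op :: "nat => nat => ((nat list => 'f) => nat list => 'f) => bool" where
 "Op m n h \<longleftrightarrow> (ALL k ph. ph : VW (n + k) --> h ph : VW (m + k))
  & (ALL c ph ps v. h (%u. c * ph u + ps u) v = c * h ph v + h ps v)
  & (ALL H ph v. h (%u. H (st u) * ph u) v = H (st v) * h ph v)"
lemma OpI: "(!!k ph. ph : VW (n + k) ==> h ph : VW (m + k)) ==> (!!c ph ps v. h (%u. c * ph u + ps u) v = c * h ph v + h ps v)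
 ==> (!!H ph v. h (%u. H (st u) * ph u) v = H (st v) * h ph v) ==> Op m n h"
 by (auto simp: Op_def)
lemma OpD: assumes "Op m n h" shows "ph : VW (n + k) ==> h ph : VW (m + k)"
 "h (%u. c * ph u + ps u) v = c * h ph v + h ps v"
 "h (%u. H (st u) * ph u) v = H (st v) * h ph v"
 using assms unfolding Op_def by blast+
lemma Op_VW: "Op m n h ==> ph : VW n ==> h ph : VW m" using OpD(1)[of m n h ph 0] by simp
lemma Op_zero: "Op m n h ==> h (%_. 0) v = 0" using OpD(3)[of m n h "%_. 0" "%_. 0" v] by simp
lemma Op_cmult: "Op m n h ==> h (%u. c * ph u) v = c * h ph v"
 using OpD(3)[of m n h "%_. c" ph v] by simp
lemma Op_add: "Op m n h ==> h (%u. ph u + ps u) v = h ph v + h ps v"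
 using OpD(2)[of m n h 1 ph ps v] by simp
lemma Op_diff: "Op m n h ==> h (%u. ph u - ps u) v = h ph v - h ps v"
 using OpD(2)[of m n h "-1" ps ph v] by simp
lemma Op_sum: assumes "Op m n h" "finite B" shows "h (%u. SUM k:B. ph k u) v = (SUM k:B. h (ph k) v)"
 using assms(2) by (induction B rule: finite_induct) (simp_all add: Op_zero[OF assms(1)] Op_add[OF assms(1)])
lemma Op_id: "Op n n id" by (rule OpI) auto
lemma Op_comp: assumes "Op m p h" "Op p n h'" shows "Op m n (h \<circ> h')"
proof (rule OpI)
 have e: "h' (%u. c * ph u + ps u) = (%u. c * h' ph u + h' ps u)" "h' (%u. H (st u) * ph u) = (%u. H (st u) * h' ph u)"
  for c ph ps H using OpD[OF assms(2)] by auto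
 fix k c ph ps v H
 show "ph : VW (n + k) ==> (h \<circ> h') ph : VW (m + k)" using OpD(1)[OF assms(1)] OpD(1)[OF assms(2)] by simp
 show "(h \<circ> h') (%u. c * ph u + ps u) v = c * (h \<circ> h') ph v + (h \<circ> h') ps v"
  using OpD(2)[OF assms(1)] by (simp add: e)
 show "(h \<circ> h') (%u. H (st u) * ph u) v = H (st v) * (h \<circ> h') ph v"
  using OpD(3)[OF assms(1)] by (simp add: e)
qed
lemma st_append: "st (x @ u) = fold flp (rev x) (st u)" by (induction x) auto
lemma Op_skip: assumes h: "Op m n h" shows "Op (p + m) (p + n) (skip p h)"
proof (rule OpI)
 fix k c ph ps v H
 show "skip p h ph : VW (p + m + k)" if f: "ph : VW (p + n + k)"
 proof (rule VW_I)
  fix v :: "nat list" assume v: "length v < p + m + k | ~ set v <= {..<N}"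
  show "skip p h ph v = 0"
  proof (cases "length v < p")
   case False
   have "(%u. ph (take p v @ u)) : VW (n + k)" using VW_sect[of ph "take p v" "n + k"] f False by (simp add: add.assoc min_def)
   hence hv: "h (%u. ph (take p v @ u)) : VW (m + k)" by (rule OpD(1)[OF h])
   show ?thesis
   proof (cases "set (take p v) <= {..<N}")
    case True
    have "set v = set (take p v) \<union> set (drop p v)" by (metis append_take_drop_id set_append)
    hence "length (drop p v) < m + k | ~ set (drop p v) <= {..<N}" using v True False by auto
    thus ?thesis using VW_D[OF hv] False by (simp add: skip_def)
   next
    case F: False
    hence "(%u. ph (take p v @ u)) = (%_. 0)" using VW_D[OF f] by auto
    thus ?thesis by (simp add: skip_def Op_zero[OF h])
   qed
  qed (simp add: skip_def)
 qed
 show "skip p h (%u. c * ph u + ps u) v = c * skip p h ph v + skip p h ps v"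
  by (simp add: skip_def OpD(2)[OF h])
 show "skip p h (%u. H (st u) * ph u) v = H (st v) * skip p h ph v"
 proof (cases "length v < p")
  case False
  have "h (%u. (%s. H (fold flp (rev (take p v)) s)) (st u) * ph (take p v @ u)) (drop p v) =
    H (fold flp (rev (take p v)) (st (drop p v))) * h (%u. ph (take p v @ u)) (drop p v)"
   using OpD(3)[OF h, where H = "%s. H (fold flp (rev (take p v)) s)"] .
  thus ?thesis using False by (simp add: skip_def st_append) (simp flip: st_append)
 qed (simp add: skip_def)
qed
lemma Op_opg: "Op (gtgt g) (gsrc g) (opg g)"
proof (rule OpI)
 fix k c ph ps v H
 show "opg g (%u. c * ph u + ps u) v = c * opg g ph v + opg g ps v"
  by (cases "(g, ph, v)" rule: opg.cases) (simp_all add: tl2_lin al2_lin ul2_lin distrib_left mult.left_commute)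
 show "opg g (%u. H (st u) * ph u) v = H (st v) * opg g ph v"
 proof (cases "(g, ph, v)" rule: opg.cases)
  case (2 f i j u)
  thus ?thesis using tl2_state[of "st u" H] by simp
 next
  case (3 f u)
  thus ?thesis using al2_state[of "st u" H] by simp
 qed (auto simp: ul2_def)
 show "opg g ph : VW (gtgt g + k)" if f: "ph : VW (gsrc g + k)"
 proof (rule VW_I)
  fix v :: "nat list" assume v: "length v < gtgt g + k | ~ set v <= {..<N}"
  thus "opg g ph v = 0" using VW_D[OF f]
  proof (cases "(g, ph, v)" rule: opg.cases)
   case (2 f i j u)
   show ?thesis
   proof (cases "length u < k | ~ set u <= {..<N}")
    case True
    hence "ph (p # r # u) = 0" for p r using VW_D[OF f] 2 by auto
    thus ?thesis using 2 by (auto intro: tl2_eq_0)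
   next
    case False
    have "ph (p # r # u) = 0" if "~ p < N | ~ r < N" for p r using VW_D[OF f, of "p # r # u"] that by auto
    hence "sup2 (%p r. ph (p # r # u))" unfolding sup2_def by blast
    thus ?thesis using sup2D[OF sup2_tl2] 2 v False by auto
   qed
  qed (auto simp: al2_def ul2_def)
 qed
qed
lemma Op_opn: "wt e ==> Op (tgt e) (src e) (opn e)"
proof (induction e)
 case (Comp f g)
 hence "Op (tgt f) (src g) (opn f \<circ> opn g)" by (intro Op_comp[of _ "tgt g"]) auto
 thus ?case by (simp only: opn.simps src.simps tgt.simps)
next
 case (Tens f g)
 have "Op (tgt f + tgt g) (src f + tgt g) (opn f)"
  using Tens by (auto simp: Op_def add.assoc)
 moreover have "Op (tgt g) (src g) (opn g)" using Tens by simp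
 ultimately have "Op (tgt f + tgt g) (src f + src g) (opn f \<circ> skip (src f) (opn g))"
  by (rule Op_comp[OF _ Op_skip])
 thus ?case by (simp only: opn.simps src.simps tgt.simps)
qed (simp_all add: Op_opg Op_id)
lemma skip_cong: assumes "!!ps v. ps : VW n ==> h1 ps v = h2 ps v" "ph : VW (k + n)" shows "skip k h1 ph = skip k h2 ph"
proof
 fix v
 show "skip k h1 ph v = skip k h2 ph v"
 using VW_sect[of ph "take k v" n] assms(2) assms(1) by (simp add: min_def skip_def)
qed
lemma opg_skip: assumes G: "Op m n G" and f: "ph : VW (gsrc g + n)"
 shows "opg g (skip (gsrc g) G ph) v = skip (gtgt g) G (opg g ph) v"
proof (cases "(g, ph, v)" rule: opg.cases)
 case (1 f i u)
 thus ?thesis using OpD(3)[OF G, where H = "%s. s i"] by (simp add: One_nat_def)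
next
 case (2 f i j u)
 show ?thesis
 proof (cases "i = j")
  case True
  show ?thesis using OpD(3)[OF G, where H = "%s. (df s i * cf s _ - (if _ = i then 1 else 0)) / (s _ + s i)"] sum.cong 2 True Op_zero[OF G] by (simp add: Op_sum[OF G finite_lessThan] numeral_2_eq_2 tl2_def)
 next
  case False
  show ?thesis using OpD(3)[OF G, where H = "%s. inverse (s i - s j)" and ph = "%w. ph (i # j # w) - ph (j # i # w)" and v = u] 2 False by (simp add: divide_inverse mult.commute Op_diff[OF G] numeral_2_eq_2 tl2_def)
 qed
next
 case (3 f u)
 show ?thesis using OpD(3)[OF G, where H = "%s. cf s _"] sum.cong 3 by (simp add: Op_sum[OF G finite_lessThan] numeral_2_eq_2 al2_def opg_Cap)
next
 case (4 f i j u)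
 have "G (%w. df (st w) i * ph w) u = df (st u) i * G ph u" using OpD(3)[OF G, where H = "%s. df s i"] .
 thus ?thesis using 4 Op_zero[OF G] by (cases "(i = j & i < N) = True") (simp_all add: numeral_2_eq_2 ul2_def del: eq_True eq_False de_Morgan_conj)
qed (auto simp: numeral_2_eq_2 One_nat_def)
text \<open>The interchange law of the model: \<open>f\<close> depends on the strands behind it only
  through their state, and \<open>G\<close> preserves the state.\<close>

lemma opn_skip: assumes "wt f" "Op m n G" "ph : VW (src f + n)"
 shows "opn f (skip (src f) G ph) = skip (tgt f) G (opn f ph)"
 using assms
proof (induction f arbitrary: m n G ph)
 case (Gen g) thus ?case using opg_skip[of m n G ph g] by (intro ext) simp
next
 case (Comp f g)
 show ?case using OpD(1)[OF Op_opn] Comp.prems Comp by simp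
next
 case (Tens f g)
 have w: "wt f" "wt g" using Tens.prems by auto
 have p: "ph : VW (src f + (src g + n))" using Tens.prems by (simp add: add.assoc)
 have "opn (Tens f g) (skip (src f + src g) G ph) = opn f (skip (src f) (opn g \<circ> skip (src g) G) ph)"
  by (simp add: skip_comp flip: skip_skip)
 also have "skip (src f) (opn g \<circ> skip (src g) G) ph = skip (src f) (skip (tgt g) G \<circ> opn g) ph"
  by (rule skip_cong[OF _ p]) (simp add: Tens.IH(2)[OF w(2) Tens.prems(2)])
 also have "... = skip (src f) (skip (tgt g) G) (skip (src f) (opn g) ph)" by (simp add: skip_comp)
 also have "opn f ... = skip (tgt f) (skip (tgt g) G) (opn f (skip (src f) (opn g) ph))"
 proof (rule Tens.IH(1)[OF w(1) Op_skip[OF Tens.prems(2)]])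
  show "skip (src f) (opn g) ph : VW (src f + (tgt g + n))"
   using OpD(1)[OF Op_skip[OF Op_opn[OF w(2)]], of ph "src f" n] p by (simp add: add.assoc)
 qed
 finally show ?case by (simp add: skip_skip)
qed simp
lemma opn_VW: "wt e ==> ph : VW (src e) ==> opn e ph : VW (tgt e)" by (rule Op_VW[OF Op_opn])
lemma skip_id: "ph : VW k ==> skip k id ph = ph" by (intro ext) (simp add: skip_def VW_D)
lemma opn_interchange:
 assumes "wt f" "wt g" "wt f'" "wt g'" "src f = tgt g" "src f' = tgt g'" "ph : VW (src g + src g')"
 shows "opn (Tens (Comp f g) (Comp f' g')) ph = opn (Comp (Tens f f') (Tens g g')) ph"
proof -
 have p: "skip (src g) (opn g') ph : VW (src g + src f')"
  using Op_VW[OF Op_skip[OF Op_opn[OF assms(4)]], of ph "src g"] assms by simp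
 let ?A = "(skip (src g) (opn g') ph)"
 have "opn (Tens (Comp f g) (Comp f' g')) ph = opn f (opn g (skip (src g) (opn f') ?A))"
  by (simp add: skip_comp)
 also have "opn g (skip (src g) (opn f') ?A) = skip (tgt g) (opn f') (opn g ?A)"
  by (rule opn_skip[OF assms(2) Op_opn[OF assms(3)] p])
 finally show ?thesis using assms by simp
qed

definition "sc3 ph u p m r = ph (p # m # r # u)"
definition "sc1 ph u p = ph (p # u)"
lemma sc3_app: "sc3 ph u p = (%m r. ph (p # m # r # u))" by (intro ext) (simp add: sc3_def)
lemma sc3: "ph : VW 3 ==> sup3 (sc3 ph u)"
proof -
 assume f: "ph : VW 3"
 have "ph (p # m # r # u) = 0" if "~ p < N | ~ m < N | ~ r < N" for p m r using VW_D[OF f, of "p # m # r # u"] that by auto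
 thus ?thesis unfolding sup3_def sc3_def by blast
qed
lemma sc1: "ph : VW 1 ==> ~ p < N ==> sc1 ph u p = 0"
 unfolding sc1_def by (rule VW_D) auto
lemma sc_ops:
 "ph : VW 2 ==> sc3 (opn (Tens eT I1) ph) u = t0 (st u) (sc3 ph u)"
 "sc3 (opn (Tens I1 eT) ph) u = t1 (st u) (sc3 ph u)"
 "ph : VW 2 ==> sc1 (opn (Tens eCap I1) ph) u = a0 (st u) (sc3 ph u)"
 "sc1 (opn (Tens I1 eCap) ph) u = a1 (st u) (sc3 ph u)"
 "sc3 (opn (Tens eCup I1) ps) u = u0 (st u) (sc1 ps u)"
 "sc3 (opn (Tens I1 eCup) ps) u = u1 (st u) (sc1 ps u)"
 using skip_id[of ph 2, unfolded numeral_2_eq_2]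
 by (auto simp: fun_eq_iff sc3_def sc1_def t0_def t1_def a0_def a1_def u0_def u1_def op3_app sc3_app One_nat_def numeral_2_eq_2 opg_Cap
   simp flip: id_def)
lemma nb_braid: assumes f: "ph : VW 3"
 shows "opn (Comp (Tens eT I1) (Comp (Tens I1 eT) (Tens eT I1))) ph = opn (Comp (Tens I1 eT) (Comp (Tens eT I1) (Tens I1 eT))) ph"
  (is "opn ?a ph = opn ?b ph")
proof
 fix v
 have w: "ps : VW 3 ==> opn (Tens eT I1) ps : VW 3" "ps : VW 3 ==> opn (Tens I1 eT) ps : VW 3" for ps
  using opn_VW[of "Tens eT I1" ps] opn_VW[of "Tens I1 eT" ps] by (simp_all add: numeral_3_eq_3 del: opn.simps)
 have le: "ps : VW 3 ==> ps : VW 2" for ps by (rule VW_le) auto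
 have C: "opn (Comp e e') ps = opn e (opn e' ps)" for e e' ps by simp
 show "opn ?a ph v = opn ?b ph v"
 proof (cases "length v < 3")
  case True
  thus ?thesis using VW_D[OF w(1)[OF w(2)[OF w(1)[OF f]]]] VW_D[OF w(2)[OF w(1)[OF w(2)[OF f]]]] unfolding C by metis
 next
  case False
  then obtain i j k u where v: "v = i # j # k # u" by (auto simp: numeral_3_eq_3 not_less Suc_le_length_iff)
  have "sc3 (opn ?a ph) u = sc3 (opn ?b ph) u"
   using braid3[OF gst_st sc3[OF f], of u u] f w le unfolding C D3_def[OF gst_st] by (simp add: sc_ops del: opn.simps One_nat_def)
  thus ?thesis unfolding v sc3_def by meson
 qed
qed
lemma nb_pitch: assumes f: "ph : VW 3"
 shows "opn (Comp (Tens I1 eCap) (Tens eT I1)) ph = opn (Comp (Tens eCap I1) (Tens I1 eT)) ph" (is "opn ?a ph = opn ?b ph")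
proof
 fix v
 have w: "opn ?a ph : VW 1" "opn ?b ph : VW 1" "opn (Tens I1 eT) ph : VW 2"
  using opn_VW[of ?a ph] opn_VW[of ?b ph] VW_le[OF opn_VW[of "Tens I1 eT" ph], of 2] f by (simp_all add: numeral_3_eq_3 del: opn.simps)
 show "opn ?a ph v = opn ?b ph v"
 proof (cases v)
  case Nil
  thus ?thesis using VW_D[OF w(1), of v] VW_D[OF w(2), of v] by simp
 next
  case (Cons i u)
  have C: "opn (Comp e e') ps = opn e (opn e' ps)" for e e' ps by simp
  have "sc1 (opn ?a ph) u = sc1 (opn ?b ph) u"
   using a1t0[OF gst_st sc3[OF f], of u u] VW_le[OF f, of 2] w(3) unfolding C by (simp add: sc_ops del: opn.simps One_nat_def)
  thus ?thesis unfolding Cons sc1_def by meson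
 qed
qed
lemma nb_zig: assumes f: "ph : VW 1"
 shows "opn (Comp (Tens eCap I1) (Tens I1 eCup)) ph = ph" (is "opn ?a ph = _")
  and "opn (Comp (Tens I1 eCap) (Tens eCup I1)) ph = ph" (is "opn ?b ph = _")
proof -
 have w: "opn ?a ph : VW 1" "opn ?b ph : VW 1" "opn (Tens I1 eCup) ph : VW 2"
  using opn_VW[of ?a ph] opn_VW[of ?b ph] VW_le[OF opn_VW[of "Tens I1 eCup" ph], of 2] f by (simp_all add: numeral_3_eq_3 del: opn.simps)
 have C: "opn (Comp e e') ps = opn e (opn e' ps)" for e e' ps by simp
 have n: "sc1 ph u i = 0 | i < N" for u i using sc1[OF f] by blast
 have "sc1 (opn ?a ph) u i = sc1 ph u i" "sc1 (opn ?b ph) u i = sc1 ph u i" for u i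
  unfolding C using a0u1[OF gst_st[of u], of "sc1 ph u" i] a1u0[OF gst_st[of u], of "sc1 ph u" i] n[of u i] w(3) by (simp_all add: sc_ops del: opn.simps One_nat_def)
 thus "opn ?a ph = ph" "opn ?b ph = ph"
  using VW_D[OF w(1), of "[]"] VW_D[OF w(2), of "[]"] VW_D[OF f, of "[]"]
  by (auto simp del: opn.simps simp: fun_eq_iff sc1_def) (metis list.exhaust)+
qed
lemma sc2_sup: assumes f: "ph : VW 2" shows "sup2 (%p m. ph (p # m # u))"
proof -
 have "ph (p # m # u) = 0" if "~ p < N | ~ m < N" for p m using VW_D[OF f, of "p # m # u"] that by auto
 thus ?thesis unfolding sup2_def by blast
qed
lemma two_cases: "(!!i j u. P (i # j # u)) ==> length v < 2 | P v"
 by (cases v; cases "tl v") auto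
lemma nb_TT: assumes f: "ph : VW 2" shows "opn (Comp eT eT) ph v = 0"
proof -
 have "length v < 2 | opn (Comp eT eT) ph v = 0"
  by (rule two_cases) (simp add: loc_TT[OF gst_st sc2_sup[OF f]])
 moreover have "opn (Comp eT eT) ph : VW 2" using opn_VW[of "Comp eT eT" ph] f by simp
 ultimately show ?thesis using VW_D by blast
qed
lemma nb_AU: "opn (Comp eCap eCup) ph v = of_nat (N mod 2) * ph v"
 using loc_AU[OF gst_st, of v "ph v"] by (simp add: al2_def ul2_def)
lemma nb_AT: "opn (Comp eCap eT) ph v = 0"
 using loc_AT[OF gst_st, of v] by simp
lemma nb_XT: assumes f: "ph : VW 2"
 shows "opn (Comp (Tens eX I1) eT) ph v - opn (Comp eT (Tens I1 eX)) ph v - opn (Tens I1 I1) ph v + opn (Comp eCup eCap) ph v = 0"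
  (is "?F v = 0")
proof -
 have 1: "opn (Tens I1 I1) ph = ph" using skip_id[OF VW_le[OF f, of 1]] by simp
 have 2: "opn (Comp (Tens eX I1) eT) ph = opn eX (opn eT ph)"
  using skip_id[OF VW_le[of "opn eT ph" 2 1]] opn_VW[of eT ph] f by simp
 have "length v < 2 | ?F v = 0"
 proof (rule two_cases)
  fix i j u
  show "?F (i # j # u) = 0"
   unfolding 1 2 using loc_XT[OF gst_st[of u] sc2_sup[OF f, of u], of j i]
   by (simp add: One_nat_def opg_Cap)
 qed
 moreover have "?F : VW 2"
 proof (rule VW_I)
  fix v :: "nat list" assume v: "length v < 2 | ~ set v <= {..<N}"
  have "opn (Comp (Tens eX I1) eT) ph : VW 2" "opn (Comp eT (Tens I1 eX)) ph : VW 2" "opn (Comp eCup eCap) ph : VW 2"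
   using opn_VW[of "Comp (Tens eX I1) eT" ph] opn_VW[of "Comp eT (Tens I1 eX)" ph] opn_VW[of "Comp eCup eCap" ph] f
   by (simp_all add: numeral_2_eq_2 del: opn.simps)
  from VW_D[OF this(1) v] VW_D[OF this(2) v] VW_D[OF this(3) v] VW_D[OF f v] show "?F v = 0"
   unfolding 1 by (simp del: opn.simps)
 qed
 ultimately show ?thesis using VW_D by blast
qed
lemma nb_AX: assumes f: "ph : VW 2" shows "opn (Comp eCap (Tens I1 eX)) ph v + opn (Comp eCap (Tens eX I1)) ph v = 0"
using skip_id[OF VW_le[OF f]] by (simp add: al2_def One_nat_def sum.distrib[symmetric])

end

section \<open>The action of the path algebra on the model\<close>

locale nbm = model N base + nbt ty
 for N and base :: "nat => 'f::field" and ty :: "('a::field, 'b::tparam) nb itself" +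
 fixes emb :: "'a => 'f"
 assumes emb: "emb 0 = 0" "emb 1 = 1" "emb (x + y) = emb x + emb y" "emb (x * y) = emb x * emb y"
  and Nt: "N mod 2 = tparam TYPE('b)"
begin
lemma emb_neg: "emb (- x) = - emb x"
 using emb(3)[of x "- x"] emb(1) by (simp add: eq_neg_iff_add_eq_0 add.commute)
lemma emb_of_nat: "emb (of_nat k) = of_nat k" by (induction k) (simp_all add: emb)

definition ev :: "nat => nat => 'a comb => (nat list => 'f) => nat list => 'f" where
 "ev m n c ph v = (SUM e:{e. c e ~= 0 & src e = n & tgt e = m}. emb (c e) * opn e ph v)"
lemma ev_alt: assumes "finite B" "{e. c e ~= 0} <= B"
 shows "ev m n c ph v = (SUM e:B. if src e = n & tgt e = m then emb (c e) * opn e ph v else 0)"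
proof -
 have "(SUM e:B. if src e = n & tgt e = m then emb (c e) * opn e ph v else 0) =
  (SUM e:{e. c e ~= 0 & src e = n & tgt e = m}. if src e = n & tgt e = m then emb (c e) * opn e ph v else 0)"
  by (rule sum.mono_neutral_right) (use assms emb(1) in auto)
 also have "... = ev m n c ph v" unfolding ev_def by (rule sum.cong) auto
 finally show ?thesis by simp
qed
lemma ev_czero [simp]: "ev m n czero ph v = 0" by (simp add: ev_def czero_def)
lemma ev_dl [simp]: "ev m n (dl e) ph v = (if src e = n & tgt e = m then opn e ph v else 0)"
 by (subst ev_alt[of "{e}"]) (auto simp: dl_def emb)
lemma ev_dl': "ev m n (dl e) ph = (if src e = n & tgt e = m then opn e ph else (%_. 0))"
 by (intro ext) simp
lemma ev_cadd: assumes "good a" "good b" shows "ev m n (cadd a b) ph v = ev m n a ph v + ev m n b ph v"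
proof -
 let ?B = "{e. a e ~= 0} \<union> {e. b e ~= 0}"
 have f: "finite ?B" using assms by (auto simp: good_def)
 have 1: "ev m n (cadd a b) ph v = (SUM e:?B. if src e = n & tgt e = m then emb (cadd a b e) * opn e ph v else 0)"
  by (rule ev_alt[OF f]) (auto simp: cadd_def)
 have 2: "ev m n a ph v = (SUM e:?B. if src e = n & tgt e = m then emb (a e) * opn e ph v else 0)"
  by (rule ev_alt[OF f]) auto
 have 3: "ev m n b ph v = (SUM e:?B. if src e = n & tgt e = m then emb (b e) * opn e ph v else 0)"
  by (rule ev_alt[OF f]) auto
 show ?thesis unfolding 1 2 3 sum.distrib[symmetric] by (intro sum.cong) (auto simp: cadd_def emb algs)
qed
lemma ev_csc: assumes "good a" shows "ev m n (csc x a) ph v = emb x * ev m n a ph v"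
proof -
 let ?B = "{e. a e ~= 0}"
 have f: "finite ?B" using assms by (auto simp: good_def)
 have 1: "ev m n (csc x a) ph v = (SUM e:?B. if src e = n & tgt e = m then emb (csc x a e) * opn e ph v else 0)"
  by (rule ev_alt[OF f]) (auto simp: csc_def)
 have 2: "ev m n a ph v = (SUM e:?B. if src e = n & tgt e = m then emb (a e) * opn e ph v else 0)"
  by (rule ev_alt[OF f]) auto
 show ?thesis unfolding 1 2 sum_distrib_left by (intro sum.cong) (auto simp: csc_def emb algs)
qed
lemma ev_cdiff: "good a ==> good b ==> ev m n (cdiff a b) ph v = ev m n a ph v - ev m n b ph v"
 by (simp add: cdiff_alt ev_cadd ev_csc good_csc emb_neg emb(2))
lemma ev_step: "wt e ==> good a ==> ev m n (cadd (csc x (dl e)) a) ph v = emb x * ev m n (dl e) ph v + ev m n a ph v"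
 by (simp only: ev_cadd ev_csc good_csc good_dl)
lemma Op_ev: assumes "good a" shows "Op m n (ev m n a)"
 using assms
proof (induction a rule: good_induct)
 case zero
 show ?case by (rule OpI) (auto simp: VW_0 fun_eq_iff VW_def)
next
 case (add c e a)
 have 1: "Op m n (ev m n (dl e))"
 proof (cases "src e = n & tgt e = m")
  case True
  hence "ev m n (dl e) = opn e" by (intro ext) simp
  thus ?thesis using Op_opn[OF add.hyps(1)] True by simp
 next
  case False
  thus ?thesis by (intro OpI) (auto simp: VW_def)
 qed
 show ?case
 proof (rule OpI)
  fix k d ph ps v H
  let ?A = "(cadd (csc c (dl e)) a)"
  show "ev m n ?A ph : VW (m + k)" if "ph : VW (n + k)"
  proof (rule VW_I)
   fix v :: "nat list" assume v: "length v < m + k | ~ set v <= {..<N}"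
   show "ev m n ?A ph v = 0"
    using VW_D[OF OpD(1)[OF 1 that] v] VW_D[OF OpD(1)[OF add.IH that] v] add.hyps by (simp add: ev_step del: ev_dl)
  qed
  show "ev m n ?A (%u. d * ph u + ps u) v = d * ev m n ?A ph v + ev m n ?A ps v"
   using OpD(2)[OF 1] OpD(2)[OF add.IH] add.hyps by (simp add: ev_step algs del: ev_dl)
  show "ev m n ?A (%u. H (st u) * ph u) v = H (st v) * ev m n ?A ph v"
   using OpD(3)[OF 1, of H] OpD(3)[OF add.IH, of H] add.hyps by (simp add: ev_step algs del: ev_dl)
 qed
qed
lemma skip_add: "skip k (%ps v. x * h1 ps v + h2 ps v) ph v = x * skip k h1 ph v + skip k h2 ph v"
 by (simp add: skip_def)
lemma ev_abs: "wt e ==> good a ==> ev m n (cadd (csc x (dl e)) a) = (%ph v. emb x * ev m n (dl e) ph v + ev m n a ph v)"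
 by (intro ext) (rule ev_step)
lemma ev_comp_left: assumes "good a" "wt e"
 shows "ev m n (comp (dl e) a) ph v = (if tgt e = m then opn e (ev (src e) n a ph) v else 0)"
 using assms(1)
proof (induction a rule: good_induct)
 case zero
 have "ev (src e) n czero ph = (%_. 0)" by (intro ext) simp
 thus ?case using Op_zero[OF Op_opn[OF assms(2)]] by simp
next
 case (add c f a)
 show ?case using Op_zero[OF Op_opn[OF assms(2)]] add OpD(2)[OF Op_opn[OF assms(2)]] assms(2) by (simp add: comp_dl ev_dl' comp_cadd_right comp_csc_right ev_cadd ev_csc good_csc good_comp good_dl ev_abs)
qed
lemma ev_comp_right: assumes "good a" "wt e"
 shows "ev m n (comp a (dl e)) ph v = (if src e = n then ev m (tgt e) a (opn e ph) v else 0)"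
 using assms(1)
proof (induction a rule: good_induct)
 case (add c f a)
 show ?case using add assms(2) by (simp add: comp_dl comp_cadd_left comp_csc_left ev_cadd ev_csc good_csc good_comp good_dl)
qed simp
lemma ev_tens_left: assumes "good a" "wt e"
 shows "ev m n (tens (dl e) a) ph v = (if tgt e <= m & src e <= n then opn e (skip (src e) (ev (m - tgt e) (n - src e) a) ph) v else 0)"
 using assms(1)
proof (induction a rule: good_induct)
 case zero
 thus ?case using Op_zero[OF Op_opn[OF assms(2)]] by (simp add: skip_def[abs_def] cong: if_cong)
next
 case (add c f a)
 have "ev m n (tens (dl e) (dl f)) ph v = (if tgt e <= m & src e <= n then opn e (skip (src e) (ev (m - tgt e) (n - src e) (dl f)) ph) v else 0)"
 proof (cases "src e + src f = n & tgt e + tgt f = m")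
  case True
  hence "ev (m - tgt e) (n - src e) (dl f) = opn f" by (intro ext) auto
  thus ?thesis using True by (auto simp: tens_dl)
 next
  case False
  hence "ev (m - tgt e) (n - src e) (dl f) = (%ph v. 0)" if "tgt e <= m" "src e <= n" using that by (intro ext) auto
  thus ?thesis using False Op_zero[OF Op_opn[OF assms(2)]] by (auto simp: tens_dl skip_def[abs_def])
 qed
 moreover have "opn e (skip (src e) (%ph v. x * h1 ph v + h2 ph v) ph) v = x * opn e (skip (src e) h1 ph) v + opn e (skip (src e) h2 ph) v" for x h1 h2
  using OpD(2)[OF Op_opn[OF assms(2)]] by (simp add: skip_add[abs_def])
 ultimately show ?case using add assms(2)
  by (simp add: tens_cadd_right tens_csc_right ev_cadd ev_csc good_csc good_tens good_dl ev_abs del: ev_dl)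
qed
lemma ev_tens_right: assumes "good a" "wt e"
 shows "ev m n (tens a (dl e)) ph v = (if tgt e <= m & src e <= n then ev (m - tgt e) (n - src e) a (skip (n - src e) (opn e) ph) v else 0)"
 using assms(1)
proof (induction a rule: good_induct)
 case (add c f a)
 show ?case using add assms(2) by (auto simp: tens_dl tens_cadd_left tens_csc_left ev_cadd ev_csc good_csc good_tens good_dl)
qed simp
lemma ev_struct: assumes a: "a : structural" and f: "ph : VW n" shows "ev m n a ph v = 0"
proof -
 have eq: "ev m n (cdiff (dl e) (dl e')) ph v = 0"
  if "wt e" "wt e'" "src e = src e'" "tgt e = tgt e'" "src e = n ==> opn e ph v = opn e' ph v" for e e'
  using that by (simp add: ev_cdiff good_dl)
 from a consider
  f g h where "a = cdiff (dl (Comp (Comp f g) h)) (dl (Comp f (Comp g h)))" "wt f" "wt g" "wt h" "src f = tgt g" "src g = tgt h"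
 | f where "a = cdiff (dl (Comp (Id (tgt f)) f)) (dl f)" "wt f"
 | f where "a = cdiff (dl (Comp f (Id (src f)))) (dl f)" "wt f"
 | f g h where "a = cdiff (dl (Tens (Tens f g) h)) (dl (Tens f (Tens g h)))" "wt f" "wt g" "wt h"
 | f where "a = cdiff (dl (Tens (Id 0) f)) (dl f)" "wt f"
 | f where "a = cdiff (dl (Tens f (Id 0))) (dl f)" "wt f"
 | k l where "a = cdiff (dl (Tens (Id k) (Id l))) (dl (Id (k + l)))"
 | f g f' g' where "a = cdiff (dl (Tens (Comp f g) (Comp f' g'))) (dl (Comp (Tens f f') (Tens g g')))"
   "wt f" "wt g" "wt f'" "wt g'" "src f = tgt g" "src f' = tgt g'"
  unfolding structural_def by blast
 thus ?thesis
 proof cases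
  case 4
  thus ?thesis unfolding 4(1) by (intro eq) (auto simp: skip_comp skip_skip comp_def[symmetric] simp flip: skip_skip)
 next
  case 6
  thus ?thesis using f unfolding 6(1) by (intro eq) (auto simp: skip_id)
 next
  case 7
  thus ?thesis using f VW_le[OF f, of k] unfolding 7(1) by (intro eq) (auto simp: skip_id)
 next
  case 8
  thus ?thesis using f opn_interchange[of f g f' g' ph] unfolding 8(1) by (intro eq) (auto simp del: opn.simps)
 qed (auto intro!: eq)
qed
lemma ev_nbrels: assumes a: "a : nbrels (tparam TYPE('b))" and f: "ph : VW n" shows "ev m n a ph v = 0"
proof -
 have g: "wt e ==> good (dl e)" for e by (rule good_dl)
 consider "a = dl (Comp eT eT)"
 | "a = cdiff (dl (Comp (Tens eT I1) (Comp (Tens I1 eT) (Tens eT I1)))) (dl (Comp (Tens I1 eT) (Comp (Tens eT I1) (Tens I1 eT))))"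
 | "a = cdiff (dl (Comp eCap eCup)) (csc (of_nat (tparam TYPE('b))) (dl (Id 0)))"
 | "a = cdiff (dl (Comp (Tens eCap I1) (Tens I1 eCup))) (dl I1)"
 | "a = cdiff (dl (Comp (Tens I1 eCap) (Tens eCup I1))) (dl I1)"
 | "a = dl (Comp eCap eT)"
 | "a = cdiff (dl (Comp (Tens I1 eCap) (Tens eT I1))) (dl (Comp (Tens eCap I1) (Tens I1 eT)))"
 | "a = lc [(1, Comp (Tens eX I1) eT), (-1, Comp eT (Tens I1 eX)), (-1, Tens I1 I1), (1, Comp eCup eCap)]"
 | "a = lc [(1, Comp eCap (Tens I1 eX)), (1, Comp eCap (Tens eX I1))]"
  using a unfolding nbrels_def by blast
 thus ?thesis
 proof cases
  case 1 thus ?thesis using nb_TT[of ph v] f by (auto simp del: opn.simps simp: numeral_2_eq_2)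
 next
  case 2 thus ?thesis using nb_braid[of ph] f by (auto simp del: opn.simps simp: ev_cdiff g numeral_3_eq_3)
 next
  case 3
  thus ?thesis using nb_AU[of ph v] Nt by (auto simp del: opn.simps(1,3,4) simp: ev_cdiff ev_csc good_csc g emb_of_nat)
 next
  case 4 thus ?thesis using nb_zig(1)[of ph] f by (auto simp del: opn.simps(1,3,4) simp: ev_cdiff g)
 next
  case 5 thus ?thesis using nb_zig(2)[of ph] f by (auto simp del: opn.simps(1,3,4) simp: ev_cdiff g)
 next
  case 6 thus ?thesis using nb_AT[of ph v] by (auto simp del: opn.simps)
 next
  case 7 thus ?thesis using nb_pitch[of ph] f by (auto simp del: opn.simps simp: ev_cdiff g numeral_3_eq_3)
 next
  case 8
  thus ?thesis using nb_XT[of ph v] f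
   by (auto simp del: opn.simps simp: lc_Cons lc_Nil ev_cadd ev_csc good_cadd good_csc g emb emb_neg numeral_2_eq_2 algs)
 next
  case 9
  thus ?thesis using nb_AX[of ph v] f
   by (auto simp del: opn.simps simp: lc_Cons lc_Nil ev_cadd ev_csc good_cadd good_csc g emb numeral_2_eq_2)
 qed
qed
lemma ev_rel: assumes "a : rel (tparam TYPE('b))" shows "ph : VW n ==> ev m n a ph v = 0"
 using assms
proof (induction arbitrary: m n ph v rule: rel.induct)
 case (rel_compL a e)
 have "ev (src e) n a ph = (%_. 0)" using rel_compL by (intro ext) simp
 thus ?case using rel_good[OF rel_compL.hyps(1)] Op_zero[OF Op_opn[OF rel_compL.hyps(2)]] rel_compL.hyps(2) by (simp add: ev_comp_left)
next
 case (rel_compR a e)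
 thus ?case using rel_good[OF rel_compR.hyps(1)] opn_VW by (auto simp: ev_comp_right)
next
 case (rel_tensL a e)
 have "skip (src e) (ev (m - tgt e) (n - src e) a) ph = skip (src e) (%_ _. 0) ph" if "src e <= n"
  by (rule skip_cong[where n = "n - src e"]) (use rel_tensL that in auto)
 thus ?case using rel_good[OF rel_tensL.hyps(1)] Op_zero[OF Op_opn[OF rel_tensL.hyps(2)]] rel_tensL.hyps(2) by (auto simp: ev_tens_left skip_def[abs_def])
next
 case (rel_tensR a e)
 have "skip (n - src e) (opn e) ph : VW (n - src e)" if "src e <= n"
  using VW_le[OF Op_VW[OF Op_skip[OF Op_opn[OF rel_tensR.hyps(2)]], of ph "n - src e"]] rel_tensR.prems that by simp
 thus ?case using rel_tensR rel_good[OF rel_tensR.hyps(1)] by (auto simp: ev_tens_right)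
qed (auto simp: ev_struct ev_nbrels ev_cadd ev_csc rel_good)

definition act :: "nat => nat => ('a, 'b) nb => (nat list => 'f) => nat list => 'f" where
 "act m n y = ev m n (qr y)"
lemma Op_act: "Op m n (act m n y)" unfolding act_def by (rule Op_ev[OF qr(1)])
lemma act_qa: assumes "good a" "ph : VW n" shows "act m n (qa a) ph v = ev m n a ph v"
proof -
 have "cdiff (qr (qa a :: ('a, 'b) nb)) a : rel (tparam TYPE('b))" by (rule rel_qr[OF assms(1)])
 from ev_rel[OF this assms(2), of m v] show ?thesis using assms(1) qr(1)[of "qa a :: ('a, 'b) nb"]
  unfolding act_def by (simp add: ev_cdiff)
qed

context
 fixes ph n assumes f: "ph : VW n"
begin
lemma act_add: "act m n (y + z) ph v = act m n y ph v + act m n z ph v"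
 using f by (cases y; cases z) (simp add: qa_add act_qa ev_cadd good_cadd)
lemma act_smul: "act m n (c *s y) ph v = emb c * act m n y ph v"
 using f by (cases y) (simp add: qa_smul act_qa ev_csc good_csc)
lemma act_q: "wt e ==> act m n (q e) ph v = (if src e = n & tgt e = m then opn e ph v else 0)"
 using f by (simp add: q_def act_qa good_dl)
lemma act_0: "act m n 0 ph v = 0" using act_smul[of m 0 0 v] emb(1) by simp
lemma act_sum: "finite B ==> act m n (sum y B) ph v = (SUM k:B. act m n (y k) ph v)"
 by (induction B rule: finite_induct) (simp_all add: act_0 act_add)
lemma act_I: "act n n (I n) ph v = ph v" by (simp add: I_def act_q)
lemma act_VW: "act m n y ph : VW m" by (rule Op_VW[OF Op_act f])
end
lemma act_step: "ph : VW n ==> act m n (c *s y + z) ph = (%v. emb c * act m n y ph v + act m n z ph v)"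
 by (intro ext) (simp add: act_add act_smul)
lemma act_mult: assumes f: "ph : VW n" and z: "hm p n z" shows "act m n (y * z) ph v = act m p y (act p n z ph) v"
proof -
 have "act m n (y * (ii p * z)) ph v = act m p y (act p n z ph) v" for y z
 proof (induction z rule: nb_induct)
  case zero
  show ?case using act_0[OF f] ext f act_0 Op_zero[OF Op_act] by simp
 next
  case (add c e z)
  have "act m n (y * (ii p * q e)) ph v = act m p y (act p n (q e) ph) v"
  proof (induction y rule: nb_induct)
   case zero
   thus ?case using act_0[OF f] act_0[OF act_VW[OF f]] by simp
  next
   case (add d e' y)
   have "act m n (q e' * (ii p * q e)) ph v = act m p (q e') (act p n (q e) ph) v"
   proof (cases "p = tgt e & src e = n")
    case True
    have "opn e ph : VW (tgt e)" using opn_VW[OF \<open>wt e\<close>] f True by simp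
    moreover have "act p n (q e) ph = opn e ph" using True act_q[OF f \<open>wt e\<close>] by (intro ext) simp
    ultimately show ?thesis using True act_q act_0 f \<open>wt e\<close> \<open>wt e'\<close> by (auto simp: I_q q_mult)
   next
    case False
    have "act p n (q e) ph = (%_. 0)" using False act_q[OF f \<open>wt e\<close>] by (intro ext) auto
    thus ?thesis using False act_q[OF f] act_0[OF f] \<open>wt e\<close> \<open>wt e'\<close> Op_zero[OF Op_act] by (auto simp: I_q q_mult)
   qed
   thus ?case using add f act_VW[OF f] by (simp add: distrib_right act_add act_smul)
  qed
  thus ?case using add f OpD(2)[OF Op_act] by (simp add: distrib_left act_add act_smul act_step)
 qed
 from this[of y z] show ?thesis using hm_left[OF z] by simp
qed
lemma act_ten: assumes f: "ph : VW (k + n)" shows "act (k + m) (k + n) (I k ** y) ph v = skip k (act m n y) ph v"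
proof (cases "length v < k")
 case True
 thus ?thesis using VW_D[OF act_VW[OF f, of "k + m" "I k ** y"], of v] by (simp add: skip_def)
next
 case False
 have s: "(%u. ph (take k v @ u)) : VW n" using VW_sect[of ph "take k v" n] f False by (simp add: min_def)
 show ?thesis
 using act_0[OF f] act_0[OF s] act_q[OF f] act_q[OF s] False f s by (induction y rule: nb_induct) (auto simp: skip_def I_def ten_q ten_add_right act_add act_smul)
qed
lemma act_L: "ph : VW (Suc n) ==> act (Suc m) (Suc n) (L y) ph (i # u) = act m n y (%u. ph (i # u)) u"
 using act_ten[of ph 1 n m y "i # u"] by (simp add: L_def)
lemma act_X0: "ph : VW (Suc n) ==> act (Suc n) (Suc n) (xx (Suc n) 0) ph (i # u) = st u i * ph (i # u)"
proof -
 assume f: "ph : VW (Suc n)"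
 have "xx (Suc n) 0 = q (Tens eX (Id n))" by (simp add: X_def pd_def gx_def) (simp add: I_def ten_q)
 thus ?thesis using act_q[OF f, of "Tens eX (Id n)"] skip_id[OF VW_le[OF f, of 1]] by (simp add: One_nat_def)
qed
lemma act_T0: "ph : VW (Suc (Suc n)) ==> act (Suc (Suc n)) (Suc (Suc n)) (tt (Suc (Suc n)) 0) ph (i # j # u) = tl2 (st u) (%p r. ph (p # r # u)) i j"
proof -
 assume f: "ph : VW (Suc (Suc n))"
 have "tt (Suc (Suc n)) 0 = q (Tens eT (Id n))" by (simp add: T_def pd_def gt_def) (simp add: I_def ten_q)
 thus ?thesis using act_q[OF f, of "Tens eT (Id n)"] skip_id[OF VW_le[OF f, of 2]] by (simp add: numeral_2_eq_2)
qed
lemma act_U0: "ph : VW n ==> act (Suc (Suc n)) n (uu (Suc (Suc n)) 0) ph (i # j # u) = ul2 (st u) (ph u) i j"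
proof -
 assume f: "ph : VW n"
 have "uu (Suc (Suc n)) 0 = q (Tens eCup (Id n))" by (simp add: U_def pd_def gu_def) (simp add: I_def ten_q)
 thus ?thesis using act_q[OF f, of "Tens eCup (Id n)"] by simp
qed

end

section \<open>Specialised standard modules and the independence of the basis diagrams\<close>

context model begin
lemma gbase: "gst base" using gst_st[of "[]"] by simp

definition LE :: "nat => (nat list => 'f) => bool" where "LE k ph \<longleftrightarrow> (ALL v. ph v ~= 0 --> length v <= k)"
lemma LE_D: "LE k ph ==> k < length v ==> ph v = 0" unfolding LE_def by (meson not_less)
lemma LE_I: "(!!v. k < length v ==> ph v = 0) ==> LE k ph" unfolding LE_def by (meson not_less)
lemma opg_LE: assumes "LE (gsrc g + k) ph" shows "LE (gtgt g + k) (opg g ph)"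
proof (rule LE_I)
 fix v :: "nat list" assume v: "gtgt g + k < length v"
 show "opg g ph v = 0"
 proof (cases "(g, ph, v)" rule: opg.cases)
  case (2 f i j u)
  have "ph (p # r # u) = 0" for p r using LE_D[OF assms, of "p # r # u"] v 2 by simp
  thus ?thesis using 2 by (simp add: tl2_eq_0)
 next
  case (3 f u)
  have "ph (p # r # u) = 0" for p r using LE_D[OF assms, of "p # r # u"] v 3 by simp
  thus ?thesis using 3 by (simp add: al2_def)
 qed (use LE_D[OF assms] v in "auto simp: ul2_def")
qed
lemma opn_LE: "wt e ==> LE (src e + k) ph ==> LE (tgt e + k) (opn e ph)"
proof (induction e arbitrary: k ph)
 case (Tens f g)
 have "LE (src f + (tgt g + k)) (skip (src f) (opn g) ph)"
 proof (rule LE_I)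
  fix v :: "nat list" assume v: "src f + (tgt g + k) < length v"
  have "LE (src g + k) (%u. ph (take (src f) v @ u))"
   using Tens.prems(2) v by (auto simp: LE_def)
  from Tens.IH(2)[OF _ this] Tens.prems(1) have "LE (tgt g + k) (opn g (%u. ph (take (src f) v @ u)))" by simp
  from LE_D[OF this, of "drop (src f) v"] show "skip (src f) (opn g) ph v = 0" using v by (simp add: skip_def)
 qed
 from Tens.IH(1)[OF _ this] Tens.prems(1) show ?case by (simp add: add.assoc)
qed (auto simp: opg_LE)

end

context nbm begin

definition VE :: "nat => (nat list => 'f) set" where "VE n = {ph : VW n. LE n ph}"
lemma VE_D: "ph : VE n ==> length v ~= n | ~ set v <= {..<N} ==> ph v = 0"
 using VW_D LE_D unfolding VE_def by (metis (mono_tags, lifting) linorder_neqE_nat mem_Collect_eq)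
lemma VE_I: "(!!v. length v ~= n | ~ set v <= {..<N} ==> ph v = 0) ==> ph : VE n"
 unfolding VE_def by (auto intro!: VW_I LE_I)
lemma VE_VW: "ph : VE n ==> ph : VW n" by (simp add: VE_def)
lemma act_VE: assumes f: "ph : VE n" shows "act m n y ph : VE m"
proof -
 have "LE m (act m n y ph)"
 proof (rule LE_I)
  fix v :: "nat list" assume v: "m < length v"
  have "act m n (q e) ph v = 0" if "wt e" for e
   using opn_LE[OF that, of 0 ph] f v LE_D by (auto simp: act_q VE_VW that) (metis VE_def add.right_neutral mem_Collect_eq)
  thus "act m n y ph v = 0"
   by (induction y rule: nb_induct) (simp_all add: act_0 act_add act_smul VE_VW[OF f])
 qed
 thus ?thesis using act_VW[OF VE_VW[OF f]] by (simp add: VE_def)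
qed
text \<open>To the right of all \<open>n\<close> letters the bubble sees only the state
  \<open>base\<close>, so it acts by one scalar.\<close>

lemma act_rb: assumes f: "ph : VE n"
 shows "act n n (rb n k) ph v = act 0 0 (lb 0 k) (%u. if u = [] then 1 else 0) [] * ph v"
proof (cases "length v = n")
 case True
 have "(%u. ph (v @ u)) = (%u. ph v * (if u = [] then 1 else 0))"
  using VE_D[OF f] True by (intro ext) auto
 thus ?thesis
  using act_ten[of ph n 0 0 "lb 0 k" v] VE_VW[OF f] True by (simp add: rb_def pd_def skip_def Op_cmult[OF Op_act] mult.commute)
next
 case False
 thus ?thesis using VE_D[OF f] VE_D[OF act_VE[OF f]] by simp
qed

text \<open>The vector \<open>vI J\<close>, the sum of all orderings of the letters in \<open>J\<close>, generates a copy of a specialised standard module.\<close>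

definition vI :: "nat set => nat list => 'f" where
 "vI J v = (if distinct v & set v = J then 1 else 0)"
lemma vI_VE: "J <= {..<N} ==> vI J : VE (card J)"
 by (rule VE_I) (auto simp: vI_def distinct_card)
lemma vI_Cons: "(%u. vI J (i # u)) = (if i : J then vI (J - {i}) else (%_. 0))"
 by (auto simp: vI_def fun_eq_iff)
lemma st_notin: "i ~: set v ==> st v i = base i" by (induction v) auto
lemma st_distinct: "distinct v ==> st v i = (if i : set v then - base i else base i)"
 by (induction v) (auto simp: st_notin flp_def)
lemma st_vI: "vI J v ~= 0 ==> st v = (%i. if i : J then - base i else base i)"
 by (auto simp: vI_def fun_eq_iff st_distinct split: if_splits)
text \<open>The state of every ordering of \<open>J\<close> is \<open>base\<close> with the signs at
  \<open>J\<close> reversed, and operators preserve states. A word with that state contains every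
  letter of \<open>J\<close>, so it is not shorter than \<open>card J\<close>.\<close>

lemma act_less_0: assumes J: "J <= {..<N}" "m < card J" shows "act m (card J) y (vI J) v = 0"
proof (rule ccontr)
 let ?n = "card J"
 let ?s = "%i. if i : J then - base i else base i"
 assume a: "act m ?n y (vI J) v ~= 0"
 hence l: "length v = m" using VE_D[OF act_VE[OF vI_VE[OF J(1)]], of v] by blast
 have "(%u. (if st u = ?s then 1 else 0) * vI J u) = vI J" using st_vI by (intro ext) force
 hence "act m ?n y (vI J) v = (if st v = ?s then 1 else 0) * act m ?n y (vI J) v"
  using OpD(3)[OF Op_act[of m ?n y], where H = "%s. if s = ?s then 1 else 0" and ph = "vI J" and v = v] by simp
 hence s: "st v = ?s" using a by (auto split: if_splits)
 have "J <= set v"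
 proof
  fix i assume i: "i : J"
  thus "i : set v" using gstD(3)[OF gbase] J st_notin[of i v] s i by fastforce
 qed
 hence "card J <= length v" using card_length[of v] card_mono[of "set v" J] by simp
 thus False using J(2) l by simp
qed
lemma act_Tk: assumes "ph : VW n" "length x + 2 <= n"
 shows "act n n (tt n (length x)) ph (x @ i # j # u) = tl2 (st u) (%p r. ph (x @ p # r # u)) i j"
 using assms
proof (induction x arbitrary: n ph)
 case Nil
 then obtain p where "n = Suc (Suc p)" by (cases n; cases "n - 1") auto
 thus ?case using act_T0[of ph p] Nil by simp
next
 case (Cons k x)
 then obtain p where n: "n = Suc p" by (cases n) auto
 show ?case using act_L[of ph p p "tt p (length x)" k "x @ i # j # u"] Cons.IH[of "%u. ph (k # u)" p] Cons.prems VW_Cons n by (simp add: n)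
qed
lemma act_T_vI: assumes J: "J <= {..<N}" shows "act (card J) (card J) (tt (card J) k) (vI J) v = 0"
proof (cases "Suc k < card J & length v = card J")
 case True
 define x where "x = take k v"
 have l: "length (drop k v) >= 2" using True by auto
 then obtain i j u where d: "drop k v = i # j # u" by (metis One_nat_def Suc_1 Suc_le_length_iff)
 have v: "v = x @ i # j # u" "length x = k" using d True by (auto simp: x_def min_def) (metis append_take_drop_id)
 show ?thesis using act_Tk[of "vI J" "card J" x i j u] v True VE_VW[OF vI_VE[OF J]] by (simp add: tl2_def vI_def insert_commute)
next
 case False
 thus ?thesis using VE_D[OF act_VE[OF vI_VE[OF J]]] act_0[OF VE_VW[OF vI_VE[OF J]]] by (auto simp: T_def)
qed
lemma act_Kst: assumes "y : Kst n" "J <= {..<N}" "n = card J" shows "act m n y (vI J) v = 0"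
 using assms(1)
proof (induction rule: Kst.induct)
 note f = VE_VW[OF vI_VE[OF assms(2), folded assms(3)]]
 note a = act_add[OF f] act_0[OF f]
 {
  case (Kst_low y)
  thus ?case
  proof (induction rule: low.induct)
   case (low_step v' p y z)
   have h: "hm p n (ii p * (z * ii n))" by (simp add: hm_def I_I assoc[symmetric]) (simp add: I_I assoc)
   have "act p n (ii p * (z * ii n)) (vI J) = (%_. 0)" using act_less_0[OF assms(2), of p] low_step(2) assms(3) by blast
   hence "act m n (y * (ii p * (z * ii n))) (vI J) v = 0" using act_mult[OF f h] Op_zero[OF Op_act] by simp
   thus ?case using low_step by (simp add: distrib_right a assoc)
  qed (simp add: a)
 next
  case (Kst_T y i)
  have "act n n (tt n i) (vI J) = (%_. 0)" using act_T_vI[OF assms(2)] assms(3) by blast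
  thus ?case using act_mult[OF f hm_T] Op_zero[OF Op_act] by simp
 next
  case (Kst_add y z)
  thus ?case by (simp add: a)
 }
qed

definition "esc J r = coeff (PROD j:J. [:1, base j:]) r"
lemma act_el: "J <= {..<N} ==> act (card J) (card J) (el (card J) r) (vI J) v = esc J r * vI J v"
proof (induction "card J" arbitrary: J r v)
 case 0
 hence J: "J = {}" using finite_subset[of J "{..<N}"] by simp
 have f: "vI J : VW 0" using VE_VW[OF vI_VE[OF 0(2)]] 0(1) by simp
 show ?case using act_I[OF f, of v] act_0[OF f] J by (auto simp: esc_def)
next
 case (Suc n)
 have fJ: "finite J" using finite_subset[OF Suc.prems] by simp
 note f = VE_VW[OF vI_VE[OF Suc.prems], folded Suc.hyps(2)]
 show ?case
 proof (cases v)
  case Nil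
  thus ?thesis using VE_D[OF vI_VE[OF Suc.prems], of v] VE_D[OF act_VE[OF vI_VE[OF Suc.prems]], of v] Suc.hyps(2) by simp
 next
  case (Cons i u)
  have L: "act (Suc n) (Suc n) (L (el n r)) (vI J) (i # u) = (if i : J then esc (J - {i}) r * vI J (i # u) else 0)" for r
  proof (cases "i : J")
   case True
   hence c: "n = card (J - {i})" using Suc.hyps(2) fJ by simp
   have "act n n (el n r) (vI (J - {i})) u = esc (J - {i}) r * vI (J - {i}) u"
    using Suc.hyps(1)[OF c, of r u] Suc.prems unfolding c[symmetric] by blast
   moreover have "vI (J - {i}) = (%u. vI J (i # u))" using True by (simp add: vI_Cons)
   ultimately show ?thesis using True act_L[OF f, of n "el n r" i u] by simp
  next
   case False
   thus ?thesis using act_L[OF f, of n "el n r" i u] Op_zero[OF Op_act] by (simp add: vI_Cons)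
  qed
  have X: "act (Suc n) (Suc n) (xx (Suc n) 0 * L (el n r)) (vI J) (i # u) = st u i * act (Suc n) (Suc n) (L (el n r)) (vI J) (i # u)" for r
   using act_mult[OF f hm_L[OF hm_el]] act_X0[OF act_VW[OF f]] by simp
  have e: "esc J r = esc (J - {i}) r + (if r = 0 then 0 else base i * esc (J - {i}) (r - 1))" if "i : J"
  proof -
   have "(PROD j:J. [:1, base j:]) = [:1, base i:] * (PROD j:J - {i}. [:1, base j:])" using prod.remove[OF fJ that] .
   thus ?thesis by (cases r) (simp_all add: esc_def mult_pCons_left)
  qed
  have "act (Suc n) (Suc n) (el (Suc n) r) (vI J) (i # u) = esc J r * vI J (i # u)"
  proof (cases "i : J")
   case True
   show ?thesis using True by (simp add: vI_def st_notin act_add[OF f] act_0[OF f] algs X L e[OF True])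
  next
   case False
   thus ?thesis using L X False by (auto simp: vI_def act_add[OF f] act_0[OF f])
  qed
  thus ?thesis using Cons Suc.hyps(2) by simp
 qed
qed

text \<open>Interpolates between the letter \<open>i\<close> in front of all orderings of
  \<open>J\<close> (\<open>k = 0\<close>) and a multiple of \<open>vI (insert i J)\<close>
  (\<open>k = card J\<close>). Each crossing acts as a divided difference and lengthens by one the
  prefix in which \<open>i\<close> may stand.\<close>

definition dI :: "nat => nat set => nat => nat list => 'f" where
 "dI i J k v = (if distinct v & set v = insert i J & i : set (take (Suc k) v)
   then PROD j:set (take (Suc k) v) - {i}. inverse (base i - base j) else 0)"
lemma dI_VE: "insert i J <= {..<N} ==> i ~: J ==> n = card J ==> dI i J k : VE (Suc n)"
proof (rule VE_I)
 fix v :: "nat list"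
 assume a: "insert i J <= {..<N}" "i ~: J" "n = card J" "length v ~= Suc n | ~ set v <= {..<N}"
 show "dI i J k v = 0" using a finite_subset[of J "{..<N}"] distinct_card[of v] by (auto simp: dI_def)
qed
lemma dI_step: assumes J: "insert i J <= {..<N}" "i ~: J" and k: "length x = k"
 shows "tl2 (st u) (%p r. dI i J k (x @ p # r # u)) a b = dI i J (Suc k) (x @ a # b # u)"
proof (cases "a = b")
 case True
 thus ?thesis by (simp add: tl2_def dI_def)
next
 case ne: False
 show ?thesis
 proof (cases "distinct (x @ a # b # u) & set (x @ a # b # u) = insert i J")
  case False
  hence "dI i J k (x @ a # b # u) = 0" "dI i J k (x @ b # a # u) = 0" "dI i J (Suc k) (x @ a # b # u) = 0"
   by (auto simp: dI_def insert_commute)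
  thus ?thesis using ne by (simp add: tl2_def)
 next
  case True
  have s: "st u a = base a" "st u b = base b" using True by (auto intro: st_notin)
  have N: "a < N" "b < N" "i < N" using True J by auto
  have nz: "base a - base b ~= 0" using gstD(6)[OF gbase N(1,2) ne] .
  have P: "dI i J k (x @ p # r # u) = (if i : insert p (set x) then PROD j:insert p (set x) - {i}. inverse (base i - base j) else 0)"
   if "p = a & r = b | p = b & r = a" for p r
   using True that k by (auto simp: dI_def insert_commute)
  let ?A = "(insert b (set x))"
  have Q: "dI i J (Suc k) (x @ a # b # u) = (if i : insert a ?A then PROD j:insert a ?A - {i}. inverse (base i - base j) else 0)"
   using True k by (simp add: dI_def)
  have x: "a ~: set x" "b ~: set x" using True by auto
  let ?D = "(base a - base b)"
  have T: "tl2 (st u) (%p r. dI i J k (x @ p # r # u)) a b = (dI i J k (x @ a # b # u) - dI i J k (x @ b # a # u)) / ?D"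
   using ne s by (simp add: tl2_def)
  consider "i = a" | "i = b" | "i : set x" "i ~= a" "i ~= b" | "i ~: set x" "i ~= a" "i ~= b" by blast
  thus ?thesis
  proof cases
   case 1
   hence "insert a ?A - {i} = insert b (set x)" "insert a (set x) - {i} = set x" using x ne by auto
   thus ?thesis unfolding T Q using P[of a b] P[of b a] 1 x ne by (simp add: divide_inverse mult.commute)
  next
   case 2
   have e: "insert a ?A - {i} = insert a (set x)" "insert b (set x) - {i} = set x" using 2 x ne by auto
   have "inverse (base b - base a) = - inverse ?D" by (metis inverse_minus_eq minus_diff_eq)
   thus ?thesis unfolding T Q using P[of a b] P[of b a] 2 x ne e by (simp add: divide_inverse mult.commute)
  next
   case 3
   have e: "insert a ?A - {i} = insert a (insert b (set x - {i}))" "insert a (set x) - {i} = insert a (set x - {i})"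
    "insert b (set x) - {i} = insert b (set x - {i})" using 3 by auto
   have nz': "base i - base a ~= 0" "base i - base b ~= 0" using gstD(6)[OF gbase] N 3 by auto
   let ?B = "(base i - base b)"
   let ?C = "(base i - base a)"
   have "(inverse ?C - inverse ?B) / ?D = inverse ?C * inverse ?B"
    unfolding division_ring_inverse_diff[OF nz'] using nz by simp
   hence "(inverse ?C * P - inverse ?B * P) / ?D = inverse ?C * (inverse ?B * P)" for P
    by (metis (no_types, lifting) left_diff_distrib assoc mult.commute times_divide_eq_right)
   thus ?thesis unfolding T Q using P[of a b] P[of b a] 3 x ne unfolding e by simp
  next
   case 4
   thus ?thesis unfolding T Q using P[of a b] P[of b a] by simp
  qed
 qed
qed
lemma act_dsc: assumes J: "insert i J <= {..<N}" "i ~: J" and n: "n = card J" and k: "k <= n"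
 shows "act (Suc n) (Suc n) (dsc (Suc n) k) (dI i J 0) = dI i J k"
 using k
proof (induction k)
 case 0
 show ?case using act_I[OF VE_VW[OF dI_VE[OF J n]]] by (intro ext) simp
next
 case (Suc k)
 note f = dI_VE[OF J n]
 show ?case
 proof
  fix v
  have "act (Suc n) (Suc n) (dsc (Suc n) (Suc k)) (dI i J 0) v = act (Suc n) (Suc n) (tt (Suc n) k) (dI i J k) v"
   using act_mult[OF VE_VW[OF f[of 0]] hm_dsc[of "Suc n" k], of "Suc n" "tt (Suc n) k" v] Suc by simp
  also have "... = dI i J (Suc k) v"
  proof (cases "length v = Suc n")
   case True
   define x where "x = take k v"
   have l: "length (drop k v) >= 2" using True Suc by auto
   then obtain a b u where d: "drop k v = a # b # u" by (metis One_nat_def Suc_1 Suc_le_length_iff)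
   have v: "v = x @ a # b # u" "length x = k" using d True Suc by (auto simp: x_def min_def) (metis append_take_drop_id)
   show ?thesis unfolding v(1) using act_Tk[OF VE_VW[OF f], of x k a b u] dI_step[OF J v(2), of u a b] Suc v by simp
  next
   case False
   thus ?thesis using VE_D[OF f, of v] VE_D[OF act_VE[OF f], of v] by simp
  qed
  finally show "act (Suc n) (Suc n) (dsc (Suc n) (Suc k)) (dI i J 0) v = dI i J (Suc k) v" .
 qed
qed
lemma dI_top: "i ~: J ==> finite J ==> dI i J (card J) v = (PROD j:J. inverse (base i - base j)) * vI (insert i J) v"
using distinct_card[of v] by (auto simp: dI_def vI_def)
lemma act_bel_thr: assumes J: "J <= {..<N}" "n = card J" and c: "c < n"
 shows "act (Suc m) n (bel n (c # l)) (vI J) (i # u) = (if i : J then base i ^ c * act m (n - 1) (bel (n - 1) l) (vI (J - {i})) u else 0)"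
proof -
 obtain p where p: "n = Suc p" using c by (cases n) auto
 have f: "vI J : VW (Suc p)" using VE_VW[OF vI_VE[OF J(1)]] J(2) p by simp
 have s: "(%u. act (Suc p) (Suc p) (xp (Suc p) 0 c) (vI J) (i # u)) = (%u. base i ^ c * vI J (i # u))"
 proof (induction c)
  case 0
  thus ?case using act_I[OF f] by (intro ext) simp
 next
  case (Suc c)
  have "act (Suc p) (Suc p) (xp (Suc p) 0 (Suc c)) (vI J) (i # u) = st u i * (base i ^ c * vI J (i # u))" for u
   using act_mult[OF f hm_xp[of "Suc p" 0 c], of "Suc p" "xx (Suc p) 0" "i # u"] act_X0[OF act_VW[OF f, of "Suc p" "xp (Suc p) 0 c"], of i u] Suc by (simp add: fun_eq_iff)
  moreover have "st u i * vI J (i # u) = base i * vI J (i # u)" for u by (auto simp: vI_def st_notin)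
  ultimately show ?case by (intro ext) (simp add: algs)
 qed
 show ?thesis using act_mult[OF f hm_xp[of "Suc p" 0 c], of "Suc m" "L (bel p l)" "i # u"] act_L[OF act_VW[OF f, of "Suc p" "xp (Suc p) 0 c"], of m "bel p l" i u] c p s Op_zero[OF Op_act] by (simp add: Op_cmult[OF Op_act] vI_Cons)
qed
lemma act_bel_cup: assumes J: "insert i J <= {..<N}" "i ~: J" "n = card J" and c: "~ c < n"
 shows "act (Suc m) n (bel n (c # l)) (vI J) (i # u) =
  df (%i. if i : J then - base i else base i) i * base i ^ (c - n) * (PROD j:J. inverse (base i - base j)) * act m (Suc n) (bel (Suc n) l) (vI (insert i J)) u"
proof -
 let ?k = "df (%i. if i : J then - base i else base i) i"
 have fin: "finite J" using J(1) finite_subset[of J "{..<N}"] by auto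
 have f: "vI J : VW n" using VE_VW[OF vI_VE[of J]] J by simp
 have 1: "(%u. act (Suc (Suc n)) n (uu (Suc (Suc n)) 0) (vI J) (i # u)) = (%u. ?k * dI i J 0 u)"
 proof
  fix u
  show "act (Suc (Suc n)) n (uu (Suc (Suc n)) 0) (vI J) (i # u) = ?k * dI i J 0 u"
  proof (cases u)
   case Nil
   thus ?thesis using VW_D[OF act_VW[OF f, of "Suc (Suc n)"], of "[i]"] by (simp add: dI_def)
  next
   case (Cons k w)
   have "dI i J 0 (k # w) = (if k = i then vI J w else 0)" using J(2) by (auto simp: dI_def vI_def)
   moreover have "df (st w) i * vI J w = ?k * vI J w" using st_vI[of J w] by (cases "vI J w = 0") auto
   ultimately show ?thesis using Cons act_U0[OF f, of i k w] J by (auto simp: ul2_def)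
  qed
 qed
 have d: "dI i J 0 : VW (Suc n)" by (rule VE_VW[OF dI_VE[OF J]])
 have 2: "act (Suc n) (Suc n) (xp (Suc n) 0 c) (dI i J 0) = (%u. base i ^ c * dI i J 0 u)" for c
 proof (induction c)
  case 0
  thus ?case using act_I[OF d] by (intro ext) simp
 next
  case (Suc c)
  have "act (Suc n) (Suc n) (xp (Suc n) 0 (Suc c)) (dI i J 0) v = base i ^ Suc c * dI i J 0 v" for v
  proof (cases v)
   case Nil
   thus ?thesis using VW_D[OF act_VW[OF d, of "Suc n"], of "[]"] VW_D[OF d, of "[]"] by simp
  next
   case (Cons k w)
   have "st w k * dI i J 0 (k # w) = base i * dI i J 0 (k # w)" by (auto simp: dI_def st_notin)
   thus ?thesis using act_mult[OF d hm_xp[of "Suc n" 0 c], of "Suc n" "xx (Suc n) 0" v] act_X0[OF act_VW[OF d, of "Suc n" "xp (Suc n) 0 c"], of k w] Suc Cons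
    by (simp add: algs)
  qed
  thus ?case by blast
 qed
 have ab: "act m n y (%u. c * ps u) = (%u. c * act m n y ps u)" for m n y c ps by (intro ext) (rule Op_cmult[OF Op_act])
 let ?A = "(dsc (Suc n) n * xp (Suc n) 0 (c - n))"
 let ?B = "(%u. (PROD j:J. inverse (base i - base j)) * vI (insert i J) u)"
 let ?C = "(act (Suc n) (Suc n) (xp (Suc n) 0 (c - n)) (dI i J 0))"
 have "act (Suc m) n (bel n (c # l)) (vI J) (i # u) = act m (Suc n) (bel (Suc n) l * ?A) (%u. ?k * dI i J 0 u) u"
  using act_mult[OF f hm_U2[of n 0], of "Suc m" "L (bel (Suc n) l * ?A)" "i # u"]
   act_L[OF act_VW[OF f, of "Suc (Suc n)" "uu (Suc (Suc n)) 0"], of m "bel (Suc n) l * ?A" i u] c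
  unfolding 1 by (simp del: dsc.simps xp.simps)
 also have "... = ?k * act m (Suc n) (bel (Suc n) l) (act (Suc n) (Suc n) (dsc (Suc n) n) ?C) u"
 proof -
  have "act (Suc n) (Suc n) ?A (dI i J 0) = act (Suc n) (Suc n) (dsc (Suc n) n) ?C"
   by (intro ext) (rule act_mult[OF d hm_xp])
  thus ?thesis unfolding ab by (simp only: act_mult[OF d hm_mult[OF hm_dsc hm_xp]])
 qed
 also have "... = ?k * (base i ^ (c - n) * act m (Suc n) (bel (Suc n) l) ?B u)"
 proof -
  have "dI i J n = ?B"
   unfolding J(3) by (intro ext) (rule dI_top[OF J(2) fin])
  thus ?thesis unfolding 2 ab act_dsc[OF J order.refl] by (simp add: ab)
 qed
 finally show ?thesis by (simp add: ab assoc)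
qed

end
lemma vandermonde:
 fixes y :: "nat => 'f::field"
 assumes "M <= card B" "!!b. b : B ==> (SUM c<M. y c * b ^ c) = 0" "c < M"
 shows "y c = 0"
proof -
 let ?A = "(SUM c<M. monom (y c) c)"
 have "?A = 0"
 proof (rule poly_eqI_degree[where A = B])
  have "degree ?A < M"
   by (rule degree_sum_less) (use assms(3) in "auto intro: le_less_trans[OF degree_monom_le]")
  thus "degree ?A < card B" using assms(1) by simp
 qed (use assms in "auto simp: poly_sum poly_monom")
 hence "coeff ?A c = 0" by simp
 thus ?thesis using assms(3) by (simp add: coeff_sum coeff_monom)
qed

context nbt begin

definition Vl :: "nat => nat => nat => nat list set" where
 "Vl n m M = {l. val n l & length l = m & set l <= {..<M}}"
lemma finite_Vl: "finite (Vl n m M)"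
 by (rule finite_subset[OF _ finite_lists_length_eq[of "{..<M}" m]]) (auto simp: Vl_def)
lemma sum_Vl: "(SUM l:Vl n (Suc m) M. f l) = (SUM c<M. SUM l:Vl (if c < n then n - 1 else Suc n) m M. f (c # l))"
proof -
 have "(SUM c<M. SUM l:Vl (if c < n then n - 1 else Suc n) m M. f (c # l)) =
   (SUM (c, l):(SIGMA c:{..<M}. Vl (if c < n then n - 1 else Suc n) m M). f (c # l))"
  by (rule sum.Sigma) (auto simp: finite_Vl)
 also have "... = (SUM l:Vl n (Suc m) M. f l)"
  by (rule sum.reindex_bij_witness[where j = "%(c, l). c # l" and i = "%l. (hd l, tl l)"])
   (auto simp: Vl_def length_Suc_conv split: if_splits)
 finally show ?thesis by simp
qed
text \<open>Only cups lower the degree, each by at most 4 times the current number of strands, and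
  that number stays below \<open>n + length l\<close>. Hence bounded degree bounds the entries, and
  only finitely many diagrams remain.\<close>

lemma bdeg_ge: "2 * int (sum_list l) <= bdeg n l + 4 * int ((n + length l) * length l)"
proof (induction l arbitrary: n)
 case (Cons c l)
 let ?A = "((n + Suc (length l)) * length l)"
 have "int ((n - 1 + length l) * length l) <= int ?A"
  "int ((Suc n + length l) * length l) = int ?A"
  by (simp_all only: of_nat_le_iff) (intro mult_le_mono1, simp, simp)
 moreover have "4 * int ((n + Suc (length l)) * Suc (length l)) = 4 * int ?A + 4 * int n + 4 * int (Suc (length l))"
  by (simp add: algs)
 ultimately show ?case using Cons[of "n - 1"] Cons[of "Suc n"] by auto
qed simp

definition Bd :: "nat => nat => int => nat list set" where
 "Bd n m D = {l. val n l & length l = m & bdeg n l = D}"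
lemma bdeg_bound: "EX M. ALL l. val n l & length l = m & bdeg n l <= D --> l : Vl n m M"
proof (intro exI allI impI)
 fix l assume l: "val n l & length l = m & bdeg n l <= D"
 have "c < Suc (nat (D + 4 * int ((n + m) * m)))" if "c : set l" for c
  using member_le_sum_list[OF that] bdeg_ge[of l n] l by auto
 thus "l : Vl n m (Suc (nat (D + 4 * int ((n + m) * m))))" using l by (auto simp: Vl_def)
qed
lemma finite_Bd: "finite (Bd n m D)"
proof -
 obtain M where "ALL l. val n l & length l = m & bdeg n l <= D --> l : Vl n m M" using bdeg_bound by blast
 thus ?thesis by (intro finite_subset[OF _ finite_Vl[of n m M]]) (auto simp: Bd_def)
qed

end

context nbm begin
text \<open>Output words are compared by their first letter \<open>i\<close>. For \<open>i\<close>
  outside \<open>J\<close> only cups contribute, for \<open>i\<close> in \<open>J\<close> threads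
  do, and in both cases the first entry \<open>c\<close> appears as the exponent of
  \<open>base i\<close>. There are enough letters for a Vandermonde system in \<open>c\<close>; the
  tail of the diagram is covered by induction with \<open>insert i J\<close> or
  \<open>J - {i}\<close>.\<close>

lemma bel_ind:
 assumes J: "J <= {..<N}" "card J = n" "M + n + m <= N"
  and z: "!!v. (SUM l:Vl n m M. y l * act m n (bel n l) (vI J) v) = 0" and l: "l : Vl n m M"
 shows "y l = 0"
 using assms
proof (induction m arbitrary: n J y l)
 case 0
 hence l: "l = []" "n = 0" "Vl n 0 M = {[]}" by (auto simp: Vl_def)
 hence "J = {}" using finite_subset[OF 0(1)] 0(2) by simp
 moreover have "vI {} [] = 1" by (simp add: vI_def)
 ultimately show ?case using 0(4)[of "[]"] act_I[OF VE_VW[OF vI_VE[of "{}"]], of "[]"] l by simp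
next
 case (Suc m)
 have fJ: "finite J" using finite_subset[OF Suc.prems(1)] by simp
 have inj: "inj_on base {..<N}" using gstD(5)[OF gbase] by (force simp: inj_on_def)
 let ?nx = "%c. if c < n then n - 1 else Suc n"
 have Z: "(SUM c<M. SUM l:Vl (?nx c) m M. y (c # l) * act (Suc m) n (bel n (c # l)) (vI J) v) = 0" for v
  using Suc.prems(4)[of v] unfolding sum_Vl .
 have gen: "(SUM c<M. if P c then y (c # l) * kp c else 0) = 0"
  if P: "!!c. c < M ==> P c ==> ?nx c = n'" and J': "J' <= {..<N}" "card J' = n'" "M + n' + m <= N" and l: "l : Vl n' m M"
   and a: "!!c l u. c < M ==> l : Vl (?nx c) m M ==> y (c # l) * act (Suc m) n (bel n (c # l)) (vI J) (i # u) =
    (if P c then y (c # l) * (kp c * act m n' (bel n' l) (vI J') u) else 0)" for P kp n' J' l i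
 proof -
  have "(SUM l:Vl n' m M. (SUM c<M. if P c then y (c # l) * kp c else 0) * act m n' (bel n' l) (vI J') u) = 0" for u
  proof -
   have "(SUM l:Vl n' m M. (SUM c<M. if P c then y (c # l) * kp c else 0) * act m n' (bel n' l) (vI J') u) =
     (SUM c<M. SUM l:Vl n' m M. if P c then y (c # l) * (kp c * act m n' (bel n' l) (vI J') u) else 0)"
    unfolding sum_distrib_right by (subst sum.swap) (intro sum.cong refl, simp add: mult_ac)
   also have "... = (SUM c<M. SUM l:Vl (?nx c) m M. y (c # l) * act (Suc m) n (bel n (c # l)) (vI J) (i # u))"
   proof (rule sum.cong[OF refl])
    fix c assume c: "c : {..<M}"
    note a' = a[OF c[unfolded lessThan_iff]]
    show "(SUM l:Vl n' m M. if P c then y (c # l) * (kp c * act m n' (bel n' l) (vI J') u) else 0) =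
      (SUM l:Vl (?nx c) m M. y (c # l) * act (Suc m) n (bel n (c # l)) (vI J) (i # u))"
    proof (cases "P c")
     case True
     hence e: "?nx c = n'" using P c by blast
     show ?thesis unfolding e by (rule sum.cong[OF refl]) (rule a'[unfolded e, symmetric])
    qed (simp add: a' del: bel.simps)
   qed
   finally show ?thesis using Z by simp
  qed
  thus ?thesis by (rule Suc.IH[OF J', of "%l. SUM c<M. if P c then y (c # l) * kp c else 0", OF _ l])
 qed
 \<comment> \<open>Cups come first: threads vanish for \<open>i\<close> outside \<open>J\<close>,
   whereas \<open>act_bel_cup\<close> is available only there. The case of threads uses that the cup
   coefficients are already 0.\<close>
 have cup: "y (c # l) = 0" if c: "n <= c" "c < M" and l: "l : Vl (Suc n) m M" for c l
 proof -
  have V: "(SUM d<M. (if d + n < M then y ((d + n) # l) else 0) * base i ^ d) = 0" if i: "i < N" "i ~: J" for i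
  proof -
   define k where "k = df (%i. if i : J then - base i else base i) i * (PROD j:J. inverse (base i - base j))"
   have iJ: "insert i J <= {..<N}" "i ~: J" "n = card J" using i Suc.prems by auto
   have "(SUM c<M. if ~ c < n then y (c # l) * (k * base i ^ (c - n)) else 0) = 0"
   proof (rule gen[of "%c. ~ c < n" "Suc n" "insert i J" l i "%c. k * base i ^ (c - n)", OF _ iJ(1) _ _ l])
    fix c l u
    show "y (c # l) * act (Suc m) n (bel n (c # l)) (vI J) (i # u) =
     (if ~ c < n then y (c # l) * (k * base i ^ (c - n) * act m (Suc n) (bel (Suc n) l) (vI (insert i J)) u) else 0)"
     using act_bel_thr[OF Suc.prems(1) iJ(3), of c] i act_bel_cup[OF iJ, of c] by (cases "c < n") (simp_all add: k_def mult_ac del: bel.simps)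
   qed (use iJ fJ Suc.prems(3) in auto)
   also have "(SUM c<M. if ~ c < n then y (c # l) * (k * base i ^ (c - n)) else 0) = k * (SUM c<M. if c < n then 0 else y (c # l) * base i ^ (c - n))"
    unfolding sum_distrib_left by (intro sum.cong) auto
   finally have "k * (SUM c<M. if c < n then 0 else y (c # l) * base i ^ (c - n)) = 0" .
   moreover have "k ~= 0"
   proof -
    define x where "x = (SOME x. set x = J & distinct x)"
    have "set x = J & distinct x" unfolding x_def by (rule someI_ex) (rule finite_distinct_list[OF fJ])
    hence "st x = (%i. if i : J then - base i else base i)" by (auto simp: st_distinct)
    hence "df (%i. if i : J then - base i else base i) i ~= 0" using df_nz[OF gst_st[of x] i(1)] by simp
    moreover have "base i ~= base j" if "j : J" for j using gstD(5)[OF gbase i(1), of j] that iJ by auto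
    ultimately show ?thesis using fJ by (simp add: k_def)
   qed
   ultimately have "0 = (SUM c<M. if c < n then 0 else y (c # l) * base i ^ (c - n))" by simp
   also have "... = (SUM c:{n..<M}. y (c # l) * base i ^ (c - n))" by (rule sum.mono_neutral_cong_right) auto
   also have "... = (SUM d<M - n. y ((d + n) # l) * base i ^ d)"
    by (rule sum.reindex_bij_witness[where i = "%d. d + n" and j = "%c. c - n"]) auto
   also have "... = (SUM d<M. (if d + n < M then y ((d + n) # l) else 0) * base i ^ d)"
    by (rule sum.mono_neutral_cong_left) auto
   finally show ?thesis by simp
  qed
  have "card (base ` ({..<N} - J)) = N - n" using card_image[OF inj_on_subset[OF inj, of "{..<N} - J"]] Suc.prems card_Diff_subset[OF fJ] by auto
  hence B: "M <= card (base ` ({..<N} - J))" using Suc.prems(3) by simp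
  have "(%d. if d + n < M then y ((d + n) # l) else 0) (c - n) = 0"
   by (rule vandermonde[OF B]) (use V c in force, use c in simp)
  thus ?thesis using c by simp
 qed
 have thr: "y (c # l) = 0" if c: "c < n" "c < M" and l: "l : Vl (n - 1) m M" for c l
 proof -
  have V: "(SUM c<n. (if c < M then y (c # l) else 0) * base i ^ c) = 0" if i: "i : J" for i
  proof -
   have iJ: "J - {i} <= {..<N}" "card (J - {i}) = n - 1" using i Suc.prems fJ by auto
   have "0 = (SUM c<M. if c < n then y (c # l) * base i ^ c else 0)"
   proof (rule gen[of "%c. c < n" "n - 1" "J - {i}" l i "%c. base i ^ c", OF _ iJ _ l, symmetric])
    fix c l u assume c: "c < M" "l : Vl (?nx c) m M"
    show "y (c # l) * act (Suc m) n (bel n (c # l)) (vI J) (i # u) =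
     (if c < n then y (c # l) * (base i ^ c * act m (n - 1) (bel (n - 1) l) (vI (J - {i})) u) else 0)"
     using act_bel_thr[OF Suc.prems(1) Suc.prems(2)[symmetric], of c] i cup[of c l] c by (cases "c < n") (simp_all add: mult_ac del: bel.simps)
   qed (use Suc.prems(3) in auto)
   also have "... = (SUM c:{..<M} \<inter> {..<n}. y (c # l) * base i ^ c)" by (rule sum.mono_neutral_cong_right) auto
   also have "... = (SUM c<n. (if c < M then y (c # l) else 0) * base i ^ c)" by (rule sum.mono_neutral_cong_left) auto
   finally show ?thesis by simp
  qed
  have "card (base ` J) = n" using card_image[OF inj_on_subset[OF inj Suc.prems(1)]] Suc.prems by simp
  hence B: "n <= card (base ` J)" by simp
  have "(%c. if c < M then y (c # l) else 0) c = 0"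
   by (rule vandermonde[OF B]) (use V c in force, use c in simp)
  thus ?thesis using c by simp
 qed
 obtain c l' where "l = c # l'" "c < M" "l' : Vl (?nx c) m M"
  using Suc.prems(5) by (auto simp: Vl_def length_Suc_conv split: if_splits)
 thus ?case using thr cup by (cases "c < n") auto
qed

end

section \<open>The proper standard ideal and a basis modulo it\<close>

context nbt begin

inductive_set Kp :: "nat => ('a, 'b) nb set" for n where
 Kp_K: "y : Kst n ==> y : Kp n"
| Kp_el: "1 <= r ==> r <= n ==> y * el n r : Kp n"
| Kp_rb: "1 <= r ==> y * rb n r : Kp n"
| Kp_add: "y : Kp n ==> z : Kp n ==> y + z : Kp n"
lemma lideal_Kp: "lideal (Kp n)"
proof -
 have "y : Kp n ==> c *s y : Kp n" for y c
 proof (induction rule: Kp.induct)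
  case (Kp_el r y) thus ?case using Kp.Kp_el[of r n "c *s y"] by simp
 next
  case (Kp_rb r y) thus ?case using Kp.Kp_rb[of r "c *s y"] by simp
 qed (auto simp: smul_add intro: Kp.intros Kst_smul)
 moreover have "y : Kp n ==> u * y : Kp n" for y u
 proof (induction rule: Kp.induct)
  case (Kp_el r y) thus ?case using Kp.Kp_el[of r n "u * y"] by (simp add: assoc)
 next
  case (Kp_rb r y) thus ?case using Kp.Kp_rb[of r "u * y"] by (simp add: assoc)
 qed (auto simp: distrib_left intro: Kp.intros Kst_left)
 ultimately show ?thesis unfolding lideal_def using Kp_K[OF lidealD(1)[OF lideal_Kst]] by (auto intro: Kp_add)
qed
lemma Kp_right: "y : Kp n ==> y * ii n = y"
 by (induction rule: Kp.induct) (auto simp: assoc distrib_right hm_right[OF hm_el] hm_right[OF hm_rb] Kst_right)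
lemma hc_low: "v : low n ==> hc d v : low n"
proof (induction rule: low.induct)
 case (low_step v m y z)
 have "hc d (y * (ii m * z)) : low n"
 proof -
  obtain D where D: "y = (SUM d:D. hc d y)" "finite D" using hc_decomp[of y] by blast
  have "hc d (y * (ii m * z)) = (SUM e:D. hc (e + (d - e)) (hc e y * (ii m * z)))"
   by (subst D(1)) (simp add: sum_distrib_right hc_sum)
  also have "... = (SUM e:D. hc e y * (ii m * hc (d - e) z))"
   using hc_mult[OF dg_hc] hc_mult[OF dg_I, of _ m z] by (metis (no_types, lifting) add_0)
  finally show ?thesis using low_step.hyps(2) by (auto intro!: lideal_sum[OF lideal_low] low_gen)
 qed
 thus ?case using low_step by (simp add: hc_add low_add)
qed (simp add: low_0)
lemma hc_lmult: "dg e z ==> hc d (y * z) = hc (d - e) y * z" using hc_mult_right[of e z "d - e" y] by simp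
lemma hc_Kst: "y : Kst n ==> hc d y : Kst n"
 by (induction rule: Kst.induct) (auto simp: hc_lmult[OF dg_I] hc_lmult[OF dg_T] hc_add intro!: Kst.intros hc_low)
lemma hc_Kp: "y : Kp n ==> hc d y : Kp n"
proof (induction rule: Kp.induct)
 case (Kp_el r y) thus ?case using Kp.Kp_el[of r n "hc (d - 2 * int r) y"] by (simp add: hc_lmult[OF dg_el])
next
 case (Kp_rb r y) thus ?case using Kp.Kp_rb[of r "hc (d - 2 * int r) y"] by (simp add: hc_lmult[OF dg_rb])
qed (auto simp: hc_add intro: Kp_add Kp_K hc_Kst)

text \<open>Normal forms without basis elements that carry a trivial central coefficient; \<open>D\<close> fixes the degree.\<close>

inductive_set NP :: "nat => nat => int option => ('a, 'b) nb set" for n m D where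
 NP_K: "y : Kst n ==> y : NP n m D"
| NP_b: "val n l ==> length l = m ==> zmon n d z ==> 0 < d ==> D = None | D = Some (bdeg n l + 2 * int d) ==> bel n l * z : NP n m D"
| NP_add: "y : NP n m D ==> y' : NP n m D ==> y + y' : NP n m D"
| NP_smul: "y : NP n m D ==> c *s y : NP n m D"
lemma NP_0: "0 : NP n m D" by (rule NP_K) (rule lidealD(1)[OF lideal_Kst])
lemma dg_bel_zmon: "zmon n d z ==> dg (bdeg n l + 2 * int d) (bel n l * z)"
 by (rule dg_mult[OF dg_bel dg_zmon])
lemma NP_hc: "y : NP n m None ==> hc D y : NP n m (Some D)"
proof (induction rule: NP.induct)
 case (NP_b l d z)
 thus ?case using dg_hc_eq[OF dg_bel_zmon[OF NP_b(3), of l], of D] NP.NP_b[OF NP_b(1-4), of "Some D"] NP_0 by auto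
qed (auto simp: hc_add intro: NP.intros hc_Kst)
lemma NF_NP: assumes "y : NF n m"
 shows "1 <= r ==> r <= n ==> y * el n r : NP n m None" "1 <= r ==> y * rb n r : NP n m None"
 using assms
proof (induction rule: NF.induct)
 case (NF_b l d z)
 { case 1 thus ?case using NP_b[OF NF_b(1,2) zmon_el[OF NF_b(3)], of r None] by (simp add: assoc) }
 { case 2 thus ?case using NP_b[OF NF_b(1,2) zmon_rb[OF NF_b(3)], of r None] by (simp add: assoc) }
qed (auto simp: distrib_right intro: NP.intros Kst_el Kst_rb)
lemma Kp_NP: assumes "y : Kp n" "hm m n y" shows "y : NP n m None"
proof -
 have "ii m * y : NP n m None" using assms(1)
 proof (induction rule: Kp.induct)
  case (Kp_el r y)
  have "hm m n (ii m * y * ii n)" by (simp add: hm_def assoc I_I)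
  from NF_NP(1)[OF NF_all[OF this] Kp_el] show ?case by (simp add: assoc hm_left[OF hm_el])
 next
  case (Kp_rb r y)
  have "hm m n (ii m * y * ii n)" by (simp add: hm_def assoc I_I)
  from NF_NP(2)[OF NF_all[OF this] Kp_rb] show ?case by (simp add: assoc hm_left[OF hm_rb])
 qed (auto simp: distrib_left intro: NP.intros Kst_left)
 thus ?thesis using assms(2) by (simp add: hm_left)
qed
lemma zmon_Kp: "zmon n d z ==> 0 < d ==> y * z : Kp n"
proof (induction arbitrary: y rule: zmon.induct)
 case (zmon_el d z r) thus ?case using Kp_el[of r n "y * z"] by (simp add: assoc)
next
 case (zmon_rb d z r) thus ?case using Kp_rb[of r "y * z"] by (simp add: assoc)
qed simp
text \<open>In a normal form every central monomial of positive degree lies in \<open>Kp\<close>, so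
  only bare basis diagrams of degree \<open>D\<close> remain.\<close>

lemma span_Kp:
 assumes "hm m n y" "dg D y"
 shows "EX c. y - (SUM l:Bd n m D. c l *s bel n l) : Kp n"
proof -
 have "EX c. hc D y - (SUM l:Bd n m D. c l *s bel n l) : Kp n" if "y : NF n m" for y
  using that
 proof (induction rule: NF.induct)
  case (NF_K y)
  thus ?case by (intro exI[of _ "%_. 0"]) (simp add: Kp_K hc_Kst)
 next
  case (NF_b l d z)
  show ?case
  proof (cases "d = 0 & bdeg n l = D")
   case True
   hence z: "z = ii n" using NF_b(3) by (auto elim: zmon.cases)
   have "(SUM l':Bd n m D. (if l' = l then 1 else 0) *s bel n l') = (SUM l':Bd n m D. if l' = l then bel n l' else 0)"
    by (intro sum.cong) (auto simp del: bel.simps)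
   also have "... = bel n l" using finite_Bd NF_b True by (simp add: Bd_def del: bel.simps)
   finally show ?thesis using True z dg_hc_eq[OF dg_bel[of n l], of D] hm_right[OF hm_bel[OF NF_b(1)]] lidealD(1)[OF lideal_Kp]
    by (intro exI[of _ "%l'. if l' = l then 1 else 0"]) (simp del: bel.simps)
  next
   case False
   have "hc D (bel n l * z) : Kp n"
   proof (cases "d = 0")
    case True
    thus ?thesis using False dg_hc_eq[OF dg_bel_zmon[OF NF_b(3), of l], of D] lidealD(1)[OF lideal_Kp] by (simp del: bel.simps)
   next
    case False
    thus ?thesis using hc_Kp[OF zmon_Kp[OF NF_b(3)]] by simp
   qed
   thus ?thesis by (intro exI[of _ "%_. 0"]) simp
  qed
 next
  case (NF_add y y')
  then obtain c c' where "hc D y - (SUM l:Bd n m D. c l *s bel n l) : Kp n" "hc D y' - (SUM l:Bd n m D. c' l *s bel n l) : Kp n" by blast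
  from lidealD(2)[OF lideal_Kp this] show ?case
   by (intro exI[of _ "%l. c l + c' l"]) (simp add: hc_add smul_add_left sum.distrib algs del: bel.simps)
 next
  case (NF_smul y c)
  then obtain c' where "hc D y - (SUM l:Bd n m D. c' l *s bel n l) : Kp n" by blast
  from lidealD(3)[OF lideal_Kp this, of c] show ?case
   by (intro exI[of _ "%l. c * c' l"]) (simp add: smul_diff nbv.scale_sum_right del: bel.simps)
 qed
 from this[OF NF_all[OF assms(1)]] show ?thesis using assms(2) by (simp add: dg_def)
qed

end

context nbm begin
text \<open>\<open>vI J\<close> is a joint eigenvector of the central elements, so each term acts as
  a multiple of a bare basis diagram. The central factor has positive degree, hence that diagram has
  degree below \<open>D\<close>.\<close>

lemma act_NP:
 assumes y: "y : NP n m (Some D)" and J: "J <= {..<N}" "n = card J" and M: "ALL l. val n l & length l = m & bdeg n l <= D --> l : Vl n m M"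
 shows "EX x. (ALL l. D <= bdeg n l --> x l = 0) & (ALL v. act m n y (vI J) v = (SUM l:Vl n m M. x l * act m n (bel n l) (vI J) v))"
 using y
proof (induction rule: NP.induct)
 note f = VE_VW[OF vI_VE[OF J(1), folded J(2)]]
 {
  case (NP_K y)
  thus ?case using act_Kst[OF _ J] by (intro exI[of _ "%_. 0"]) simp
 next
  case (NP_b l d z)
  have "EX k. ALL v. act n n z (vI J) v = k * vI J v" using NP_b(3)
  proof (induction rule: zmon.induct)
   case zmon_I
   thus ?case using act_I[OF f] by (intro exI[of _ 1]) simp
  next
   case (zmon_el d z r)
   then obtain k where k: "ALL v. act n n z (vI J) v = k * vI J v" by blast
   have "act n n (el n r) (vI J) = (%v. esc J r * vI J v)" using act_el[OF J(1), folded J(2)] by blast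
   thus ?case using act_mult[OF f hm_el] k by (intro exI[of _ "esc J r * k"]) (simp add: Op_cmult[OF Op_act])
  next
   case (zmon_rb d z r)
   then obtain k where k: "ALL v. act n n z (vI J) v = k * vI J v" by blast
   obtain k' where "act n n (rb n r) (vI J) = (%v. k' * vI J v)" using act_rb[OF vI_VE[OF J(1)], folded J(2)] by blast
   thus ?case using act_mult[OF f hm_rb] k by (intro exI[of _ "k' * k"]) (simp add: Op_cmult[OF Op_act])
  qed
  then obtain k where k: "act n n z (vI J) = (%v. k * vI J v)" by blast
  have lV: "l : Vl n m M" using M NP_b by auto
  have "act m n (bel n l * z) (vI J) v = (SUM l':Vl n m M. (if l' = l then k else 0) * act m n (bel n l') (vI J) v)" for v
  proof -
   have "(SUM l':Vl n m M. (if l' = l then k else 0) * act m n (bel n l') (vI J) v) = (SUM l':Vl n m M. if l' = l then k * act m n (bel n l') (vI J) v else 0)"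
    by (intro sum.cong) (auto simp del: bel.simps)
   thus ?thesis using act_mult[OF f hm_zmon[OF NP_b(3)], of m "bel n l" v] lV k finite_Vl by (simp add: Op_cmult[OF Op_act] del: bel.simps)
  qed
  thus ?case using NP_b by (intro exI[of _ "%l'. if l' = l then k else 0"]) (auto simp del: bel.simps)
 next
  case (NP_add y y')
  then obtain x x' where "(ALL l. D <= bdeg n l --> x l = 0) & (ALL v. act m n y (vI J) v = (SUM l:Vl n m M. x l * act m n (bel n l) (vI J) v))"
   "(ALL l. D <= bdeg n l --> x' l = 0) & (ALL v. act m n y' (vI J) v = (SUM l:Vl n m M. x' l * act m n (bel n l) (vI J) v))" by blast
  thus ?case by (intro exI[of _ "%l. x l + x' l"]) (simp add: act_add[OF f] distrib_right sum.distrib)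
 next
  case (NP_smul y c)
  then obtain x where "(ALL l. D <= bdeg n l --> x l = 0) & (ALL v. act m n y (vI J) v = (SUM l:Vl n m M. x l * act m n (bel n l) (vI J) v))" by blast
  thus ?case by (intro exI[of _ "%l. emb c * x l"]) (simp add: act_smul[OF f] sum_distrib_left assoc)
 }
qed
text \<open>Applied to \<open>vI\<close>, a relation modulo \<open>Kp\<close> in degree
  \<open>D\<close> equates a combination of diagrams of degree \<open>D\<close> with one of lower
  degree, which \<open>bel_ind\<close> allows only if its coefficients in degree \<open>D\<close>
  are 0.\<close>

lemma bel_indep':
 assumes "(SUM l:Bd n m D. c l *s bel n l) : Kp n" and M: "ALL l. val n l & length l = m & bdeg n l <= D --> l : Vl n m M"
  and N: "M + n + m <= N" and l: "l : Bd n m D"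
 shows "c l = 0"
proof -
 let ?y = "SUM l:Bd n m D. c l *s bel n l"
 have J: "{..<n} <= {..<N}" "n = card {..<n}" using N by auto
 note f = VE_VW[OF vI_VE[OF J(1), folded J(2)]]
 have hm: "hm m n ?y" by (rule hm_sum) (auto simp: Bd_def intro!: hm_smul hm_bel)
 have dg: "dg D ?y" by (rule dg_sum) (auto simp: Bd_def intro!: dg_smul dg_bel)
 have "?y : NP n m (Some D)" using NP_hc[OF Kp_NP[OF assms(1) hm], of D] dg by (simp add: dg_def)
 from act_NP[OF this J M] obtain x where x: "!!l. D <= bdeg n l ==> x l = 0"
  "!!v. act m n ?y (vI {..<n}) v = (SUM l:Vl n m M. x l * act m n (bel n l) (vI {..<n}) v)" by blast
 have B: "Bd n m D <= Vl n m M" using M by (auto simp: Bd_def)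
 have "act m n ?y (vI {..<n}) v = (SUM l:Vl n m M. (if l : Bd n m D then emb (c l) else 0) * act m n (bel n l) (vI {..<n}) v)" for v
 proof -
  have "act m n ?y (vI {..<n}) v = (SUM l:Bd n m D. emb (c l) * act m n (bel n l) (vI {..<n}) v)"
   by (simp add: act_sum[OF f finite_Bd] act_smul[OF f])
  also have "... = (SUM l:Vl n m M. (if l : Bd n m D then emb (c l) else 0) * act m n (bel n l) (vI {..<n}) v)"
   by (rule sum.mono_neutral_cong_left[OF finite_Vl B]) auto
  finally show ?thesis .
 qed
 hence "(SUM l:Vl n m M. ((if l : Bd n m D then emb (c l) else 0) - x l) * act m n (bel n l) (vI {..<n}) v) = 0" for v
  using x(2)[of v] by (simp add: left_diff_distrib sum_subtractf)
 from bel_ind[OF J(1) J(2)[symmetric] N this, of l] have "(if l : Bd n m D then emb (c l) else 0) - x l = 0" using l B by blast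
 hence "emb (c l) = 0" using l x(1)[of l] by (simp add: Bd_def)
 moreover have "emb (c l) * emb (inverse (c l)) = 1" if "c l ~= 0" using emb(4)[of "c l" "inverse (c l)"] that emb(2) by simp
 ultimately show ?thesis by (metis mult_zero_left zero_neq_one)
qed

end
text \<open>Distinct powers of an indeterminate over the field are generic eigenvalues; that a power
  does not cancel with itself is \<open>2 ~= 0\<close>.\<close>

lemma bel_indep_gen:
 fixes c :: "nat list => 'a::field"
 assumes two: "(2 :: 'a) ~= 0" and K: "(SUM l:nbt.Bd n m D. c l *s nbt.bel n l) : (nbt.Kp n :: ('a, 'b::tparam) nb set)" and l: "l : nbt.Bd n m D"
 shows "c l = 0"
proof -
 obtain M where M: "ALL l. nbt.val n l & length l = m & nbt.bdeg n l <= D --> l : nbt.Vl n m M" using nbt.bdeg_bound by blast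
 \<comment> \<open>Large enough for \<open>bel_indep'\<close>, and of the parity of
   \<open>t\<close>.\<close>
 define N where "N = 2 * (M + n + m) + tparam TYPE('b)"
 define base :: "nat => 'a poly fract" where "base i = Fraction_Field.Fract (monom 1 (Suc i)) 1" for i
 have g: "model0.gst N base" unfolding model0.gst_def
 proof (intro allI impI conjI)
  fix i j :: nat
  have ij: "coeff (monom (1::'a) (Suc i) + monom 1 (Suc j)) (Suc i) ~= 0" using two by (auto simp: one_add_one)
  hence "monom (1::'a) (Suc i) + monom 1 (Suc j) ~= 0" by (metis coeff_0)
  thus "base i + base j ~= 0" by (simp add: base_def Zero_fract_def Fraction_Field.eq_fract)
  show "base i ~= base j" if "i ~= j" using that by (simp add: base_def Fraction_Field.eq_fract monom_eq_iff')
 qed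
 interpret nbm N base "TYPE(('a, 'b) nb)" "%x. Fraction_Field.Fract [:x:] 1"
 proof (unfold_locales)
  show "N mod 2 = tparam TYPE('b)" using tparam_le[where 'a='b] by (simp add: N_def) presburger
 qed (use g in "auto simp: Zero_fract_def One_fract_def one_pCons mult.commute")
 show ?thesis by (rule bel_indep'[OF K M _ l]) (simp add: N_def)
qed

context nbt begin
lemma bel_indep: "(2 :: 'a) ~= 0 ==> (SUM l:Bd n m D. c l *s bel n l) : Kp n ==> l : Bd n m D ==> c l = 0"
 by (rule bel_indep_gen)
end

section \<open>Ranks modulo a left ideal\<close>

lemma nontrivial_relation:
 fixes a :: "'i => nat => 'k::field"
 shows "finite P ==> d < card P ==> EX c. (EX i:P. c i ~= 0) & (ALL j<d. (SUM i:P. c i * a i j) = 0)"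
proof (induction d arbitrary: P a)
 case 0
 then obtain i where "i : P" by fastforce
 thus ?case by (intro exI[of _ "%_. 1"]) auto
next
 case (Suc d)
 show ?case
 proof (cases "ALL i:P. a i d = 0")
  case True
  thus ?thesis using Suc.IH[OF Suc.prems(1), of a] Suc.prems(2) by (auto simp: less_Suc_eq)
 next
  case False
  then obtain p where p: "p : P" "a p d ~= 0" by blast
  let ?f = "%i. a i d / a p d"
  obtain c where c: "EX i:P - {p}. c i ~= 0" "ALL j<d. (SUM i:P - {p}. c i * (a i j - ?f i * a p j)) = 0"
  proof -
   have "finite (P - {p})" "d < card (P - {p})" using Suc.prems p by auto
   from Suc.IH[OF this, of "%i j. a i j - ?f i * a p j"] show ?thesis using that by blast
  qed
  define c' where "c' i = (if i = p then - (SUM i:P - {p}. c i * ?f i) else c i)" for i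
  have s: "(SUM i:P. c' i * a i j) = (SUM i:P - {p}. c i * (a i j - ?f i * a p j))" for j
  proof -
   have "(SUM i:P. c' i * a i j) = c' p * a p j + (SUM i:P - {p}. c' i * a i j)" by (rule sum.remove[OF Suc.prems(1) p(1)])
   also have "(SUM i:P - {p}. c' i * a i j) = (SUM i:P - {p}. c i * a i j)" by (intro sum.cong) (auto simp: c'_def)
   finally show ?thesis by (simp add: c'_def sum_distrib_right right_diff_distrib sum_subtractf assoc)
  qed
  have "(SUM i:P. c' i * a i j) = 0" if "j < Suc d" for j
   using c(2) that p(2) unfolding s by (cases "j = d") auto
  moreover have "EX i:P. c' i ~= 0" using c(1) by (auto simp: c'_def)
  ultimately show ?thesis by blast
 qed
qed

context nbt begin

text \<open>Ranks modulo \<open>K\<close>, by counting vectors, so that no quotient space has to be formed.\<close>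

definition ind :: "('a, 'b) nb set => ('a, 'b) nb set => nat => (nat => ('a, 'b) nb) => bool" where
 "ind K S d b \<longleftrightarrow> (ALL i<d. b i : S) & (ALL c. (SUM i<d. c i *s b i) : K --> (ALL i<d. c i = 0))"
definition Rk :: "('a, 'b) nb set => ('a, 'b) nb set => nat => bool" where
 "Rk K S d \<longleftrightarrow> (EX b. ind K S d b & (ALL y:S. EX c. y - (SUM i<d. c i *s b i) : K))"
definition sbs :: "('a, 'b) nb set => bool" where
 "sbs S \<longleftrightarrow> 0 : S & (ALL y:S. ALL z:S. y + z : S) & (ALL c. ALL y:S. c *s y : S)"
lemma sbsD: "sbs S ==> 0 : S" "sbs S ==> y : S ==> z : S ==> y + z : S" "sbs S ==> y : S ==> c *s y : S"
 by (auto simp: sbs_def)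
lemma sbs_sum: "sbs S ==> (!!i. i : B ==> f i : S) ==> sum f B : S"
 by (induction B rule: infinite_finite_induct) (auto intro: sbsD)
lemma sbs_diff: "sbs S ==> y : S ==> z : S ==> y - z : S"
 using sbsD(2)[of S y "(-1) *s z"] sbsD(3)[of S z "-1"] by simp
lemma lideal_sbs: "lideal K ==> sbs K" by (auto simp: sbs_def intro: lidealD)
lemma ind_le:
 assumes K: "sbs K" and i: "ind K S d b" and r: "Rk K S' d'" and S: "!!y. y : S ==> y : S'"
 shows "d <= d'"
proof (rule ccontr)
 assume "~ d <= d'"
 obtain b' where b': "ALL y:S'. EX c. y - (SUM j<d'. c j *s b' j) : K" using r unfolding Rk_def by blast
 have "ALL i<d. EX c. b i - (SUM j<d'. c j *s b' j) : K" using i b' S unfolding ind_def by blast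
 then obtain a where a: "ALL i<d. b i - (SUM j<d'. a i j *s b' j) : K" by metis
 obtain c where c: "EX i<d. c i ~= 0" "ALL j<d'. (SUM i<d. c i * a i j) = 0"
  using nontrivial_relation[of "{..<d}" d' a] \<open>~ d <= d'\<close> by auto
 let ?A = "(SUM i<d. c i *s (b i - (SUM j<d'. a i j *s b' j)))"
 let ?B = "(SUM i<d. SUM j<d'. (c i * a i j) *s b' j)"
 have "(SUM i<d. c i *s b i) = ?A + ?B"
  by (simp add: smul_diff nbv.scale_sum_right sum_subtractf)
 also have "?B = 0"
  unfolding sum.swap[of _ "{..<d'}"] using c(2) by (simp flip: nbv.scale_sum_left)
 also have "?A + 0 : K"
  unfolding add_0_right using a by (intro sbs_sum[OF K] sbsD(3)[OF K]) auto
 finally show False using i c(1) unfolding ind_def by blast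
qed
lemma Rk_mono: "sbs K ==> Rk K S d ==> Rk K S' d' ==> (!!y. y : S ==> y : S') ==> d <= d'"
 unfolding Rk_def[of K S] using ind_le by blast
lemma Rk_unique: "sbs K ==> Rk K S d ==> Rk K S d' ==> d = d'"
 using Rk_mono[of K S d S d'] Rk_mono[of K S d' S d] by force
lemma sum_split: "(SUM i<d + d'. f i) = (SUM i<d. f i) + (SUM i<d'. f (d + i :: nat) :: ('a, 'b) nb)"
 by (induction d') (simp_all add: add.assoc)
lemma Rk_plus:
 assumes K: "sbs K" and S: "sbs S" "Rk K S d" and Y: "sbs Y" "Rk K Y d'"
  and f: "!!y. y : K ==> f * y : K" and inj: "!!y s. y : Y ==> s : S ==> s + f * y : K ==> y : K"
 shows "Rk K {s + f * y | s y. s : S & y : Y} (d + d')"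
proof -
 obtain b where b: "ind K S d b" "ALL y:S. EX c. y - (SUM i<d. c i *s b i) : K" using S(2) by (auto simp: Rk_def)
 obtain b' where b': "ind K Y d' b'" "ALL y:Y. EX c. y - (SUM i<d'. c i *s b' i) : K" using Y(2) by (auto simp: Rk_def)
 define g where "g i = (if i < d then b i else f * b' (i - d))" for i
 have sum: "(SUM i<d + d'. c i *s g i) = (SUM i<d. c i *s b i) + f * (SUM i<d'. c (d + i) *s b' i)" for c
  by (simp add: sum_split g_def sum_distrib_left)
 have "ind K {s + f * y | s y. s : S & y : Y} (d + d') g"
  unfolding ind_def
 proof (intro conjI allI impI)
  fix i assume "i < d + d'"
  have "b i : S" if "i < d" using b(1) that by (simp add: ind_def)
  hence 1: "g i = g i + f * 0 & g i : S & 0 : Y" if "i < d" using that sbsD(1)[OF Y(1)] by (simp add: g_def)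
  have "b' (i - d) : Y" if "~ i < d" using b'(1) that \<open>i < d + d'\<close> by (simp add: ind_def)
  hence 2: "g i = 0 + f * b' (i - d) & 0 : S & b' (i - d) : Y" if "~ i < d" using that sbsD(1)[OF S(1)] by (simp add: g_def)
  show "g i : {s + f * y | s y. s : S & y : Y}" using 1 2 by blast
 next
  fix c i assume z: "(SUM i<d + d'. c i *s g i) : K" and i: "i < d + d'"
  have m: "(SUM i<d. c i *s b i) : S" "(SUM i<d'. c (d + i) *s b' i) : Y"
   using b(1) b'(1) by (auto simp: ind_def intro!: sbs_sum[OF S(1)] sbs_sum[OF Y(1)] sbsD(3)[OF S(1)] sbsD(3)[OF Y(1)])
  have k: "(SUM i<d'. c (d + i) *s b' i) : K" using inj[OF m(2,1)] z unfolding sum .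
  hence 1: "ALL i<d. c i = 0" using sbs_diff[OF K z f[OF k]] b(1) by (simp add: sum ind_def)
  have 2: "ALL i<d'. c (d + i) = 0" using b'(1)[unfolded ind_def, THEN conjunct2, THEN spec[where x = "%i. c (d + i)"]] k by simp
  show "c i = 0" using 1 2[rule_format, of "i - d"] i by (cases "i < d") auto
 qed
 moreover have "EX c. (s + f * y) - (SUM i<d + d'. c i *s g i) : K" if sy: "s : S" "y : Y" for s y
 proof -
  obtain c where c1: "s - (SUM i<d. c i *s b i) : K" using bspec[OF b(2) sy(1)] by (elim exE)
  obtain c' where c2: "y - (SUM i<d'. c' i *s b' i) : K" using bspec[OF b'(2) sy(2)] by (elim exE)
  note c = c1 c2
  have "(s + f * y) - (SUM i<d + d'. (if i < d then c i else c' (i - d)) *s g i) = (s - (SUM i<d. c i *s b i)) + f * (y - (SUM i<d'. c' i *s b' i))"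
   unfolding sum by (simp add: right_diff_distrib)
  from sbsD(2)[OF K c(1) f[OF c(2)], folded this] show ?thesis by (intro exI[of _ "%i. if i < d then c i else c' (i - d)"])
 qed
 ultimately show ?thesis unfolding Rk_def by blast
qed
lemma Rk_0: "sbs K ==> Rk K {0} 0" unfolding Rk_def ind_def by (auto dest: sbsD(1))
lemma ind_ext: assumes K: "sbs K" and b: "ind K S d b" and y: "y : S" "!!c. y - (SUM i<d. c i *s b i) ~: K"
 shows "ind K S (Suc d) (%i. if i = d then y else b i)"
 unfolding ind_def
proof (intro conjI allI impI)
 fix c i assume a: "(SUM i<Suc d. c i *s (if i = d then y else b i)) : K" and i: "i < Suc d"
 have s: "(SUM i<d. c i *s b i) + c d *s y : K" using a by simp
 have "c d = 0"
 proof (rule ccontr)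
  assume nz: "c d ~= 0"
  have "inverse (c d) *s ((SUM i<d. c i *s b i) + c d *s y) = y - (SUM i<d. (- (inverse (c d) * c i)) *s b i)"
   using nz by (simp add: smul_add nbv.scale_sum_right sum_negf)
  thus False using sbsD(3)[OF K s, of "inverse (c d)"] y(2)[of "%i. - (inverse (c d) * c i)"] by simp
 qed
 moreover from this s b have "ALL i<d. c i = 0" by (simp add: ind_def)
 ultimately show "c i = 0" using i by (auto simp: less_Suc_eq)
qed (use b y in "auto simp: ind_def less_Suc_eq")
text \<open>Independent families in \<open>S\<close> have at most \<open>d'\<close> members, and a
  largest one spans \<open>S\<close> modulo \<open>K\<close> by \<open>ind_ext\<close>.\<close>

lemma Rk_sub:
 assumes K: "sbs K" and r: "Rk K S' d'" and S: "sbs S" "S <= S'"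
 shows "EX d<=d'. Rk K S d"
proof -
 define d where "d = (GREATEST d. EX b. ind K S d b)"
 have z: "EX b. ind K S 0 b" by (auto simp: ind_def)
 have le: "d <= d'" if "EX b. ind K S d b" for d using ind_le[OF K _ r] that S(2) by blast
 have "EX b. ind K S d b" unfolding d_def by (rule GreatestI_nat[of "%d. EX b. ind K S d b", OF z]) (use le in blast)
 then obtain b where b: "ind K S d b" by blast
 have max: "d2 <= d" if "ind K S d2 b2" for d2 b2 unfolding d_def by (rule Greatest_le_nat[of _ _ d']) (use le that in blast)+
 have "EX c. y - (SUM i<d. c i *s b i) : K" if y: "y : S" for y
 proof (rule ccontr)
  assume n: "~ ?thesis"
  have "ind K S (Suc d) (%i. if i = d then y else b i)" by (rule ind_ext[OF K b y]) (use n in blast)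
  thus False using max[of "Suc d"] by simp
 qed
 thus ?thesis using b le unfolding Rk_def by blast
qed
lemma Rk_strict:
 assumes K: "sbs K" and S: "sbs S" "Rk K S d" and S': "sbs S'" "Rk K S' d'" "S <= S'" and y: "y : S'" "!!s. s : S ==> y - s ~: K"
 shows "d < d'"
proof -
 obtain b where b: "ind K S d b" using S(2) by (auto simp: Rk_def)
 have "(SUM i<d. c i *s b i) : S" for c using b by (auto simp: ind_def intro!: sbs_sum[OF S(1)] sbsD(3)[OF S(1)])
 hence "ind K S' (Suc d) (%i. if i = d then y else b i)" using b S'(3) y by (intro ind_ext[OF K]) (auto simp: ind_def)
 from ind_le[OF K this S'(2)] show ?thesis by simp
qed

text \<open>A triangular system: the \<open>al j\<close> and \<open>bt l\<close> are detected by the \<open>dd j\<close> and \<open>ae l\<close> in the order \<open>al 0, bt 0, al 1, ...\<close>\<close>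
lemma Rk_tri:
 fixes al bt dd ae :: "nat => ('a, 'b) nb"
 assumes K: "lideal K" and V: "!!j. sbs (V j)" "!!j. Rk K (V j) (dV j)" and U: "!!j. sbs (U' j)" "!!j. Rk K (U' j) (dU j)"
  and dd: "!!j j' v. j <= b ==> j' <= j ==> v : V j' ==> dd j * (al j' * v) = (if j' = j then v else 0)"
   "!!j l u. j <= b ==> l < j ==> u : U' l ==> dd j * (bt l * u) = 0"
  and ae: "!!l l' u. l < b ==> l' <= l ==> u : U' l' ==> ae l * (bt l' * u) = (if l' = l then u else 0)"
   "!!j l v. l < b ==> j <= l ==> v : V j ==> ae l * (al j * v) = 0"
 shows "Rk K {(SUM i<=b. al i * v i) + (SUM l<b. bt l * u l) | v u. (ALL i. v i : V i) & (ALL l. u l : U' l)} ((SUM i<=b. dV i) + (SUM l<b. dU l))"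
proof -
 define M where "M j = {(SUM i<=j. al i * v i) + (SUM l<j. bt l * u l) | v u. (ALL i. v i : V i) & (ALL l. u l : U' l)}" for j
 have sM: "sbs (M j)" for j unfolding sbs_def
 proof (intro conjI ballI allI)
  show "0 : M j" unfolding M_def using sbsD(1)[OF V(1)] sbsD(1)[OF U(1)]
   by (simp, intro exI[of _ "%_. 0"]) simp
  fix y c assume "y : M j"
  then obtain v u where y: "y = (SUM i<=j. al i * v i) + (SUM l<j. bt l * u l)" "ALL i. v i : V i" "ALL l. u l : U' l" unfolding M_def by blast
  show "c *s y : M j" unfolding M_def y(1) using y(2,3) sbsD(3)[OF V(1)] sbsD(3)[OF U(1)]
   by (simp, intro exI[of _ "%i. c *s v i"] exI[of _ "%i. c *s u i"]) (simp add: smul_add nbv.scale_sum_right)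
  fix z assume "z : M j"
  then obtain v' u' where z: "z = (SUM i<=j. al i * v' i) + (SUM l<j. bt l * u' l)" "ALL i. v' i : V i" "ALL l. u' l : U' l" unfolding M_def by blast
  show "y + z : M j" unfolding M_def y(1) z(1) using y(2,3) z(2,3) sbsD(2)[OF V(1)] sbsD(2)[OF U(1)]
   by (simp, intro exI[of _ "%i. v i + v' i"] exI[of _ "%i. u i + u' i"]) (simp add: distrib_left sum.distrib)
 qed
 have "j <= b ==> Rk K (M j) ((SUM i<=j. dV i) + (SUM l<j. dU l))" for j
 proof (induction j)
  case 0
  have "Rk K {s + al 0 * y | s y. s : {0} & y : V 0} (0 + dV 0)"
  proof (rule Rk_plus[OF lideal_sbs[OF K] _ Rk_0[OF lideal_sbs[OF K]] V(1,2)])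
   fix y s assume y: "y : V 0" "s : {0 :: ('a, 'b) nb}" "s + al 0 * y : K"
   thus "y : K" using lidealD(4)[OF K y(3), of "dd 0"] dd(1)[of 0 0 y] by simp
  qed (auto simp: sbs_def lidealD(4)[OF K])
  moreover have "{s + al 0 * y | s y. s : {0} & y : V 0} = M 0"
  proof (intro set_eqI iffI)
   fix x assume "x : {s + al 0 * y | s y. s : {0} & y : V 0}"
   then obtain y where y: "x = al 0 * y" "y : V 0" by auto
   have "x = (SUM i<=0. al i * ((%_. 0)(0 := y)) i) + (SUM l<0. bt l * 0)" by (simp add: y)
   moreover have "ALL i. ((%_. 0)(0 := y)) i : V i" using y sbsD(1)[OF V(1)] by auto
   ultimately show "x : M 0" unfolding M_def mem_Collect_eq using sbsD(1)[OF U(1)] by (intro exI[of _ "(%_. 0)(0 := y)"] exI[of _ "%_. 0"]) auto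
  qed (auto simp: M_def)
  ultimately show ?case by simp
 next
  case (Suc j)
  note R = Suc.IH[OF Suc_leD[OF Suc.prems]]
  define M' where "M' = {s + bt j * y | s y. s : M j & y : U' j}"
  have ae0: "ae j * s = 0" if "s : M j" for s
   using that Suc.prems unfolding M_def by (auto simp: distrib_left sum_distrib_left ae intro!: sum.neutral)
  have 1: "Rk K M' ((SUM i<=j. dV i) + (SUM l<j. dU l) + dU j)" unfolding M'_def
  proof (rule Rk_plus[OF lideal_sbs[OF K] sM R U(1,2)])
   fix y s assume y: "y : U' j" "s : M j" "s + bt j * y : K"
   thus "y : K" using lidealD(4)[OF K y(3), of "ae j"] ae(1)[of j j y] ae0 Suc.prems by (simp add: distrib_left)
  qed (auto simp: lidealD(4)[OF K])
  have dd0: "dd (Suc j) * s = 0" if "s : M'" for s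
   using that Suc.prems unfolding M'_def M_def by (auto simp: distrib_left sum_distrib_left dd intro!: sum.neutral)
  have sM': "sbs M'" unfolding M'_def using sM[of j] U(1)[of j]
   by (auto simp: sbs_def) (metis add.right_neutral mult_zero_right, metis (no_types, lifting) add.assoc add.left_commute distrib_left, metis smul_add smul_right)
  have "Rk K {s + al (Suc j) * y | s y. s : M' & y : V (Suc j)} ((SUM i<=j. dV i) + (SUM l<j. dU l) + dU j + dV (Suc j))"
  proof (rule Rk_plus[OF lideal_sbs[OF K] sM' 1 V(1,2)])
   fix y s assume y: "y : V (Suc j)" "s : M'" "s + al (Suc j) * y : K"
   thus "y : K" using lidealD(4)[OF K y(3), of "dd (Suc j)"] dd(1)[of "Suc j" "Suc j" y] dd0 Suc.prems by (simp add: distrib_left)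
  qed (auto simp: lidealD(4)[OF K])
  moreover have "{s + al (Suc j) * y | s y. s : M' & y : V (Suc j)} = M (Suc j)"
  proof (intro set_eqI iffI)
   fix x assume "x : {s + al (Suc j) * y | s y. s : M' & y : V (Suc j)}"
   then obtain v u y y' where x: "x = (SUM i<=j. al i * v i) + (SUM l<j. bt l * u l) + bt j * y' + al (Suc j) * y"
    "ALL i. v i : V i" "ALL l. u l : U' l" "y' : U' j" "y : V (Suc j)" unfolding M'_def M_def by blast
   have "x = (SUM i<=Suc j. al i * (v(Suc j := y)) i) + (SUM l<Suc j. bt l * (u(j := y')) l)"
    unfolding x(1) by (simp add: algs)
   moreover have "ALL i. (v(Suc j := y)) i : V i" "ALL l. (u(j := y')) l : U' l" using x by auto
   ultimately show "x : M (Suc j)" unfolding M_def by blast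
  next
   fix x assume "x : M (Suc j)"
   then obtain v u where x: "x = (SUM i<=Suc j. al i * v i) + (SUM l<Suc j. bt l * u l)" "ALL i. v i : V i" "ALL l. u l : U' l" unfolding M_def by blast
   have "x = ((SUM i<=j. al i * v i) + (SUM l<j. bt l * u l) + bt j * u j) + al (Suc j) * v (Suc j)" unfolding x(1) by (simp add: algs)
   thus "x : {s + al (Suc j) * y | s y. s : M' & y : V (Suc j)}" using x(2,3) unfolding M'_def M_def by blast
  qed
  ultimately show ?case by (simp add: algs)
 qed
 from this[of b] show ?thesis unfolding M_def by simp
qed

end

section \<open>Ranks of the truncations by \<open>ei b\<close>, and the recursion that adds a
  strand\<close>

context nbt begin

abbreviation LL :: "nat => ('a, 'b) nb => ('a, 'b) nb" where "LL k \<equiv> L ^^ k"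
lemma LL_simps [simp]: "LL k 0 = 0" "LL k (y + z) = LL k y + LL k z" "LL k (c *s y) = c *s LL k y" "LL k (y * z) = LL k y * LL k z"
 "LL k (ii n) = ii (k + n)"
 by (induction k) auto
lemma LL_sum: "LL k (sum f B) = (SUM i:B. LL k (f i))" by (induction B rule: infinite_finite_induct) auto
lemma LL_L: "LL (Suc k) y = LL k (L y)" by (simp add: funpow_swap1)
lemma hm_LL: "hm m n y ==> hm (k + m) (k + n) (LL k y)" by (induction k) (auto intro: hm_L)
lemma dg_LL: "dg d y ==> dg d (LL k y)" by (induction k) (auto intro: dg_L)

text \<open>Degree \<open>D\<close> of the space of morphisms from \<open>n\<close> strands that are
  fixed by \<open>ei b\<close> with \<open>k\<close> free strands on its left. Modulo
  \<open>Kp n\<close> this is a truncated weight space of the proper standard module;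
  \<open>k = 0\<close> gives the multiplicity.\<close>

definition Sp :: "nat => nat => nat => int => ('a, 'b) nb set" where
 "Sp k b n D = {y. hm (k + b) n y & dg D y & LL k (ei b) * y = y}"
lemma SpD: "y : Sp k b n D ==> hm (k + b) n y" "y : Sp k b n D ==> dg D y" "y : Sp k b n D ==> LL k (ei b) * y = y"
 by (auto simp: Sp_def)
lemma sbs_Sp: "sbs (Sp k b n D)"
 by (auto simp: sbs_def Sp_def distrib_left intro: hm_add dg_add hm_smul dg_smul)
lemma hc_e: "dg 0 e ==> hc d (e * y) = e * hc d y" using hc_mult[of 0 e d y] by simp
lemma hm_hc: "hm m n y ==> hm m n (hc d y)"
 using hc_e[OF dg_I, of d m y] hc_lmult[OF dg_I, of d y n] by (simp add: hm_def)
lemma hom_space_Rk: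
 assumes two: "(2 :: 'a) ~= 0" shows "Rk (Kp n) {y. hm m n y & dg D y} (card (Bd n m D))"
proof -
 obtain h where h: "bij_betw h {..<card (Bd n m D)} (Bd n m D)"
  using ex_bij_betw_nat_finite[OF finite_Bd[of n m D]] by (auto simp: atLeast0LessThan)
 have s: "(SUM i<card (Bd n m D). c (h i) *s bel n (h i)) = (SUM l:Bd n m D. c l *s bel n l)" for c
  by (rule sum.reindex_bij_betw[OF h])
 have hB: "h i : Bd n m D" if "i < card (Bd n m D)" for i using h that by (auto simp: bij_betw_def)
 show ?thesis unfolding Rk_def ind_def
 proof (intro exI[of _ "%i. bel n (h i)"] conjI allI impI ballI)
  fix i assume "i < card (Bd n m D)"
  thus "bel n (h i) : {y. hm m n y & dg D y}" using hB[of i] hm_bel dg_bel by (auto simp: Bd_def)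
 next
  fix c i assume a: "(SUM i<card (Bd n m D). c i *s bel n (h i)) : Kp n" and i: "i < card (Bd n m D)"
  define c' where "c' l = c (the_inv_into {..<card (Bd n m D)} h l)" for l
  have c': "c' (h i) = c i" if "i < card (Bd n m D)" for i
   using the_inv_into_f_f[of h "{..<card (Bd n m D)}" i] h that by (simp add: c'_def bij_betw_def)
  show "c i = 0" using sum.cong bel_indep[OF two, where n = n and m = m and D = D and c = c' and l = "h i"] a hB[OF i] c'[OF i] by (simp add: c' s[of c', symmetric])
 next
  fix y :: "('a, 'b) nb" assume "y : {y. hm m n y & dg D y}"
  then obtain c where "y - (SUM l:Bd n m D. c l *s bel n l) : Kp n" using span_Kp by blast
  thus "EX c. y - (SUM i<card (Bd n m D). c i *s bel n (h i)) : Kp n" unfolding s[of c, symmetric] by (intro exI[of _ "%i. c (h i)"])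
 qed
qed

definition dk :: "nat => nat => nat => int => nat" where "dk k b n D = (THE d. Rk (Kp n) (Sp k b n D) d)"
lemma sbs_Kp: "sbs (Kp n)" by (rule lideal_sbs[OF lideal_Kp])
lemma dkI: "Rk (Kp n) (Sp k b n D) d ==> dk k b n D = d"
 unfolding dk_def by (rule the_equality) (auto intro: Rk_unique[OF sbs_Kp])

context assumes two: "(2 :: 'a) ~= 0" begin
lemma dk_ex: "EX d<=card (Bd n (k + b) D). Rk (Kp n) (Sp k b n D) d"
 by (rule Rk_sub[OF sbs_Kp hom_space_Rk[OF two] sbs_Sp]) (auto simp: Sp_def)
lemma dk: "Rk (Kp n) (Sp k b n D) (dk k b n D)" using dk_ex[of n k b D] dkI by blast
lemma dk_le: "dk k b n D <= card (Bd n (k + b) D)" using dk_ex[of n k b D] dkI by blast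
lemma dk_0: "dk k 0 n D = card (Bd n k D)"
proof (rule dkI)
 have "Sp k 0 n D = {y. hm k n y & dg D y}" by (auto simp: Sp_def ei_def hm_left)
 thus "Rk (Kp n) (Sp k 0 n D) (card (Bd n k D))" using hom_space_Rk[OF two] by simp
qed
lemma gg_rho: "gg m = gg m * (rho m * w m)"
 by (subst (1 2) gg_eq) (simp add: assoc w_rho_w)
text \<open>Every crossing kills \<open>gg m\<close>, the one at the cup by \<open>TUs\<close>. The
  first \<open>l\<close> crossings of the train consume the dots, and the next one meets the bare
  \<open>gg m\<close>.\<close>

lemma dsc_xp_gg: assumes "l < j" "j <= Suc m" shows "dsc (m + 2) j * (xp (m + 2) 0 l * gg m) = 0"
proof -
 have T: "tt (m + 2) i * gg m = 0" for i
 proof (cases "i = 0")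
  case True
  have "gg m = L (dsc (Suc m) m) * (uu (Suc (Suc m)) 0 * w m)" by (simp add: gg_alt)
  show ?thesis
  proof (cases m)
   case 0
   thus ?thesis using True by (simp add: gg_alt flip: assoc)
  next
   case (Suc p)
   have "tt (m + 2) 0 * (dsc1 (m + 2) m * uu (m + 2) 0) = tt (m + 2) 0 * (L (L (dsc m p)) * (tt (m + 2) (Suc 0) * uu (m + 2) 0))"
    using dsc_Suc[of "Suc m" p, THEN arg_cong[of _ _ L]] by (simp add: Suc assoc)
   also have "... = L (L (dsc m p)) * (tt (m + 2) 0 * (tt (m + 2) 0 * uu (m + 2) (Suc 0)))"
    unfolding TUs[symmetric] using mult_ext[OF far0(2)[OF hm_dsc[of m p]]] by simp
   also have "... = 0" by (simp flip: assoc[of "tt _ _"])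
   finally show ?thesis using True by (simp add: gg_eq) (simp flip: assoc)
  qed
 next
  case False
  thus ?thesis using T_gg[of i m] by simp
 qed
 have l: "dsc (m + 2) l * (xp (m + 2) 0 l * gg m) = gg m"
 proof (subst dsc_xp)
  show "ii (m + 2) * gg m = gg m" using hm_left[OF hm_gg] by simp
  fix i assume "i < l"
  thus "aa (m + 2) 0 * (xp (m + 2) 0 i * gg m) = 0" using A_xp_gg[of i m] assms by simp
 qed (use T assms in auto)
 have "dsc (m + 2) (Suc (l + d)) * (xp (m + 2) 0 l * gg m) = 0" for d
 proof (induction d)
  case 0
  thus ?case by (simp add: assoc l T del: add_2_eq_Suc')
 next
  case (Suc d)
  thus ?case by (simp add: assoc)
 qed
 from this[of "j - Suc l"] show ?thesis using assms by simp
qed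
text \<open>\<open>Lw_decomp\<close> shows that the pieces span, and \<open>Rk_tri\<close> with
  trains and dotted caps as detectors makes their ranks add up. A piece of type \<open>b - 1\<close>
  occurs only for \<open>cc b = 1\<close>; otherwise \<open>gg_in_w\<close> absorbs it into the
  pieces of type \<open>b + 1\<close>.\<close>

lemma dk_rec:
 "dk (Suc k) b n D = (SUM j<=b. dk k (Suc b) n (D - 2 * int j)) + (SUM l<b. if cc b = 1 then dk k (b - 1) n (D + 2 * int (b - 1) - 2 * int l) else 0)"
proof (rule dkI)
 let ?V = "%j. Sp k (Suc b) n (D - 2 * int j)"
 let ?U = "%l. if cc b = 1 then Sp k (b - 1) n (D + 2 * int (b - 1) - 2 * int l) else {0}"
 let ?al = "%j. LL k (xp (Suc b) 0 j)" and ?bt = "%l. LL k (xp (Suc b) 0 l * (gg (b - 1) * rho (b - 1)))"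
 let ?dd = "%j. LL k (dsc (Suc b) j)" and ?ae = "%l. LL k (aa (Suc b) 0 * xp (Suc b) 0 (b - 1 - l))"
 have xx_add: "xp m 0 i * (xp m 0 j * y) = xp m 0 (i + j) * y" for m i j y
  by (induction i) (simp_all add: assoc hm_left'[OF hm_xp] del: One_nat_def)
 let ?D = "(w (Suc b) * rho (Suc b))"
 have V: "?al j * v = LL k (xp (Suc b) 0 j * ?D) * v" if "v : ?V j" for j v
  using SpD(3)[OF that, symmetric] by (metis (no_types, lifting) LL_simps(4) ei_def assoc)
 have V1: "LL k ?D * v = v" if "v : ?V j" for j v using SpD(3)[OF that] by (simp add: ei_def)
 have U1: "LL k (w (b - 1) * rho (b - 1)) * u = u" if "u : ?U l" for l u using that SpD(3) by (auto simp: ei_def split: if_splits)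
 have "Rk (Kp n) {(SUM i<=b. ?al i * v i) + (SUM l<b. ?bt l * u l) | v u. (ALL i. v i : ?V i) & (ALL l. u l : ?U l)}
   ((SUM i<=b. dk k (Suc b) n (D - 2 * int i)) + (SUM l<b. if cc b = 1 then dk k (b - 1) n (D + 2 * int (b - 1) - 2 * int l) else 0))"
 proof (rule Rk_tri[where dd = ?dd and ae = ?ae, OF lideal_Kp])
  fix j show "sbs (?U j)" by (auto simp: sbs_Sp) (simp add: sbs_def)
  show "Rk (Kp n) (?U j) (if cc b = 1 then dk k (b - 1) n (D + 2 * int (b - 1) - 2 * int j) else 0)" using dk Rk_0[OF sbs_Kp] by simp
 next
  fix j j' v assume a: "j <= b" "j' <= j" "v : ?V j'"
  have "?dd j * (?al j' * v) = LL k (dsc (Suc b) j * (xp (Suc b) 0 j' * w (Suc b)) * rho (Suc b)) * v"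
   unfolding V[OF a(3)] by (simp add: assoc del: w.simps xp.simps dsc.simps)
  also have "... = (if j' = j then LL k ?D * v else 0)"
   using dsc_xp_w[of j' j "Suc b"] a by (simp del: w.simps xp.simps dsc.simps)
  finally show "?dd j * (?al j' * v) = (if j' = j then v else 0)" using V1[OF a(3)] by simp
 next
  fix j l u assume a: "j <= b" "l < j" "u : ?U l"
  obtain m where m: "b = Suc m" using a by (cases b) auto
  have "dsc (Suc b) j * (xp (Suc b) 0 l * gg (b - 1)) = 0" using dsc_xp_gg[of l j m] a m by (simp del: xp.simps dsc.simps)
  from arg_cong[OF this, of "%x. LL k x * (LL k (rho (b - 1)) * u)"] show "?dd j * (?bt l * u) = 0"
   by (simp add: assoc del: xp.simps dsc.simps rho.simps)
 next
  fix l l' u assume a: "l < b" "l' <= l" "u : ?U l'"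
  have "?ae l * (?bt l' * u) = LL k (aa (Suc b) 0 * (xp (Suc b) 0 (b - 1 - l + l') * gg (b - 1)) * rho (b - 1)) * u"
   unfolding LL_simps(4)[symmetric] assoc[symmetric, of _ _ u] by (simp add: assoc xx_add del: xp.simps LL_simps)
  also have "aa (Suc b) 0 * (xp (Suc b) 0 (b - 1 - l + l') * gg (b - 1)) = (if l' = l then cc b *s w (b - 1) else 0)"
   using A_xp_gg[of "b - 1 - l + l'" "b - 1"] a by auto
  finally show "?ae l * (?bt l' * u) = (if l' = l then u else 0)"
   using U1[OF a(3)] a(3) by (auto split: if_splits simp del: w.simps)
 next
  fix l j v assume a: "l < b" "j <= l" "v : ?V j"
  have "?ae l * (?al j * v) = LL k (aa (Suc b) 0 * (xp (Suc b) 0 (b - 1 - l + j) * w (Suc b)) * rho (Suc b)) * v"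
   unfolding V[OF a(3)] LL_simps(4)[symmetric] assoc[symmetric, of _ _ v] by (simp add: assoc xx_add del: xp.simps LL_simps w.simps)
  also have "aa (Suc b) 0 * (xp (Suc b) 0 (b - 1 - l + j) * w (Suc b)) = 0" by (rule A_xp_w(1)) (use a in auto)
  finally show "?ae l * (?al j * v) = 0" by (simp only: mult_zero_left LL_simps(1))
 qed (use dk sbs_Sp in auto)
 moreover have "{(SUM i<=b. ?al i * v i) + (SUM l<b. ?bt l * u l) | v u. (ALL i. v i : ?V i) & (ALL l. u l : ?U l)} = Sp (Suc k) b n D" (is "?S = _")
 proof (intro set_eqI iffI)
  have ew: "L (ei b) * L (w b) = L (w b)" using arg_cong[OF ei_w(1), of L b] by simp
  have eLw: "L (ei b) * (xp (Suc b) 0 j * (L (w b) * c)) = xp (Suc b) 0 j * (L (w b) * c)" for j c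
   unfolding mult_ext[OF xp_L[OF hm_ei[of b], of j], symmetric] mult_ext1[OF ew] ..
  have dal: "dg (2 * int j) (?al j)" for j by (rule dg_LL[OF dg_xp])
  have dbt: "dg (2 * int l - 2 * int (b - 1)) (?bt l)" if "l < b" for l
  proof -
   obtain m where m: "b = Suc m" using \<open>l < b\<close> by (cases b) auto
   \<comment> \<open>The degrees of \<open>gg m\<close> and \<open>rho m\<close> add up to
     \<open>-2m\<close>, which is the origin of the shift by \<open>2 * int (b - 1)\<close> in the
     recursion.\<close>
   have e: "2 * int l - 2 * int m = 2 * int l + (- int (Suc m * m) + int (m * (m - 1)))" by (cases m) (simp_all add: algs)
   show ?thesis unfolding m diff_Suc_1 e by (intro dg_LL dg_mult dg_xp dg_gg dg_rho)
  qed
  {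
   fix x assume "x : ?S"
   then obtain v u where x: "x = (SUM i<=b. ?al i * v i) + (SUM l<b. ?bt l * u l)" and v: "!!i. v i : ?V i" and u: "!!l. u l : ?U l" by blast
   have "?al j * v j : Sp (Suc k) b n D" for j
   proof -
    have "hm (Suc k + b) n (?al j * v j)" using hm_mult[OF hm_LL[OF hm_xp[of "Suc b" 0 j], of k] SpD(1)[OF v[of j]]] by simp
    moreover have "dg D (?al j * v j)" using dg_mult[OF dal[of j] SpD(2)[OF v[of j]]] by simp
    moreover have "L (ei b) * (xp (Suc b) 0 j * ?D) = xp (Suc b) 0 j * ?D"
     unfolding w_alt assoc by (rule eLw)
    from arg_cong[OF this, of "LL k"] have "LL (Suc k) (ei b) * (?al j * v j) = ?al j * v j"
     unfolding V[OF v] LL_L LL_simps(4)[symmetric] assoc[symmetric, of _ _ "v j"] by simp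
    ultimately show ?thesis by (simp add: Sp_def)
   qed
   moreover have "?bt l * u l : Sp (Suc k) b n D" if l: "l < b" for l
   proof (cases "cc b = 1")
    case True
    obtain m where m: "b = Suc m" using l by (cases b) auto
    have u': "u l : Sp k m n (D + 2 * int m - 2 * int l)" using u[of l] True m by simp
    have "hm (Suc k + b) n (?bt l * u l)"
     using hm_mult[OF hm_LL[OF hm_mult[OF hm_xp[of "Suc b" 0 l] hm_mult[OF hm_gg[of m, folded m] hm_rho]], of k] SpD(1)[OF u']] m by simp
    moreover have "dg D (?bt l * u l)" using dg_mult[OF dbt[OF l] SpD(2)[OF u']] m by simp
    moreover have "L (ei b) * (xp (Suc b) 0 l * (gg m * rho m)) = xp (Suc b) 0 l * (gg m * rho m)"
     unfolding gg_def m[symmetric] assoc by (rule eLw)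
    from arg_cong[OF this, of "LL k"] have "LL (Suc k) (ei b) * (?bt l * u l) = ?bt l * u l"
     unfolding LL_L LL_simps(4)[symmetric] assoc[symmetric, of _ _ "u l"] using m by simp
    ultimately show ?thesis by (simp add: Sp_def)
   next
    case False
    thus ?thesis using u[of l] sbsD(1)[OF sbs_Sp] by simp
   qed
   ultimately show "x : Sp (Suc k) b n D" unfolding x by (intro sbsD(2)[OF sbs_Sp] sbs_sum[OF sbs_Sp]) auto
  }
  fix y assume y: "y : Sp (Suc k) b n D"
  note yD = SpD[OF y]
  obtain p r where pr: "L (w b) = (SUM j<=b. xp (Suc b) 0 j * (w (Suc b) * p j)) + (SUM l<b. xp (Suc b) 0 l * (gg (b - 1) * r l))"
   using Lw_decomp by blast
  define z where "z = LL k (L (rho b)) * y"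
  have yz: "y = LL k (L (w b)) * z" using yD(3) unfolding LL_L by (simp add: z_def ei_def assoc)
  have zn: "z * ii n = z" by (simp add: z_def assoc hm_right[OF yD(1)])
  have VI: "hc d (LL k (w e * c) * z) : Sp k e n d" for d c e
  proof -
   have "hm (k + e) n (LL k (w e * c) * z)"
    using hm_left[OF hm_LL[OF hm_w[of e], of k]] zn by (simp add: hm_def assoc del: w.simps) (simp del: w.simps flip: assoc)
   moreover have "LL k (ei e) * hc d (LL k (w e * c) * z) = hc d (LL k (w e * c) * z)"
    unfolding hc_e[OF dg_LL[OF dg_ei], symmetric] assoc[symmetric] LL_simps(4)[symmetric] ei_w(1) by simp
   ultimately show ?thesis by (simp add: Sp_def hm_hc dg_hc)
  qed
  define h where "h = xp (Suc b) 0 b * uu (Suc b) 0"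
  have gh: "gg (b - 1) = w (Suc b) * h" if "0 < b" "cc b ~= 1" using gg_in_w[of "b - 1"] cc_cases[of b] that by (simp add: h_def del: w.simps xp.simps)
  \<comment> \<open>For \<open>cc b = 0\<close> the terms with \<open>gg\<close> are added to the
    coefficients of \<open>w (Suc b)\<close>. The index \<open>j = b\<close> receives none, since
    \<open>l\<close> runs below \<open>b\<close>.\<close>
  define vz where "vz j = (w (Suc b) * (p j + (if cc b = 1 | j = b then 0 else h * r j)))" for j
  define v where "v j = hc (D - 2 * int j) (LL k (vz j) * z)" for j
  define u where "u l = (if cc b = 1 then hc (D + 2 * int (b - 1) - 2 * int l) (LL k (w (b - 1) * r l) * z) else 0)" for l
  have "L (w b) = (SUM j<=b. xp (Suc b) 0 j * vz j) + (SUM l<b. if cc b = 1 then xp (Suc b) 0 l * (gg (b - 1) * rho (b - 1)) * (w (b - 1) * r l) else 0)"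
  proof (cases "cc b = 1")
   case True
   have "gg (b - 1) * r l = gg (b - 1) * rho (b - 1) * (w (b - 1) * r l)" for l by (subst gg_rho) (simp add: assoc)
   thus ?thesis unfolding pr using True by (simp add: vz_def assoc del: w.simps xp.simps)
  next
   case False
   let ?E = "(SUM j<=b. if j = b then 0 else xp (Suc b) 0 j * (w (Suc b) * (h * r j)))"
   have "(SUM j<=b. xp (Suc b) 0 j * vz j) = (SUM j<=b. xp (Suc b) 0 j * (w (Suc b) * p j)) + ?E"
    unfolding sum.distrib[symmetric] by (rule sum.cong) (auto simp: vz_def False distrib_left simp del: w.simps xp.simps)
   also have "?E = (SUM l<b. xp (Suc b) 0 l * (gg (b - 1) * r l))"
    by (rule sum.mono_neutral_cong_right) (auto simp: gh False assoc simp del: w.simps xp.simps One_nat_def)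
   finally show ?thesis unfolding pr using False by (simp only: if_False sum.neutral_const add_0_right)
  qed
  from arg_cong[OF this, of "%x. LL k x * z"]
  have "y = (SUM j<=b. ?al j * (LL k (vz j) * z)) + (SUM l<b. if cc b = 1 then ?bt l * (LL k (w (b - 1) * r l) * z) else 0)"
   unfolding yz[symmetric] by (simp add: LL_sum distrib_right sum_distrib_right assoc if_distrib[of "LL k"] if_distrib[of "%x. x * z"] del: w.simps xp.simps cong: if_cong)
  hence "hc D y = (SUM j<=b. hc D (?al j * (LL k (vz j) * z))) + (SUM l<b. if cc b = 1 then hc D (?bt l * (LL k (w (b - 1) * r l) * z)) else 0)"
   by (simp only: hc_add hc_sum if_distrib[of "hc D"] hc_zero)
  also have "(SUM j<=b. hc D (?al j * (LL k (vz j) * z))) = (SUM j<=b. ?al j * v j)"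
   unfolding v_def using hc_mult[OF dal, of _ "D - 2 * int _"] by (intro sum.cong refl) (metis add_diff_cancel_left' diff_add_cancel add.commute)
  also have "(SUM l<b. if cc b = 1 then hc D (?bt l * (LL k (w (b - 1) * r l) * z)) else 0) = (SUM l<b. ?bt l * u l)"
  proof (rule sum.cong[OF refl])
   fix l assume "l : {..<b}"
   thus "(if cc b = 1 then hc D (?bt l * (LL k (w (b - 1) * r l) * z)) else 0) = ?bt l * u l"
    unfolding u_def using hc_mult[OF dbt, of l "D + 2 * int (b - 1) - 2 * int l" "LL k (w (b - 1) * r l) * z"] by simp
  qed
  finally have "y = (SUM j<=b. ?al j * v j) + (SUM l<b. ?bt l * u l)" using yD(2) by (simp add: dg_def)
  moreover have "ALL i. v i : ?V i" "ALL l. u l : ?U l" unfolding v_def vz_def u_def using VI by (auto simp del: w.simps LL_simps)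
  ultimately show "y : ?S" by blast
 qed
 ultimately show "Rk (Kp n) (Sp (Suc k) b n D) ((SUM j<=b. dk k (Suc b) n (D - 2 * int j)) + (SUM l<b. if cc b = 1 then dk k (b - 1) n (D + 2 * int (b - 1) - 2 * int l) else 0))" by simp
qed

end
end

section \<open>The generating function and the solution of the recursion\<close>

definition Qc :: "nat => int => rat" where
 "Qc m j = (if j < 0 then 0 else fps_nth (inverse (PROD i:{1..m}. 1 - fps_X ^ (4 * i))) (nat j))"
lemma Qc_0: "Qc 0 j = (if j = 0 then 1 else 0)" by (auto simp: Qc_def)
lemma Qc_Suc: "Qc (Suc m) j - Qc (Suc m) (j - 4 * int (Suc m)) = Qc m j"
proof -
 let ?P = "PROD i:{1..m}. (1 - fps_X ^ (4 * i)) :: rat fps" and ?f = "1 - fps_X ^ (4 * Suc m) :: rat fps"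
 have nz: "fps_nth ?f 0 ~= 0" by simp
 have e: "(PROD i:{1..Suc m}. 1 - fps_X ^ (4 * i)) = ?P * ?f" by (simp add: mult.commute)
 have "inverse (?P * ?f) * ?f = inverse ?P"
  using inverse_mult_eq_1[OF nz] by (simp add: fps_inverse_mult assoc)
 hence "inverse ?P = inverse (?P * ?f) - inverse (?P * ?f) * fps_X ^ (4 * Suc m)"
  unfolding right_diff_distrib[of "inverse (?P * ?f)"] mult_1_right by (rule sym)
 hence "fps_nth (inverse ?P) k = fps_nth (inverse (?P * ?f)) k - (if k < 4 * Suc m then 0 else fps_nth (inverse (?P * ?f)) (k - 4 * Suc m))" for k
  by (simp add: fps_X_power_mult_right_nth del: mult_Suc_right)
 note r = this[of "nat j"]
 have n: "nat (j - 4 * int (Suc m)) = nat j - 4 * Suc m" "0 <= j ==> nat j < 4 * Suc m \<longleftrightarrow> j - 4 * int (Suc m) < 0" by linarith+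
 show ?thesis
 proof (cases "j < 0")
  case False
  thus ?thesis unfolding Qc_def e n(1) r using n(2) by (simp only: if_False not_less split: if_split) simp
 qed (simp add: Qc_def)
qed
lemma pcoeff_Qc: "pcoeff m a d = Qc m (- d - int a)"
proof -
 have "nat (- d - int a) = nat (- d) - a" by simp
 thus ?thesis by (auto simp: pcoeff_def Qc_def fps_X_power_mult_nth)
qed
text \<open>The uniqueness principle for the recursions, which determine only differences
  \<open>g D - g (D - p)\<close>: descending by \<open>p\<close> reaches the range where
  \<open>g\<close> vanishes.\<close>

lemma periodic_zero:
 fixes g :: "int => 'r::zero"
 assumes "!!D. g D = g (D - p)" "0 < p" "!!D. D < lo ==> g D = 0"
 shows "g D = 0"
proof -
 have *: "g D = g (D - p * int k)" for k
 proof (induction k)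
  case (Suc k)
  thus ?case using assms(1)[of "D - p * int k"] by (simp add: algs)
 qed simp
 define k where "k = nat (D - lo + 1)"
 have "int k * 1 <= int k * p" using assms(2) by (intro mult_left_mono) auto
 hence "D - p * int k < lo" by (subst mult.commute) (unfold mult_1_right, insert k_def, linarith)
 thus ?thesis using * assms(3) by metis
qed
lemma telescope2: "(SUM j<m. g (E - 2 * int j)) - (SUM j<m. g (E - 2 - 2 * int j)) = g E - (g (E - 2 * int m) :: int)"
 by (induction m) (simp_all add: algs)

context nbt begin
lemma Bd_empty: "D < - 4 * int ((n + m) * m) ==> Bd n m D = {}"
proof (rule ccontr)
 assume a: "D < - 4 * int ((n + m) * m)" "Bd n m D ~= {}"
 then obtain l where "length l = m" "bdeg n l = D" by (auto simp: Bd_def)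
 thus False using bdeg_ge[of l n] a(1) by simp
qed
text \<open>Raising the first entry by one embeds the words for \<open>D - 2\<close> into those for
  \<open>D\<close>; the complement consists of the words that begin with \<open>n\<close>.\<close>

lemma card_step:
 assumes F: "!!E. finite (F E)" and m: "!!E l. E < elow ==> F E = ({} :: nat list set)"
 shows "int (card {c # l | c l. n <= c & l : F (D - 2 * int c)}) - int (card {c # l | c l. n <= c & l : F (D - 2 - 2 * int c)}) = int (card (F (D - 2 * int n)))"
proof -
 let ?P = "%D. {c # l | c l. n <= c & l : F (D - 2 * int c)}" and ?S = "%x. Suc (hd x) # tl x"
 have fin: "finite (?P D)" for D
 proof (rule finite_subset)
  let ?A = "(SIGMA c:{..nat (D - elow)}. F (D - 2 * int c))"
  show "?P D <= (%(c, l). c # l) ` ?A"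
  proof
   fix x assume "x : ?P D"
   then obtain c l where x: "x = c # l" "l : F (D - 2 * int c)" by blast
   hence "c <= nat (D - elow)" using m[of "D - 2 * int c"] by (cases "D - 2 * int c < elow") auto
   thus "x : (%(c, l). c # l) ` ?A" using x by force
  qed
 qed (auto intro: F)
 have "?P D = (#) n ` F (D - 2 * int n) \<union> ?S ` ?P (D - 2)"
 proof (intro set_eqI iffI)
  fix x assume "x : ?P D"
  then obtain c l where x: "x = c # l" "n <= c" "l : F (D - 2 * int c)" by blast
  show "x : (#) n ` F (D - 2 * int n) \<union> ?S ` ?P (D - 2)"
  proof (cases "c = n")
   case False
   then obtain c' where c': "c = Suc c'" "n <= c'" using x by (cases c) auto
   hence "x = ?S (c' # l)" "c' # l : ?P (D - 2)" using x by (auto simp: algs)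
   thus ?thesis by blast
  qed (use x in auto)
 qed (auto simp: algs)
 moreover have "inj_on ?S (?P (D - 2))" by (auto simp: inj_on_def)
 moreover have "(#) n ` F (D - 2 * int n) \<inter> ?S ` ?P (D - 2) = {}" by auto
 ultimately have "card (?P D) = card (F (D - 2 * int n)) + card (?P (D - 2))"
  using fin F by (simp add: card_Un_disjoint card_image)
 thus ?thesis by simp
qed

context assumes two: "(2 :: 'a) ~= 0" begin
lemma dk_neg: "D < - 4 * int ((n + (k + b)) * (k + b)) ==> dk k b n D = 0"
 using dk_le[OF two, of k b n D] Bd_empty[of D n "k + b"] by simp
text \<open>Between \<open>D\<close> and \<open>D - 2\<close> both sums of \<open>dk_rec\<close>
  telescope to their end terms.\<close>

lemma dk_diff:
 "int (dk (Suc k) b n D) - int (dk (Suc k) b n (D - 2)) = int (dk k (Suc b) n D) - int (dk k (Suc b) n (D - 2 * int b - 2))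
  + (if cc b = 1 & 0 < b then int (dk k (b - 1) n (D + 2 * int b - 2)) - int (dk k (b - 1) n (D - 2)) else 0)"
proof -
 let ?f = "%D. int (dk k (Suc b) n D)" and ?g = "%D. int (dk k (b - 1) n D)"
 have 1: "int (dk (Suc k) b n D) = (SUM j<Suc b. ?f (D - 2 * int j)) + (if cc b = 1 then SUM l<b. ?g ((D + 2 * int (b - 1)) - 2 * int l) else 0)" for D
  unfolding dk_rec[OF two] by (simp add: lessThan_Suc_atMost)
 show ?thesis unfolding 1[of D] 1[of "D - 2"]
  using telescope2[of ?f D "Suc b"] telescope2[of ?g "D + 2 * int (b - 1)" b] by (cases b) (auto simp: algs simp del: sum.lessThan_Suc)
qed
lemma card_Bd_rec:
 "int (dk (Suc k) 0 n D) - int (dk (Suc k) 0 n (D - 2)) =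
  (if 0 < n then int (dk k 0 (n - 1) D) - int (dk k 0 (n - 1) (D - 2 * int n)) else 0) + int (dk k 0 (Suc n) (D + 2 * int n))"
proof -
 let ?R = "%a F D. {c # l | c l. a <= c & l : F (D - 2 * int c)}"
 let ?F = "Bd (n - 1) k" and ?G = "%E. Bd (Suc n) k (E + 4 * int n)"
 have fR: "finite (?R a ?F D)" for a D
 proof (rule finite_subset)
  let ?A = "(SIGMA c:{..nat (D + 4 * int ((n - 1 + k) * k))}. ?F (D - 2 * int c))"
  show "?R a ?F D <= (%(c, l). c # l) ` ?A"
  proof
   fix x assume "x : ?R a ?F D"
   then obtain c l where x: "x = c # l" "l : ?F (D - 2 * int c)" by blast
   thus "x : (%(c, l). c # l) ` ?A" using Bd_empty[of "D - 2 * int c" "n - 1" k] x by fastforce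
  qed
 qed (auto intro: finite_Bd)
 have sF: "int (card (?R a ?F D)) - int (card (?R a ?F (D - 2))) = int (card (?F (D - 2 * int a)))" for a
  by (rule card_step[OF finite_Bd Bd_empty])
 have sG: "int (card (?R n ?G D)) - int (card (?R n ?G (D - 2))) = int (card (?G (D - 2 * int n)))"
  by (rule card_step[OF finite_Bd Bd_empty, where elow = "- 4 * int ((Suc n + k) * k) - 4 * int n"]) simp
 \<comment> \<open>Threads have first entries below \<open>n\<close>. They are counted as all
   entries minus those from \<open>n\<close> on, so the words \<open>?R n ?F\<close> are added on
   the other side; \<open>card_step\<close> then applies to each family.\<close>
 have B: "Bd n (Suc k) D \<union> ?R n ?F D = ?R 0 ?F D \<union> ?R n ?G D" "Bd n (Suc k) D \<inter> ?R n ?F D = ?R n ?F D \<inter> ?R n ?G D"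
   "?R 0 ?F D \<inter> ?R n ?G D = ?R n ?F D \<inter> ?R n ?G D" for D
 proof -
  have m: "[] ~: Bd n (Suc k) D" "c # l : Bd n (Suc k) D \<longleftrightarrow> (if c < n then l : ?F (D - 2 * int c) else l : ?G (D - 2 * int c))" for c l
   by (auto simp: Bd_def)
  have r: "[] ~: ?R a H D" "c # l : ?R a H D \<longleftrightarrow> a <= c & l : H (D - 2 * int c)" for c l a H by auto
  show "Bd n (Suc k) D \<union> ?R n ?F D = ?R 0 ?F D \<union> ?R n ?G D" (is "?s = ?t")
  proof (rule set_eqI)
   fix x show "x : ?s \<longleftrightarrow> x : ?t"
   using m(1) r(1) by (cases x) (auto simp: Un_iff m r)
  qed
  show "Bd n (Suc k) D \<inter> ?R n ?F D = ?R n ?F D \<inter> ?R n ?G D" (is "?s = ?t")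
  proof (rule set_eqI)
   fix x show "x : ?s \<longleftrightarrow> x : ?t"
   using m(1) r(1) by (auto simp: Int_iff m r)
  qed
  show "?R 0 ?F D \<inter> ?R n ?G D = ?R n ?F D \<inter> ?R n ?G D" by auto
 qed
 have fG: "finite (?R n ?G D)" for D
 proof -
  have "finite (Bd n (Suc k) D \<union> ?R n ?F D)" using finite_Bd fR by (rule finite_UnI)
  thus ?thesis unfolding B(1) by (rule finite_subset[rotated]) (rule Un_upper2)
 qed
 have c: "int (card (Bd n (Suc k) D)) + int (card (?R n ?F D)) = int (card (?R 0 ?F D)) + int (card (?R n ?G D))" for D
  using card_Un_Int[OF finite_Bd fR, of n "Suc k" D n D] card_Un_Int[OF fR fG, of 0 D D] B[of D] by simp
 show ?thesis unfolding dk_0[OF two] using c[of D] c[of "D - 2"] sF[of 0] sF[of n] sG by (auto simp: algs)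
qed
text \<open>For \<open>b = 0\<close> this counts basis words by their first entry. For
  \<open>b = Suc c\<close>, \<open>dk_diff\<close> expresses the difference of the ranks in degrees
  \<open>D\<close> and \<open>D - (2c + 2)\<close> by ranks for \<open>c\<close> and
  \<open>c - 1\<close>, where the identity is known by induction. So the defect \<open>G\<close> has
  period \<open>2c + 2\<close>, and it vanishes in low degrees.\<close>

lemma dk_restrict:
 "int (dk (Suc k) b n D) - int (dk (Suc k) b n (D - 2)) =
  (if 0 < n then int (dk k b (n - 1) D) - int (dk k b (n - 1) (D - 2 * int n)) else 0) + int (dk k b (Suc n) (D + 2 * int n))"
proof (induction b arbitrary: k n D rule: less_induct)
 case (less b)
 show ?case
 proof (cases b)
  case 0
  thus ?thesis using card_Bd_rec by simp
 next
  case (Suc c)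
  define G where "G D = int (dk (Suc k) b n D) - int (dk (Suc k) b n (D - 2)) -
   ((if 0 < n then int (dk k b (n - 1) D) - int (dk k b (n - 1) (D - 2 * int n)) else 0) + int (dk k b (Suc n) (D + 2 * int n)))" for D
  define h where "h k n D = (if cc c = 1 & 0 < c then int (dk k (c - 1) n (D + 2 * int c - 2)) - int (dk k (c - 1) n (D - 2)) else 0)" for k n D
  have hh: "h (Suc k) n D - h (Suc k) n (D - 2) = (if 0 < n then h k (n - 1) D - h k (n - 1) (D - 2 * int n) else 0) + h k (Suc n) (D + 2 * int n)" for D
   using less.IH[of "c - 1" k n "D + 2 * int c - 2"] less.IH[of "c - 1" k n "D - 2"] Suc by (auto simp: h_def algs)
  have d: "int (dk k b n D) - int (dk k b n (D - 2 * int c - 2)) = int (dk (Suc k) c n D) - int (dk (Suc k) c n (D - 2)) - h k n D" for k n D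
   using dk_diff[of k c n D] Suc by (simp add: h_def)
  have per: "G D = G (D - (2 * int c + 2))" for D
   using hh[of D] less.IH[of c "Suc k" n D] less.IH[of c "Suc k" n "D - 2"] d[of "Suc k" n D] d[of "Suc k" n "D - 2"] d[of k "Suc n" "D + 2 * int n"]
    d[of k "n - 1" D] d[of k "n - 1" "D - 2 * int n"] Suc
   by (cases "0 < n") (simp_all add: G_def algs)
  \<comment> \<open>Low enough for every rank that occurs in \<open>G D\<close>, also for the one
    taken in degree \<open>D + 2n\<close>.\<close>
  define D0 where "D0 = - 4 * int ((n + 2 + (Suc k + b)) * (Suc k + b)) - 2 * int n"
  have neg: "dk k' b n' E = 0" if "E <= D0 + 2 * int n" "k' <= Suc k" "n' <= Suc n" for k' n' E
  proof (rule dk_neg)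
   have "(n' + (k' + b)) * (k' + b) <= (n + 1 + (Suc k + b)) * (Suc k + b)" using that by (intro mult_le_mono) auto
   moreover have "(n + 2 + (Suc k + b)) * (Suc k + b) = (n + 1 + (Suc k + b)) * (Suc k + b) + (Suc k + b)" by (simp add: algs)
   ultimately have "int ((n' + (k' + b)) * (k' + b)) + 1 <= int ((n + 2 + (Suc k + b)) * (Suc k + b))" by linarith
   thus "E < - 4 * int ((n' + (k' + b)) * (k' + b))" using that(1) unfolding D0_def by linarith
  qed
  have "G D = 0" for D
   by (rule periodic_zero[of G "2 * int c + 2" D0]) (use per neg in "auto simp: G_def")
  from this[of D] show ?thesis by (simp add: G_def)
 qed
qed

text \<open>The expected rank: the multiplicity of the theorem, with the exponent of
  \<open>q\<close> rewritten as a degree by \<open>d = shift n - shift b - D\<close>.\<close>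

definition tf :: "nat => nat => int => rat" where
 "tf b n D = (if n <= b & even (b - n) then
   (let m = (b - n) div 2 in Qc m (D - (shift n - shift b + int (if cc n = 1 then m * (2 * m - 1) else m * (2 * m + 1))))) else 0)"
lemma shift_Suc: "shift (Suc n) = shift n + int n"
proof -
 have "Suc n * n = n * (n - 1) + 2 * n" by (cases n) auto
 thus ?thesis by (simp add: shift_def)
qed
lemma shift_add: "shift (n + k) = shift n + int n * int k + shift k"
 by (induction k) (auto simp: shift_Suc algs shift_def[of 0])
lemma shift_double: "shift (2 * m) = int m * (2 * int m - 1)"
 by (induction m) (auto simp: shift_Suc algs shift_def[of 0])
lemma tf_eq: "tf (n + 2 * m) n D = Qc m (D + (2 * int n * int m + (if cc n = 1 then 0 else - 2 * int m)))"
proof -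
 have "int (m * (2 * m - 1)) = int m * (2 * int m - 1)" by (cases m) (auto simp: algs)
 hence "D - (shift n - shift (n + 2 * m) + int (if cc n = 1 then m * (2 * m - 1) else m * (2 * m + 1))) = D + (2 * int n * int m + (if cc n = 1 then 0 else - 2 * int m))"
  unfolding shift_add shift_double by (auto simp: algs)
 moreover have "n <= n + 2 * m & even (n + 2 * m - n)" "(n + 2 * m - n) div 2 = m" by simp_all
 ultimately show ?thesis unfolding tf_def Let_def by (simp only: if_True simp_thms)
qed
lemma tf_0: "~ (n <= b & even (b - n)) ==> tf b n D = 0" unfolding tf_def by (rule if_not_P)
text \<open>In each parity case all terms become shifts of \<open>Qc m\<close> by
  \<open>Qc_Suc\<close>; this is where the factor \<open>1 - q^(-4m)\<close> enters.\<close>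

lemma tf_rec:
 "tf (Suc b) n D - tf (Suc b) n (D - 2 * int b - 2) = (if 0 < n then tf b (n - 1) D - tf b (n - 1) (D - 2 * int n) else 0)
  + tf b (Suc n) (D + 2 * int n) - (if cc b = 1 & 0 < b then tf (b - 1) n (D + 2 * int b - 2) - tf (b - 1) n (D - 2) else 0)"
proof (cases "n <= Suc b & even (Suc b - n)")
 case False
 hence "tf (Suc b) n E = 0" "tf b (Suc n) E = 0" "0 < n ==> tf b (n - 1) E = 0" "0 < b ==> tf (b - 1) n E = 0" for E
  by (intro tf_0; force)+
 thus ?thesis by simp
next
 case True
 then obtain m where m: "Suc b = n + 2 * m" by (metis dvd_def le_add_diff_inverse)
 have c2: "cc (k + 2 * i) = cc k" for k i by (auto simp: cc_def)
 have cb: "cc b = 1 - cc n" using cc_Suc[of b] c2[of n m] m by simp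
 have t1: "tf b (n - 1) E = Qc m (E + (2 * (int n - 1) * int m + (if cc n = 1 then - 2 * int m else 0)))" if "0 < n" for E
 proof -
  have "b = n - 1 + 2 * m" using m that by simp
  moreover have "cc (n - 1) = 1 - cc n" using cc_Suc[of "n - 1"] that by simp
  ultimately show ?thesis using tf_eq[of "n - 1" m E] that cc_cases[of n] by (auto simp: of_nat_diff)
 qed
 show ?thesis
 proof (cases m)
  case 0
  hence z: "tf b (Suc n) E = 0" "0 < b ==> tf (b - 1) n E = 0" for E using m by (auto intro!: tf_0)
  show ?thesis unfolding m z(1) tf_eq using t1 z(2) m 0 by (auto simp: algs)
 next
  case (Suc p)
  have t2: "tf b (Suc n) E = Qc p (E + (2 * (int n + 1) * int p + (if cc n = 1 then - 2 * int p else 0)))" for E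
  using m Suc tf_eq[of "Suc n" p E] cc_Suc[of n] cc_cases[of n] by (auto simp: algs)
  have t3: "tf (b - 1) n E = Qc p (E + (2 * int n * int p + (if cc n = 1 then 0 else - 2 * int p)))" for E
  using m Suc tf_eq[of n p E] by simp
  have b: "int b = int n + 2 * int m - 1" "0 < b" using m Suc by linarith+
  have Q: "Qc p j = Qc m j - Qc m (j - 4 * int m)" for j using Qc_Suc[of p j] Suc by simp
  have e: "int p = int m - 1" using Suc by simp
  show ?thesis using cc_cases[of n] b(2)
   unfolding m tf_eq t2 t3 cb Q e b(1) by (cases "0 < n") (auto simp: t1 algs simp del: One_nat_def)
 qed
qed

text \<open>Equating \<open>dk_diff\<close> and \<open>dk_restrict\<close> for one auxiliary strand
  eliminates it and gives the recursion that \<open>tf_rec\<close> states for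
  \<open>tf\<close>.\<close>

theorem dk_tf: "of_nat (dk 0 b n D) = tf b n D"
proof (induction b arbitrary: n D rule: less_induct)
 case (less b)
 show ?case
 proof (cases b)
  case 0
  have "Bd n 0 D = (if n = 0 & D = 0 then {[]} else {})" by (auto simp: Bd_def)
  thus ?thesis using tf_eq[of 0 0 D] 0 by (cases "n = 0") (auto simp: dk_0[OF two] Qc_0 tf_0)
 next
  case (Suc c)
  have r: "int (dk 0 b n D) - int (dk 0 b n (D - 2 * int c - 2)) = (if 0 < n then int (dk 0 c (n - 1) D) - int (dk 0 c (n - 1) (D - 2 * int n)) else 0)
    + int (dk 0 c (Suc n) (D + 2 * int n)) - (if cc c = 1 & 0 < c then int (dk 0 (c - 1) n (D + 2 * int c - 2)) - int (dk 0 (c - 1) n (D - 2)) else 0)" for D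
   using dk_diff[of 0 c n D] dk_restrict[of 0 c n D] Suc by simp
  define G where "G D = of_nat (dk 0 b n D) - tf b n D" for D
  have per: "G D = G (D - (2 * int c + 2))" for D
  proof -
   have "of_nat (dk 0 b n D) - of_nat (dk 0 b n (D - 2 * int c - 2)) = tf b n D - tf b n (D - 2 * int c - 2)"
    unfolding Suc tf_rec using arg_cong[OF r[of D], of rat_of_int] less.IH[of c] less.IH[of "c - 1"] Suc by (simp split: if_splits)
   thus ?thesis by (simp add: G_def algs)
  qed
  have neg: "G D = 0" if "D < min (- 4 * int ((n + b) * b)) (shift n - shift b)" for D
  proof -
   show ?thesis using that dk_neg[of D n 0 b] by (simp add: tf_def Let_def Qc_def G_def)
  qed
  show ?thesis using periodic_zero[where g = G and p = "2 * int c + 2", OF per _ neg] by (fastforce simp: G_def)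
 qed
qed

end
end

section \<open>Endomorphisms of degree at most 0, and irreducible subquotients\<close>

context nbt begin
lemma PX_dg: "y : PX n ==> EX e>=0. dg e y & (e = 0 --> (EX c. y = c *s ii n))"
proof (induction rule: PX.induct)
 case PX_I
 thus ?case by (intro exI[of _ 0]) (auto intro: exI[of _ 1])
next
 case (PX_X y i)
 then obtain e where "e >= 0" "dg e y" by blast
 thus ?case using dg_mult[OF dg_X[of n i]] by (intro exI[of _ "2 + e"]) auto
next
 case (PX_rb y k)
 then obtain e where e: "e >= 0" "dg e y" "e = 0 ==> EX c. y = c *s ii n" by blast
 have "dg (2 * int k + e) (rb n k * y)" by (rule dg_mult[OF dg_rb e(2)])
 moreover have "EX c. rb n k * y = c *s ii n" if "2 * int k + e = 0"
  using that e by (cases k) (auto simp: rb_0 I_I)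
 ultimately show ?case using e(1) by (intro exI[of _ "2 * int k + e"]) simp
qed
text \<open>Modulo \<open>Kst n\<close> an endomorphism is a combination of products of dots and
  bubbles, and these have positive degree unless they are multiples of the identity.\<close>

lemma endo_deg:
 assumes "hm n n y" "dg D y" "D <= 0"
 shows "EX c. y - c *s ii n : Kst n & (D < 0 --> c = 0)"
proof -
 have "EX c. hc D y - c *s ii n : Kst n & (D < 0 --> c = 0)" if "y : PK n" for y using that
 proof (induction rule: PK.induct)
  case (PK_K y)
  thus ?case by (intro exI[of _ 0]) (simp add: hc_Kst)
 next
  case (PK_X y)
  from PX_dg[OF this] obtain e where e: "e >= 0" "dg e y" "e = 0 ==> EX c. y = c *s ii n" by blast
  show ?case
  proof (cases "e = D")
   case True
   then obtain c where "y = c *s ii n" "D = 0" using e assms(3) by auto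
   thus ?thesis using True lidealD(1)[OF lideal_Kst] by (intro exI[of _ c]) (simp add: dg_hc_eq[OF dg_I])
  next
   case False
   thus ?thesis using lidealD(1)[OF lideal_Kst] by (intro exI[of _ 0]) (simp add: dg_hc_eq[OF e(2)])
  qed
 next
  case (PK_add y z)
  then obtain c c' where "hc D y - c *s ii n : Kst n" "hc D z - c' *s ii n : Kst n" "D < 0 --> c = 0 & c' = 0" by blast
  thus ?case using lidealD(2)[OF lideal_Kst, of "hc D y - c *s ii n" n "hc D z - c' *s ii n"]
   by (intro exI[of _ "c + c'"]) (simp add: hc_add smul_add_left algs)
 next
  case (PK_smul y c)
  then obtain c' where "hc D y - c' *s ii n : Kst n" "D < 0 --> c' = 0" by blast
  thus ?case using lidealD(3)[OF lideal_Kst, of "hc D y - c' *s ii n" n c]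
   by (intro exI[of _ "c * c'"]) (simp add: smul_diff)
 qed
 from this[OF endo_PK[OF assms(1)]] show ?thesis using assms(2) by (simp add: dg_def)
qed

text \<open>Crossings generate a matrix algebra modulo \<open>low\<close>, so a weight vector is detected by \<open>w c\<close>.\<close>
lemma w_gen: "lideal M ==> (!!z. w c * z : M) ==> low c <= M ==> ii c : M"
proof (induction c arbitrary: M)
 case 0
 thus ?case using "0.prems"(2)[of "ii 0"] by (simp add: I_I)
next
 case (Suc c)
 note M = lidealD[OF Suc.prems(1)]
 obtain p r where pr: "L (w c) = (SUM j<=c. xp (Suc c) 0 j * (w (Suc c) * p j)) + (SUM l<c. xp (Suc c) 0 l * (gg (c - 1) * r l))"
  using Lw_decomp by blast
 have g: "gg (c - 1) * y : low (Suc c)" if "l < c" for l y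
 proof -
  have "hm (Suc c) (c - 1) (gg (c - 1))" using hm_gg[of "c - 1"] that by simp
  from low_right[OF low_hm_right[OF _ this]] show ?thesis by simp
 qed
 have 1: "xp (Suc c) 0 j * (w (Suc c) * (p j * y)) : M" for j y by (rule M(4)[OF Suc.prems(2)])
 have 2: "xp (Suc c) 0 l * (gg (c - 1) * (r l * y)) : M" if "l < c" for l y using M(4) g[OF that] Suc.prems(3) by blast
 have Lz: "L (w c) * y : M" for y
  unfolding pr distrib_right sum_distrib_right assoc
  by (intro M(2) lideal_sum[OF Suc.prems(1)] 1 2) simp
 have "ii c : {y. ALL z. L y * z : M}"
 proof (rule Suc.IH)
  show "lideal {y. ALL z. L y * z : M}" using M by (simp add: lideal_def distrib_right assoc)
  show "low c <= {y. ALL z. L y * z : M}" using Suc.prems(3) low_right[OF L_low] by blast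
 qed (use Lz in "simp add: assoc")
 hence "L (ii c) * ii (Suc c) : M" by blast
 thus ?case by (simp add: I_I)
qed
text \<open>Otherwise the proper standard module would be 0, while the rank in degree 0 for
  \<open>n = b\<close> is 1.\<close>

lemma not_I_Kp: assumes two: "(2 :: 'a) ~= 0" shows "ii b ~: Kp b"
proof
 assume I: "ii b : Kp b"
 have "Rk (Kp b) (Sp 0 b b 0) 0"
  unfolding Rk_def ind_def using lidealD(4)[OF lideal_Kp I] SpD(1)[of _ 0 b b 0] hm_right[of b b] by (intro exI) (auto, metis add_0)
 hence "rat_of_nat 0 = tf b b 0" using dk_tf[OF two, of b b 0] dkI by metis
 thus False using tf_eq[OF two, of b 0 0] by (simp add: Qc_0 split: if_splits)
qed
text \<open>By \<open>endo_deg\<close>, \<open>ei b\<close> is a scalar \<open>c\<close> modulo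
  \<open>Kst b\<close>. Multiplication by \<open>w b\<close> from the right sends
  \<open>Kst b\<close> into \<open>low b\<close> and \<open>ei b\<close> to \<open>w b\<close>; if
  \<open>c\<close> were not 1, then \<open>w b\<close> and by \<open>w_gen\<close> the identity
  would be low.\<close>

lemma ei_Kst: assumes two: "(2 :: 'a) ~= 0" shows "ii b - ei b : Kst b"
proof -
 obtain c where c: "ei b - c *s ii b : Kst b" using endo_deg[OF hm_ei dg_ei] by blast
 have Kw: "y * w b : low b" if "y : Kst b" for y using that
  by (induction rule: Kst.induct) (auto simp: distrib_right assoc hm_left[OF hm_w] simp del: w.simps intro: low_add low_right low_0)
 have "c = 1"
 proof (rule ccontr)
  assume "c ~= 1"
  have "(1 - c) *s w b : low b" using Kw[OF c] by (simp add: left_diff_distrib ei_w hm_left[OF hm_w] nbv.scale_left_diff_distrib del: w.simps)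
  from low_smul[OF this, of "inverse (1 - c)"] have "w b : low b" using \<open>c ~= 1\<close> by (simp del: w.simps)
  hence "ii b : low b" by (intro w_gen lideal_low low_right) auto
  thus False using not_I_Kp[OF two] Kp_K[OF Kst_low'[OF _ hm_I]] by blast
 qed
 thus ?thesis using lidealD(5)[OF lideal_Kst c] by simp
qed

definition gsm :: "nat => ('a, 'b) nb set => ('a, 'b) nb set => bool" where
 "gsm n K S \<longleftrightarrow> lideal S & K <= S & (ALL y:S. y * ii n = y) & (ALL y:S. ALL d. hc d y : S)"
lemma gsmD: "gsm n K S ==> lideal S" "gsm n K S ==> y : K ==> y : S" "gsm n K S ==> y : S ==> y * ii n = y" "gsm n K S ==> y : S ==> hc d y : S"
 by (auto simp: gsm_def)

definition cyc :: "('a, 'b) nb set => ('a, 'b) nb => ('a, 'b) nb set" where "cyc S x = {s + y * x | s y. s : S}"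
lemma cyc_base: "gsm n K S ==> s : S ==> s : cyc S x" unfolding cyc_def by (rule CollectI, rule exI[of _ s], rule exI[of _ 0]) simp
lemma cyc_gen: "gsm n K S ==> y * x : cyc S x" unfolding cyc_def using lidealD(1)[OF gsmD(1)] by force
lemma gsm_cyc: assumes S: "gsm n K S" and x: "dg d x" "x * ii n = x" shows "gsm n K (cyc S x)"
proof -
 note L = lidealD[OF gsmD(1)[OF S]]
 have "lideal (cyc S x)" unfolding lideal_def
 proof (intro conjI ballI allI)
  show "0 : cyc S x" using cyc_base[OF S L(1)] .
  fix y c u assume "y : cyc S x"
  then obtain s a where y: "y = s + a * x" "s : S" by (auto simp: cyc_def)
  show "c *s y : cyc S x" unfolding y cyc_def using L(3)[OF y(2), of c] by (rule_tac CollectI, rule_tac exI[of _ "c *s s"], rule_tac exI[of _ "c *s a"]) (simp add: smul_add)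
  show "u * y : cyc S x" unfolding y cyc_def using L(4)[OF y(2), of u] by (rule_tac CollectI, rule_tac exI[of _ "u * s"], rule_tac exI[of _ "u * a"]) (simp add: distrib_left assoc)
  fix z assume "z : cyc S x"
  then obtain s' a' where z: "z = s' + a' * x" "s' : S" by (auto simp: cyc_def)
  show "y + z : cyc S x" unfolding y z cyc_def using L(2)[OF y(2) z(2)]
   by (rule_tac CollectI, rule_tac exI[of _ "s + s'"], rule_tac exI[of _ "a + a'"]) (simp add: distrib_right)
 qed
 moreover have "hc e y : cyc S x" "y * ii n = y" if yc: "y : cyc S x" for y e
 proof -
  obtain s a where y: "y = s + a * x" "s : S" using yc by (auto simp: cyc_def)
  show "hc e y : cyc S x" using gsmD(4)[OF S y(2), of e] unfolding y(1) cyc_def by (auto simp: hc_add hc_lmult[OF x(1)])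
  show "y * ii n = y" unfolding y(1) using gsmD(3)[OF S y(2)] x(2) by (simp add: distrib_right assoc)
 qed
 ultimately show ?thesis unfolding gsm_def using cyc_base[OF S] gsmD(2)[OF S] by blast
qed

text \<open>Equality of \<open>S0\<close> and \<open>S1\<close> is not excluded here; the uses
  supply a vector of \<open>S1\<close> outside \<open>S0\<close>.\<close>

definition irrN :: "nat => ('a, 'b) nb set => ('a, 'b) nb set => bool" where
 "irrN n S0 S1 \<longleftrightarrow> gsm n (Kp n) S0 & gsm n (Kp n) S1 & S0 <= S1 & (ALL S. gsm n S0 S & S <= S1 --> S = S0 | S = S1)"

context
 fixes n S0 S1
 assumes irr: "irrN n S0 S1"
begin
lemma g0: "gsm n (Kp n) S0" and g1: "gsm n (Kp n) S1" and g01: "S0 <= S1" using irr by (auto simp: irrN_def)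
lemmas L0 = lidealD[OF gsmD(1)[OF g0]] and L1 = lidealD[OF gsmD(1)[OF g1]]
lemma irr_cyc: assumes x: "x : S1" "x ~: S0" "dg d x" "ii p * x = x" shows "cyc S0 x = S1"
proof -
 have "gsm n S0 (cyc S0 x)" using gsm_cyc[OF g0 x(3) gsmD(3)[OF g1 x(1)]] cyc_base[OF g0] by (auto simp: gsm_def)
 moreover have "cyc S0 x <= S1" unfolding cyc_def using g01 L1(2) L1(4)[OF x(1)] by auto
 moreover have "x : cyc S0 x" using cyc_gen[OF g0, of "ii p" x] x(4) by simp
 ultimately show ?thesis using irr x(2) unfolding irrN_def by blast
qed
lemma irr_gen:
 assumes x: "x : S1" "x ~: S0" "dg d x" "ii p * x = x" and y: "y : S1" "dg d' y" "ii c * y = y"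
 shows "EX z. hm c p z & dg (d' - d) z & y - z * x : S0"
proof -
 have "y : cyc S0 x" using irr_cyc[OF x] y(1) by blast
 then obtain s z where s: "y = s + z * x" "s : S0" by (auto simp: cyc_def)
 define z' where "z' = hc (d' - d) (ii c * (z * ii p))"
 have "hm c p (ii c * (z * ii p))" by (simp add: hm_def assoc I_I)
 moreover have "y - z' * x = ii c * hc d' s"
 proof -
  have "z' * x = hc d' (ii c * (z * ii p) * x)" using hc_lmult[OF x(3), of d' "ii c * (z * ii p)"] by (simp add: z'_def)
  also have "ii c * (z * ii p) * x = y - ii c * s" using x(4) s(1) y(3) by (simp add: assoc) (metis add_diff_cancel_left' distrib_left)
  finally show ?thesis using y(2) by (simp add: hc_diff hc_e[OF dg_I] dg_def)
 qed
 ultimately show ?thesis using L0(4)[OF gsmD(4)[OF g0 s(2)]] hm_hc dg_hc unfolding z'_def by metis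
qed
text \<open>Says that \<open>b\<close> is the least weight of the subquotient. If the least weight
  were \<open>c < b\<close>, a vector \<open>u\<close> fixed by \<open>ei c\<close> would be killed
  by all of \<open>Kp c\<close>. The way from \<open>u\<close> to \<open>v\<close>, and the
  reflection of the way back, are then nonzero truncated elements modulo \<open>Kp c\<close>, and
  their degrees contradict \<open>pos\<close>.\<close>

lemma minw:
 assumes two: "(2 :: 'a) ~= 0" and v: "v : S1" "v ~: S0" "dg dv v" "ei b * v = v" and y: "y : low b"
 shows "y * v : S0"
proof -
 define c where "c = (LEAST c. EX x:S1. ii c * x ~: S0)"
 have v1: "ii b * v = v" using v(4) hm_left'[OF hm_ei[of b], of v] by simp
 have c: "EX x:S1. ii c * x ~: S0" and cb: "c <= b" unfolding c_def
  using v v1 by (auto intro!: LeastI[of "%c. EX x:S1. ii c * x ~: S0" b] Least_le bexI[of _ v])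
 have min: "ii m * x : S0" if "m < c" "x : S1" for m x using that not_less_Least unfolding c_def by blast
 have low: "y * x : S0" if y: "y : low c" and x: "x : S1" for y x using y
 proof (induction rule: low.induct)
  case (low_step v m y z)
  thus ?case using L0(2)[OF L0(4)[OF min[OF low_step(2) L1(4)[OF x, of z]], of y]] by (simp add: distrib_right assoc)
 qed (simp add: L0(1))
 show ?thesis
 proof (cases "c = b")
  case True thus ?thesis using low y v by simp
 next
  case False
  obtain x where x: "x : S1" "ii c * x ~: S0" using c by blast
  have "EX z. w c * z * x ~: S0"
  proof (rule ccontr)
   assume a: "~ ?thesis"
   have "ii c : {y. y * x : S0}"
    by (rule w_gen) (use a low[OF _ x(1)] L0 in "auto simp: lideal_def distrib_right assoc")
   thus False using x(2) by simp
  qed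
  then obtain z where z: "w c * z * x ~: S0" by blast
  obtain D where D: "w c * z * x = (SUM d:D. hc d (w c * z * x))" using hc_decomp[of "w c * z * x"] by blast
  then obtain du where du: "hc du (w c * z * x) ~: S0" using z lideal_sum[OF gsmD(1)[OF g0]] by metis
  define u where "u = hc du (w c * z * x)"
  have u: "u : S1" "u ~: S0" "dg du u" using du gsmD(4)[OF g1 L1(4)[OF x(1)]] dg_hc by (auto simp: u_def)
  have eu: "ei c * u = u" unfolding u_def hc_e[OF dg_ei, symmetric] assoc ei_w(2) ..
  have u1: "ii c * u = u" using eu hm_left'[OF hm_ei[of c], of u] by simp
  have uw: "u = w c * (rho c * u)" using eu by (simp add: ei_def assoc)
  have Tu: "tt c i * u = 0" for i by (subst uw) simp
  have Ku: "k * u : S0" if "k : Kst c" for k using that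
   by (induction rule: Kst.induct) (auto simp: assoc u1 Tu distrib_right L0(1) intro: low u(1) L0(2))
  \<comment> \<open>If \<open>f * u\<close> survived, irreducibility would lead back to
    \<open>u\<close> by an endomorphism of negative degree; by \<open>endo_deg\<close> it lies in
    \<open>Kst c\<close>, hence so does its product with \<open>f\<close>, which therefore kills
    \<open>u\<close>.\<close>
  have neg: "f * u : S0" if f: "hm c c f" "dg (2 * int r) f" "1 <= r" "!!k. k : Kst c ==> k * f : Kst c" for f r
  proof (rule ccontr)
   assume a: "f * u ~: S0"
   obtain z where z: "hm c c z" "dg (du - (2 * int r + du)) z" "u - z * (f * u) : S0"
    using irr_gen[OF L1(4)[OF u(1)] a dg_mult[OF f(2) u(3)] hm_left'[OF f(1)] u(1,3) u1] by blast
   have "z * (f * u) : S0" using endo_deg[OF z(1,2)] f(3) Ku[OF f(4)] by (simp add: assoc)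
   from L0(2)[OF z(3) this] show False using u(2) by simp
  qed
  have el: "el c r * u : S0" if "1 <= r" for r using neg[OF hm_el dg_el that Kst_el] .
  have rb: "rb c r * u : S0" if "1 <= r" for r using neg[OF hm_rb dg_rb that Kst_rb] .
  have Kpu: "k * u : S0" if "k : Kp c" for k using that
   by (induction rule: Kp.induct) (auto simp: assoc distrib_right simp del: One_nat_def intro: Ku L0(2) L0(4)[OF el] L0(4)[OF rb])
  \<comment> \<open>Extends from \<open>u\<close> to the whole weight space \<open>c\<close>, which
    is reached from \<open>u\<close> by dots and bubbles, and these commute with \<open>el\<close>
    and \<open>rb\<close>.\<close>
  have all: "el c r * y : S0 & rb c r * y : S0" if r: "1 <= r" and y: "y : S1" "ii c * y = y" "dg d y" for r y d
  proof -
   obtain z where z: "hm c c z" "y - z * u : S0" using irr_gen[OF u(1,2,3) u1 y(1,3,2)] by blast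
   have "el c r * (p * u) : S0 & rb c r * (p * u) : S0" if "p : PK c" for p using that
   proof (induction rule: PK.induct)
    case (PK_X p)
    hence "el c r * p = p * el c r & rb c r * p = p * rb c r"
    proof (induction rule: PX.induct)
     case PX_I thus ?case by (simp add: hm_left[OF hm_el] hm_right[OF hm_el] hm_left[OF hm_rb] hm_right[OF hm_rb])
    next
     case (PX_X p i)
     thus ?case using mult_ext[OF el_X[of c r i]] mult_ext[OF rb_comm[OF hm_X[of c i], of r]] by (simp add: assoc)
    next
     case (PX_rb p k)
     thus ?case using mult_ext[OF rb_comm[OF hm_el[of c r], of k], symmetric] mult_ext[OF rb_comm[OF hm_rb[of c k], of r]] by (simp add: assoc)
    qed
    hence "el c r * (p * u) = p * (el c r * u)" "rb c r * (p * u) = p * (rb c r * u)" by (simp_all flip: assoc)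
    thus ?case using L0(4) el[OF r] rb[OF r] by simp
   qed (auto simp: distrib_right distrib_left intro: L0(2,3,4) Ku)
   from this[OF endo_PK[OF z(1)]] have "el c r * (z * u) : S0" "rb c r * (z * u) : S0" by auto
   from L0(2)[OF L0(4)[OF z(2), of "el c r"] this(1)] L0(2)[OF L0(4)[OF z(2), of "rb c r"] this(2)] show ?thesis by (simp add: right_diff_distrib)
  qed
  have starel: "star (el m r) = el m r" for m r
   by (induction m arbitrary: r) (use far0(1)[OF hm_el] in "auto simp: star_I")
  have starrb: "star (rb m r) = rb m r" for m r
  by (simp add: star_I xp_XX rb_def lb_def star_pd assoc)
  have starlow: "w c * (star y * x) : S0" if y: "y : low c" and x: "x : S1" for y x using y
  proof (induction rule: low.induct)
   case (low_step v m y z)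
   thus ?case using L0(2)[OF L0(4)[OF min[OF low_step(2) L1(4)[OF x, of "star y"]], of "w c * star z"]]
    by (simp add: distrib_right distrib_left star_I assoc del: w.simps)
  qed (simp add: L0(1))
  \<comment> \<open>The reflection puts the generators of \<open>Kp c\<close> on the left. The low
    ones vanish by minimality of \<open>c\<close>, crossings are killed by \<open>w c\<close>, and
    the central ones vanish by \<open>all\<close>.\<close>
  have starK: "w c * (star y * m) : S0" if y: "y : Kp c" "dg e y" "hm b c y" and m: "m : S1" "dg d m" for y m d e
  proof -
   have 1: "w c * (star y * m) : S0" if "y : Kst c" for y using that
   proof (induction rule: Kst.induct)
    case (Kst_low y)
    thus ?case using starlow[OF _ m(1)] hm_right'[OF hm_w[of c]] by (simp add: star_I assoc del: w.simps)
   qed (auto simp: distrib_right distrib_left assoc L0(1) intro: L0(2))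
   have 2: "w c * (star (hc e' y) * m) : S0" if "y : Kp c" for y e' using that
   proof (induction rule: Kp.induct)
    case (Kp_K y)
    thus ?case by (intro 1 hc_Kst)
   next
    case (Kp_el r y)
    have "el c r * (ii c * (star (hc (e' - 2 * int r) y) * m)) : S0"
     by (rule all[THEN conjunct1, OF Kp_el(1) L1(4)[OF L1(4)[OF m(1)]] _ dg_mult[OF dg_I dg_mult[OF dg_star[OF dg_hc] m(2)]]]) (simp add: I_I flip: assoc)
    thus ?case using L0(4) by (simp add: hc_lmult[OF dg_el] starel assoc hm_right'[OF hm_el] del: w.simps)
   next
    case (Kp_rb r y)
    have "rb c r * (ii c * (star (hc (e' - 2 * int r) y) * m)) : S0"
     by (rule all[THEN conjunct2, OF Kp_rb(1) L1(4)[OF L1(4)[OF m(1)]] _ dg_mult[OF dg_I dg_mult[OF dg_star[OF dg_hc] m(2)]]]) (simp add: I_I flip: assoc)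
    thus ?case using L0(4) by (simp add: hc_lmult[OF dg_rb] starrb assoc hm_right'[OF hm_rb] del: w.simps)
   qed (auto simp: hc_add distrib_right distrib_left L0(1) intro: L0(2))
   from 2[OF y(1), of e] show ?thesis using y(2) by (simp add: dg_def)
  qed
  \<comment> \<open>A nonzero rank makes the argument of \<open>Qc\<close> nonnegative. The bound is
    strict because \<open>c\<close> differs from \<open>b\<close>, so that \<open>m\<close> is
    positive.\<close>
  have pos: "shift c - shift b < D" if "x : Sp 0 b c D" "x ~: Kp c" for D x
  proof -
   have "dk 0 b c D ~= 0"
   proof
    assume "dk 0 b c D = 0"
    hence "Rk (Kp c) (Sp 0 b c D) 0" using dk[OF two, of c 0 b D] by simp
    thus False using that unfolding Rk_def by auto
   qed
   hence "tf b c D ~= 0" using dk_tf[OF two, of b c D] by simp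
   moreover from this obtain m where m: "b = c + 2 * m" by (metis tf_0[OF two] dvd_def le_add_diff_inverse)
   ultimately have "0 <= D + (2 * int c * int m + (if cc c = 1 then 0 else - 2 * int m))"
    using tf_eq[OF two, of c m D] by (auto simp: Qc_def not_less split: if_splits)
   moreover have "shift b = shift c + 2 * int c * int m + int m * (2 * int m - 1)"
    unfolding m shift_add[OF two] shift_double[OF two] by simp
   moreover have "0 < int m * (2 * int m - 1)" using m \<open>c ~= b\<close> by (intro mult_pos_pos) auto
   ultimately show ?thesis by (auto split: if_splits)
  qed
  obtain y1 where y1: "hm b c y1" "dg (dv - du) y1" "v - y1 * u : S0" using irr_gen[OF u(1,2,3) u1 v(1,3) v1] by blast
  have "ei b * y1 : Sp 0 b c (dv - du)"
   using hm_mult[OF hm_ei y1(1)] dg_mult[OF dg_ei y1(2)] ei_ei[of b] by (simp add: Sp_def flip: assoc)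
  moreover have "ei b * y1 ~: Kp c"
  proof
   assume "ei b * y1 : Kp c"
   hence "ei b * y1 * u : S0" by (rule Kpu)
   from L0(2)[OF L0(4)[OF y1(3), of "ei b"] this] show False using v by (simp add: right_diff_distrib assoc)
  qed
  ultimately have 1: "shift c - shift b < dv - du" by (rule pos)
  have s2: "2 * shift k = int (k * (k - 1))" for k by (induction k) (simp_all add: shift_Suc[OF two] shift_def[of 0] algs)
  let ?A = "(int (c * (c - 1)) + du - dv)"
  obtain p where p: "hm c b p" "dg ?A p" "rho c * u - p * v : S0"
   using irr_gen[OF v(1,2,3) v1 L1(4)[OF u(1)] dg_mult[OF dg_rho u(3)] hm_left'[OF hm_rho]] by blast
  have st: "star (p * w b) = w b * star p" by simp
  have "w b * star p : Sp 0 b c (- int (b * (b - 1)) + ?A)"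
   using hm_mult[OF hm_w hm_star[OF p(1)]] dg_mult[OF dg_w dg_star[OF p(2)]] ei_w(2)[of b] by (simp add: Sp_def del: w.simps)
  moreover have "w b * star p ~: Kp c"
  proof
   assume "w b * star p : Kp c"
   from starK[OF this dg_mult[OF dg_w dg_star[OF p(2)]] hm_mult[OF hm_w hm_star[OF p(1)]] L1(4)[OF v(1)] dg_mult[OF dg_rho v(3)], of b]
   have "w c * (p * (w b * (rho b * v))) : S0" by (simp add: assoc del: w.simps)
   hence "w c * (p * v) : S0" using v(4) by (simp add: ei_def assoc del: w.simps)
   from L0(2)[OF L0(4)[OF p(3), of "w c"] this] show False using uw u(2) by (simp add: right_diff_distrib del: w.simps)
  qed
  ultimately have "shift c - shift b < - int (b * (b - 1)) + ?A" by (rule pos)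
  thus ?thesis using 1 s2[of b] s2[of c] by linarith
 qed
qed

end
end

section \<open>Chains of submodules with many factors of the right kind\<close>

context nbt begin

definition st :: "nat => nat => int => ('a, 'b) nb set => ('a, 'b) nb set => bool" where
 "st n b j S0 S1 \<longleftrightarrow> irrN n S0 S1 & (EX v:S1 - S0. dg j v & ei b * v = v)"

text \<open>The number counts steps that are known to be of the right kind, while
  \<open>ch_le\<close> admits arbitrary steps. So it bounds the true count from below, which
  suffices for a supremum.\<close>

inductive ch :: "nat => nat => int => ('a, 'b) nb set => ('a, 'b) nb set => nat => bool" for n b j S where
 ch_refl: "gsm n (Kp n) S ==> ch n b j S S 0"
| ch_le: "ch n b j S S1 N ==> gsm n (Kp n) S2 ==> S1 <= S2 ==> ch n b j S S2 N"
| ch_st: "ch n b j S S1 N ==> st n b j S1 S2 ==> ch n b j S S2 (Suc N)"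
lemma ch_trans: "ch n b j S1 S2 M ==> ch n b j S S1 N ==> ch n b j S S2 (N + M)"
 by (induction rule: ch.induct) (auto intro: ch_le ch_st)
lemma ch_fun: "ch n b j S S1 N ==> EX k W. W 0 = S & W k = S1 & (ALL r<=k. gsm n (Kp n) (W r)) & (ALL r<k. W r <= W (Suc r))
  & N <= card {r : {1..k}. st n b j (W (r - 1)) (W r)}"
proof (induction rule: ch.induct)
 case ch_refl
 thus ?case by (intro exI[of _ 0] exI[of _ "%_. S"]) simp
next
 case (ch_le S1 N S2)
 then obtain k W where W: "W 0 = S" "W k = S1" "ALL r<=k. gsm n (Kp n) (W r)" "ALL r<k. W r <= W (Suc r)"
  "N <= card {r : {1..k}. st n b j (W (r - 1)) (W r)}" by blast
 define W' where "W' = W(Suc k := S2)"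
 have "card {r : {1..k}. st n b j (W (r - 1)) (W r)} <= card {r : {1..Suc k}. st n b j (W' (r - 1)) (W' r)}"
  by (intro card_mono) (auto simp: W'_def)
 thus ?case using W ch_le by (intro exI[of _ "Suc k"] exI[of _ W']) (auto simp: W'_def le_Suc_eq less_Suc_eq)
next
 case (ch_st S1 N S2)
 then obtain k W where W: "W 0 = S" "W k = S1" "ALL r<=k. gsm n (Kp n) (W r)" "ALL r<k. W r <= W (Suc r)"
  "N <= card {r : {1..k}. st n b j (W (r - 1)) (W r)}" by blast
 define W' where "W' = W(Suc k := S2)"
 have "insert (Suc k) {r : {1..k}. st n b j (W (r - 1)) (W r)} <= {r : {1..Suc k}. st n b j (W' (r - 1)) (W' r)}"
  using W(2) ch_st(2) by (auto simp: W'_def)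
 from card_mono[OF _ this] have "Suc (card {r : {1..k}. st n b j (W (r - 1)) (W r)}) <= card {r : {1..Suc k}. st n b j (W' (r - 1)) (W' r)}" by simp
 moreover have "gsm n (Kp n) S2" "S1 <= S2" using ch_st(2) by (auto simp: st_def irrN_def)
 ultimately show ?case using W by (intro exI[of _ "Suc k"] exI[of _ W']) (auto simp: W'_def le_Suc_eq less_Suc_eq)
qed
lemma gsm_trans: "gsm n (Kp n) M ==> gsm n M S ==> gsm n (Kp n) S" by (auto simp: gsm_def)

context assumes two: "(2 :: 'a) ~= 0" begin
lemma Kst_v: assumes irr: "irrN n S0 S1" and v: "v : S1" "v ~: S0" "dg j v" "ei b * v = v" and y: "y : Kst b"
 shows "y * v : S0"
 using y
proof (induction rule: Kst.induct)
 { case (Kst_low y) thus ?case by (metis v(4) hm_left'[OF hm_ei[of b], of v] minw[OF irr two v] assoc) }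
 { case (Kst_T y i)
  show ?case using v(4) T_w'[of b i "rho b * v"] lidealD(1)[OF gsmD(1)[OF g0[OF irr]]] by (simp add: ei_def assoc) }
 { case (Kst_add y z) thus ?case using lidealD(2)[OF gsmD(1)[OF g0[OF irr]]] by (simp add: distrib_right) }
qed
text \<open>A truncated vector \<open>v\<close> outside \<open>S0\<close> produces one factor: in
  the module generated over \<open>S0\<close> by \<open>v\<close>, Zorn's lemma gives a largest
  submodule without \<open>v\<close>. The quotient is irreducible and its truncation has rank 1, so
  the ranks of the two remaining gaps add up to one less, and the induction applies to both.\<close>

lemma ch_ex:
 "gsm n (Kp n) S0 ==> gsm n (Kp n) S1 ==> S0 <= S1 ==> Rk (Kp n) (S0 \<inter> Sp 0 b n j) d0 ==> Rk (Kp n) (S1 \<inter> Sp 0 b n j) d1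
  ==> ch n b j S0 S1 (d1 - d0)"
proof (induction "d1 - d0" arbitrary: S0 S1 d0 d1 rule: less_induct)
 case less
 let ?Z = "Sp 0 b n j"
 note K = sbs_Kp[of n]
 have sb: "sbs (S \<inter> ?Z)" if "gsm n (Kp n) S" for S
  using lideal_sbs[OF gsmD(1)[OF that]] sbs_Sp[of 0 b n j] by (auto simp: sbs_def)
 show ?case
 proof (cases "d1 <= d0")
  case True
  thus ?thesis using ch_le[OF ch_refl[OF less(2)] less(3,4)] by simp
 next
  case False
  then obtain v where v: "v : S1" "v : ?Z" "v ~: S0" using Rk_mono[OF K less(6,5)] by blast
  have v': "dg j v" "ei b * v = v" "hm b n v" using v(2) by (auto simp: Sp_def)
  let ?C = "cyc S0 v"
  have C: "gsm n (Kp n) ?C" by (rule gsm_cyc[OF less(2) v'(1) gsmD(3)[OF less(3) v(1)]])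
  have vC: "v : ?C" using cyc_gen[OF less(2), of "ii b" v] hm_left[OF v'(3)] by simp
  have CS: "?C <= S" if "gsm n (Kp n) S" "S0 <= S" "v : S" for S
   unfolding cyc_def using that(2) lidealD(2)[OF gsmD(1)[OF that(1)] _ lidealD(4)[OF gsmD(1)[OF that(1)] that(3)]] by blast
  define F where "F = {M. gsm n (Kp n) M & S0 <= M & M <= ?C & v ~: M}"
  have "EX M:F. ALL X:F. M <= X --> X = M"
  proof (rule subset_Zorn_nonempty)
   show "F ~= {}" using less(2) v(3) cyc_base[OF less(2)] unfolding F_def by blast
   fix c assume c: "c ~= {}" "subset.chain F c"
   have F: "S : F" if "S : c" for S using that c(2) by (auto simp: subset.chain_def)
   have two_in: "EX S:c. y : S & z : S" if yz: "y : \<Union>c" "z : \<Union>c" for y z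
   using yz subset_chain_def[of F c] c(2) by blast
   have g: "gsm n (Kp n) S" if "S : c" for S using F[OF that] by (simp add: F_def)
   have "lideal (\<Union>c)" unfolding lideal_def
   proof (intro conjI ballI allI)
    show "0 : \<Union>c" using c(1) lidealD(1)[OF gsmD(1)[OF g]] by fast
    show "y + z : \<Union>c" if yz: "y : \<Union>c" "z : \<Union>c" for y z
    proof -
     obtain S where S: "S : c" "y : S" "z : S" using two_in[OF yz] by blast
     from lidealD(2)[OF gsmD(1)[OF g[OF S(1)]] S(2,3)] S(1) show ?thesis by blast
    qed
   qed (use lidealD(3,4)[OF gsmD(1)[OF g]] in fast)+
   moreover obtain S where S: "S : c" using c(1) by blast
   moreover have "Kp n <= \<Union>c" using gsmD(2)[OF g[OF S]] S by blast
   ultimately have "gsm n (Kp n) (\<Union>c)" unfolding gsm_def using gsmD(3,4)[OF g] by fast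
   thus "\<Union>c : F" using F c(1) unfolding F_def by blast
  qed
  then obtain M where MF: "M : F" and max: "!!X. X : F ==> M <= X ==> X = M" by blast
  from MF have M: "gsm n (Kp n) M" "S0 <= M" "M <= ?C" "v ~: M" unfolding F_def by auto
  have irr: "irrN n M ?C" unfolding irrN_def
  proof (intro conjI allI impI M(1,3) C)
   fix S assume S: "gsm n M S & S <= ?C"
   hence S': "gsm n (Kp n) S" "M <= S" using gsm_trans[OF M(1)] by (auto simp: gsm_def)
   show "S = M | S = ?C"
   using CS[OF S'(1)] S'(2) M(2) S max[of S] S' by (auto simp: F_def)
  qed
  have Rk: "EX d. Rk (Kp n) (S \<inter> ?Z) d" if "gsm n (Kp n) S" for S
   using Rk_sub[OF K dk[OF two] sb[OF that]] by blast
  obtain dM dC where d: "Rk (Kp n) (M \<inter> ?Z) dM" "Rk (Kp n) (?C \<inter> ?Z) dC" using Rk M(1) C by blast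
  have CS1: "?C <= S1" by (rule CS[OF less(3,4) v(1)])
  have le: "d0 <= dM" "dC <= d1" using Rk_mono[OF K less(5) d(1)] Rk_mono[OF K d(2) less(6)] M(2) CS1 by blast+
  have lt: "dM < dC"
  proof (rule Rk_strict[OF K sb[OF M(1)] d(1) sb[OF C] d(2)])
   show "v : ?C \<inter> ?Z" using vC v by blast
   show "v - s ~: Kp n" if "s : M \<inter> ?Z" for s
    using lidealD(2)[OF gsmD(1)[OF M(1)] gsmD(2)[OF M(1)], of "v - s" s] that M(4) by auto
  qed (use M(3) in blast)
  \<comment> \<open>A truncated vector of the factor is obtained from \<open>v\<close> by an
    endomorphism of degree 0. This is a scalar modulo \<open>Kst b\<close>, and \<open>Kst_v\<close>
    sends the rest into \<open>M\<close>.\<close>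
  have dC: "dC <= dM + 1"
  proof -
   let ?Y = "range (%c. c *s v)"
   have Y: "sbs ?Y" unfolding sbs_def by (auto simp flip: smul_add_left)
   have nM: "c = 0" if "c *s v : M" for c
   proof (rule ccontr)
    assume "c ~= 0"
    thus False using lidealD(3)[OF gsmD(1)[OF M(1)] that, of "inverse c"] M(4) by simp
   qed
   have "ind (Kp n) ?Y 1 (%_. v)" unfolding ind_def
    using nM gsmD(2)[OF M(1)] by (auto intro: range_eqI[of _ _ 1])
   moreover have "EX c'. c *s v - (SUM i<1::nat. c' i *s v) : Kp n" for c
    using sbsD(1)[OF K] by (intro exI[of _ "%_. c"]) simp
   ultimately have "Rk (Kp n) ?Y 1" unfolding Rk_def by blast
   from Rk_plus[OF K sb[OF M(1)] d(1) Y this, of "ii b"]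
   have "Rk (Kp n) {s + ii b * y | s y. s : M \<inter> ?Z & y : ?Y} (dM + 1)"
   proof this
    fix y s assume a: "y : ?Y" "s : M \<inter> ?Z" "s + ii b * y : Kp n"
    then obtain c where c: "y = c *s v" by blast
    thus "y : Kp n" using lidealD(6)[OF gsmD(1)[OF M(1)] gsmD(2)[OF M(1) a(3)], of s] a(2) hm_left[OF v'(3)] nM sbsD(1)[OF K] c by fastforce
   qed (rule lidealD(4)[OF lideal_Kp])
   moreover have "x : {s + ii b * y | s y. s : M \<inter> ?Z & y : ?Y}" if x: "x : ?C \<inter> ?Z" for x
   proof -
    have x': "x : ?C" "dg j x" "hm b n x" using x by (auto simp: Sp_def)
    obtain z where z: "hm b b z" "dg (j - j) z" "x - z * v : M"
     using irr_gen[OF irr vC M(4) v'(1) hm_left[OF v'(3)] x'(1,2) hm_left[OF x'(3)]] by blast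
    obtain c where c: "z - c *s ii b : Kst b" using endo_deg[OF z(1,2)] by auto
    have "x - c *s v : M"
     using lidealD(2)[OF gsmD(1)[OF M(1)] z(3) Kst_v[OF irr vC M(4) v'(1,2) c]] hm_left[OF v'(3)] by (simp add: left_diff_distrib)
    moreover have "x - c *s v : ?Z" using sbs_diff[OF sbs_Sp _ sbsD(3)[OF sbs_Sp v(2)]] x by blast
    ultimately show ?thesis using hm_left[OF v'(3)] by (intro CollectI exI[of _ "x - c *s v"] exI[of _ "c *s v"]) auto
   qed
   ultimately show ?thesis using Rk_mono[OF K d(2)] by blast
  qed
  have 1: "ch n b j S0 M (dM - d0)" by (rule less(1)[OF _ less(2) M(1,2) less(5) d(1)]) (use lt le False in linarith)
  have 2: "ch n b j ?C S1 (d1 - dC)" by (rule less(1)[OF _ C less(3) CS1 d(2) less(6)]) (use lt le False in linarith)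
  have "st n b j M ?C" unfolding st_def using irr vC M(4) v' by blast
  moreover have "Suc (dM - d0) + (d1 - dC) = d1 - d0" using lt le dC by linarith
  ultimately show ?thesis using ch_trans[OF 2 ch_st[OF 1]] by metis
 qed
qed

end

section \<open>Return to formal combinations and to the ideals of the statement\<close>

definition res :: "nat => 'a comb => 'a comb" where "res n a = (%e. if src e = n then a e else 0)"
abbreviation qb :: "'a comb => ('a, 'b) nb" where "qb \<equiv> qa"
lemma good_res: "good a ==> good (res n a)"
 unfolding good_def res_def by (auto elim: rev_finite_subset)
lemma qb_res: "good a ==> qb a * ii n = qb (res n a)"
proof (induction a rule: good_induct)
 case zero
 have "res n czero = czero" by (auto simp: res_def czero_def)
 thus ?case by (simp flip: zero_nb_def)
next
 case (add c e a)
 have "res n (cadd (csc c (dl e)) a) = cadd (csc c (res n (dl e))) (res n a)" by (auto simp: res_def cadd_def csc_def)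
 moreover have "res n (dl e) = (if src e = n then dl e else czero)" by (auto simp: res_def dl_def czero_def)
 ultimately have "qb (res n (cadd (csc c (dl e)) a)) = c *s (if src e = n then q e else 0) + qb (res n a)"
  using add by (auto simp: qa_simps[symmetric] good_csc good_dl good_res q_def zero_nb_def)
 thus ?case using add by (simp add: qa_simps[symmetric] good_csc good_dl distrib_right I_q flip: q_def)
qed
lemma Pn_good: "a : Pn n ==> good a" by (auto simp: Pn_def good_def)
lemma Pn_iff: "a : Pn n \<longleftrightarrow> good a & res n a = a"
 by (auto simp: Pn_def good_def res_def fun_eq_iff)
lemma Pn_right: "a : Pn n ==> qb a * ii n = qb a" by (simp add: Pn_iff qb_res)
lemma Pn_ex: fixes y :: "('a, 'b) nb" assumes "y * ii n = y" shows "EX a:Pn n. qb a = y"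
proof -
 have "res n (res n (qr y)) = res n (qr y)" by (auto simp: res_def)
 thus ?thesis using qb_res[OF qr(1)[of y], of n] assms good_res[OF qr(1)[of y], of n] qr(2)[of y] by (intro bexI[of _ "res n (qr y)"]) (auto simp: Pn_iff)
qed
lemma Pn_closed:
 fixes a a' :: "'a comb"
 shows "(czero :: 'a comb) : Pn n" "a : Pn n ==> a' : Pn n ==> cadd a a' : Pn n" "a : Pn n ==> csc c a : Pn n"
 "a : Pn n ==> a' : Pn n ==> cdiff a a' : Pn n" "a : Pn n ==> good g ==> comp g a : Pn n" "a : Pn n ==> hom d a : Pn n"
proof -
 have f: "res n a = a ==> src e ~= n ==> a e = 0" for a :: "'a comb" and e by (metis res_def)
 have r: "(!!e. src e ~= n ==> a e = 0) ==> res n a = a" for a :: "'a comb" by (auto simp: res_def)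
 show "(czero :: 'a comb) : Pn n" by (simp add: Pn_def czero_def)
 show "a : Pn n ==> a' : Pn n ==> cadd a a' : Pn n" by (auto simp: Pn_iff good_cadd intro!: r) (auto simp: cadd_def f)
 show "a : Pn n ==> csc c a : Pn n" by (auto simp: Pn_iff good_csc intro!: r) (auto simp: csc_def f)
 show "a : Pn n ==> a' : Pn n ==> cdiff a a' : Pn n" by (auto simp: Pn_iff good_cdiff intro!: r) (auto simp: cdiff_def f)
 show "a : Pn n ==> hom d a : Pn n" by (auto simp: Pn_iff good_hom intro!: r) (auto simp: hom_def f)
 show "a : Pn n ==> good g ==> comp g a : Pn n"
  by (auto simp: Pn_iff good_comp intro!: r) (auto simp: Defs.comp_def f split: mexp.split)
qed
lemma qb_comp: "good g ==> good a ==> qb (comp g a) = qb g * qb a" by (simp add: qa_mult)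
lemma qb_czero: "qb czero = 0" by (simp add: zero_nb_def)

text \<open>Preimages in \<open>Pn n\<close>. Together with \<open>gsub_ex\<close> they match the
  submodules in the sense of \<open>gsub\<close> with those in the sense of
  \<open>gsm\<close>.\<close>

definition Cs :: "nat => ('a, 'b) nb set => 'a comb set" where "Cs n S = {a : Pn n. qb a : S}"
lemma gsub_Cs: assumes "gsm n K S" shows "gsub (Cs n K) (Pn n) (Cs n S)"
 unfolding gsub_def Cs_def using gsmD(2,4)[OF assms] lidealD[OF gsmD(1)[OF assms]]
 by (auto simp: Pn_closed Pn_good qb_czero qb_comp good_dl qa_simps[symmetric] qa_hc[symmetric])
lemma comp_closed: assumes "czero : W" "ALL a:W. ALL b:W. cadd a b : W" "ALL c. ALL a:W. csc c a : W" "ALL a:W. ALL e. wt e --> comp (dl e) a : W" and a: "a : W"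
 shows "good g ==> comp g a : W"
 by (induction g rule: good_induct) (use assms in "auto simp: comp_cadd_left comp_csc_left")
lemma gsub_ex: assumes W: "gsub (Cs n K) (Pn n) W" and K: "0 : K" "!!y. y : K ==> y * ii n = y"
 shows "gsm n K (qb ` W)" "W = Cs n (qb ` W)"
proof -
 note w = W[unfolded gsub_def]
 have P: "a : Pn n" if "a : W" for a using w that by blast
 note g = Pn_good[OF P]
 have mem: "a : W" if m: "a : Pn n" "qb a : qb ` W" for a
 proof -
  obtain b where b: "b : W" "qb a = qb b" using m(2) by blast
  have "cdiff a b : Cs n K" using m(1) P[OF b(1)] b(2) K(1) by (simp add: Cs_def Pn_closed Pn_good qa_diff[symmetric])
  hence "cadd (cdiff a b) b : W" using w b(1) by blast
  moreover have "cadd (cdiff a b) b = a" by (simp add: cadd_def cdiff_def)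
  ultimately show ?thesis by simp
 qed
 thus "W = Cs n (qb ` W)" using P by (auto simp: Cs_def)
 have "lideal (qb ` W)" unfolding lideal_def
 proof (intro conjI ballI allI)
  show "0 : qb ` W" using w qb_czero by force
  fix y u :: "('a, 'b) nb" and c assume "y : qb ` W"
  then obtain a where a: "a : W" "y = qb a" by blast
  show "c *s y : qb ` W" using w a g by (auto simp: qa_smul intro!: imageI)
  have "comp (qr u) a : W" by (rule comp_closed[OF _ _ _ _ a(1) qr(1)]) (use w in blast)+
  thus "u * y : qb ` W" using qb_comp[OF qr(1)[of u] g[OF a(1)]] qr(2)[of u] a(2) by force
  fix z assume "z : qb ` W"
  then obtain a' where "a' : W" "z = qb a'" by blast
  thus "y + z : qb ` W" using w a g by (auto simp: qa_add intro!: imageI)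
 qed
 moreover have "K <= qb ` W"
 proof
  fix y assume y: "y : K"
  obtain a where "a : Pn n" "qb a = y" using Pn_ex[OF K(2)[OF y]] by blast
  thus "y : qb ` W" using w y by (auto simp: Cs_def)
 qed
 moreover have "y * ii n = y & hc d y : qb ` W" if y: "y : qb ` W" for y d
 proof -
  obtain a where a: "a : W" "y = qb a" using y by blast
  show ?thesis using qa_hc[OF g[OF a(1)]] Pn_right[OF P[OF a(1)]] a w by blast
 qed
 ultimately show "gsm n K (qb ` W)" by (simp add: gsm_def)
qed

end
abbreviation "sl \<equiv> sorted_list_of_set"

text \<open>Subsets are split by whether they contain 1, which matches the recursion of
  \<open>el\<close> on the leftmost strand.\<close>

lemma sum_sub_Suc:
 "(SUM S:{S. S <= {1..Suc n} & card S = r}. f (sl S)) =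
  (SUM S:{S. S <= {1..n} & card S = r}. f (map Suc (sl S))) +
  (if r = 0 then 0 else SUM S:{S. S <= {1..n} & card S = r - 1}. f (1 # map Suc (sl S)) :: 'z::ab_group_add)"
proof -
 let ?P = "%n r. {S. S <= {1..n::nat} & card S = r}"
 have fin: "finite (?P n r)" for n r by (rule finite_subset[of _ "Pow {1..n}"]) auto
 have fS: "finite S" if "S : ?P n r" for S n r using that finite_subset[of S "{1..n}"] by auto
 have l: "sl (Suc ` S) = map Suc (sl S)"
   "sl (insert 1 (Suc ` S)) = 1 # map Suc (sl S)" if "S : ?P n r" for S r
 proof -
  have s: "sorted (map Suc (sl S))" "distinct (map Suc (sl S))" "set (sl S) = S"
   using fS[OF that] by (auto simp: sorted_map distinct_map intro: sorted_wrt_mono_rel[OF _ sorted_sorted_list_of_set])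
  show "sl (Suc ` S) = map Suc (sl S)"
   using sorted_list_of_set.idem_if_sorted_distinct[OF s(1,2)] s(3) by simp
  have "sorted (1 # map Suc (sl S))" "distinct (1 # map Suc (sl S))" using s that by auto
  from sorted_list_of_set.idem_if_sorted_distinct[OF this] show "sl (insert 1 (Suc ` S)) = 1 # map Suc (sl S)"
   using s(3) by simp
 qed
 have i: "inj_on ((`) Suc) A" for A by (rule inj_onI) (simp add: inj_image_eq_iff)
 have i': "inj_on (%S. insert 1 (Suc ` S)) (?P n r)" for r
 proof (rule inj_onI)
  fix S S' assume a: "S : ?P n r" "S' : ?P n r" "insert 1 (Suc ` S) = insert 1 (Suc ` S')"
  have "1 ~: Suc ` S" "1 ~: Suc ` S'" using a(1,2) by auto
  from insert_ident[OF this] show "S = S'" by (metis a(3) iffD1 inj_image_eq_iff[OF inj_Suc] iffD1[rotated])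
 qed
 have e: "?P (Suc n) r = (`) Suc ` ?P n r \<union> (if r = 0 then {} else (%S. insert 1 (Suc ` S)) ` ?P n (r - 1))" (is "_ = ?A \<union> ?B")
 proof (intro set_eqI iffI)
  fix S assume S: "S : ?P (Suc n) r"
  define S' where "S' = (%x. x - 1) ` (S - {1})"
  have S': "S - {1} = Suc ` S'" using S unfolding S'_def image_image by (force simp: image_iff)
  have sub: "S' <= {1..n}" using S unfolding S'_def by (auto simp: le_diff_conv subset_iff)
  have c: "card S' = card (S - {1})" unfolding S' by (simp add: card_image)
  show "S : ?A \<union> ?B"
  proof (cases "1 : S")
   case True
   hence "card S' = r - 1" "r ~= 0" "S = insert 1 (Suc ` S')" using c S fS[OF S] S' by (auto simp: card_Diff_singleton)
   thus ?thesis using sub by auto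
  next
   case False thus ?thesis using c S S' sub by auto
  qed
 next
  fix S assume "S : ?A \<union> ?B"
  then consider S' where "S' : ?P n r" "S = Suc ` S'" | S' where "r ~= 0" "S' : ?P n (r - 1)" "S = insert 1 (Suc ` S')" by (auto split: if_splits)
  thus "S : ?P (Suc n) r"
  proof cases
   case 1 thus ?thesis by (auto simp: card_image)
  next
   case 2
   hence "1 ~: Suc ` S'" "finite S'" using fS[OF 2(2)] by auto
   thus ?thesis using 2 by (auto simp: card_image)
  qed
 qed
 have "?A \<inter> ?B = {}"
 proof (intro equals0I)
  fix S assume "S : ?A \<inter> ?B"
  hence "1 : S" "1 ~: S" by (auto split: if_splits)
  thus False by blast
 qed
 hence "(SUM S:?P (Suc n) r. f (sl S)) = (SUM S:?A. f (sl S)) + (SUM S:?B. f (sl S))"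
  unfolding e using fin by (intro sum.union_disjoint) auto
 also have "(SUM S:?A. f (sl S)) = (SUM S:?P n r. f (map Suc (sl S)))"
  unfolding sum.reindex[OF i] by (rule sum.cong) (auto simp: l)
 also have "(SUM S:?B. f (sl S)) = (if r = 0 then 0 else SUM S:?P n (r - 1). f (1 # map Suc (sl S)))"
  using sum.reindex[OF i'[of "r - 1"], of "%S. f (sl S)"] by (auto simp: l l[unfolded One_nat_def] o_def intro!: sum.cong)
 finally show ?thesis .
qed

context nbt begin
lemma q_tauE: "1 <= i ==> i < n ==> q (tauE n i) = tt n (i - 1)"
 by (simp add: tauE_def T_def pd_def gt_def I_def ten_q)
lemma q_xE: "1 <= i ==> i <= n ==> q (xE n i) = xx n (i - 1)"
 using diff_Suc_less[of n "i - 1"] by (simp add: xE_def X_def pd_def gx_def I_def ten_q less_eq_Suc_le)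
lemma wt_E: "wt (tauE n i)" "wt (xE n i)" by (simp_all add: tauE_def xE_def)
lemma st_xE: "1 <= i ==> i <= n ==> src (xE n i) = n & tgt (xE n i) = n" by (simp add: xE_def)
lemma src_tauE: "1 <= i ==> i < n ==> src (tauE n i) = n" by (simp add: tauE_def)
lemma q_xprod: "set l <= {1..n} ==> wt (xprod n l) & src (xprod n l) = n & tgt (xprod n l) = n & q (xprod n l) = foldr (%i y. xx n (i - 1) * y) l (ii n)"
proof (induction l)
 case (Cons i l)
 thus ?case using st_xE[of i n] wt_E(2)[of n i] q_xE[of i n] q_mult[of "xE n i" "xprod n l", where 'a = 'a and 'b = 'b] by simp
qed (simp add: I_def)
lemma el_sum: "(SUM S:{S. S <= {1..n} & card S = r}. foldr (%i y. xx n (i - 1) * y) (sl S) (ii n)) = el n r"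
proof (induction n arbitrary: r)
 case 0
 have "{S. S <= {1..0::nat} & card S = r} = (if r = 0 then {{}} else {})" by auto
 thus ?case by simp
next
 case (Suc n)
 have m: "set l <= {1..} ==> foldr (%i y. xx (Suc n) (i - 1) * y) (map Suc l) (ii (Suc n)) = L (foldr (%i y. xx n (i - 1) * y) l (ii n))" for l
  by (induction l) (auto simp: Suc_le_eq)
 have m': "foldr (%i y. xx (Suc n) (i - 1) * y) (map Suc (sl S)) (ii (Suc n)) = L (foldr (%i y. xx n (i - 1) * y) (sl S) (ii n))"
  if "S <= {1..n}" for S proof (rule m)
  show "set (sl S) <= {1..}" using finite_subset[OF that] that by auto
 qed
 have k: "(SUM S:{S. S <= {1..n} & card S = r}. foldr (%i y. xx (Suc n) (i - 1) * y) (map Suc (sl S)) (ii (Suc n))) = L (el n r)" for r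
  unfolding Suc[symmetric] L_sum by (rule sum.cong[OF refl m']) simp
 have "r = 0 ==> L (el n r) = el (Suc n) r" by simp
 thus ?case unfolding sum_sub_Suc[where f = "%l. foldr (%i y. xx (Suc n) (i - 1) * y) l (ii (Suc n))"]
  using k[of r] k[of "r - 1"] by (auto simp: gr0_conv_Suc simp flip: sum_distrib_left)
qed
lemma qb_sum: "finite F ==> (!!S. S : F ==> wt (g S) & src (g S) = n) ==>
  ((%e. SUM S:F. dl (g S) e) :: 'a comb) : Pn n & qb (%e. SUM S:F. dl (g S) e) = (SUM S:F. q (g S))"
proof (induction F rule: finite_induct)
 case empty
 show ?case using Pn_closed(1)[of n] qb_czero[unfolded czero_def] by (simp add: czero_def)
next
 case (insert S F)
 let ?A = "(%e. SUM S:F. dl (g S) e)"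
 have e: "(%e. SUM S:insert S F. dl (g S) e) = cadd (dl (g S)) ?A" using insert.hyps by (simp add: cadd_def)
 have d: "(dl (g S) :: 'a comb) : Pn n" using insert.prems by (auto simp: Pn_def dl_def)
 have i: "(?A :: 'a comb) : Pn n" "qb ?A = (SUM S:F. q (g S))" using insert by auto
 show ?case unfolding e using Pn_closed(2)[OF d i(1)] qa_add[OF Pn_good[OF d] Pn_good[OF i(1)], where 'b = 'b] i(2) insert.hyps by (simp add: q_def)
qed
lemma esym_el: "(esym n r :: 'a comb) : Pn n" "qb (esym n r) = el n r"
proof -
 let ?F = "{S. S <= {1..n} & card S = r}"
 have f: "finite ?F" by (rule finite_subset[of _ "Pow {1..n}"]) auto
 have s: "set (sl S) <= {1..n}" if "S : ?F" for S using that finite_subset[of S "{1..n}"] by auto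
 have w: "wt (xprod n (sl S)) & src (xprod n (sl S)) = n" if "S : ?F" for S using q_xprod[OF s[OF that]] by blast
 note m = qb_sum[OF f, where g = "%S. xprod n (sl S)" and n = n, OF w]
 show "(esym n r :: 'a comb) : Pn n" unfolding esym_def by (rule m[THEN conjunct1])
 have "qb (esym n r) = (SUM S:?F. q (xprod n (sl S)))" unfolding esym_def by (rule m[THEN conjunct2])
 also have "... = (SUM S:?F. foldr (%i y. xx n (i - 1) * y) (sl S) (ii n))"   proof (rule sum.cong[OF refl])
  fix S assume "S : ?F"
  from q_xprod[OF s[OF this]] show "q (xprod n (sl S)) = foldr (%i y. xx n (i - 1) * y) (sl S) (ii n)" by blast
 qed
 also have "... = el n r" by (rule el_sum)
 finally show "qb (esym n r) = el n r" .
qed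
text \<open>The dots sit on the right leg of the bubble in \<open>bE\<close> and on the left leg in
  \<open>rb\<close>; moving them over the cup costs the sign.\<close>

lemma bE_rb: "(dl (Tens (Id n) (bE r)) :: 'a comb) : Pn n" "qb (dl (Tens (Id n) (bE r))) = (-1) ^ r *s rb n r"
proof -
 have x: "wt (xpow r) & src (xpow r) = 1 & tgt (xpow r) = 1 & q (xpow r) = xp 1 0 r"
 proof (induction r)
  case (Suc r)
  thus ?case using q_mult[of eX "xpow r", where 'a = 'a and 'b = 'b] by (simp add: X_def gx_def)
 qed (simp add: I_def)
 have w: "wt (bE r)" "src (bE r) = 0" using x by (simp_all add: bE_def)
 thus "(dl (Tens (Id n) (bE r)) :: 'a comb) : Pn n" by (auto simp: Pn_def dl_def)
 have "q (bE r) = q eCap * (q (Tens (Id 1) (xpow r)) * q eCup)" using x by (simp add: bE_def q_mult)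
 also have "q (Tens (Id 1) (xpow r)) = xp 2 1 r" using x using ten_q[of "Id 1" "xpow r", where 'a = 'a and 'b = 'b] L_xp[of 1 0 r] by (simp add: numeral_2_eq_2 L_def I_def del: xp.simps)
 also have "q eCap * (xp 2 1 r * q eCup) = aa 2 0 * (xp 2 1 r * uu 2 0)" by (simp add: A_def U_def ga_def gu_def)
 also have "... = (-1) ^ r *s lb 0 r" using xp_U[of 2 0 r] by (simp add: lb_def numeral_2_eq_2 del: xp.simps)
 finally show "qb (dl (Tens (Id n) (bE r))) = (-1) ^ r *s rb n r"
  using w ten_q[of "Id n" "bE r", where 'a = 'a and 'b = 'b] by (simp add: rb_def pd_def flip: q_def I_def)
qed
lemma ideal_good: "a : idealLow (tparam TYPE('b)) n ==> good a & qb a : low n"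
proof (induction rule: idealLow.induct)
 case (il_rel a)
 have "cdiff a czero = a" by (simp add: cdiff_def czero_def)
 hence "qb a = qb czero" using rel_good[OF il_rel] il_rel by (subst qa_eq_iff) auto
 thus ?case using rel_good[OF il_rel] qb_czero low_0 by simp
next
 case (il_unit m)
 thus ?case using low_gen[OF il_unit, of "ii m" "ii m"] by (simp add: good_dl I_I flip: q_def I_def)
qed (auto simp: good_cadd good_csc good_comp good_dl qb_czero low_0 qb_comp intro: low_left low_right
 simp flip: qa_add qa_smul intro: low_add low_smul)
lemma ideal_comp: assumes "a : idealLow t n" shows "good g ==> comp g a : idealLow t n" "good g ==> comp a g : idealLow t n"
 by (induction g rule: good_induct) (use assms in "auto simp: comp_cadd_left comp_csc_left comp_cadd_right comp_csc_right intro: idealLow.intros")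
lemma low_rep: "v : low n ==> EX a:idealLow (tparam TYPE('b)) n. qb a = v"
proof (induction rule: low.induct)
 case low_0
 thus ?case using il_zero qb_czero by blast
next
 case (low_step v m y z)
 then obtain a where a: "a : idealLow (tparam TYPE('b)) n" "qb a = v" by blast
 have "comp (qr y) (comp (dl (Id m)) (qr z)) : idealLow (tparam TYPE('b)) n"
  by (intro ideal_comp qr il_unit low_step)
 moreover have "qb (comp (qr y) (comp (dl (Id m)) (qr z))) = y * (ii m * z)"
  by (simp add: qb_comp good_comp good_dl qr flip: q_def I_def)
 ultimately show ?case using a il_add ideal_good qa_add by (metis (no_types, lifting))
qed
text \<open>It is enough to represent each element of \<open>K\<close> once: two representatives in
  \<open>Pn n\<close> differ by an element of \<open>rel\<close>, which belongs to
  \<open>idealLow\<close> and hence to \<open>S\<close>.\<close>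

lemma lsub_eq:
 assumes S: "S <= Cs n K" "lideal K" "idealLow (tparam TYPE('b)) n \<inter> Pn n <= S" and r: "!!y. y : K ==> EX a:lsub S. qb a = y"
 shows "lsub S = Cs n K"
proof
 show *: "lsub S <= Cs n K"
 proof
  fix a assume "a : lsub S"
  thus "a : Cs n K"
   by (induction rule: lsub.induct) (use S(1) lidealD[OF S(2)] in "auto simp: Cs_def Pn_closed Pn_good qb_czero qb_comp good_dl simp flip: qa_add qa_smul")
 qed
 show "Cs n K <= lsub S"
 proof
  fix a assume a: "a : Cs n K"
  then obtain a' where a': "a' : lsub S" "qb a' = qb a" using r by (auto simp: Cs_def)
  have p: "a : Pn n" "a' : Pn n" using a a' * by (auto simp: Cs_def)
  have "cdiff a a' : rel (tparam TYPE('b))" using qa_eq_iff[OF Pn_good[OF p(1)] Pn_good[OF p(2)], where 't = 'b] a'(2) by simp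
  hence "cdiff a a' : lsub S" using S(3) Pn_closed(4)[OF p] by (intro ls_base) (auto intro: il_rel)
  from ls_add[OF this a'(1)] show "a : lsub S" by (simp add: cadd_def cdiff_def)
 qed
qed
lemma lsub_comp: "a : lsub S ==> good g ==> comp g a : lsub S"
 by (rule comp_closed) (auto intro: lsub.intros)
lemma Kst_rep: assumes S: "idealLow (tparam TYPE('b)) n \<inter> Pn n <= S" "{dl (tauE n i) | i. 1 <= i & i < n} <= S" "S <= Pn n" and y: "y : Kst n"
 shows "EX a:lsub S. a : Pn n & qb a = y"
 using y
proof (induction rule: Kst.induct)
 case (Kst_low v)
 then obtain a where a: "a : idealLow (tparam TYPE('b)) n" "qb a = v" using low_rep by blast
 have "comp a (dl (Id n)) : Pn n"
  using good_comp[OF conjunct1[OF ideal_good[OF a(1)]] good_dl[of "Id n"]] by (auto simp: Pn_def good_def Defs.comp_def dl_def split: mexp.splits if_splits)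
 moreover have "comp a (dl (Id n)) : lsub S" using calculation ideal_comp(2)[OF a(1) good_dl[of "Id n"]] S(1) by (auto intro: ls_base)
 moreover have "qb (comp a (dl (Id n))) = v * ii n" using ideal_good[OF a(1)] a(2) by (simp add: qb_comp good_dl flip: q_def I_def)
 ultimately show ?case by blast
next
 case (Kst_T y i)
 show ?case
 proof (cases "Suc i < n")
  case True
  have p: "dl (tauE n (Suc i)) : S" using S(2) True by auto
  hence "comp (qr y) (dl (tauE n (Suc i))) : lsub S" "comp (qr y) (dl (tauE n (Suc i))) : Pn n"
   using lsub_comp[OF ls_base qr(1)] Pn_closed(5)[OF _ qr(1)] S(3) by blast+
  moreover have "qb (comp (qr y) (dl (tauE n (Suc i)))) = y * tt n i"
   using q_tauE[of "Suc i" n] True by (simp add: qb_comp good_dl wt_E qr flip: q_def)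
  ultimately show ?thesis by blast
 next
  case False
  thus ?thesis using ls_zero[of S] Pn_closed(1)[of n] qb_czero by (auto simp: T_def)
 qed
next
 case (Kst_add y z)
 then obtain a a' where "a : lsub S" "a : Pn n" "qb a = y" "a' : lsub S" "a' : Pn n" "qb a' = z" by blast
 thus ?case using ls_add[of a S a'] Pn_closed(2)[of a n a'] by (intro bexI[of _ "cadd a a'"]) (auto simp: Pn_good simp flip: qa_add)
qed
lemma low_Cs: "idealLow (tparam TYPE('b)) n \<inter> Pn n <= Cs n (Kst n)"
 using ideal_good Kst_low Pn_right by (fastforce simp: Cs_def)
lemma tau_Cs: "{dl (tauE n i) | i. 1 <= i & i < n} <= Cs n (Kst n)"
proof clarify
 fix i assume i: "1 <= i" "i < n"
 have "qb (dl (tauE n i)) = ii n * tt n (i - 1)" using q_tauE[OF i] hm_left[OF hm_T, of n "i - 1"] by (simp flip: q_def)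
 moreover have "dl (tauE n i) : Pn n" using src_tauE[OF i] wt_E by (auto simp: Pn_def dl_def)
 ultimately show "dl (tauE n i) : Cs n (Kst n)" using Kst_T[of "ii n" n "i - 1"] by (simp only: Cs_def mem_Collect_eq)
qed
lemma Kstd_Cs: "Kstd (tparam TYPE('b)) n = Cs n (Kst n)"
 unfolding Kstd_def proof (rule lsub_eq)
 let ?S = "(idealLow (tparam TYPE('b)) n \<inter> Pn n) \<union> {dl (tauE n i) | i. 1 <= i & i < n} :: 'a comb set"
 show S: "?S <= Cs n (Kst n)" using low_Cs tau_Cs by blast
 hence SP: "?S <= Pn n" by (auto simp: Cs_def)
 show "EX a:lsub ?S. qb a = y" if "y : Kst n" for y using Kst_rep[OF _ _ SP that] by blast
qed (auto intro: lideal_Kst)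
lemma Kprop_Cs: "Kprop (tparam TYPE('b)) n = Cs n (Kp n)"
proof -
 let ?S = "(idealLow (tparam TYPE('b)) n \<inter> Pn n) \<union> {dl (tauE n i) | i. 1 <= i & i < n} \<union> {esym n r | r. 1 <= r & r <= n} \<union> {dl (Tens (Id n) (bE r)) | r. 1 <= r} :: 'a comb set"
 have u: "el n r = ii n * el n r" "rb n r = ii n * rb n r" for r by (simp_all add: hm_left[OF hm_el] hm_left[OF hm_rb])
 have "Cs n (Kst n) <= Cs n (Kp n)" by (auto simp: Cs_def Kp_K)
 hence S: "?S <= Cs n (Kp n)" using low_Cs tau_Cs
 proof -
  have "esym n r : Cs n (Kp n)" if "1 <= r" "r <= n" for r using esym_el Kp_el[OF that, of "ii n"] u by (simp add: Cs_def)
  moreover have "dl (Tens (Id n) (bE r)) : Cs n (Kp n)" if "1 <= r" for r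
   using bE_rb[of n r] lidealD(3)[OF lideal_Kp Kp_rb[OF that, of "ii n" n]] u by (simp add: Cs_def)
  ultimately show ?thesis using low_Cs tau_Cs \<open>Cs n (Kst n) <= Cs n (Kp n)\<close> by blast
 qed
 have SP: "?S <= Pn n" using S by (auto simp: Cs_def)
 have rep: "EX a:lsub ?S. a : Pn n & qb a = y" if "y : Kp n" for y using that
 proof (induction rule: Kp.induct)
  case (Kp_K y)
  show ?case by (rule Kst_rep[OF _ _ SP Kp_K]) auto
 next
  case (Kp_el r y)
  have "esym n r : lsub ?S" using Kp_el by (auto intro!: ls_base)
  have "qb (comp (qr y) (esym n r)) = y * el n r" using qb_comp[OF qr(1)[of y] Pn_good[OF esym_el(1)], of n r] qr(2)[of y] esym_el(2)[of n r] by simp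
  thus ?case using lsub_comp[OF \<open>esym n r : lsub ?S\<close> qr(1)[of y]] Pn_closed(5)[OF esym_el(1) qr(1)[of y]] by blast
 next
  case (Kp_rb r y)
  let ?b = "csc ((-1) ^ r) (dl (Tens (Id n) (bE r))) :: 'a comb"
  have l: "?b : lsub ?S" using Kp_rb by (auto intro!: ls_base ls_smult)
  have p: "?b : Pn n" by (rule Pn_closed(3)[OF bE_rb(1)])
  show ?case using bE_rb(2)[of n r] qb_comp[OF qr(1)[of y] Pn_good[OF p]] qr(2)[of y] lsub_comp[OF l qr(1)[of y]] Pn_closed(5)[OF p qr(1)[of y]] by (auto simp: qa_smul[OF Pn_good[OF bE_rb(1)], symmetric])
 next
  case (Kp_add y z)
  then obtain a a' where "a : lsub ?S" "a : Pn n" "qb a = y" "a' : lsub ?S" "a' : Pn n" "qb a' = z" by blast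
  thus ?case using ls_add[of a ?S a'] Pn_closed(2)[of a n a'] by (intro bexI[of _ "cadd a a'"]) (auto simp: Pn_good simp flip: qa_add)
 qed
 show ?thesis unfolding Kprop_def by (rule lsub_eq[OF S lideal_Kp]) (use rep in auto)
qed

end

section \<open>Counting the factors \<open>L(b)\<close> by the truncation\<close>

context nbt begin
lemma left_unit: "EX N. ALL N'>=N. (SUM c<N'. ii c) * y = y"
proof (induction y rule: nb_induct)
 case (add c e y)
 then obtain N where N: "!!N'. N <= N' ==> (SUM c<N'. ii c) * y = y" by blast
 have "(SUM c<N'. ii c) * q e = q e" if "tgt e < N'" for N'
  using that by (simp add: sum_distrib_right I_q[OF add(1)])
 thus ?case using N by (intro exI[of _ "max N (Suc (tgt e))"]) (auto simp: distrib_left)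
qed simp
lemma weight_notin: assumes J: "lideal J" and y: "y ~: J" shows "EX c. ii c * y ~: J"
proof (rule ccontr)
 assume a: "~ ?thesis"
 obtain N where "(SUM c<N. ii c) * y = y" using left_unit[of y] by blast
 moreover have "(SUM c<N. ii c) * y : J" unfolding sum_distrib_right by (rule lideal_sum[OF J]) (use a in blast)
 ultimately show False using y by simp
qed

context assumes two: "(2 :: 'a) ~= 0" begin
text \<open>\<open>U'\<close> is the annihilator of \<open>v\<close> in \<open>NB 1_b\<close>, so
  the quotient by it is the subquotient \<open>S1 / S0\<close> up to a shift. It contains
  \<open>Kst b\<close>; hence a truncated vector outside \<open>S0\<close> identifies the
  subquotient as a shift of \<open>L(b)\<close>.\<close>

lemma ann_irr:
 assumes irr: "irrN n S0 S1" and v: "v : S1" "v ~: S0" "dg j v" "ei b * v = v"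
 defines "U' \<equiv> {p. p * ii b = p & p * v : S0}"
 shows "gsm b (Kst b) U'" "irr (Pn b) (Cs b U')"
proof -
 note L0 = lidealD[OF gsmD(1)[OF g0[OF irr]]]
 have v1: "ii b * v = v" using v(4) hm_left'[OF hm_ei[of b], of v] by simp
 have "lideal U'" unfolding lideal_def U'_def by (auto simp: L0 distrib_right assoc)
 moreover have "Kst b <= U'" using Kst_v[OF two irr v] Kst_right unfolding U'_def by blast
 moreover have "hc d p : U'" if p: "p : U'" for p d
 using hc_lmult[OF v(3), of "d + j" p] hc_lmult[OF dg_I, of d p b] p gsmD(4)[OF g0[OF irr], of "p * v" "d + j"] by (simp add: U'_def)
 ultimately show g: "gsm b (Kst b) U'" by (auto simp: gsm_def U'_def)
 obtain i where i: "i : Pn b" "qb i = ii b" using Pn_ex[of "ii b" b] by (auto simp: I_I)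
 show "irr (Pn b) (Cs b U')" unfolding irr_def
 proof (intro conjI allI impI)
  have "i ~: Cs b U'" using v1 v(2) i by (simp add: U'_def Cs_def)
  thus "Cs b U' ~= Pn b" using i(1) by metis
  fix W assume W: "gsub (Cs b U') (Pn b) W"
  have Ur: "y * ii b = y" if "y : U'" for y using that by (simp add: U'_def)
  note W' = gsub_ex[OF W lidealD(1)[OF gsmD(1)[OF g]] Ur]
  show "W = Cs b U' | W = Pn b"
  proof (cases "qb ` W <= U'")
   case True
   hence "qb ` W = U'" using gsmD(2)[OF W'(1)] by blast
   thus ?thesis using W'(2) by simp
  next
   case False
   then obtain p where p: "p : qb ` W" "p ~: U'" by blast
   obtain c where c: "ii c * p ~: U'" using weight_notin[OF gsmD(1)[OF g] p(2)] by blast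
   obtain D where "finite D & (ALL D'. finite D' & D <= D' --> ii c * p = (SUM d:D'. hc d (ii c * p)))" using hc_decomp[of "ii c * p"] by blast
   hence D: "ii c * p = (SUM d:D. hc d (ii c * p))" by blast
   obtain d where d: "hc d (ii c * p) ~: U'" using c D lideal_sum[OF gsmD(1)[OF g]] by metis
   define x where "x = hc d (ii c * p)"
   have xW: "x : qb ` W" unfolding x_def by (rule gsmD(4)[OF W'(1) lidealD(4)[OF gsmD(1)[OF W'(1)] p(1)]])
   have x: "dg d x" "ii c * x = x" "x ~: U'" using d dg_hc by (auto simp: x_def I_I simp flip: hc_e[OF dg_I] assoc)
   have xv: "x * v : S1" "x * v ~: S0" "dg (d + j) (x * v)" "ii c * (x * v) = x * v"
    using lidealD(4)[OF gsmD(1)[OF g1[OF irr]] v(1)] x gsmD(3)[OF W'(1) xW] dg_mult[OF x(1) v(3)] by (auto simp: U'_def simp flip: assoc)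
   hence "v : cyc S0 (x * v)" using irr_cyc[OF irr xv] v(1) by simp
   then obtain s z where s: "v = s + z * (x * v)" "s : S0" by (auto simp: cyc_def)
   have "(ii b - z * x) * v = s" using s(1) v1 by (simp add: left_diff_distrib assoc) (metis add_diff_cancel_right')
   hence "ii b - z * x : U'" using s(2) gsmD(3)[OF W'(1) xW] by (simp add: U'_def left_diff_distrib assoc I_I)
   from lidealD(2)[OF gsmD(1)[OF W'(1)] gsmD(2)[OF W'(1) this] lidealD(4)[OF gsmD(1)[OF W'(1)] xW, of z]]
   have "ii b : qb ` W" by simp
   hence "a : Cs b (qb ` W)" if "a : Pn b" for a
    using lidealD(4)[OF gsmD(1)[OF W'(1)], of "ii b" "qb a"] Pn_right[OF that] that by (simp add: Cs_def)
   hence "Pn b <= W" using W'(2) by blast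
   thus ?thesis using W unfolding gsub_def by blast
  qed
 qed
qed
text \<open>The isomorphism inverts the map from \<open>a\<close> to \<open>a * v\<close>, so its
  values are chosen. By \<open>uniq\<close> they are determined modulo \<open>U'\<close>, and every
  homomorphism property follows from that.\<close>

lemma isoL_st:
 assumes s: "st n b (shift n - shift b - d) S0 S1"
 shows "isoL (tparam TYPE('b)) n (Cs n S0) (Cs n S1) b d"
proof -
 let ?j = "shift n - shift b - d"
 obtain v where irr: "irrN n S0 S1" and v: "v : S1" "v ~: S0" "dg ?j v" "ei b * v = v" using s by (auto simp: st_def)
 note L0 = lidealD[OF gsmD(1)[OF g0[OF irr]]] and L1 = lidealD[OF gsmD(1)[OF g1[OF irr]]]
 have v1: "ii b * v = v" using v(4) hm_left'[OF hm_ei[of b], of v] by simp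
 define U' where "U' = {p. p * ii b = p & p * v : S0}"
 note U = ann_irr[OF irr v, folded U'_def]
 define ph where "ph w = (SOME a. a : Pn b & qb a * v - qb w : S0)" for w :: "'a comb"
 have "EX a. a : Pn b & qb a * v - qb w : S0" if "w : Cs n S1" for w
 proof -
  have "qb w : cyc S0 v" using irr_cyc[OF irr v(1-3) v1] that by (simp add: Cs_def)
  then obtain s z where s: "qb w = s + z * v" "s : S0" by (auto simp: cyc_def)
  obtain a where a: "a : Pn b" "qb a = z * ii b" using Pn_ex[of "z * ii b" b] by (auto simp: assoc I_I)
  show ?thesis using a(2) s(1) v1 a(1) L0(5)[OF s(2)] by (auto simp: assoc)
 qed
 hence ph: "ph w : Pn b" "qb (ph w) * v - qb w : S0" if "w : Cs n S1" for w
  using that someI_ex[of "%a. a : Pn b & qb a * v - qb w : S0"] unfolding ph_def by blast+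
 have uniq: "cdiff (ph w) a : Cs b U'" if w: "w : Cs n S1" and a: "a : Pn b" "qb a * v - qb w : S0" for w a
 proof -
  have p: "cdiff (ph w) a : Pn b" by (rule Pn_closed(4)[OF ph(1)[OF w] a(1)])
  have "qb (cdiff (ph w) a) = qb (ph w) - qb a" by (rule qa_diff[OF Pn_good[OF ph(1)[OF w]] Pn_good[OF a(1)], symmetric])
  hence "qb (cdiff (ph w) a) * v : S0" using L0(6)[OF ph(2)[OF w] a(2)] by (simp add: left_diff_distrib)
  thus ?thesis using p Pn_right[OF p] by (simp add: Cs_def U'_def)
 qed
 have C: "cadd w w' : Cs n S1" "csc c w : Cs n S1" "wt e ==> comp (dl e) w : Cs n S1" "hom k w : Cs n S1" if "w : Cs n S1" "w' : Cs n S1" for w w' c e k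
  using gsub_Cs[OF g1[OF irr]] that unfolding gsub_def by blast+
 note g = Pn_good and Pg = Pn_good[OF ph(1)]
 have Cg: "good w" if "w : Cs n S1" for w using that Pn_good by (auto simp: Cs_def)
 show ?thesis unfolding isoL_def Kstd_Cs
 proof (intro exI[of _ "Cs b U'"] exI[of _ ph] conjI ballI allI impI)
  show "gsub (Cs b (Kst b)) (Pn b) (Cs b U')" by (rule gsub_Cs[OF U(1)])
  show "irr (Pn b) (Cs b U')" by (rule U(2))
  fix w assume w: "w : Cs n S1"
  show "ph w : Pn b" by (rule ph(1)[OF w])
  show "cdiff (ph (cadd w w')) (cadd (ph w) (ph w')) : Cs b U'" if w': "w' : Cs n S1" for w'
  proof (rule uniq[OF C(1)[OF w w'] Pn_closed(2)[OF ph(1)[OF w] ph(1)[OF w']]])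
   show "qb (cadd (ph w) (ph w')) * v - qb (cadd w w') : S0"
    using L0(2)[OF ph(2)[OF w] ph(2)[OF w']] by (simp add: distrib_right algs flip: qa_add[OF Pg[OF w] Pg[OF w']] qa_add[OF Cg[OF w] Cg[OF w']])
  qed
  show "cdiff (ph (csc c w)) (csc c (ph w)) : Cs b U'" for c
  proof (rule uniq[OF C(2)[OF w w] Pn_closed(3)[OF ph(1)[OF w]]])
   show "qb (csc c (ph w)) * v - qb (csc c w) : S0"
    using L0(3)[OF ph(2)[OF w], of c] by (simp add: smul_diff flip: qa_smul[OF Pg[OF w]] qa_smul[OF Cg[OF w]])
  qed
  show "cdiff (ph (comp (dl e) w)) (comp (dl e) (ph w)) : Cs b U'" if e: "wt e" for e
  using uniq[OF C(3)[OF w w e] Pn_closed(5)[OF ph(1)[OF w] good_dl[OF e]]] L0(4)[OF ph(2)[OF w], of "qb (dl e)"] by (simp add: qb_comp[OF good_dl[OF e] Pg[OF w]] qb_comp[OF good_dl[OF e] Cg[OF w]] right_diff_distrib assoc)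
  show "cdiff (ph (hom k w)) (hom (k - shift n + shift b + d) (ph w)) : Cs b U'" for k
  proof (rule uniq[OF C(4)[OF w w] Pn_closed(6)[OF ph(1)[OF w]]])
   have "hc (k - shift n + shift b + d) (qb (ph w)) * v = hc k (qb (ph w) * v)" using hc_lmult[OF v(3), of k "qb (ph w)"] by (simp add: algs)
   thus "qb (hom (k - shift n + shift b + d) (ph w)) * v - qb (hom k w) : S0"
    using gsmD(4)[OF g0[OF irr] ph(2)[OF w], of k] by (simp add: hc_diff flip: qa_hc[OF Pg[OF w]] qa_hc[OF Cg[OF w]])
  qed
  show "ph w : Cs b U' \<longleftrightarrow> w : Cs n S0" using L0(6)[OF _ ph(2)[OF w], of "qb (ph w) * v"] L0(2)[OF ph(2)[OF w], of "qb w"] w ph(1)[OF w] Pn_right[OF ph(1)[OF w]] by (auto simp: Cs_def U'_def)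
 next
  fix p :: "'a comb" assume p: "p : Pn b"
  have pv: "qb p * v : S1" by (rule L1(4)[OF v(1)])
  obtain w where w: "w : Pn n" "qb w = qb p * v" using Pn_ex[OF gsmD(3)[OF g1[OF irr] pv]] by blast
  hence "w : Cs n S1" using pv by (simp add: Cs_def)
  moreover from uniq[OF this p] have "cdiff (ph w) p : Cs b U'" using w(2) L0(1) by simp
  ultimately show "EX w:Cs n S1. cdiff (ph w) p : Cs b U'" by blast
 qed
qed
text \<open>The converse: \<open>ei b\<close> is nonzero in \<open>L(b)\<close>, because it equals
  the identity modulo \<open>Kst b\<close>. The vector is obtained by applying \<open>ei b\<close>
  to a preimage of the identity and taking the component of the right degree.\<close>

lemma isoL_vec:
 assumes iso: "isoL (tparam TYPE('b)) n (Cs n S0) (Cs n S1) b d" and S1: "gsm n (Kp n) S1"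
 shows "EX v:S1 \<inter> Sp 0 b n (shift n - shift b - d). v ~: S0"
proof -
 let ?j = "shift n - shift b - d"
 obtain U ph where U: "gsub (Cs b (Kst b)) (Pn b) U" "irr (Pn b) U" and ph [rule_format]:
   "ALL w:Cs n S1. ph w : Pn b"
   "ALL w:Cs n S1. ALL w':Cs n S1. cdiff (ph (cadd w w')) (cadd (ph w) (ph w')) : U"
   "ALL c. ALL w:Cs n S1. cdiff (ph (csc c w)) (csc c (ph w)) : U"
   "ALL e. ALL w:Cs n S1. wt e --> cdiff (ph (comp (dl e) w)) (comp (dl e) (ph w)) : U"
   "ALL w:Cs n S1. ALL j. cdiff (ph (hom j w)) (hom (j - shift n + shift b + d) (ph w)) : U"
   "ALL w:Cs n S1. ph w : U \<longleftrightarrow> w : Cs n S0" "ALL p:Pn b. EX w:Cs n S1. cdiff (ph w) p : U"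
  using iso unfolding isoL_def Kstd_Cs by (elim exE conjE) (rule that)
 define U' where "U' = qb ` U"
 have Ue: "gsm b (Kst b) U'" "U = Cs b U'"
  unfolding U'_def by (rule gsub_ex[OF U(1) lidealD(1)[OF lideal_Kst] Kst_right]; assumption)+
 note LU = lidealD[OF gsmD(1)[OF Ue(1)]]
 have "ii b ~: U'"
 proof
  assume "ii b : U'"
  from LU(4)[OF this] have "a : Cs b U'" if "a : Pn b" for a using Pn_right[OF that] that by (metis (no_types, lifting) Cs_def mem_Collect_eq)
  hence "Pn b <= Cs b U'" by blast
  thus False using Ue(2) U unfolding irr_def gsub_def by blast
 qed
 hence eU: "ei b ~: U'" using LU(2)[OF gsmD(2)[OF Ue(1) ei_Kst[OF two, of b]], of "ei b"] by auto
 have C: "good w" "cadd w w' : Cs n S1" "csc c w : Cs n S1" "wt e ==> comp (dl e) w : Cs n S1" "hom k w : Cs n S1"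
  if "w : Cs n S1" "w' : Cs n S1" for w w' c e k
  using gsub_Cs[OF S1] that Pn_good[of w n] unfolding gsub_def Cs_def by blast+
 have Cc: "comp g w : Cs n S1" if "w : Cs n S1" "good g" for w g
  by (rule comp_closed[OF _ _ _ _ that]) (use gsub_Cs[OF S1] in "auto simp: gsub_def")
 have dU: "qb a - qb a' : U'" if "cdiff a a' : U" "good a" "good a'" for a a'
  using that qa_diff[OF that(2,3), where 'b = 'b] by (auto simp: U'_def)
 note g = Pn_good[OF ph(1)]
 have cadd': "qb (ph (cadd w w')) - (qb (ph w) + qb (ph w')) : U'" if "w : Cs n S1" "w' : Cs n S1" for w w'
  using dU[OF ph(2)[OF that] g[OF C(2)[OF that]] good_cadd[OF g[OF that(1)] g[OF that(2)]]] by (simp add: qa_add[OF g[OF that(1)] g[OF that(2)], symmetric])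
 have csc': "qb (ph (csc c w)) - c *s qb (ph w) : U'" if "w : Cs n S1" for w c
  using dU[OF ph(3)[OF that] g[OF C(3)[OF that that]] good_csc[OF g[OF that]]] by (simp add: qa_smul[OF g[OF that], symmetric])
 have comp': "qb (ph (comp x w)) - qb x * qb (ph w) : U'" if w: "w : Cs n S1" and "good x" for w x
  using that(2)
 proof (induction x rule: good_induct)
  case zero
  have "comp czero w = csc 0 w" by (auto simp: czero_def csc_def Defs.comp_def split: mexp.splits)
  thus ?case using csc'[OF w, of 0] by (simp add: qb_czero)
 next
  case (add c e a)
  have 1: "qb (ph (comp (dl e) w)) - q e * qb (ph w) : U'"
   using dU[OF ph(4)[OF w add(1)] g[OF C(4)[OF w w add(1)]] good_comp[OF good_dl[OF add(1)] g[OF w]]] by (simp add: qb_comp[OF good_dl[OF add(1)] g[OF w]] q_def)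
  note m = C(4)[OF w w add(1)] Cc[OF w add(2)] C(3)[OF C(4)[OF w w add(1)] w, of c]
  have q: "qb (cadd (csc c (dl e)) a) = c *s q e + qb a" using add by (simp add: q_def good_csc good_dl flip: qa_add qa_smul)
  from LU(2)[OF LU(2)[OF LU(2)[OF cadd'[OF m(3,2)] csc'[OF m(1), of c]] LU(3)[OF 1, of c]] add(3)]
  show ?case by (simp add: q comp_cadd_left comp_csc_left smul_diff distrib_right algs)
 qed
 have "dl (Id b) : Pn b" by (auto simp: Pn_def dl_def)
 then obtain w where w: "w : Cs n S1" "cdiff (ph w) (dl (Id b)) : U" using ph(7) by blast
 have w1: "qb (ph w) - ii b : U'" using dU[OF w(2) g[OF w(1)] good_dl] by (simp add: I_def q_def)
 define w1 where "w1 = comp (qr (ei b)) w"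
 have w1C: "w1 : Cs n S1" unfolding w1_def by (rule Cc[OF w(1) qr(1)])
 have "qb (ph w1) - ei b * qb (ph w) : U'" using comp'[OF w(1) qr(1)[of "ei b"]] by (simp add: w1_def qr)
 from LU(2)[OF this LU(4)[OF w1, of "ei b"]] have "qb (ph w1) - ei b : U'" by (simp add: right_diff_distrib hm_right[OF hm_ei])
 from gsmD(4)[OF Ue(1) this, of 0] have 2: "hc 0 (qb (ph w1)) - ei b : U'" using dg_ei by (simp add: hc_diff dg_def)
 have hC: "hom ?j w1 : Cs n S1" by (rule C(5)[OF w1C w1C])
 let ?A = "(ph (hom ?j w1))"
 have "qb ?A - hc 0 (qb (ph w1)) : U'"
  using dU[OF ph(5)[OF w1C, of ?j] g[OF hC] good_hom[OF g[OF w1C]]] by (simp add: qa_hc[OF g[OF w1C]])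
 from LU(2)[OF this 2] have 3: "qb ?A - ei b : U'" by simp
 have "qb ?A ~: U'"
 proof
  assume "qb ?A : U'"
  from LU(6)[OF this 3] show False using eU by simp
 qed
 hence "ph (hom ?j w1) ~: U" by (auto simp: U'_def)
 hence n0: "hom ?j w1 ~: Cs n S0" using ph(6)[OF hC] by blast
 have v: "qb (hom ?j w1) = hc ?j (ei b * qb w)"
  using qa_hc[OF C(1)[OF w1C w1C], where 'b = 'b] qb_comp[OF qr(1)[of "ei b"] C(1)[OF w(1) w(1)]] by (simp add: w1_def qr)
 show ?thesis
 proof (intro bexI[of _ "hc ?j (ei b * qb w)"])
  show "hc ?j (ei b * qb w) ~: S0" using n0 hC v by (simp add: Cs_def)
  have "hc ?j (ei b * qb w) : S1" using hC v by (simp add: Cs_def)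
  moreover have "hm b n (hc ?j (ei b * qb w))"
   using gsmD(3)[OF S1 calculation] by (simp add: hm_def hm_left'[OF hm_ei] flip: hc_e[OF dg_I] )
  moreover have "ei b * hc ?j (ei b * qb w) = hc ?j (ei b * qb w)" by (simp add: ei_ei flip: hc_e[OF dg_ei] assoc)
  ultimately show "hc ?j (ei b * qb w) : S1 \<inter> Sp 0 b n ?j" using dg_hc by (simp add: Sp_def)
 qed
qed
lemma Rk_ex: "gsm n (Kp n) S ==> EX d. Rk (Kp n) (S \<inter> Sp 0 b n j) d"
 using Rk_sub[OF sbs_Kp dk[OF two, of n 0 b j], of "S \<inter> Sp 0 b n j"] lideal_sbs[OF gsmD(1)] sbs_Sp[of 0 b n j] by (fastforce simp: sbs_def)
text \<open>At most: by \<open>isoL_vec\<close> every factor isomorphic to the shifted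
  \<open>L(b)\<close> raises the rank of the truncation. At least: \<open>ch_ex\<close> between
  \<open>Kp n\<close> and all of \<open>NB 1_n\<close> gives a chain with as many factors as the
  full rank, and \<open>isoL_st\<close> recognises them.\<close>

lemma gmult_dk: "gmult TYPE('a) (tparam TYPE('b)) n b d = enat (dk 0 b n (shift n - shift b - d))"
proof (rule antisym)
 let ?j = "shift n - shift b - d"
 let ?Z = "Sp 0 b n ?j"
 define chain where "chain k W \<longleftrightarrow> W 0 = Kprop (tparam TYPE('b)) n & W k = Pn n & (ALL r<=k. gsub (Kprop (tparam TYPE('b)) n) (Pn n) (W r)) & (ALL r<k. W r <= W (Suc r))"
  for k and W :: "nat => 'a comb set"
 let ?iso = "%W r. isoL (tparam TYPE('b)) n (W (r - 1)) (W r) b d"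
 have gm: "gmult TYPE('a) (tparam TYPE('b)) n b d = Sup {enat (card {r : {1..k}. ?iso W r}) | k W. chain k W}"
  unfolding gmult_def chain_def ..
 show "gmult TYPE('a) (tparam TYPE('b)) n b d <= enat (dk 0 b n ?j)" unfolding gm
 proof (rule Sup_least, clarify)
  fix k W assume c: "chain k W"
  define S where "S r = qb ` W r" for r
  have S: "gsm n (Kp n) (S r)" "W r = Cs n (S r)" if "r <= k" for r
   using gsub_ex[of n "Kp n" "W r"] c that Kp_right lidealD(1)[OF lideal_Kp] unfolding S_def chain_def Kprop_Cs by blast+
  have SS: "S r <= S (Suc r)" if "r < k" for r using c that unfolding S_def chain_def by blast
  define f where "f r = (SOME d. Rk (Kp n) (S r \<inter> ?Z) d)" for r
  have f: "Rk (Kp n) (S r \<inter> ?Z) (f r)" if "r <= k" for r unfolding f_def by (rule someI_ex[OF Rk_ex[OF S(1)[OF that]]])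
  have sb: "sbs (S r \<inter> ?Z)" if "r <= k" for r using lideal_sbs[OF gsmD(1)[OF S(1)[OF that]]] sbs_Sp[of 0 b n ?j] by (auto simp: sbs_def)
  have "m <= k ==> card {r : {1..m}. ?iso W r} <= f m" for m
  proof (induction m)
   case (Suc m)
   hence m: "m <= k" "Suc m <= k" "m < k" by auto
   have le: "f m <= f (Suc m)" by (rule Rk_mono[OF sbs_Kp f[OF m(1)] f[OF m(2)]]) (use SS[OF m(3)] in blast)
   show ?case
   proof (cases "?iso W (Suc m)")
    case True
    then obtain v where v: "v : S (Suc m) \<inter> ?Z" "v ~: S m" using isoL_vec[of n "S m" "S (Suc m)" b d] S m by auto
    have "f m < f (Suc m)"
    proof (rule Rk_strict[OF sbs_Kp sb[OF m(1)] f[OF m(1)] sb[OF m(2)] f[OF m(2)] _ v(1)])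
     show "S m \<inter> ?Z <= S (Suc m) \<inter> ?Z" using SS[OF m(3)] by blast
     show "v - s ~: Kp n" if "s : S m \<inter> ?Z" for s
      using lidealD(2)[OF gsmD(1)[OF S(1)[OF m(1)]] gsmD(2)[OF S(1)[OF m(1)]], of "v - s" s] that v(2) by auto
    qed
    moreover have "{r : {1..Suc m}. ?iso W r} = insert (Suc m) {r : {1..m}. ?iso W r}" using True by (auto simp: le_Suc_eq)
    ultimately show ?thesis using Suc m by simp
   next
    case False
    hence "{r : {1..Suc m}. ?iso W r} = {r : {1..m}. ?iso W r}" by (auto simp: le_Suc_eq)
    thus ?thesis using Suc le m by simp
   qed
  qed simp
  from this[of k] have "card {r : {1..k}. ?iso W r} <= f k" by simp
  also have "... <= dk 0 b n ?j" by (rule Rk_mono[OF sbs_Kp f[OF order_refl] dk[OF two]]) blast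
  finally show "enat (card {r : {1..k}. ?iso W r}) <= enat (dk 0 b n ?j)" by simp
 qed
 let ?T = "{y. y * ii n = y} :: ('a, 'b) nb set"
 have KT: "Kp n <= ?T" using Kp_right by blast
 have gK: "gsm n (Kp n) (Kp n)" unfolding gsm_def using lideal_Kp Kp_right hc_Kp by blast
 have "hc d y * ii n = hc d y" if "y * ii n = y" for d y using hc_lmult[OF dg_I, of d y n] that by simp
 hence gT: "gsm n (Kp n) ?T" unfolding gsm_def using KT by (auto simp: lideal_def distrib_right assoc)
 have "Rk (Kp n) (Kp n \<inter> ?Z) 0" by (simp add: Rk_def ind_def)
 moreover have "?T \<inter> ?Z = ?Z" using hm_right SpD(1) by fastforce
 ultimately have "ch n b ?j (Kp n) ?T (dk 0 b n ?j)" using ch_ex[OF two gK gT KT, of b ?j 0 "dk 0 b n ?j"] dk[OF two, of n 0 b ?j] by simp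
 from ch_fun[OF this] obtain k S where S: "S 0 = Kp n" "S k = ?T" "ALL r<=k. gsm n (Kp n) (S r)" "ALL r<k. S r <= S (Suc r)"
  "dk 0 b n ?j <= card {r : {1..k}. st n b ?j (S (r - 1)) (S r)}" by blast
 define W where "W r = Cs n (S r)" for r
 have "chain k W" using Pn_right gsub_Cs S(3,4) by (auto simp: Cs_def chain_def W_def Kprop_Cs S(1,2))
 moreover have "card {r : {1..k}. st n b ?j (S (r - 1)) (S r)} <= card {r : {1..k}. ?iso W r}"
  by (rule card_mono) (auto simp: W_def intro: isoL_st)
 ultimately show "enat (dk 0 b n ?j) <= gmult TYPE('a) (tparam TYPE('b)) n b d"
  unfolding gm using S(5) by (intro Sup_upper2[of "enat (card {r : {1..k}. ?iso W r})"]) auto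
qed
lemma gmult_tf: "EX c. gmult TYPE('a) (tparam TYPE('b)) n b d = enat c & of_nat c = tf b n (shift n - shift b - d)"
 using gmult_dk dk_tf[OF two] by blast
lemma gmult_pcoeff: "EX c. gmult TYPE('a) (tparam TYPE('b)) n (n + 2 * m) d = enat c &
  of_nat c = pcoeff m (if n mod 2 = tparam TYPE('b) mod 2 then m * (2 * m - 1) else m * (2 * m + 1)) d"
using gmult_tf[of n "n + 2 * m" d] by (simp add: tf_def[OF two] pcoeff_Qc cc_iff[symmetric] Let_def algs)
lemma gmult_zero: "~ (n <= b & even (b - n)) ==> gmult TYPE('a) (tparam TYPE('b)) n b d = 0"
 using gmult_tf[of n b d] tf_0[OF two, of n b] by (auto simp: zero_enat_def)

end
end

theorem theoremD:
  fixes K :: "'k::field itself" and t n :: nat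
  assumes "(2::'k) \<noteq> 0" and "t \<le> 1"
  shows "(\<forall>m d. \<exists>c. gmult K t n (n + 2 * m) d = enat c \<and>
             of_nat c = pcoeff m (if n mod 2 = t mod 2 then m * (2 * m - 1) else m * (2 * m + 1)) d)
       \<and> (\<forall>b d. \<not> (n \<le> b \<and> even (b - n)) \<longrightarrow> gmult K t n b d = 0)"
proof -
 have K: "gmult K = gmult TYPE('k)" by (intro ext) (simp add: gmult_def)
 \<comment> \<open>The value of \<open>t\<close> selects the instance of \<open>tparam\<close>, and
   with it the algebra.\<close>
 consider "t = tparam TYPE(unit)" | "t = tparam TYPE(bool)" using assms(2) by (auto simp: tparam_unit_def tparam_bool_def le_Suc_eq)
 thus ?thesis
 proof cases
  case 1
  show ?thesis unfolding K 1 using nbt.gmult_pcoeff[OF assms(1)] nbt.gmult_zero[OF assms(1)] by blast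
 next
  case 2
  show ?thesis unfolding K 2 using nbt.gmult_pcoeff[OF assms(1)] nbt.gmult_zero[OF assms(1)] by blast
 qed
qed

end
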